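(* Generalized hexagonal caterpillars are universal graphs for the class $\mathcal{X}$; that is, every generalized hexagonal caterpillar belongs to $\mathcal{X}$, and every graph $G \in \mathcal{X}$ is an induced subgraph of some generalized hexagonal caterpillar.
   Context: All graphs are finite and simple. The class $\mathcal{X}$ consists of all graphs containing none of the following graphs as an induced subgraph: the cycles $C_n$ for $n\ge 3$, $n\neq 6$; the tree $S_{3,3,3}$ (one centre vertex with three attached disjoint paths of length 3); the graph $C_6^{+3c}$ ($C_6$ with one pendant vertex attached to each of three consecutive vertices of the cycle); the graph $C_6^{+3nc}$ ($C_6$ with one pendant vertex attached to each of three pairwise non-adjacent vertices of the cycle); the graph $C_6^{+2l2}$ ($C_6$ with a path of length 2 attached at each of two adjacent vertices of the cycle, i.e. with $C_6 = c_1\dots c_6$, new vertices $x,x',y,y'$ and new edges $c_1x, xx', c_2y, yy'$). Lobsters. A lobster is a tree containing a path such that every vertex of the tree is at distance at most 2 from the path. The gluing vertices of a lobster are the two endpoints (possibly equal) of a shortest path having this property. Hexagonal strips. For $k\ge 2$, $C_{6,k}$ is the graph with vertex set $\{a,b,a_j,b_j: 1\le j\le k\}$ and edge set $\{aa_j, a_jb_j, b_jb: 1\le j\le k\}$. Given $n\in\mathbb{N}$, integers $k_1,\dots,k_n\ge 2$ and $d_1,\dots,d_{n-1}\in\{1,-1\}$, let $C^i_{6,k_i}$ be a copy of $C_{6,k_i}$ with vertices $a^i,b^i,a^i_j,b^i_j$ ($1\le j\le k_i$). The hexagonal strip $H(k_1,d_1,k_2,\dots,d_{n-1},k_n)$ is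 obtained from the disjoint union of these copies by gluing, for each $i=1,\dots,n-1$, the edge $b^i_2b^i$ to the edge $a^{i+1}a^{i+1}_1$: if $d_i=1$, then $b^i_2$ is identified with $a^{i+1}$ and $b^i$ with $a^{i+1}_1$; if $d_i=-1$, then $b^i_2$ is identified with $a^{i+1}_1$ and $b^i$ with $a^{i+1}$. Hexagonal caterpillars. A hexagonal caterpillar with gluing vertices $a$ and $b$, where $a\in\{a^1,a^1_1\}$ and $b\in\{b^n,b^n_2\}$, is a graph consisting of a hexagonal strip $H(k_1,d_1,\dots,d_{n-1},k_n)$ together with some (any number, possibly zero, of) pendant vertices attached to vertices among $a^i,b^i,a^i_1,b^i_2$ ($1\le i\le n$), and with some trees of radius 2 attached at $a$ and at $b$ (i.e. rooted trees all of whose vertices are at distance at most 2 from the root, the root being identified with $a$, respectively $b$). Generalized hexagonal caterpillars. Let $H_1,\dots,H_k$ ($k\ge1$) be vertex-disjoint graphs, each a hexagonal caterpillar or a lobster, with $a_i$ and $b_i$ the gluing vertices of $H_i$. The generalized hexagonal caterpillar $(H_1,b_1,a_2,H_2,b_2,a_3,H_3,\dots,b_{k-1},a_k,H_k)$ is the graph obtained from $H_1,\dots,H_k$ by identifying $b_i$ with $a_{i+1}$ for every $i=1,\dots,k-1$. *)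

theory Defs
  imports "Graph_Theory.Graph_Theory"
begin

section \<open>Finite simple graphs\<close>

text \<open>
  A finite simple graph is a \<^locale>\<open>pair_graph\<close>: finitely many vertices, and an irreflexive,
  symmetric set of arcs, each edge being represented by its two orientations.
\<close>

definition undirected :: "'a set \<Rightarrow> 'a rel \<Rightarrow> 'a pair_pre_digraph" where
  "undirected V E = \<lparr>pverts = V, parcs = E \<union> E\<inverse>\<rparr>"

definition contains_induced :: "'a pair_pre_digraph \<Rightarrow> 'b pair_pre_digraph \<Rightarrow> bool" where
  "contains_induced G F \<longleftrightarrow>
     (\<exists>K. induced_subgraph K (with_proj G) \<and> digraph_iso (with_proj F) K)"

text \<open>
  The library's \<^const>\<open>tree\<close> is not usable for symmetric digraphs, because there the two
  orientations of an edge form a directed cycle of length 2.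
\<close>

definition graph_tree :: "'a pair_pre_digraph \<Rightarrow> bool" where
  "graph_tree T \<longleftrightarrow> pair_graph T \<and> connected (with_proj T) \<and>
     \<not> (\<exists>c. pre_digraph.cycle (with_proj T) c \<and> 3 \<le> length c)"

definition graph_dist :: "'a pair_pre_digraph \<Rightarrow> 'a \<Rightarrow> 'a \<Rightarrow> ereal" where
  "graph_dist G u v = wf_digraph.\<mu> (with_proj G) (\<lambda>_. 1) u v"

definition map_graph :: "('a \<Rightarrow> 'b) \<Rightarrow> 'a pair_pre_digraph \<Rightarrow> 'b pair_pre_digraph" where
  "map_graph f G = \<lparr>pverts = f ` pverts G, parcs = map_prod f f ` parcs G\<rparr>"

definition disjoint_union :: "nat set \<Rightarrow> (nat \<Rightarrow> 'a pair_pre_digraph) \<Rightarrow> (nat \<times> 'a) pair_pre_digraph"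
  where
  "disjoint_union I G =
     \<lparr>pverts = (SIGMA i:I. pverts (G i)),
      parcs = {((i, x), (i, y)) | i x y. i \<in> I \<and> (x, y) \<in> parcs (G i)}\<rparr>"

text \<open>
  Identifying \<open>x\<close> with \<open>y\<close> for all \<open>(x, y) \<in> R\<close>: the vertices of the new graph are the classes of
  the equivalence relation generated by \<open>R\<close>.
\<close>

definition ident_class :: "'a rel \<Rightarrow> 'a \<Rightarrow> 'a set" where
  "ident_class R x = (R \<union> R\<inverse>)\<^sup>* `` {x}"

definition identify :: "'a pair_pre_digraph \<Rightarrow> 'a rel \<Rightarrow> 'a set pair_pre_digraph" where
  "identify G R = map_graph (ident_class R) G"


section \<open>The class \<open>\<X>\<close>\<close>

definition cycle_edges :: "nat \<Rightarrow> nat rel" where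
  "cycle_edges n = {(i, (i + 1) mod n) | i. i < n}"

definition cycle_graph :: "nat \<Rightarrow> nat pair_pre_digraph" where
  "cycle_graph n = undirected {..<n} (cycle_edges n)"

definition S333 :: "nat pair_pre_digraph" where
  "S333 = undirected {..<10} {(0, 1), (1, 2), (2, 3), (0, 4), (4, 5), (5, 6), (0, 7), (7, 8), (8, 9)}"

definition C6_3c :: "nat pair_pre_digraph" where
  "C6_3c = undirected {..<9} (cycle_edges 6 \<union> {(0, 6), (1, 7), (2, 8)})"

definition C6_3nc :: "nat pair_pre_digraph" where
  "C6_3nc = undirected {..<9} (cycle_edges 6 \<union> {(0, 6), (2, 7), (4, 8)})"

definition C6_2l2 :: "nat pair_pre_digraph" where
  "C6_2l2 = undirected {..<10} (cycle_edges 6 \<union> {(0, 6), (6, 7), (1, 8), (8, 9)})"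

definition class_X :: "'a pair_pre_digraph set" where
  "class_X = {G. pair_graph G \<and>
     (\<forall>n\<ge>3. n \<noteq> 6 \<longrightarrow> \<not> contains_induced G (cycle_graph n)) \<and>
     \<not> contains_induced G S333 \<and>
     \<not> contains_induced G C6_3c \<and>
     \<not> contains_induced G C6_3nc \<and>
     \<not> contains_induced G C6_2l2}"


section \<open>Lobsters\<close>

definition lobster_path :: "'a pair_pre_digraph \<Rightarrow> 'a list \<Rightarrow> bool" where
  "lobster_path L p \<longleftrightarrow> vpath p (with_proj L) \<and>
     (\<forall>v\<in>pverts L. \<exists>w\<in>set p. graph_dist L w v \<le> 2)"

text \<open>\<open>L\<close> is a lobster with gluing vertices \<open>a\<close> and \<open>b\<close>.\<close>

definition lobster :: "'a pair_pre_digraph \<Rightarrow> 'a \<Rightarrow> 'a \<Rightarrow> bool" where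
  "lobster L a b \<longleftrightarrow> graph_tree L \<and>
     (\<exists>p. lobster_path L p \<and> (\<forall>q. lobster_path L q \<longrightarrow> length p \<le> length q) \<and>
          a = hd p \<and> b = last p)"


section \<open>Hexagonal strips\<close>

text \<open>\<open>PA\<close>, \<open>PB\<close>, \<open>QA j\<close>, \<open>QB j\<close> stand for the vertices $a$, $b$, $a_j$, $b_j$ of $C_{6,k}$.\<close>

datatype hex_vertex = PA | PB | QA nat | QB nat

definition C6k :: "nat \<Rightarrow> hex_vertex pair_pre_digraph" where
  "C6k k = undirected ({PA, PB} \<union> QA ` {1..k} \<union> QB ` {1..k})
     (\<Union>j\<in>{1..k}. {(PA, QA j), (QA j, QB j), (QB j, PB)})"

definition strip_gluing :: "nat \<Rightarrow> (nat \<Rightarrow> int) \<Rightarrow> (nat \<times> hex_vertex) rel" where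
  "strip_gluing n d = (\<Union>i\<in>{1..<n}.
     if d i = 1 then {((i, QB 2), (i + 1, PA)), ((i, PB), (i + 1, QA 1))}
     else {((i, QB 2), (i + 1, QA 1)), ((i, PB), (i + 1, PA))})"

definition strip_params :: "nat \<Rightarrow> (nat \<Rightarrow> nat) \<Rightarrow> (nat \<Rightarrow> int) \<Rightarrow> bool" where
  "strip_params n k d \<longleftrightarrow> 1 \<le> n \<and> (\<forall>i\<in>{1..n}. 2 \<le> k i) \<and> (\<forall>i\<in>{1..<n}. d i \<in> {1, -1})"

text \<open>$H(k_1,d_1,\ldots,d_{n-1},k_n)$\<close>

definition hexagonal_strip ::
    "nat \<Rightarrow> (nat \<Rightarrow> nat) \<Rightarrow> (nat \<Rightarrow> int) \<Rightarrow> (nat \<times> hex_vertex) set pair_pre_digraph" where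
  "hexagonal_strip n k d = identify (disjoint_union {1..n} (\<lambda>i. C6k (k i))) (strip_gluing n d)"

definition strip_vertex :: "nat \<Rightarrow> (nat \<Rightarrow> int) \<Rightarrow> nat \<Rightarrow> hex_vertex \<Rightarrow> (nat \<times> hex_vertex) set" where
  "strip_vertex n d i x = ident_class (strip_gluing n d) (i, x)"


section \<open>Hexagonal caterpillars\<close>

definition radius2_tree :: "'a pair_pre_digraph \<Rightarrow> 'a \<Rightarrow> bool" where
  "radius2_tree T r \<longleftrightarrow> graph_tree T \<and> r \<in> pverts T \<and> (\<forall>v\<in>pverts T. graph_dist T r v \<le> 2)"

text \<open>
  \<open>decorated S U a b G\<close>: the graph \<open>G\<close> arises from \<open>S\<close> by attaching pendant vertices to vertices
  in \<open>U\<close> and trees of radius 2 at \<open>a\<close> and \<open>b\<close>.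
\<close>

inductive decorated ::
    "'a pair_pre_digraph \<Rightarrow> 'a set \<Rightarrow> 'a \<Rightarrow> 'a \<Rightarrow> 'a pair_pre_digraph \<Rightarrow> bool"
  for S U a b where
  base: "decorated S U a b S"
| pendant: "decorated S U a b \<lparr>pverts = insert v (pverts G), parcs = parcs G \<union> {(u, v), (v, u)}\<rparr>"
    if "decorated S U a b G" "u \<in> U" "v \<notin> pverts G"
| tree: "decorated S U a b \<lparr>pverts = pverts G \<union> pverts T, parcs = parcs G \<union> parcs T\<rparr>"
    if "decorated S U a b G" "r \<in> {a, b}" "radius2_tree T r" "pverts G \<inter> pverts T = {r}"

text \<open>
  \<open>G\<close> is a hexagonal caterpillar with gluing vertices \<open>a\<close> and \<open>b\<close>; the injection \<open>f\<close> names the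
  vertices of its hexagonal strip.
\<close>

definition hexagonal_caterpillar :: "'a pair_pre_digraph \<Rightarrow> 'a \<Rightarrow> 'a \<Rightarrow> bool" where
  "hexagonal_caterpillar G a b \<longleftrightarrow>
     (\<exists>n k d f. strip_params n k d \<and> inj_on f (pverts (hexagonal_strip n k d)) \<and>
        a \<in> {f (strip_vertex n d 1 PA), f (strip_vertex n d 1 (QA 1))} \<and>
        b \<in> {f (strip_vertex n d n PB), f (strip_vertex n d n (QB 2))} \<and>
        decorated (map_graph f (hexagonal_strip n k d))
          {f (strip_vertex n d i x) | i x. i \<in> {1..n} \<and> x \<in> {PA, PB, QA 1, QB 2}} a b G)"


section \<open>Generalized hexagonal caterpillars\<close>

text \<open>
  The graphs \<open>H i\<close> have vertices in \<^typ>\<open>nat\<close>, which is no restriction as they are finite;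
  \<^const>\<open>disjoint_union\<close> makes them vertex-disjoint.
\<close>

definition generalized_hexagonal_caterpillar :: "'a pair_pre_digraph \<Rightarrow> bool" where
  "generalized_hexagonal_caterpillar G \<longleftrightarrow>
     (\<exists>k (H :: nat \<Rightarrow> nat pair_pre_digraph) a b. 1 \<le> k \<and>
        (\<forall>i\<in>{1..k}. hexagonal_caterpillar (H i) (a i) (b i) \<or> lobster (H i) (a i) (b i)) \<and>
        digraph_iso
          (with_proj (identify (disjoint_union {1..k} H)
             {((i, b i), (i + 1, a (i + 1))) | i. i \<in> {1..<k}}))
          (with_proj G))"

end

(* A generalized hexagonal caterpillar belongs to the class because each forbidden graph F is tame: a cut
   vertex of F always has a side that is a path with at most 3 vertices. Hence an induced copy of F in a graph
   that is glued together at a vertex can be moved into one of the two parts, once that part is prolonged by a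
   path of length 3 at the gluing vertex. It remains to see that single blocks prolonged at both ends contain no
   forbidden graph. A lobster becomes a tree whose vertices are within distance 2 of a path; a hexagonal
   caterpillar without its trees becomes an induced subgraph of a two-way infinite strip with infinitely many
   pendant vertices, in which all induced cycles are hexagons around a single cell.

   Conversely, let D be a connected part of a graph in the class such that an outside path of length 3 is
   attached to D at a vertex r. The absence of S_{3,3,3} and of hexagons with attachments forces the structure of D
   at r: a star of depth 2 and an edge, or a cell formed by all hexagons through an edge at r, can be peeled off,
   and the rest of D is again attached in the same way. Peeling in both directions from the middle of the graph
   gives a chain of lobsters and strips, and the chains of different components are joined by long paths. *)
theory Submission
  imports Defs
begin

section \<open>Induced copies as relation embeddings\<close>

lemma map_graph_simps [simp]:
  "pverts (map_graph f G) = f ` pverts G"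
  "parcs (map_graph f G) = map_prod f f ` parcs G"
  by (simp_all add: map_graph_def)

lemma digraph_iso_map_graph:
  assumes "pair_wf_digraph G" "inj_on f (pverts G)"
  shows "digraph_iso (with_proj G) (with_proj (map_graph f G))"
proof -
  interpret pair_wf_digraph G by fact
  let ?h = "\<lparr>iso_verts = f, iso_arcs = map_prod f f, iso_head = snd, iso_tail = fst\<rparr>"
  have "inj_on (map_prod f f) (parcs G)"
    using assms(2) in_arcsD1 in_arcsD2 by (auto simp: inj_on_def)
  then have "digraph_isomorphism ?h"
    using assms(2) wf_digraph by (auto simp: digraph_isomorphism_def)
  moreover have "with_proj (map_graph f G) = app_iso ?h (with_proj G)"
    by (simp add: with_proj_def app_iso_def map_graph_def)
  ultimately show ?thesis unfolding digraph_iso_def by blast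
qed

lemma digraph_iso_imp_map_graph:
  assumes "digraph_iso (with_proj G) (with_proj H)"
  shows "\<exists>f. inj_on f (pverts G) \<and> H = map_graph f G"
proof -
  obtain h where h: "pre_digraph.digraph_isomorphism (with_proj G) h"
    "with_proj H = app_iso h (with_proj G)"
    using assms unfolding digraph_iso_def by blast
  let ?f = "iso_verts h"
  have eqs: "pverts H = ?f ` pverts G" "parcs H = iso_arcs h ` parcs G"
    "iso_tail h = fst" "iso_head h = snd"
    using h(2) by (auto simp: with_proj_def app_iso_def)
  have a: "iso_arcs h e = map_prod ?f ?f e" if "e \<in> parcs G" for e
    using h(1) that eqs(3,4) by (auto simp: pre_digraph.digraph_isomorphism_def prod_eq_iff)
  have "parcs H = map_prod ?f ?f ` parcs G"
    unfolding eqs(2) using a by (intro image_cong) auto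
  then have "H = map_graph ?f G" using eqs(1) by simp
  moreover have "inj_on ?f (pverts G)"
    using h(1) by (auto simp: pre_digraph.digraph_isomorphism_def)
  ultimately show ?thesis by blast
qed

lemma contains_induced_iff:
  assumes "pair_wf_digraph G" "pair_wf_digraph F"
  shows "contains_induced G F \<longleftrightarrow> (\<exists>f. inj_on f (pverts F) \<and> f ` pverts F \<subseteq> pverts G \<and>
    (\<forall>x\<in>pverts F. \<forall>y\<in>pverts F. (f x, f y) \<in> parcs G \<longleftrightarrow> (x, y) \<in> parcs F))"
    (is "?L \<longleftrightarrow> ?R")
proof
  interpret F: pair_wf_digraph F by fact
  interpret G: pair_wf_digraph G by fact
  {
    assume ?L
    then obtain K where K: "induced_subgraph K (with_proj G)" "digraph_iso (with_proj F) K"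
      unfolding contains_induced_def by blast
    let ?K = "\<lparr>pverts = verts K, parcs = arcs K\<rparr>"
    have "K = with_proj ?K"
      using K(1) by (auto simp: induced_subgraph_def subgraph_def compatible_def with_proj_def)
    with K(2) obtain f where f: "inj_on f (pverts F)" "?K = map_graph f F"
      using digraph_iso_imp_map_graph[of F ?K] by auto
    have v: "verts K = f ` pverts F" and a: "arcs K = map_prod f f ` parcs F"
      using f(2) by (auto simp: map_graph_def)
    have sub: "f ` pverts F \<subseteq> pverts G"
      using K(1) v by (auto simp: induced_subgraph_def subgraph_def)
    have ind: "arcs K = {e \<in> parcs G. fst e \<in> verts K \<and> snd e \<in> verts K}"
      using K(1) by (auto simp: induced_subgraph_def)
    have "(f x, f y) \<in> parcs G \<longleftrightarrow> (x, y) \<in> parcs F" if "x \<in> pverts F" "y \<in> pverts F" for x y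
    proof -
      have "(f x, f y) \<in> parcs G \<longleftrightarrow> (f x, f y) \<in> arcs K"
        unfolding ind v using that by auto
      also have "\<dots> \<longleftrightarrow> (x, y) \<in> parcs F"
      proof
        assume "(f x, f y) \<in> arcs K"
        then obtain x' y' where xy: "(x', y') \<in> parcs F" "f x = f x'" "f y = f y'"
          unfolding a by auto
        then have "x' = x" "y' = y"
          using f(1) that F.in_arcsD1[OF xy(1)] F.in_arcsD2[OF xy(1)] by (auto dest: inj_onD)
        with xy(1) show "(x, y) \<in> parcs F" by simp
      qed (force simp: a)
      finally show ?thesis .
    qed
    with f(1) sub show ?R by blast
  next
    assume ?R
    then obtain f where f: "inj_on f (pverts F)" "f ` pverts F \<subseteq> pverts G"
      "\<And>x y. x \<in> pverts F \<Longrightarrow> y \<in> pverts F \<Longrightarrow> (f x, f y) \<in> parcs G \<longleftrightarrow> (x, y) \<in> parcs F"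
      by blast
    let ?K = "map_graph f F"
    have "pair_wf_digraph ?K"
      using F.in_arcsD1 F.in_arcsD2 by unfold_locales auto
    moreover have "map_prod f f ` parcs F = {e \<in> parcs G. fst e \<in> f ` pverts F \<and> snd e \<in> f ` pverts F}"
    proof (intro equalityI subsetI)
      fix e assume "e \<in> map_prod f f ` parcs F"
      then obtain x y where xy: "(x, y) \<in> parcs F" "e = (f x, f y)" by auto
      then show "e \<in> {e \<in> parcs G. fst e \<in> f ` pverts F \<and> snd e \<in> f ` pverts F}"
        using f(3)[OF F.in_arcsD1[OF xy(1)] F.in_arcsD2[OF xy(1)]]
          F.in_arcsD1[OF xy(1)] F.in_arcsD2[OF xy(1)] by simp
    next
      fix e assume e: "e \<in> {e \<in> parcs G. fst e \<in> f ` pverts F \<and> snd e \<in> f ` pverts F}"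
      then obtain x y where "x \<in> pverts F" "fst e = f x" "y \<in> pverts F" "snd e = f y"
        by blast
      then have xy: "x \<in> pverts F" "y \<in> pverts F" "e = (f x, f y)"
        by (auto simp: prod_eq_iff)
      then have "(x, y) \<in> parcs F" using f(3) e by simp
      then show "e \<in> map_prod f f ` parcs F" using xy(3) by force
    qed
    ultimately have "induced_subgraph (with_proj ?K) (with_proj G)"
      using f(2) G.wf_digraph
      by (auto simp: induced_subgraph_def subgraph_def compatible_def wf_digraph_wp_iff)
    then show ?L
      unfolding contains_induced_def using digraph_iso_map_graph[OF assms(2) f(1)] by blast
  }
qed

definition emb :: "nat \<Rightarrow> nat rel \<Rightarrow> 'v rel \<Rightarrow> bool" where
  "emb n F E \<longleftrightarrow> (\<exists>f. inj_on f {..<n} \<and>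
     (\<forall>i<n. \<forall>j<n. (f i, f j) \<in> E \<longleftrightarrow> (i, j) \<in> F \<union> F\<inverse>))"

lemma contains_induced_undirected:
  assumes "pair_wf_digraph G" "F \<subseteq> {..<n} \<times> {..<n}" "{..<n} \<subseteq> Field F"
  shows "contains_induced G (undirected {..<n} F) \<longleftrightarrow> emb n F (parcs G)"
proof -
  interpret G: pair_wf_digraph G by fact
  have wf: "pair_wf_digraph (undirected {..<n} F)"
    using assms(2) by unfold_locales (auto simp: undirected_def)
  have "f i \<in> pverts G"
    if "\<forall>x\<in>{..<n}. \<forall>y\<in>{..<n}. (f x, f y) \<in> parcs G \<longleftrightarrow> (x, y) \<in> F \<union> F\<inverse>" "i < n" for f i
  proof -
    obtain j where "(i, j) \<in> F \<union> F\<inverse>" using assms(3) \<open>i < n\<close> by (force simp: Field_def)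
    then have "(f i, f j) \<in> parcs G" using that assms(2) by blast
    then show ?thesis by (rule G.in_arcsD1)
  qed
  then show ?thesis
    unfolding contains_induced_iff[OF assms(1) wf] emb_def
    by (auto simp: undirected_def image_subset_iff Ball_def)
qed

abbreviation "S333_edges \<equiv> {(0::nat, 1::nat), (1, 2), (2, 3), (0, 4), (4, 5), (5, 6), (0, 7), (7, 8), (8, 9)}"
abbreviation "C6_3c_edges \<equiv> cycle_edges 6 \<union> {(0, 6), (1, 7), (2, 8)}"
abbreviation "C6_3nc_edges \<equiv> cycle_edges 6 \<union> {(0, 6), (2, 7), (4, 8)}"
abbreviation "C6_2l2_edges \<equiv> cycle_edges 6 \<union> {(0, 6), (6, 7), (1, 8), (8, 9)}"

definition Xfree :: "'v rel \<Rightarrow> bool" where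
  "Xfree E \<longleftrightarrow> (\<forall>n\<ge>3. n \<noteq> 6 \<longrightarrow> \<not> emb n (cycle_edges n) E) \<and>
     \<not> emb 10 S333_edges E \<and> \<not> emb 9 C6_3c_edges E \<and>
     \<not> emb 9 C6_3nc_edges E \<and> \<not> emb 10 C6_2l2_edges E"

lemma cycle_edges_6: "cycle_edges 6 = {(0, 1), (1, 2), (2, 3), (3, 4), (4, 5), (5, 0)}"
proof -
  have "{i::nat. i < 6} = {0, 1, 2, 3, 4, 5}" by auto
  then have "cycle_edges 6 = (\<lambda>i. (i, (i + 1) mod 6)) ` {0, 1, 2, 3, 4, 5}"
    unfolding cycle_edges_def by blast
  then show ?thesis by (simp del: One_nat_def)
qed

lemma less_10: "{..<10} = {0, 1, 2, 3, 4, 5, 6, 7, 8, 9::nat}"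
  and less_9: "{..<9} = {0, 1, 2, 3, 4, 5, 6, 7, 8::nat}"
  by auto

lemma class_X_iff: "G \<in> class_X \<longleftrightarrow> pair_graph G \<and> Xfree (parcs G)"
proof (cases "pair_graph G")
  case True
  then interpret pair_graph G .
  have wf: "pair_wf_digraph G" by unfold_locales
  have c: "contains_induced G (cycle_graph n) \<longleftrightarrow> emb n (cycle_edges n) (parcs G)" if "n \<ge> 3" for n
    unfolding cycle_graph_def using that
    by (intro contains_induced_undirected[OF wf]) (auto simp: cycle_edges_def Field_def)
  have "contains_induced G S333 \<longleftrightarrow> emb 10 S333_edges (parcs G)"
    "contains_induced G C6_3c \<longleftrightarrow> emb 9 C6_3c_edges (parcs G)"
    "contains_induced G C6_3nc \<longleftrightarrow> emb 9 C6_3nc_edges (parcs G)"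
    "contains_induced G C6_2l2 \<longleftrightarrow> emb 10 C6_2l2_edges (parcs G)"
    unfolding S333_def C6_3c_def C6_3nc_def C6_2l2_def
    by (intro contains_induced_undirected[OF wf];
        simp add: less_10 less_9 cycle_edges_6 Field_def Domain.simps Range.simps; fail)+
  then show ?thesis using c True unfolding class_X_def Xfree_def by auto
qed (auto simp: class_X_def)

lemma emb_comp:
  assumes "emb n F E" "inj_on \<phi> (Field E)"
    "\<And>x y. x \<in> Field E \<Longrightarrow> y \<in> Field E \<Longrightarrow> (\<phi> x, \<phi> y) \<in> E' \<longleftrightarrow> (x, y) \<in> E"
    "{..<n} \<subseteq> Field F" "F \<subseteq> {..<n} \<times> {..<n}"
  shows "emb n F E'"
proof -
  obtain f where f: "inj_on f {..<n}" "\<And>i j. i < n \<Longrightarrow> j < n \<Longrightarrow> (f i, f j) \<in> E \<longleftrightarrow> (i, j) \<in> F \<union> F\<inverse>"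
    using assms(1) unfolding emb_def by blast
  have fld: "f i \<in> Field E" if "i < n" for i
  proof -
    have "i \<in> Field F" using assms(4) that by auto
    then obtain j where "(i, j) \<in> F \<union> F\<inverse>" unfolding Field_def by blast
    then have "(f i, f j) \<in> E" using f(2) that assms(5) by blast
    then show ?thesis by (auto simp: Field_def)
  qed
  have "inj_on (\<phi> \<circ> f) {..<n}"
    using f(1) assms(2) fld by (auto simp: inj_on_def)
  moreover have "(\<phi> (f i), \<phi> (f j)) \<in> E' \<longleftrightarrow> (i, j) \<in> F \<union> F\<inverse>" if "i < n" "j < n" for i j
    using that assms(3) fld f(2) by simp
  ultimately show ?thesis unfolding emb_def by (intro exI[of _ "\<phi> \<circ> f"]) simp
qed

lemma Xfree_embed:
  assumes X: "Xfree E'" and "inj_on \<phi> (Field E)"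
    "\<And>x y. x \<in> Field E \<Longrightarrow> y \<in> Field E \<Longrightarrow> (\<phi> x, \<phi> y) \<in> E' \<longleftrightarrow> (x, y) \<in> E"
  shows "Xfree E"
proof -
  note t = emb_comp[OF _ assms(2,3)]
  have "emb n (cycle_edges n) E'" if "emb n (cycle_edges n) E" "n \<ge> 3" for n
    using that by (intro t[where F = "cycle_edges n"]) (auto simp: cycle_edges_def Field_def)
  moreover have "emb 10 S333_edges E \<Longrightarrow> emb 10 S333_edges E'"
    "emb 9 C6_3c_edges E \<Longrightarrow> emb 9 C6_3c_edges E'"
    "emb 9 C6_3nc_edges E \<Longrightarrow> emb 9 C6_3nc_edges E'"
    "emb 10 C6_2l2_edges E \<Longrightarrow> emb 10 C6_2l2_edges E'"
    by (erule t; simp add: less_10 less_9 cycle_edges_6 Field_def Domain.simps Range.simps; fail)+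
  ultimately show ?thesis using X unfolding Xfree_def by blast
qed

section \<open>Local structure of graphs in the class\<close>

lemma all_less_numerals:
  "(\<forall>i<10. P i) \<longleftrightarrow> P 0 \<and> P 1 \<and> P 2 \<and> P 3 \<and> P 4 \<and> P 5 \<and> P 6 \<and> P 7 \<and> P 8 \<and> P (9::nat)"
  "(\<forall>i<9. P i) \<longleftrightarrow> P 0 \<and> P 1 \<and> P 2 \<and> P 3 \<and> P 4 \<and> P 5 \<and> P 6 \<and> P 7 \<and> P (8::nat)"
  "(\<forall>i<8. P i) \<longleftrightarrow> P 0 \<and> P 1 \<and> P 2 \<and> P 3 \<and> P 4 \<and> P 5 \<and> P 6 \<and> P (7::nat)"
  "(\<forall>i<5. P i) \<longleftrightarrow> P 0 \<and> P 1 \<and> P 2 \<and> P 3 \<and> P (4::nat)"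
  "(\<forall>i<4. P i) \<longleftrightarrow> P 0 \<and> P 1 \<and> P 2 \<and> P (3::nat)"
  "(\<forall>i<3. P i) \<longleftrightarrow> P 0 \<and> P 1 \<and> P (2::nat)"
  by (simp_all add: eval_nat_numeral All_less_Suc conj_ac)

lemma emb_list:
  assumes "length xs = n" "distinct xs"
    "\<And>i j. i < n \<Longrightarrow> j < n \<Longrightarrow> (xs ! i, xs ! j) \<in> E \<longleftrightarrow> (i, j) \<in> F \<union> F\<inverse>"
  shows "emb n F E"
  unfolding emb_def using assms
  by (intro exI[of _ "\<lambda>i. xs ! i"]) (auto simp: inj_on_def nth_eq_iff_index_eq)

lemma emb_list':
  assumes "distinct xs" "\<forall>i<n. \<forall>j<n. (xs ! i, xs ! j) \<in> E \<longleftrightarrow> (i, j) \<in> F \<union> F\<inverse>" "length xs = n"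
  shows "emb n F E"
  by (rule emb_list[OF assms(3,1)]) (simp add: assms(2))

lemma cycle_edges_iff:
  assumes "3 \<le> n" "i < n" "j < n"
  shows "(i, j) \<in> cycle_edges n \<union> (cycle_edges n)\<inverse> \<longleftrightarrow>
    j = Suc i \<or> i = Suc j \<or> (i = 0 \<and> j = n - 1) \<or> (j = 0 \<and> i = n - 1)"
proof -
  have 1: "(i, j) \<in> cycle_edges n \<longleftrightarrow> j = Suc i \<or> (j = 0 \<and> i = n - 1)" if "i < n" "j < n" for i j
  proof (cases "Suc i < n")
    case True
    then show ?thesis using that by (auto simp: cycle_edges_def)
  next
    case False
    then have "Suc i = n" using that by simp
    then show ?thesis using that by (auto simp: cycle_edges_def)
  qed
  show ?thesis using 1[of i j] 1[of j i] assms by auto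
qed

locale xfree =
  fixes E :: "'v rel"
  assumes sym: "(x, y) \<in> E \<Longrightarrow> (y, x) \<in> E"
    and irr: "(x, x) \<notin> E"
    and X: "Xfree E"
begin

lemma no_cyc: "3 \<le> n \<Longrightarrow> n \<noteq> 6 \<Longrightarrow> \<not> emb n (cycle_edges n) E"
  using X unfolding Xfree_def by blast

lemma no3: "(x, y) \<in> E \<Longrightarrow> (y, z) \<in> E \<Longrightarrow> (z, x) \<in> E \<Longrightarrow> False"
proof -
  assume a: "(x, y) \<in> E" "(y, z) \<in> E" "(z, x) \<in> E"
  then have "x \<noteq> y" "y \<noteq> z" "z \<noteq> x" using irr by auto
  then have "emb 3 (cycle_edges 3) E"
    using a sym irr
    apply (intro emb_list[of "[x, y, z]"])
      apply simp apply simp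
    by (subst cycle_edges_iff) (auto simp: less_Suc_eq numeral_3_eq_3)
  then show False using no_cyc[of 3] by simp
qed

lemma no4: "(x, y) \<in> E \<Longrightarrow> (y, z) \<in> E \<Longrightarrow> (z, w) \<in> E \<Longrightarrow> (w, x) \<in> E \<Longrightarrow> x = z \<or> y = w"
proof (rule ccontr)
  assume a: "(x, y) \<in> E" "(y, z) \<in> E" "(z, w) \<in> E" "(w, x) \<in> E" and n: "\<not> (x = z \<or> y = w)"
  have d: "x \<noteq> y" "y \<noteq> z" "z \<noteq> w" "w \<noteq> x" using a irr by auto
  have e: "(x, z) \<notin> E" "(y, w) \<notin> E" "(z, x) \<notin> E" "(w, y) \<notin> E" using no3 a sym by blast+
  have "emb 4 (cycle_edges 4) E"
    apply (rule emb_list[of "[x, y, z, w]"])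
    using d n apply simp using d n apply auto[1]
    using a e sym irr
    by (subst cycle_edges_iff) (auto simp: less_Suc_eq eval_nat_numeral)
  then show False using no_cyc[of 4] by simp
qed

lemma no5: "(a, b) \<in> E \<Longrightarrow> (b, c) \<in> E \<Longrightarrow> (c, d) \<in> E \<Longrightarrow> (d, e) \<in> E \<Longrightarrow> (e, a) \<in> E \<Longrightarrow> False"
proof -
  assume a: "(a, b) \<in> E" "(b, c) \<in> E" "(c, d) \<in> E" "(d, e) \<in> E" "(e, a) \<in> E"
  have s: "(b, a) \<in> E" "(c, b) \<in> E" "(d, c) \<in> E" "(e, d) \<in> E" "(a, e) \<in> E"
    using a sym by blast+
  have d1: "a \<noteq> b" "b \<noteq> c" "c \<noteq> d" "d \<noteq> e" "e \<noteq> a" using a irr by auto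
  have d2: "a \<noteq> c" "b \<noteq> d" "c \<noteq> e" "d \<noteq> a" "e \<noteq> b"
    using no3 a by blast+
  have e: "(a, c) \<notin> E" "(b, d) \<notin> E" "(c, e) \<notin> E" "(d, a) \<notin> E" "(e, b) \<notin> E"
    using no3 a s by blast+
  then have e': "(c, a) \<notin> E" "(d, b) \<notin> E" "(e, c) \<notin> E" "(a, d) \<notin> E" "(b, e) \<notin> E"
    using sym by blast+
  have "emb 5 (cycle_edges 5) E"
    apply (rule emb_list[of "[a, b, c, d, e]"])
    using d1 d2 apply simp using d1 d2 apply auto[1]
    using a s e e' irr
    by (subst cycle_edges_iff) (auto simp: less_Suc_eq eval_nat_numeral)
  then show False using no_cyc[of 5] by simp
qed

lemma n3: "(a, b) \<in> E \<Longrightarrow> (b, c) \<in> E \<Longrightarrow> (a, c) \<notin> E \<and> (c, a) \<notin> E"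
  using no3 sym by blast

lemma n4: "(a, b) \<in> E \<Longrightarrow> (b, c) \<in> E \<Longrightarrow> (c, d) \<in> E \<Longrightarrow> a \<noteq> c \<Longrightarrow> b \<noteq> d \<Longrightarrow>
    (a, d) \<notin> E \<and> (d, a) \<notin> E"
  using no4 sym by blast

lemma n5: "(a, b) \<in> E \<Longrightarrow> (b, c) \<in> E \<Longrightarrow> (c, d) \<in> E \<Longrightarrow> (d, e) \<in> E \<Longrightarrow>
    (a, e) \<notin> E \<and> (e, a) \<notin> E"
  using no5 sym by blast

definition hex :: "'v \<Rightarrow> 'v \<Rightarrow> 'v \<Rightarrow> 'v \<Rightarrow> 'v \<Rightarrow> 'v \<Rightarrow> bool" where
  "hex a b c d e f \<longleftrightarrow> distinct [a, b, c, d, e, f] \<and> (a, b) \<in> E \<and> (b, c) \<in> E \<and> (c, d) \<in> E \<and>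
     (d, e) \<in> E \<and> (e, f) \<in> E \<and> (f, a) \<in> E"

lemma hex_rot: "hex a b c d e f \<Longrightarrow> hex b c d e f a"
  unfolding hex_def by auto

lemma hex_rev: "hex a b c d e f \<Longrightarrow> hex a f e d c b"
  unfolding hex_def using sym by auto

lemma hexI:
  assumes "(a, b) \<in> E" "(b, c) \<in> E" "(c, d) \<in> E" "(d, e) \<in> E" "(e, f) \<in> E" "(f, a) \<in> E"
    "a \<noteq> c" "b \<noteq> d" "c \<noteq> e" "d \<noteq> f" "e \<noteq> a" "f \<noteq> b"
  shows "hex a b c d e f"
proof -
  have "a \<noteq> b" "b \<noteq> c" "c \<noteq> d" "d \<noteq> e" "e \<noteq> f" "f \<noteq> a" using assms(1-6) irr by auto
  moreover have "a \<noteq> d" "b \<noteq> e" "c \<noteq> f" using no3 assms(1-6) sym by blast+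
  ultimately show ?thesis using assms unfolding hex_def by auto
qed

lemma hex_adj:
  assumes "hex a b c d e f"
  shows "(a, b) \<in> E" "(b, c) \<in> E" "(c, d) \<in> E" "(d, e) \<in> E" "(e, f) \<in> E" "(f, a) \<in> E"
    "(b, a) \<in> E" "(c, b) \<in> E" "(d, c) \<in> E" "(e, d) \<in> E" "(f, e) \<in> E" "(a, f) \<in> E"
    "(a, c) \<notin> E" "(b, d) \<notin> E" "(c, e) \<notin> E" "(d, f) \<notin> E" "(e, a) \<notin> E" "(f, b) \<notin> E"
    "(c, a) \<notin> E" "(d, b) \<notin> E" "(e, c) \<notin> E" "(f, d) \<notin> E" "(a, e) \<notin> E" "(b, f) \<notin> E"
    "(a, d) \<notin> E" "(b, e) \<notin> E" "(c, f) \<notin> E" "(d, a) \<notin> E" "(e, b) \<notin> E" "(f, c) \<notin> E"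
proof -
  have h: "distinct [a, b, c, d, e, f]" "(a, b) \<in> E" "(b, c) \<in> E" "(c, d) \<in> E" "(d, e) \<in> E" "(e, f) \<in> E" "(f, a) \<in> E"
    using assms unfolding hex_def by auto
  show s: "(a, b) \<in> E" "(b, c) \<in> E" "(c, d) \<in> E" "(d, e) \<in> E" "(e, f) \<in> E" "(f, a) \<in> E"
    "(b, a) \<in> E" "(c, b) \<in> E" "(d, c) \<in> E" "(e, d) \<in> E" "(f, e) \<in> E" "(a, f) \<in> E"
    using h sym by auto
  show "(a, c) \<notin> E" "(b, d) \<notin> E" "(c, e) \<notin> E" "(d, f) \<notin> E" "(e, a) \<notin> E" "(f, b) \<notin> E"
    "(c, a) \<notin> E" "(d, b) \<notin> E" "(e, c) \<notin> E" "(f, d) \<notin> E" "(a, e) \<notin> E" "(b, f) \<notin> E"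
    using no3 s by blast+
  show "(a, d) \<notin> E" using no4[of a b c d] s h(1) sym by auto
  show "(d, a) \<notin> E" using no4[of a b c d] s h(1) sym by auto
  show "(b, e) \<notin> E" using no4[of b c d e] s h(1) sym by auto
  show "(e, b) \<notin> E" using no4[of b c d e] s h(1) sym by auto
  show "(c, f) \<notin> E" using no4[of c d e f] s h(1) sym by auto
  show "(f, c) \<notin> E" using no4[of c d e f] s h(1) sym by auto
qed

lemma attach_once:
  assumes "hex a b c d e f" "(x, a) \<in> E" "x \<notin> {a, b, c, d, e, f}"
  shows "(x, b) \<notin> E" "(x, c) \<notin> E" "(x, d) \<notin> E" "(x, e) \<notin> E" "(x, f) \<notin> E"
    "(b, x) \<notin> E" "(c, x) \<notin> E" "(d, x) \<notin> E" "(e, x) \<notin> E" "(f, x) \<notin> E"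
proof -
  note h = hex_adj[OF assms(1)]
  have d: "distinct [a, b, c, d, e, f]" using assms(1) unfolding hex_def by auto
  note ax = sym[OF assms(2)]
  show b: "(x, b) \<notin> E" using n3[OF assms(2), of b] h by blast
  show f: "(x, f) \<notin> E" using n3[OF assms(2), of f] h by blast
  show c: "(x, c) \<notin> E" using n4[of x a b c] h d assms(2,3) by auto
  show e: "(x, e) \<notin> E" using n4[of x a f e] h d assms(2,3) by auto
  show d: "(x, d) \<notin> E" using n5[of x a b c d] h assms(2) by blast
  show "(b, x) \<notin> E" "(c, x) \<notin> E" "(d, x) \<notin> E" "(e, x) \<notin> E" "(f, x) \<notin> E"
    using b c d e f sym by blast+
qed

lemma h3c:
  assumes H: "hex a b c d e f" and "(x, a) \<in> E" "x \<notin> {a, b, c, d, e, f}"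
    "(y, b) \<in> E" "y \<notin> {a, b, c, d, e, f}" "(z, c) \<in> E" "z \<notin> {a, b, c, d, e, f}"
  shows False
proof -
  note h = hex_adj[OF H]
  have d: "distinct [a, b, c, d, e, f]" using H unfolding hex_def by auto
  note ax = attach_once[OF H assms(2,3)]
  have ay: "(y, a) \<notin> E" "(y, c) \<notin> E" "(y, d) \<notin> E" "(y, e) \<notin> E" "(y, f) \<notin> E"
    "(a, y) \<notin> E" "(c, y) \<notin> E" "(d, y) \<notin> E" "(e, y) \<notin> E" "(f, y) \<notin> E"
    using attach_once[OF hex_rot[OF H] assms(4)] assms(5) by auto
  have az: "(z, a) \<notin> E" "(z, b) \<notin> E" "(z, d) \<notin> E" "(z, e) \<notin> E" "(z, f) \<notin> E"
    "(a, z) \<notin> E" "(b, z) \<notin> E" "(d, z) \<notin> E" "(e, z) \<notin> E" "(f, z) \<notin> E"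
    using attach_once[OF hex_rot[OF hex_rot[OF H]] assms(6)] assms(7) by auto
  have dd: "x \<noteq> y" "x \<noteq> z" "y \<noteq> z" using ax ay az assms by auto
  have s: "(a, x) \<in> E" "(b, y) \<in> E" "(c, z) \<in> E" using assms sym by auto
  have xy: "(x, y) \<notin> E" "(y, x) \<notin> E"
    using n4[of x a b y] assms(2,3,5) s h by auto
  have yz: "(y, z) \<notin> E" "(z, y) \<notin> E"
    using n4[of y b c z] assms(4,5,7) s h by auto
  have xz: "(x, z) \<notin> E" "(z, x) \<notin> E"
    using n5[of x a b c z] assms(2) s h by blast+
  have "emb 9 C6_3c_edges E"
    apply (rule emb_list[of "[a, b, c, d, e, f, x, y, z]"])
    using d dd assms(3,5,7) apply simp using d dd assms(3,5,7) apply auto[1]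
  proof -
    let ?xs = "[a, b, c, d, e, f, x, y, z]"
    have "\<forall>i<9. \<forall>j<9. (?xs ! i, ?xs ! j) \<in> E \<longleftrightarrow> (i, j) \<in> C6_3c_edges \<union> C6_3c_edges\<inverse>"
      unfolding all_less_numerals cycle_edges_6
      using h ax ay az xy yz xz s assms(2,4,6) irr by (simp add: nth_Cons')
    then show "\<And>i j. i < 9 \<Longrightarrow> j < 9 \<Longrightarrow> (?xs ! i, ?xs ! j) \<in> E \<longleftrightarrow> (i, j) \<in> C6_3c_edges \<union> C6_3c_edges\<inverse>"
      by blast
  qed
  then show False using X unfolding Xfree_def by blast
qed

lemma h3nc:
  assumes H: "hex a b c d e f" and "(x, a) \<in> E" "x \<notin> {a, b, c, d, e, f}"
    "(y, c) \<in> E" "y \<notin> {a, b, c, d, e, f}" "(z, e) \<in> E" "z \<notin> {a, b, c, d, e, f}"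
  shows False
proof -
  note h = hex_adj[OF H]
  have d: "distinct [a, b, c, d, e, f]" using H unfolding hex_def by auto
  note ax = attach_once[OF H assms(2,3)]
  have ay: "(y, a) \<notin> E" "(y, b) \<notin> E" "(y, d) \<notin> E" "(y, e) \<notin> E" "(y, f) \<notin> E"
    "(a, y) \<notin> E" "(b, y) \<notin> E" "(d, y) \<notin> E" "(e, y) \<notin> E" "(f, y) \<notin> E"
    using attach_once[OF hex_rot[OF hex_rot[OF H]] assms(4)] assms(5) by auto
  have az: "(z, a) \<notin> E" "(z, b) \<notin> E" "(z, c) \<notin> E" "(z, d) \<notin> E" "(z, f) \<notin> E"
    "(a, z) \<notin> E" "(b, z) \<notin> E" "(c, z) \<notin> E" "(d, z) \<notin> E" "(f, z) \<notin> E"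
    using attach_once[OF hex_rot[OF hex_rot[OF hex_rot[OF hex_rot[OF H]]]] assms(6)] assms(7) by auto
  have dd: "x \<noteq> y" "x \<noteq> z" "y \<noteq> z" using ax ay az assms by auto
  have s: "(a, x) \<in> E" "(c, y) \<in> E" "(e, z) \<in> E" using assms sym by auto
  have xy: "(x, y) \<notin> E" "(y, x) \<notin> E"
    using n5[of x a b c y] assms(2) s h by blast+
  have yz: "(y, z) \<notin> E" "(z, y) \<notin> E"
    using n5[of y c d e z] assms(4) s h by blast+
  have xz: "(x, z) \<notin> E" "(z, x) \<notin> E"
    using n5[of x a f e z] assms(2) s h by blast+
  have "emb 9 C6_3nc_edges E"
    apply (rule emb_list[of "[a, b, c, d, e, f, x, y, z]"])
    using d dd assms(3,5,7) apply simp using d dd assms(3,5,7) apply auto[1]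
  proof -
    let ?xs = "[a, b, c, d, e, f, x, y, z]"
    have "\<forall>i<9. \<forall>j<9. (?xs ! i, ?xs ! j) \<in> E \<longleftrightarrow> (i, j) \<in> C6_3nc_edges \<union> C6_3nc_edges\<inverse>"
      unfolding all_less_numerals cycle_edges_6
      using h ax ay az xy yz xz s assms(2,4,6) irr by (simp add: nth_Cons')
    then show "\<And>i j. i < 9 \<Longrightarrow> j < 9 \<Longrightarrow> (?xs ! i, ?xs ! j) \<in> E \<longleftrightarrow> (i, j) \<in> C6_3nc_edges \<union> C6_3nc_edges\<inverse>"
      by blast
  qed
  then show False using X unfolding Xfree_def by blast
qed

lemma h2l2:
  assumes H: "hex a b c d e f"
    and x: "(x, a) \<in> E" "x \<notin> {a, b, c, d, e, f}" "(x', x) \<in> E" "x' \<notin> {a, b, c, d, e, f}"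
    and y: "(y, b) \<in> E" "y \<notin> {a, b, c, d, e, f}" "(y', y) \<in> E" "y' \<notin> {a, b, c, d, e, f}"
  shows "(x', d) \<in> E \<or> (y', e) \<in> E \<or> (x', y') \<in> E"
proof (rule ccontr)
  assume n: "\<not> ((x', d) \<in> E \<or> (y', e) \<in> E \<or> (x', y') \<in> E)"
  note h = hex_adj[OF H]
  have d: "distinct [a, b, c, d, e, f]" using H unfolding hex_def by auto
  have s: "(a, x) \<in> E" "(x, x') \<in> E" "(b, y) \<in> E" "(y, y') \<in> E" using x y sym by auto
  have n': "(x', d) \<notin> E" "(y', e) \<notin> E" "(x', y') \<notin> E" "(d, x') \<notin> E" "(e, y') \<notin> E" "(y', x') \<notin> E"
    using n sym by blast+
  note ax = attach_once[OF H x(1,2)]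
  have ay: "(y, a) \<notin> E" "(y, c) \<notin> E" "(y, d) \<notin> E" "(y, e) \<notin> E" "(y, f) \<notin> E"
    "(a, y) \<notin> E" "(c, y) \<notin> E" "(d, y) \<notin> E" "(e, y) \<notin> E" "(f, y) \<notin> E"
    using attach_once[OF hex_rot[OF H] y(1)] y(2) by auto
  have p: "(x', a) \<notin> E" using n3[of x' x a] x by blast
  have q: "(y', b) \<notin> E" using n3[of y' y b] y by blast
  have p1: "(x', b) \<notin> E" using n4[of x' x a b] x h by auto
  have p5: "(x', f) \<notin> E" using n4[of x' x a f] x h by auto
  have p2: "(x', c) \<notin> E" using n5[of x' x a b c] x h by blast
  have p4: "(x', e) \<notin> E" using n5[of x' x a f e] x h by blast
  have q0: "(y', a) \<notin> E" using n4[of y' y b a] y h by auto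
  have q2: "(y', c) \<notin> E" using n4[of y' y b c] y h by auto
  have q3: "(y', d) \<notin> E" using n5[of y' y b c d] y h by blast
  have q5: "(y', f) \<notin> E" using n5[of y' y b a f] y h by blast
  note pq = p p1 p2 p4 p5 q q0 q2 q3 q5
  have pq': "(a, x') \<notin> E" "(b, x') \<notin> E" "(c, x') \<notin> E" "(e, x') \<notin> E" "(f, x') \<notin> E"
     "(a, y') \<notin> E" "(b, y') \<notin> E" "(c, y') \<notin> E" "(d, y') \<notin> E" "(f, y') \<notin> E"
    using pq sym by blast+
  have xy: "(x, y) \<notin> E" using n4[of x a b y] s x y h by auto
  have xy': "(x, y') \<notin> E" using n5[of x a b y y'] x s h by blast
  have x'y: "(x', y) \<notin> E" using n5[of x' x a b y] s x h by blast
  have zz: "(y, x) \<notin> E" "(y', x) \<notin> E" "(y, x') \<notin> E" using xy xy' x'y sym by blast+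
  have dd: "x \<noteq> y" "x \<noteq> x'" "x \<noteq> y'" "x' \<noteq> y" "x' \<noteq> y'" "y \<noteq> y'"
    using ax ay x y s pq n' irr xy xy' x'y zz by auto
  have "emb 10 C6_2l2_edges E"
    apply (rule emb_list[of "[a, b, c, d, e, f, x, x', y, y']"])
    using d dd x y apply simp using d dd x y apply auto[1]
  proof -
    let ?xs = "[a, b, c, d, e, f, x, x', y, y']"
    have "\<forall>i<10. \<forall>j<10. (?xs ! i, ?xs ! j) \<in> E \<longleftrightarrow> (i, j) \<in> C6_2l2_edges \<union> C6_2l2_edges\<inverse>"
      unfolding all_less_numerals cycle_edges_6
      using h ax ay pq pq' xy xy' x'y zz n' s x(1,3) y(1,3) irr by (simp add: nth_Cons')
    then show "\<And>i j. i < 10 \<Longrightarrow> j < 10 \<Longrightarrow> (?xs ! i, ?xs ! j) \<in> E \<longleftrightarrow> (i, j) \<in> C6_2l2_edges \<union> C6_2l2_edges\<inverse>"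
      by blast
  qed
  then show False using X unfolding Xfree_def by blast
qed

text \<open>The remaining non-adjacencies between the legs follow from the absence of short odd cycles
  and of 4-cycles.\<close>

lemma s333:
  assumes l: "(r, a1) \<in> E" "(a1, a2) \<in> E" "(a2, a3) \<in> E" "a2 \<noteq> r" "a3 \<noteq> a1"
    and m: "(r, b1) \<in> E" "(b1, b2) \<in> E" "(b2, b3) \<in> E" "b2 \<noteq> r" "b3 \<noteq> b1"
    and n: "(r, c1) \<in> E" "(c1, c2) \<in> E" "(c2, c3) \<in> E" "c2 \<noteq> r" "c3 \<noteq> c1"
    and d: "a1 \<noteq> b1" "a1 \<noteq> c1" "b1 \<noteq> c1"
    and ab: "(a2, b3) \<notin> E" "(a3, b2) \<notin> E" "(a3, b3) \<notin> E" "a3 \<noteq> b3"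
    and ac: "(a2, c3) \<notin> E" "(a3, c2) \<notin> E" "(a3, c3) \<notin> E" "a3 \<noteq> c3"
    and bc: "(b2, c3) \<notin> E" "(b3, c2) \<notin> E" "(b3, c3) \<notin> E" "b3 \<noteq> c3"
  shows False
proof -
  have leg: "(a1, r) \<in> E \<and> (a2, a1) \<in> E \<and> (a3, a2) \<in> E \<and> r \<noteq> a1 \<and> a1 \<noteq> a2 \<and> a2 \<noteq> a3 \<and> r \<noteq> a3 \<and>
      (r, a2) \<notin> E \<and> (a2, r) \<notin> E \<and> (r, a3) \<notin> E \<and> (a3, r) \<notin> E \<and> (a1, a3) \<notin> E \<and> (a3, a1) \<notin> E"
    if "(r, a1) \<in> E" "(a1, a2) \<in> E" "(a2, a3) \<in> E" "a2 \<noteq> r" "a3 \<noteq> a1" for a1 a2 a3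
  proof -
    have "(a1, r) \<in> E" "(a2, a1) \<in> E" "(a3, a2) \<in> E" using that sym by auto
    moreover have "r \<noteq> a1" "a1 \<noteq> a2" "a2 \<noteq> a3" using that irr by auto
    moreover have "(r, a2) \<notin> E" "(a2, r) \<notin> E" "(a1, a3) \<notin> E" "(a3, a1) \<notin> E"
      using no3 that sym by blast+
    moreover have "(a3, r) \<notin> E" using no4[of r a1 a2 a3] that by auto
    moreover have "(r, a3) \<notin> E" using calculation sym by blast
    moreover have "r \<noteq> a3" using that calculation by auto
    ultimately show ?thesis by blast
  qed
  have pair: "(a1, b1) \<notin> E \<and> (a1, b2) \<notin> E \<and> (a2, b1) \<notin> E \<and> (a2, b2) \<notin> E \<and> (a1, b3) \<notin> E \<and> (a3, b1) \<notin> E \<and>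
      (b1, a1) \<notin> E \<and> (b1, a2) \<notin> E \<and> (b2, a1) \<notin> E \<and> (b2, a2) \<notin> E \<and> (b1, a3) \<notin> E \<and> (b3, a1) \<notin> E \<and>
      (b3, a2) \<notin> E \<and> (b2, a3) \<notin> E \<and> (b3, a3) \<notin> E \<and>
      a1 \<noteq> b2 \<and> a1 \<noteq> b3 \<and> a2 \<noteq> b1 \<and> a2 \<noteq> b2 \<and> a2 \<noteq> b3 \<and> a3 \<noteq> b1 \<and> a3 \<noteq> b2"
    if l: "(r, a1) \<in> E" "(a1, a2) \<in> E" "(a2, a3) \<in> E" "a2 \<noteq> r" "a3 \<noteq> a1"
      and m: "(r, b1) \<in> E" "(b1, b2) \<in> E" "(b2, b3) \<in> E" "b2 \<noteq> r" "b3 \<noteq> b1" and d: "a1 \<noteq> b1"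
      and ab: "(a2, b3) \<notin> E" "(a3, b2) \<notin> E" "(a3, b3) \<notin> E" for a1 a2 a3 b1 b2 b3
  proof -
    note L = leg[OF l] and M = leg[OF m]
    have "(a1, b1) \<notin> E" using no3[of r a1 b1] L M l m by blast
    moreover have "(a1, b2) \<notin> E" using no4[of r a1 b2 b1] L M l m d by blast
    moreover have "(b1, a2) \<notin> E" using no4[of r b1 a2 a1] L M l m d by blast
    moreover have "(a2, b2) \<notin> E" using no5[of r a1 a2 b2 b1] L M l m by blast
    moreover have "(a1, b3) \<notin> E" using no5[of r a1 b3 b2 b1] L M l m by blast
    moreover have "(b1, a3) \<notin> E" using no5[of r b1 a3 a2 a1] L M l m by blast
    ultimately have *: "(a1, b1) \<notin> E \<and> (a1, b2) \<notin> E \<and> (a2, b1) \<notin> E \<and> (a2, b2) \<notin> E \<and> (a1, b3) \<notin> E \<and> (a3, b1) \<notin> E \<and>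
      (b1, a1) \<notin> E \<and> (b1, a2) \<notin> E \<and> (b2, a1) \<notin> E \<and> (b2, a2) \<notin> E \<and> (b1, a3) \<notin> E \<and> (b3, a1) \<notin> E \<and>
      (b3, a2) \<notin> E \<and> (b2, a3) \<notin> E \<and> (b3, a3) \<notin> E" using ab sym by blast
    then show ?thesis using l m L M by blast
  qed
  note A = leg[OF l] and B = leg[OF m] and C = leg[OF n]
  note AB = pair[OF l m d(1) ab(1-3)] and AC = pair[OF l n d(2) ac(1-3)] and BC = pair[OF m n d(3) bc(1-3)]
  have dist: "distinct [r, a1, a2, a3, b1, b2, b3, c1, c2, c3]"
    using l m n d ab(4) ac(4) bc(4) A B C AB AC BC by simp
  let ?xs = "[r, a1, a2, a3, b1, b2, b3, c1, c2, c3]"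
  have "\<forall>i<10. \<forall>j<10. (?xs ! i, ?xs ! j) \<in> E \<longleftrightarrow> (i, j) \<in> S333_edges \<union> S333_edges\<inverse>"
    unfolding all_less_numerals
    using l m n ab ac bc A B C AB AC BC irr by (simp add: nth_Cons')
  from emb_list'[OF dist this] have "emb 10 S333_edges E" by simp
  then show False using X unfolding Xfree_def by blast
qed

end

section \<open>Components and shortest paths\<close>

context xfree
begin

definition comp :: "'v set \<Rightarrow> 'v \<Rightarrow> 'v set" where
  "comp K y = {z. (y, z) \<in> (Restr E K)\<^sup>*}"

definition conn :: "'v set \<Rightarrow> bool" where
  "conn D \<longleftrightarrow> (\<forall>x\<in>D. \<forall>y\<in>D. (x, y) \<in> (Restr E D)\<^sup>*)"

lemma Restr_sym: "(x, y) \<in> (Restr E K)\<^sup>* \<Longrightarrow> (y, x) \<in> (Restr E K)\<^sup>*"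
proof -
  have "sym_on UNIV (Restr E K)" using sym by (auto intro: symI)
  then show "(x, y) \<in> (Restr E K)\<^sup>* \<Longrightarrow> (y, x) \<in> (Restr E K)\<^sup>*"
    by (metis sym_rtrancl symD)
qed

lemma comp_self: "y \<in> comp K y"
  by (simp add: comp_def)

lemma comp_sub: "y \<in> K \<Longrightarrow> comp K y \<subseteq> K"
proof
  fix z assume y: "y \<in> K" and "z \<in> comp K y"
  then have "(y, z) \<in> (Restr E K)\<^sup>*" by (simp add: comp_def)
  then show "z \<in> K" by (induction rule: rtrancl_induct) (use y in auto)
qed

lemma comp_closed: "z \<in> comp K y \<Longrightarrow> (z, w) \<in> E \<Longrightarrow> y \<in> K \<Longrightarrow> w \<in> K \<Longrightarrow> w \<in> comp K y"
  using comp_sub[of y K] unfolding comp_def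
  by (auto intro: rtrancl.rtrancl_into_rtrancl)

lemma comp_least:
  assumes "y \<in> S" "\<And>z w. z \<in> S \<Longrightarrow> (z, w) \<in> E \<Longrightarrow> z \<in> K \<Longrightarrow> w \<in> K \<Longrightarrow> w \<in> S"
  shows "comp K y \<subseteq> S"
proof
  fix z assume "z \<in> comp K y"
  then have "(y, z) \<in> (Restr E K)\<^sup>*" by (simp add: comp_def)
  then show "z \<in> S" by (induction rule: rtrancl_induct) (use assms in auto)
qed

lemma comp_conn: "y \<in> K \<Longrightarrow> conn (comp K y)"
proof -
  assume y: "y \<in> K"
  have *: "(y, z) \<in> (Restr E (comp K y))\<^sup>*" if "z \<in> comp K y" for z
  proof -
    from that have "(y, z) \<in> (Restr E K)\<^sup>*" by (simp add: comp_def)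
    then have "(y, z) \<in> (Restr E (comp K y))\<^sup>* \<and> z \<in> comp K y"
    proof (induction rule: rtrancl_induct)
      case base
      then show ?case using comp_self by simp
    next
      case (step u v)
      then have "v \<in> comp K y" using comp_closed y by blast
      with step show ?case by (auto intro: rtrancl.rtrancl_into_rtrancl)
    qed
    then show ?thesis by simp
  qed
  show "conn (comp K y)" unfolding conn_def
  proof (intro ballI)
    fix u v assume "u \<in> comp K y" "v \<in> comp K y"
    then show "(u, v) \<in> (Restr E (comp K y))\<^sup>*"
      using *[of u] *[of v] Restr_sym rtrancl_trans by metis
  qed
qed

lemma connI:
  assumes "r \<in> D" "\<And>z. z \<in> D \<Longrightarrow> (z, r) \<in> (Restr E D)\<^sup>*"
  shows "conn D"
  unfolding conn_def
proof (intro ballI)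
  fix u v assume "u \<in> D" "v \<in> D"
  then show "(u, v) \<in> (Restr E D)\<^sup>*"
    by (intro rtrancl_trans[OF assms(2) Restr_sym[OF assms(2)]])
qed

lemma conn_gate:
  assumes D: "conn D" and D': "D' \<subseteq> D" and t: "t \<in> D'"
    and T: "\<And>x. x \<in> T \<Longrightarrow> (x, t) \<in> (Restr E D')\<^sup>*"
    and g: "\<And>x y. x \<in> D' \<Longrightarrow> y \<in> D - D' \<Longrightarrow> (x, y) \<in> E \<Longrightarrow> x \<in> T"
  shows "conn D'"
proof (rule connI[OF t])
  fix z assume z: "z \<in> D'"
  have "(z, t) \<in> (Restr E D)\<^sup>*" using D D' t z unfolding conn_def by blast
  then show "(z, t) \<in> (Restr E D')\<^sup>*" using z
  proof (induction rule: converse_rtrancl_induct)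
    case base
    then show ?case by simp
  next
    case (step y w)
    show ?case
    proof (cases "w \<in> D'")
      case True
      then have "(y, w) \<in> Restr E D'" using step by auto
      then show ?thesis using step.IH[OF True] by (rule converse_rtrancl_into_rtrancl)
    next
      case False
      then have "y \<in> T" using g[of y w] step by auto
      then show ?thesis by (rule T)
    qed
  qed
qed

lemma conn_nbr:
  assumes "conn D" "r \<in> D" "z \<in> D" "z \<noteq> r"
  shows "\<exists>y\<in>D. y \<noteq> r \<and> (r, y) \<in> E \<and> z \<in> comp (D - {r}) y"
proof -
  have "(z, r) \<in> (Restr E D)\<^sup>*" using assms unfolding conn_def by blast
  then show ?thesis using assms(3,4)
  proof (induction rule: converse_rtrancl_induct)
    case base
    then show ?case by simp
  next
    case (step z w)
    show ?case
    proof (cases "w = r")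
      case True
      then show ?thesis using step sym comp_self by (intro bexI[of _ z]) auto
    next
      case False
      then obtain y where y: "y \<in> D" "y \<noteq> r" "(r, y) \<in> E" "w \<in> comp (D - {r}) y"
        using step by blast
      then have "z \<in> comp (D - {r}) y"
        using comp_closed[of w "D - {r}" y z] step sym by auto
      then show ?thesis using y by blast
    qed
  qed
qed

lemma minpath:
  assumes "A \<subseteq> K" "B \<subseteq> K" "A \<inter> B = {}" "a \<in> A" "b \<in> B" "(a, b) \<in> (Restr E K)\<^sup>*"
  shows "\<exists>m g. 1 \<le> m \<and> g 0 \<in> A \<and> g m \<in> B \<and> (\<forall>i\<le>m. g i \<in> K) \<and> (\<forall>i<m. (g i, g (Suc i)) \<in> E) \<and>
    (\<forall>i\<le>m. 0 < i \<longrightarrow> g i \<notin> A) \<and> (\<forall>i<m. g i \<notin> B) \<and> inj_on g {..m} \<and>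
    (\<forall>i\<le>m. \<forall>j\<le>m. (g i, g j) \<in> E \<longrightarrow> j = Suc i \<or> i = Suc j)"
proof -
  let ?R = "Restr E K"
  let ?P = "\<lambda>m. \<exists>a\<in>A. \<exists>b\<in>B. (a, b) \<in> ?R ^^ m"
  define m where "m = (LEAST m. ?P m)"
  have ex: "?P k" if "(a, b) \<in> ?R ^^ k" for k using that assms by blast
  obtain k where "(a, b) \<in> ?R ^^ k" using assms(6) rtrancl_imp_relpow by blast
  then have Pm: "?P m" unfolding m_def by (intro LeastI[of ?P k] ex)
  have least: "m \<le> k" if "a' \<in> A" "b' \<in> B" "(a', b') \<in> ?R ^^ k" for a' b' k
    unfolding m_def by (rule Least_le) (use that in blast)
  obtain a' b' g where g: "a' \<in> A" "b' \<in> B" "g 0 = a'" "g m = b'" "\<And>i. i < m \<Longrightarrow> (g i, g (Suc i)) \<in> ?R"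
    using Pm unfolding relpow_fun_conv by blast
  have seg: "(g i, g j) \<in> ?R ^^ (j - i)" if "i \<le> j" "j \<le> m" for i j
    unfolding relpow_fun_conv
    by (rule exI[of _ "\<lambda>k. g (i + k)"]) (use that g(5) in auto)
  have m1: "1 \<le> m"
  proof (rule ccontr)
    assume "\<not> 1 \<le> m"
    then have "m = 0" by simp
    then show False using g assms(3) by auto
  qed
  have notA: "g i \<notin> A" if "i \<le> m" "0 < i" for i
    using least[of "g i" "g m" "m - i"] seg[of i m] that g(2,4) by fastforce
  have notB: "g i \<notin> B" if "i < m" for i
    using least[of "g 0" "g i" i] seg[of 0 i] that g(1,3) by fastforce
  have short: "j \<le> Suc i" if "i \<le> j" "j \<le> m" "(g i, g j) \<in> E" for i j
  proof -
    have K: "g l \<in> K" if "l \<le> m" for l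
      using g(5)[of l] g(2,4) assms(2) that by (cases "l = m") auto
    have "(g 0, g j) \<in> ?R ^^ Suc i"
      using seg[of 0 i] that K[of i] K[of j] by (auto intro: relpow_Suc_I)
    then have "(g 0, g m) \<in> ?R ^^ (Suc i + (m - j))"
      using seg[of j m] that unfolding relpow_add[of "Suc i"] by blast
    then have "m \<le> Suc i + (m - j)" using least g(1-4) by blast
    then show ?thesis using that by linarith
  qed
  have inj': False if "i < j" "j \<le> m" "g i = g j" for i j
  proof -
    have "(g 0, g m) \<in> ?R ^^ (i + (m - j))"
      using seg[of 0 i] seg[of j m] that unfolding relpow_add by auto
    then have "m \<le> i + (m - j)" using least g(1-4) by blast
    then show ?thesis using that by linarith
  qed
  have K: "g l \<in> K" if "l \<le> m" for l
    using g(5)[of l] g(2,4) assms(2) that by (cases "l = m") auto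
  have "inj_on g {..m}"
    unfolding inj_on_def using inj' by (metis atMost_iff linorder_neqE_nat)
  moreover have "j = Suc i \<or> i = Suc j" if "i \<le> m" "j \<le> m" "(g i, g j) \<in> E" for i j
  proof (cases "i \<le> j")
    case True
    then have "j \<le> Suc i" using short that by blast
    moreover have "i \<noteq> j" using that irr by auto
    ultimately show ?thesis using True by linarith
  next
    case False
    then have "i \<le> Suc j" using short[of j i] that sym by auto
    then show ?thesis using False by linarith
  qed
  moreover have "\<forall>i<m. (g i, g (Suc i)) \<in> E" using g(5) by blast
  ultimately show ?thesis
    using m1 g(1-4) notA notB K by (intro exI[of _ m] exI[of _ g]) auto
qed

lemma close_cycle:
  assumes g: "\<And>i. i < m \<Longrightarrow> (g i, g (Suc i)) \<in> E" "inj_on g {..m}"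
      "\<And>i j. i \<le> m \<Longrightarrow> j \<le> m \<Longrightarrow> (g i, g j) \<in> E \<Longrightarrow> j = Suc i \<or> i = Suc j"
    and y: "distinct ys" "length ys = l" "l \<noteq> 0"
      "\<And>i j. i < l \<Longrightarrow> j < l \<Longrightarrow> (ys ! i, ys ! j) \<in> E \<longleftrightarrow> j = Suc i \<or> i = Suc j"
    and d: "\<And>i k. i \<le> m \<Longrightarrow> k < l \<Longrightarrow> g i \<noteq> ys ! k"
    and c: "\<And>i k. i \<le> m \<Longrightarrow> k < l \<Longrightarrow> (g i, ys ! k) \<in> E \<longleftrightarrow> (i = m \<and> k = 0) \<or> (i = 0 \<and> k = l - 1)"
    and n: "3 \<le> Suc m + l"
  shows "Suc m + l = 6"
proof (rule ccontr)
  assume n6: "Suc m + l \<noteq> 6"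
  let ?n = "Suc m + l"
  define f where "f = (\<lambda>i. if i \<le> m then g i else ys ! (i - Suc m))"
  have gg: "(g i, g j) \<in> E \<longleftrightarrow> j = Suc i \<or> i = Suc j" if "i \<le> m" "j \<le> m" for i j
    using g(1)[of i] g(1)[of j] g(3)[of i j] that sym by auto
  have "inj_on f {..<?n}"
  proof (rule inj_onI)
    fix i j assume ij: "i \<in> {..<?n}" "j \<in> {..<?n}" "f i = f j"
    consider "i \<le> m" "j \<le> m" | "i \<le> m" "m < j" | "m < i" "j \<le> m" | "m < i" "m < j" by linarith
    then show "i = j"
    proof cases
      case 1
      then show ?thesis using ij g(2) by (auto simp: f_def dest: inj_onD)
    next
      case 2
      then show ?thesis using ij d[of i "j - Suc m"] by (auto simp: f_def)
    next
      case 3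
      then have "g j = ys ! (i - Suc m)" "i - Suc m < l" using ij by (auto simp: f_def)
      then show ?thesis using d[of j "i - Suc m"] 3(2) by blast
    next
      case 4
      then have "i - Suc m < l" "j - Suc m < l" using ij by auto
      then have "i - Suc m = j - Suc m" using ij 4 y(1,2) by (auto simp: f_def nth_eq_iff_index_eq)
      then show ?thesis using 4 by linarith
    qed
  qed
  moreover have "(f i, f j) \<in> E \<longleftrightarrow> (i, j) \<in> cycle_edges ?n \<union> (cycle_edges ?n)\<inverse>"
    if ij: "i < ?n" "j < ?n" for i j
  proof -
    have c': "(ys ! k, g i) \<in> E \<longleftrightarrow> (i = m \<and> k = 0) \<or> (i = 0 \<and> k = l - 1)" if "i \<le> m" "k < l" for i k
      using c[OF that] sym by blast
    consider "i \<le> m" "j \<le> m" | "i \<le> m" "m < j" | "m < i" "j \<le> m" | "m < i" "m < j" by linarith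
    then show ?thesis
      unfolding cycle_edges_iff[OF n ij]
    proof cases
      case 1
      then show "(f i, f j) \<in> E \<longleftrightarrow> j = Suc i \<or> i = Suc j \<or> i = 0 \<and> j = ?n - 1 \<or> j = 0 \<and> i = ?n - 1"
        using gg y(3) by (auto simp: f_def)
    next
      case 2
      then have "(f i, f j) \<in> E \<longleftrightarrow> (i = m \<and> j - Suc m = 0) \<or> (i = 0 \<and> j - Suc m = l - 1)"
        using c[of i "j - Suc m"] ij by (simp add: f_def)
      then show "(f i, f j) \<in> E \<longleftrightarrow> j = Suc i \<or> i = Suc j \<or> i = 0 \<and> j = ?n - 1 \<or> j = 0 \<and> i = ?n - 1"
        using 2 y(3) by auto
    next
      case 3
      then have "(f i, f j) \<in> E \<longleftrightarrow> (j = m \<and> i - Suc m = 0) \<or> (j = 0 \<and> i - Suc m = l - 1)"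
        using c'[of j "i - Suc m"] ij by (simp add: f_def)
      then show "(f i, f j) \<in> E \<longleftrightarrow> j = Suc i \<or> i = Suc j \<or> i = 0 \<and> j = ?n - 1 \<or> j = 0 \<and> i = ?n - 1"
        using 3 y(3) by auto
    next
      case 4
      then have "(f i, f j) \<in> E \<longleftrightarrow> j - Suc m = Suc (i - Suc m) \<or> i - Suc m = Suc (j - Suc m)"
        using y(4)[of "i - Suc m" "j - Suc m"] ij by (simp add: f_def)
      then show "(f i, f j) \<in> E \<longleftrightarrow> j = Suc i \<or> i = Suc j \<or> i = 0 \<and> j = ?n - 1 \<or> j = 0 \<and> i = ?n - 1"
        using 4 by auto
    qed
  qed
  ultimately have "emb ?n (cycle_edges ?n) E" unfolding emb_def by blast
  then show False using no_cyc n n6 by blast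
qed

lemma ear:
  assumes "r \<notin> K" and N: "\<And>x. x \<in> K \<Longrightarrow> (r, x) \<in> E \<longleftrightarrow> x \<in> A \<or> x \<in> B"
    and "A \<subseteq> K" "B \<subseteq> K" "A \<inter> B = {}" "a \<in> A" "b \<in> B" "(a, b) \<in> (Restr E K)\<^sup>*"
  shows "\<exists>a\<in>A. \<exists>b\<in>B. \<exists>d1\<in>K. \<exists>d2\<in>K. \<exists>d3\<in>K. hex r a d1 d2 d3 b"
proof -
  obtain m g where m0: "1 \<le> m" "g 0 \<in> A" "g m \<in> B" "\<forall>i\<le>m. g i \<in> K"
    "\<forall>i<m. (g i, g (Suc i)) \<in> E" "\<forall>i\<le>m. 0 < i \<longrightarrow> g i \<notin> A"
    "\<forall>i<m. g i \<notin> B" "inj_on g {..m}"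
    "\<forall>i\<le>m. \<forall>j\<le>m. (g i, g j) \<in> E \<longrightarrow> j = Suc i \<or> i = Suc j"
    using minpath[OF assms(3-8)] by (elim exE conjE) (rule that)
  note m = m0(1-3) m0(4-7)[rule_format] m0(8) m0(9)[rule_format]
  have gr: "(g i, r) \<in> E \<longleftrightarrow> i = m \<or> i = 0" if "i \<le> m" for i
  proof -
    have "(g i, r) \<in> E \<longleftrightarrow> g i \<in> A \<or> g i \<in> B" using N[OF m(4)[OF that]] sym by blast
    moreover have "g i \<in> A \<longleftrightarrow> i = 0" using m(2,6) that by auto
    moreover have "g i \<in> B \<longleftrightarrow> i = m" using m(3,7) that by (metis le_neq_implies_less)
    ultimately show ?thesis by blast
  qed
  have "Suc m + 1 = 6"
  proof (rule close_cycle[of m g "[r]"])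
    show "\<And>i k. i \<le> m \<Longrightarrow> k < 1 \<Longrightarrow> g i \<noteq> [r] ! k" using m(4) assms(1) by auto
    show "\<And>i k. i \<le> m \<Longrightarrow> k < 1 \<Longrightarrow>
        ((g i, [r] ! k) \<in> E) = (i = m \<and> k = 0 \<or> i = 0 \<and> k = 1 - 1)" using gr by auto
  qed (use m irr in auto)
  then have m4: "m = 4" by simp
  have e: "(g 0, g 1) \<in> E" "(g 1, g 2) \<in> E" "(g 2, g 3) \<in> E" "(g 3, g 4) \<in> E"
    using m(5)[of 0] m(5)[of 1] m(5)[of 2] m(5)[of 3] m4 by (simp_all add: eval_nat_numeral)
  have h: "hex r (g 0) (g 1) (g 2) (g 3) (g 4)"
  proof (rule hexI)
    show "(r, g 0) \<in> E" "(g 4, r) \<in> E" using gr[of 0] gr[of 4] m4 sym by auto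
    show "r \<noteq> g 1" "g 3 \<noteq> r" using m(4)[of 1] m(4)[of 3] m4 assms(1) by auto
    have "g i \<noteq> g j" if "i \<le> 4" "j \<le> 4" "i \<noteq> j" for i j
      using inj_onD[OF m(8)] that unfolding m4 by blast
    then show "g 0 \<noteq> g 2" "g 1 \<noteq> g 3" "g 2 \<noteq> g 4" "g 4 \<noteq> g 0" by simp_all
  qed (use e in auto)
  have k: "g 1 \<in> K" "g 2 \<in> K" "g 3 \<in> K" "g 4 \<in> B" using m(3,4) m4 by auto
  show ?thesis
  proof (intro bexI)
    show "hex r (g 0) (g 1) (g 2) (g 3) (g 4)" by (rule h)
  qed (use k m(2) in simp_all)
qed

end

section \<open>Building blocks\<close>

definition symcl :: "'v rel \<Rightarrow> 'v rel" where
  "symcl R = R \<union> R\<inverse>"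

lemma symcl_Un: "symcl (A \<union> B) = symcl A \<union> symcl B"
  by (auto simp: symcl_def)

lemma symcl_iff: "(x, y) \<in> symcl R \<longleftrightarrow> (x, y) \<in> R \<or> (y, x) \<in> R"
  by (auto simp: symcl_def)

lemma symcl_sym: "(x, y) \<in> symcl R \<Longrightarrow> (y, x) \<in> symcl R"
  by (auto simp: symcl_def)

text \<open>\<open>cell L R M C\<close>: the graph \<open>(M, C)\<close> is a hexagonal cell $C_{6,k}$, where \<open>X\<close> and \<open>g ` X\<close>
  are the sets of the vertices $a_j$ and $b_j$, with left edge \<open>L\<close> and right edge \<open>R\<close>.\<close>

definition cell :: "'v set \<Rightarrow> 'v set \<Rightarrow> 'v set \<Rightarrow> 'v rel \<Rightarrow> bool" where
  "cell L R M C \<longleftrightarrow> (\<exists>a b X g x1 x2. finite X \<and> x1 \<in> X \<and> x2 \<in> X \<and> x1 \<noteq> x2 \<and> inj_on g X \<and>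
     a \<noteq> b \<and> a \<notin> X \<and> b \<notin> X \<and> a \<notin> g ` X \<and> b \<notin> g ` X \<and> X \<inter> g ` X = {} \<and>
     L = {a, x1} \<and> R = {b, g x2} \<and> M = {a, b} \<union> X \<union> g ` X \<and>
     C = symcl (Pair a ` X \<union> (\<lambda>x. (x, g x)) ` X \<union> (\<lambda>x. (g x, b)) ` X))"

lemma cell_sym: "cell L R M C \<Longrightarrow> cell R L M C"
proof -
  assume "cell L R M C"
  then obtain a b X g x1 x2 where c: "finite X" "x1 \<in> X" "x2 \<in> X" "x1 \<noteq> x2" "inj_on g X"
     "a \<noteq> b" "a \<notin> X" "b \<notin> X" "a \<notin> g ` X" "b \<notin> g ` X" "X \<inter> g ` X = {}"
     "L = {a, x1}" "R = {b, g x2}" "M = {a, b} \<union> X \<union> g ` X"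
     "C = symcl (Pair a ` X \<union> (\<lambda>x. (x, g x)) ` X \<union> (\<lambda>x. (g x, b)) ` X)"
    unfolding cell_def by (elim exE conjE) (rule that)
  let ?h = "inv_into X g"
  have h: "?h (g x) = x" if "x \<in> X" for x using that c(5) by simp
  have hg: "?h ` g ` X = X" using h by force
  have ih: "inj_on ?h (g ` X)" using h by (auto simp: inj_on_def)
  have e1: "(\<lambda>x. (x, ?h x)) ` g ` X = (\<lambda>x. (g x, x)) ` X"
    unfolding image_image using h by (auto intro!: image_cong)
  have e2: "(\<lambda>x. (?h x, a)) ` g ` X = (\<lambda>x. (x, a)) ` X"
    unfolding image_image using h by (auto intro!: image_cong)
  have C: "C = symcl (Pair b ` g ` X \<union> (\<lambda>x. (x, ?h x)) ` g ` X \<union> (\<lambda>x. (?h x, a)) ` g ` X)"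
    unfolding c(15) e1 e2 by (auto simp: symcl_def image_iff)
  show ?thesis
    unfolding cell_def
  proof (intro exI conjI)
    show "C = symcl (Pair b ` g ` X \<union> (\<lambda>x. (x, ?h x)) ` g ` X \<union> (\<lambda>x. (?h x, a)) ` g ` X)" by (rule C)
    show "L = {a, ?h (g x1)}" using c h by simp
    show "R = {b, g x2}" using c by simp
    show "M = {b, a} \<union> g ` X \<union> ?h ` g ` X" using c hg by auto
    show "g x2 \<noteq> g x1" using c by (auto dest: inj_onD)
    show "inj_on ?h (g ` X)" by (rule ih)
  qed (use c hg in auto)
qed

lemma cell_sub:
  assumes "cell L R M C"
  shows "L \<subseteq> M" "R \<subseteq> M" "L \<inter> R = {}" "finite M" "C \<subseteq> M \<times> M"
  using assms unfolding cell_def by (auto simp: symcl_def)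

inductive strip :: "nat \<Rightarrow> 'v set \<Rightarrow> 'v set \<Rightarrow> 'v set \<Rightarrow> 'v rel \<Rightarrow> 'v set \<Rightarrow> bool" where
  base: "x \<noteq> y \<Longrightarrow> strip 0 {x, y} {x, y} {x, y} {(x, y), (y, x)} {x, y}"
| snoc: "strip n L R S C U \<Longrightarrow> cell R R' M C' \<Longrightarrow> S \<inter> M = R \<Longrightarrow>
    strip (Suc n) L R' (S \<union> M) (C \<union> C') (U \<union> R')"

lemma strip_sub:
  assumes "strip n L R S C U"
  shows "L \<subseteq> S \<and> R \<subseteq> S \<and> U \<subseteq> S \<and> L \<subseteq> U \<and> R \<subseteq> U \<and> finite S \<and> C \<subseteq> S \<times> S"
  using assms
proof induction
  case (snoc n L R S C U R' M C')
  then show ?case using cell_sub[OF snoc(2)] by auto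
qed auto

lemma strip_cell_edge:
  assumes "cell L R M C"
  obtains x y where "L = {x, y}" "x \<noteq> y" "(x, y) \<in> C" "(y, x) \<in> C"
proof -
  obtain a b X g x1 x2 where "x1 \<in> X" "a \<notin> X" "L = {a, x1}"
     "C = symcl (Pair a ` X \<union> (\<lambda>x. (x, g x)) ` X \<union> (\<lambda>x. (g x, b)) ` X)"
    using assms unfolding cell_def
    apply (elim exE conjE)
    subgoal for a b X g x1 x2 by (rule that[of x1 X a g b])
    done
  then show ?thesis by (intro that[of a x1]) (auto simp: symcl_def)
qed

lemma strip_right_edge:
  assumes "strip n L R S C U"
  shows "\<exists>x y. R = {x, y} \<and> x \<noteq> y \<and> (x, y) \<in> C \<and> (y, x) \<in> C"
  using assms
proof (cases rule: strip.cases)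
  case (snoc n0 R0 S0 C0 U0 M C')
  obtain x y where xy: "R = {x, y}" "x \<noteq> y" "(x, y) \<in> C'" "(y, x) \<in> C'"
    by (rule strip_cell_edge[OF cell_sym[OF snoc(6)]])
  then show ?thesis unfolding snoc(3) by (intro exI[of _ x] exI[of _ y]) simp
qed auto

lemma strip_concat:
  assumes "strip m R T S' C' U'" "strip n L R S C U" "S \<inter> S' = R"
  shows "strip (n + m) L T (S \<union> S') (C \<union> C') (U \<union> U')"
  using assms
proof induction
  case (base x y)
  obtain x' y' where "{x, y} = {x', y'}" "x' \<noteq> y'" "(x', y') \<in> C" "(y', x') \<in> C"
    using strip_right_edge[OF base(2)] by blast
  then have "{(x, y), (y, x)} \<subseteq> C" by (auto simp: doubleton_eq_iff)
  then have "C \<union> {(x, y), (y, x)} = C" by blast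
  moreover have "U \<union> {x, y} = U" "S \<union> {x, y} = S" using strip_sub[OF base(2)] by blast+
  ultimately show ?case using base by simp
next
  case (snoc m R Q S' C' U' Q' M D)
  have sub: "R \<subseteq> S'" "Q \<subseteq> S'" using strip_sub[OF snoc(1)] by auto
  have RS: "R \<subseteq> S" using strip_sub[OF snoc(5)] by auto
  have 1: "S \<inter> S' = R" using snoc(6) sub RS by blast
  have "(S \<union> S') \<inter> M = Q" using snoc(3,6) sub by blast
  from strip.snoc[OF snoc(4)[OF snoc(5) 1] snoc(2) this]
  show ?case by (simp add: Un_assoc)
qed

lemma strip_one:
  assumes "cell L R M C"
  shows "strip (Suc 0) L R M C (L \<union> R)"
proof -
  obtain x y where L: "L = {x, y}" "x \<noteq> y" "(x, y) \<in> C" "(y, x) \<in> C"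
    using strip_cell_edge[OF assms] by blast
  have "strip 0 L L L {(x, y), (y, x)} L" using strip.base[OF L(2)] unfolding L(1) .
  from strip.snoc[OF this assms] have "strip (Suc 0) L R (L \<union> M) ({(x, y), (y, x)} \<union> C) (L \<union> R)"
    using cell_sub[OF assms] by blast
  moreover have "L \<union> M = M" "{(x, y), (y, x)} \<union> C = C" using cell_sub[OF assms] L by auto
  ultimately show ?thesis by simp
qed

lemma strip_rev:
  assumes "strip n L R S C U"
  shows "strip n R L S C U"
  using assms
proof induction
  case (base x y)
  then show ?case by (rule strip.base)
next
  case (snoc n L R S C U R' M C')
  have "R \<subseteq> U" using strip_sub[OF snoc(1)] by auto
  have "strip (Suc 0 + n) R' L (M \<union> S) (C' \<union> C) ((R' \<union> R) \<union> U)"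
    by (rule strip_concat[OF snoc(4) strip_one[OF cell_sym[OF snoc(2)]]]) (use snoc(3) in blast)
  moreover have "(R' \<union> R) \<union> U = U \<union> R'" using \<open>R \<subseteq> U\<close> by blast
  ultimately show ?case by (simp add: Un_commute)
qed

text \<open>\<open>deco S C U V W\<close>: the graph \<open>(V, W)\<close> arises from \<open>(S, C)\<close> by adding pendant vertices at \<open>U\<close>.\<close>

definition deco :: "'v set \<Rightarrow> 'v rel \<Rightarrow> 'v set \<Rightarrow> 'v set \<Rightarrow> 'v rel \<Rightarrow> bool" where
  "deco S C U V W \<longleftrightarrow> (\<exists>P Q. V = S \<union> P \<and> P \<inter> S = {} \<and> Q \<subseteq> P \<times> U \<and>
     (\<forall>p\<in>P. \<exists>!u. (p, u) \<in> Q) \<and> W = C \<union> symcl Q)"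

lemma decoE:
  assumes "deco S C U V W"
  obtains P Q where "V = S \<union> P" "P \<inter> S = {}" "Q \<subseteq> P \<times> U" "\<forall>p\<in>P. \<exists>!u. (p, u) \<in> Q" "W = C \<union> symcl Q"
  using assms unfolding deco_def
  apply (elim exE conjE)
  subgoal for P Q by (rule that[of P Q])
  done

lemma deco_refl: "deco S C U S C"
  unfolding deco_def by (intro exI[of _ "{}"]) (auto simp: symcl_def)

lemma deco_sub: "deco S C U V W \<Longrightarrow> S \<subseteq> V \<and> C \<subseteq> W"
  unfolding deco_def by auto

lemma deco_union:
  assumes "deco S C U V W" "deco S' C' U' V' W'" "V \<inter> V' \<subseteq> S \<inter> S'"
  shows "deco (S \<union> S') (C \<union> C') (U \<union> U') (V \<union> V') (W \<union> W')"
proof -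
  obtain P Q where p: "V = S \<union> P" "P \<inter> S = {}" "Q \<subseteq> P \<times> U" "\<forall>p\<in>P. \<exists>!u. (p, u) \<in> Q" "W = C \<union> symcl Q"
    by (rule decoE[OF assms(1)])
  obtain P' Q' where p': "V' = S' \<union> P'" "P' \<inter> S' = {}" "Q' \<subseteq> P' \<times> U'" "\<forall>p\<in>P'. \<exists>!u. (p, u) \<in> Q'" "W' = C' \<union> symcl Q'"
    by (rule decoE[OF assms(2)])
  have d: "P \<inter> P' = {}" "(P \<union> P') \<inter> (S \<union> S') = {}" using assms(3) p p' by blast+
  have "\<exists>!u. (p, u) \<in> Q \<union> Q'" if "p \<in> P \<union> P'" for p
  proof (cases "p \<in> P")
    case True
    then have "(p, u) \<notin> Q'" for u using p'(3) d by blast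
    then show ?thesis using bspec[OF p(4) True] by simp
  next
    case False
    then have "(p, u) \<notin> Q" for u using p(3) by blast
    then show ?thesis using bspec[OF p'(4), of p] that False by simp
  qed
  moreover have "Q \<union> Q' \<subseteq> (P \<union> P') \<times> (U \<union> U')" using p(3) p'(3) by blast
  moreover have "W \<union> W' = (C \<union> C') \<union> symcl (Q \<union> Q')" using p(5) p'(5) by (auto simp: symcl_def)
  moreover have "V \<union> V' = (S \<union> S') \<union> (P \<union> P')" using p(1) p'(1) by blast
  ultimately show ?thesis unfolding deco_def
    by (intro exI[of _ "P \<union> P'"] exI[of _ "Q \<union> Q'"] conjI d(2)) blast+
qed

definition star_graph :: "'v set \<Rightarrow> 'v rel \<Rightarrow> 'v \<Rightarrow> bool" where
  "star_graph D W r \<longleftrightarrow> (\<exists>Y Z par. D = {r} \<union> Y \<union> Z \<and> r \<notin> Y \<and> r \<notin> Z \<and> Y \<inter> Z = {} \<and> par ` Z \<subseteq> Y \<and>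
     W = symcl (Pair r ` Y \<union> (\<lambda>z. (z, par z)) ` Z))"

context xfree
begin

definition anti :: "'v set \<Rightarrow> 'v set \<Rightarrow> bool" where
  "anti A B \<longleftrightarrow> (\<forall>x\<in>A. \<forall>y\<in>B. (x, y) \<notin> E)"

lemma Restr_Un: "anti (A - B) (B - A) \<Longrightarrow> Restr E (A \<union> B) = Restr E A \<union> Restr E B"
  unfolding anti_def using sym by blast

text \<open>\<open>good D r\<close>: the part of the graph on \<open>D\<close> can be built as a chain of blocks which ends at \<open>r\<close>.\<close>

inductive good :: "'v set \<Rightarrow> 'v \<Rightarrow> bool" where
  star: "star_graph D (Restr E D) r \<Longrightarrow> good D r"
| edge: "good D w \<Longrightarrow> w \<in> D \<Longrightarrow> (w, w') \<in> E \<Longrightarrow> w' \<notin> D \<Longrightarrow> anti {w'} (D - {w}) \<Longrightarrow> good (insert w' D) w'"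
| glue_star: "good D w \<Longrightarrow> star_graph S (Restr E S) w \<Longrightarrow> D \<inter> S = {w} \<Longrightarrow> anti (D - {w}) (S - {w}) \<Longrightarrow>
    good (D \<union> S) w"
| glue_strip: "good D w \<Longrightarrow> strip n L R S C U \<Longrightarrow> 1 \<le> n \<Longrightarrow> deco S C U V (Restr E V) \<Longrightarrow> w \<in> L \<Longrightarrow> w' \<in> R \<Longrightarrow>
    D \<inter> V = {w} \<Longrightarrow> anti (D - {w}) (V - {w}) \<Longrightarrow> good (D \<union> V) w'"

definition resE :: "'v set \<Rightarrow> 'v \<Rightarrow> 'v \<Rightarrow> nat \<Rightarrow> bool" where
  "resE D u v n \<longleftrightarrow> (\<exists>L S C U V D1 w. strip n L {u, v} S C U \<and> deco S C U V (Restr E V) \<and> w \<in> L \<and>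
     good D1 w \<and> D = D1 \<union> V \<and> D1 \<inter> V = {w} \<and> anti (D1 - {w}) (V - {w}))"

definition ctxR :: "'v set \<Rightarrow> 'v \<Rightarrow> bool" where
  "ctxR D r \<longleftrightarrow> finite D \<and> conn D \<and> r \<in> D \<and> (\<exists>p1 p2 p3. p1 \<notin> D \<and> p2 \<notin> D \<and> p3 \<notin> D \<and>
     (r, p1) \<in> E \<and> (p1, p2) \<in> E \<and> (p2, p3) \<in> E \<and> p3 \<noteq> p1 \<and>
     (\<forall>x\<in>D. ((x, p1) \<in> E \<longrightarrow> x = r) \<and> (x, p2) \<notin> E \<and> (x, p3) \<notin> E))"

definition ctxE :: "'v set \<Rightarrow> 'v \<Rightarrow> 'v \<Rightarrow> bool" where
  "ctxE D u v \<longleftrightarrow> finite D \<and> conn D \<and> u \<in> D \<and> v \<in> D \<and> (\<exists>h1 h2 h3 h4. hex u h1 h2 h3 h4 v \<and>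
     h1 \<notin> D \<and> h2 \<notin> D \<and> h3 \<notin> D \<and> h4 \<notin> D \<and>
     (\<forall>x\<in>D. ((x, h1) \<in> E \<longrightarrow> x = u) \<and> (x, h2) \<notin> E \<and> (x, h3) \<notin> E \<and> ((x, h4) \<in> E \<longrightarrow> x = v)))"

text \<open>\<open>cellres D u v D' q w\<close>: peeling off a cell (and pendant vertices) at the edge \<open>uv\<close> of \<open>D\<close>
  leaves \<open>D'\<close>, attached at the opposite edge \<open>qw\<close>.\<close>

definition cellres :: "'v set \<Rightarrow> 'v \<Rightarrow> 'v \<Rightarrow> 'v set \<Rightarrow> 'v \<Rightarrow> 'v \<Rightarrow> bool" where
  "cellres D u v D' q w \<longleftrightarrow> ctxE D' q w \<and> (\<exists>M C V. cell {q, w} {u, v} M C \<and>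
     deco M C {u, v} V (Restr E V) \<and> D = D' \<union> V \<and> D' \<inter> V = {q, w} \<and> anti (D' - {q, w}) (V - {q, w}))"

lemma resE_step:
  assumes c: "cellres D u v D' q w" and r: "resE D' q w n"
  shows "resE D u v (Suc n)"
proof -
  obtain M C V where m: "cell {q, w} {u, v} M C" "deco M C {u, v} V (Restr E V)" "D = D' \<union> V" "D' \<inter> V = {q, w}"
    "anti (D' - {q, w}) (V - {q, w})" using c unfolding cellres_def by blast
  obtain L S C' U V' D1 x where s: "strip n L {q, w} S C' U" "deco S C' U V' (Restr E V')" "x \<in> L"
     "good D1 x" "D' = D1 \<union> V'" "D1 \<inter> V' = {x}" "anti (D1 - {x}) (V' - {x})"
    using r unfolding resE_def by blast
  have sub: "{q, w} \<subseteq> S" "S \<subseteq> V'" "{q, w} \<subseteq> M" "M \<subseteq> V" "L \<subseteq> S"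
    using strip_sub[OF s(1)] deco_sub[OF s(2)] cell_sub[OF m(1)] deco_sub[OF m(2)] by auto
  have SM: "S \<inter> M = {q, w}" using sub m(4) s(5) by blast
  have VV: "V' \<inter> V = {q, w}" using sub m(4) s(5) by blast
  have "deco (S \<union> M) (C' \<union> C) (U \<union> {u, v}) (V' \<union> V) (Restr E V' \<union> Restr E V)"
    by (rule deco_union[OF s(2) m(2)]) (use VV sub in blast)
  moreover have "Restr E V' \<union> Restr E V = Restr E (V' \<union> V)"
    by (rule Restr_Un[symmetric]) (use m(5) s(5) VV in \<open>unfold anti_def, blast\<close>)
  ultimately have 1: "deco (S \<union> M) (C' \<union> C) (U \<union> {u, v}) (V' \<union> V) (Restr E (V' \<union> V))" by simp
  have 2: "D = D1 \<union> (V' \<union> V)" using m(3) s(5) by blast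
  have x: "x \<in> V'" using s(3) sub by blast
  have qx: "y \<in> D1 \<Longrightarrow> y \<in> {q, w} \<Longrightarrow> y = x" for y using s(6) sub by blast
  have 3: "D1 \<inter> (V' \<union> V) = {x}" using s(5,6) m(4) qx by blast
  have 4: "anti (D1 - {x}) (V' \<union> V - {x})"
    unfolding anti_def
  proof (intro ballI)
    fix y z assume y: "y \<in> D1 - {x}" and z: "z \<in> V' \<union> V - {x}"
    show "(y, z) \<notin> E"
    proof (cases "z \<in> V'")
      case True
      then show ?thesis using s(7) y z unfolding anti_def by blast
    next
      case False
      then have "z \<in> V - {q, w}" using z sub by blast
      moreover have "y \<in> D' - {q, w}" using y qx s(5) by blast
      ultimately show ?thesis using m(5) unfolding anti_def by blast
    qed
  qed
  show ?thesis
    unfolding resE_def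
    using strip.snoc[OF s(1) m(1) SM] 1 s(3,4) 2 3 4 by blast
qed

lemma resE_good:
  assumes "resE D u v n" "1 \<le> n" "r \<in> {u, v}"
  shows "good D r"
proof -
  obtain L S C' U V' D1 x where s: "strip n L {u, v} S C' U" "deco S C' U V' (Restr E V')" "x \<in> L"
     "good D1 x" "D = D1 \<union> V'" "D1 \<inter> V' = {x}" "anti (D1 - {x}) (V' - {x})"
    using assms(1) unfolding resE_def by blast
  show ?thesis unfolding s(5) by (rule good.glue_strip[OF s(4,1) assms(2) s(2,3) assms(3) s(6,7)])
qed

end

section \<open>Peeling off stars and cells\<close>

context xfree
begin

lemma star_rest:
  assumes D: "conn D" and r: "r \<in> D" and C: "C \<subseteq> D" "r \<notin> C"
    and Ccl: "\<And>x y. x \<in> C \<Longrightarrow> y \<in> D \<Longrightarrow> (x, y) \<in> E \<Longrightarrow> y \<noteq> r \<Longrightarrow> y \<in> C"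
    and sh: "\<And>y y2 y3. y \<in> D - C \<Longrightarrow> (r, y) \<in> E \<Longrightarrow> y2 \<in> D \<Longrightarrow> y2 \<noteq> r \<Longrightarrow> (y, y2) \<in> E \<Longrightarrow>
      y3 \<in> D \<Longrightarrow> y3 \<noteq> r \<Longrightarrow> y3 \<noteq> y \<Longrightarrow> (y2, y3) \<notin> E"
  shows "star_graph (D - C) (Restr E (D - C)) r"
proof -
  define Y where "Y = {y \<in> D - C. (r, y) \<in> E}"
  define Z where "Z = D - C - {r} - Y"
  have ex: "\<exists>y\<in>Y. (z, y) \<in> E" if z: "z \<in> Z" for z
  proof -
    obtain y where y: "y \<in> D" "y \<noteq> r" "(r, y) \<in> E" "z \<in> comp (D - {r}) y"
      using conn_nbr[OF D r, of z] z unfolding Z_def by blast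
    have yC: "y \<notin> C"
    proof
      assume "y \<in> C"
      have "comp (D - {r}) y \<subseteq> C" by (rule comp_least[OF \<open>y \<in> C\<close>]) (use Ccl in blast)
      then show False using y(4) z unfolding Z_def by blast
    qed
    then have yY: "y \<in> Y" using y unfolding Y_def by blast
    have "comp (D - {r}) y \<subseteq> insert y {x. (y, x) \<in> E}"
    proof (rule comp_least)
      fix a b assume a: "a \<in> insert y {x. (y, x) \<in> E}" "(a, b) \<in> E" "a \<in> D - {r}" "b \<in> D - {r}"
      show "b \<in> insert y {x. (y, x) \<in> E}"
        using sh[of y a b] y yC a by blast
    qed simp
    then have "z = y \<or> (y, z) \<in> E" using y(4) by blast
    moreover have "z \<noteq> y" using z yY unfolding Z_def by blast
    ultimately show ?thesis using yY sym by blast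
  qed
  define par where "par = (\<lambda>z. SOME y. y \<in> Y \<and> (z, y) \<in> E)"
  have par: "par z \<in> Y" "(z, par z) \<in> E" if "z \<in> Z" for z
    using someI_ex[of "\<lambda>y. y \<in> Y \<and> (z, y) \<in> E"] ex[OF that] unfolding par_def by blast+
  have Zn: "b = par z" if z: "z \<in> Z" and b: "b \<in> D" "b \<noteq> r" "(z, b) \<in> E" for z b
    using sh[of "par z" z b] par[OF z] z b sym unfolding Y_def Z_def by blast
  have rY: "r \<notin> Y" unfolding Y_def using irr by blast
  have rZ: "r \<notin> Z" unfolding Z_def by blast
  have ZD: "z \<in> D - C \<and> (r, z) \<notin> E" if "z \<in> Z" for z using that unfolding Y_def Z_def by blast
  let ?W = "symcl (Pair r ` Y \<union> (\<lambda>z. (z, par z)) ` Z)"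
  have D_eq: "D - C = {r} \<union> Y \<union> Z" using r C unfolding Y_def Z_def by blast
  have "Restr E (D - C) = ?W"
  proof (intro equalityI subrelI)
    fix x y assume xy: "(x, y) \<in> Restr E (D - C)"
    have "x \<noteq> y" using xy irr by blast
    consider "x = r" | "y = r" | "x \<in> Z" | "y \<in> Z" | "x \<in> Y" "y \<in> Y" using xy D_eq by blast
    then show "(x, y) \<in> ?W"
    proof cases
      case 1
      then show ?thesis using xy unfolding Y_def by (auto simp: symcl_iff)
    next
      case 2
      then show ?thesis using xy sym unfolding Y_def by (auto simp: symcl_iff)
    next
      case 3
      then have "y \<noteq> r" using ZD xy sym by blast
      then have "y = par x" using Zn[OF 3] xy by blast
      then show ?thesis using 3 by (auto simp: symcl_iff)
    next
      case 4
      then have "x \<noteq> r" using ZD xy by blast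
      then have "x = par y" using Zn[OF 4] xy sym by blast
      then show ?thesis using 4 by (auto simp: symcl_iff)
    next
      case 5
      then have "(r, x) \<in> E" "(y, r) \<in> E" using sym unfolding Y_def by blast+
      then show ?thesis using no3 xy by blast
    qed
  next
    fix x y assume "(x, y) \<in> ?W"
    then have "(x, y) \<in> Pair r ` Y \<union> (\<lambda>z. (z, par z)) ` Z \<or> (y, x) \<in> Pair r ` Y \<union> (\<lambda>z. (z, par z)) ` Z"
      by (simp add: symcl_iff)
    moreover have "(x, y) \<in> E \<and> x \<in> D - C \<and> y \<in> D - C" if "(x, y) \<in> Pair r ` Y \<union> (\<lambda>z. (z, par z)) ` Z" for x y
      using that
    proof
      assume "(x, y) \<in> Pair r ` Y"
      then show ?thesis using r C unfolding Y_def by auto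
    next
      assume "(x, y) \<in> (\<lambda>z. (z, par z)) ` Z"
      then have "x \<in> Z" "y = par x" by auto
      then show ?thesis using par[of x] ZD[of x] unfolding Y_def by blast
    qed
    ultimately show "(x, y) \<in> Restr E (D - C)" using sym by blast
  qed
  moreover have "par ` Z \<subseteq> Y" using par by blast
  moreover have "Y \<inter> Z = {}" unfolding Z_def by blast
  ultimately show ?thesis
    unfolding star_graph_def using D_eq rY rZ
    by - (rule exI[of _ Y], rule exI[of _ Z], rule exI[of _ par], intro conjI)
qed

lemma cell_core:
  assumes D: "finite D" "conn D" and uv: "u \<in> D" "v \<in> D" "(u, v) \<in> E"
    and XY: "\<And>x x' y y'. x \<in> D \<Longrightarrow> x' \<in> D \<Longrightarrow> y \<in> D \<Longrightarrow> y' \<in> D \<Longrightarrow> (u, x) \<in> E \<Longrightarrow> x \<noteq> v \<Longrightarrow> (x, x') \<in> E \<Longrightarrow> x' \<noteq> u \<Longrightarrow>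
      (v, y) \<in> E \<Longrightarrow> y \<noteq> u \<Longrightarrow> (y, y') \<in> E \<Longrightarrow> y' \<noteq> v \<Longrightarrow> (x', y') \<in> E"
    and x0: "x0 \<in> D" "x0' \<in> D" "(u, x0) \<in> E" "x0 \<noteq> v" "(x0, x0') \<in> E" "x0' \<noteq> u"
    and y0: "y \<in> D" "q \<in> D" "(v, y) \<in> E" "y \<noteq> u" "(y, q) \<in> E" "q \<noteq> v"
    and uni: "\<And>z z'. z \<in> D \<Longrightarrow> z' \<in> D \<Longrightarrow> (v, z) \<in> E \<Longrightarrow> z \<noteq> u \<Longrightarrow> (z, z') \<in> E \<Longrightarrow> z' \<noteq> v \<Longrightarrow> z = y"
  shows "\<exists>D' q w. cellres D u v D' q w"
proof -
  have vu: "(v, u) \<in> E" "(y, v) \<in> E" "(q, y) \<in> E" using uv y0 sym by blast+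
  define X where "X = {x \<in> D. (u, x) \<in> E \<and> x \<noteq> v \<and> (\<exists>x'\<in>D. (x, x') \<in> E \<and> x' \<noteq> u)}"
  define g where "g = (\<lambda>x. SOME x'. x' \<in> D \<and> (x, x') \<in> E \<and> x' \<noteq> u)"
  have g0: "g x \<in> D \<and> (x, g x) \<in> E \<and> g x \<noteq> u" if "x \<in> X" for x
    unfolding g_def by (rule someI_ex) (use that X_def in blast)
  have Xp: "x \<in> D" "(u, x) \<in> E" "(x, u) \<in> E" "x \<noteq> v" if "x \<in> X" for x
    using that sym unfolding X_def by blast+
  have gq: "(z, q) \<in> E" "(q, z) \<in> E" if "x \<in> X" "z \<in> D" "(x, z) \<in> E" "z \<noteq> u" for x z
    using XY[of x z y q] Xp[OF that(1)] that y0 sym by blast+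
  have gp: "g x \<in> D" "(x, g x) \<in> E" "(g x, x) \<in> E" "g x \<noteq> u" "(g x, q) \<in> E" "(q, g x) \<in> E" if "x \<in> X" for x
    using g0[OF that] gq[OF that, of "g x"] sym by blast+
  have qu: "(q, u) \<notin> E" "(u, q) \<notin> E" using n4[OF vu(3,2,1)] y0 by blast+
  have yu: "(y, u) \<notin> E" "(u, y) \<notin> E" using n3[OF vu(2,1)] by blast+
  have qv: "(q, v) \<notin> E" "(v, q) \<notin> E" using n3[OF vu(3,2)] by blast+
  have q_ne: "q \<noteq> u" "q \<noteq> v" "q \<noteq> y" "q \<notin> X"
    using yu y0 irr qu unfolding X_def by blast+
  have xv: "(x, v) \<notin> E" "(v, x) \<notin> E" if "x \<in> X" for x using n3[OF Xp(3)[OF that] uv(3)] by blast+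
  have xy: "(x, y) \<notin> E" "(y, x) \<notin> E" if "x \<in> X" for x
    using n4[OF Xp(3)[OF that] uv(3) y0(3)] Xp[OF that] y0(4) by blast+
  have gne: "g x \<noteq> v" "g x \<noteq> y" "g x \<noteq> q" "g x \<notin> X" if "x \<in> X" for x
  proof -
    show "g x \<noteq> v" using gp(2)[OF that] xv[OF that] by metis
    show "g x \<noteq> y" using gp(2)[OF that] xy[OF that] by metis
    show "g x \<noteq> q" using gp(5)[OF that] irr by metis
    show "g x \<notin> X"
    proof
      assume "g x \<in> X"
      then show False using no3[of u x "g x"] Xp[OF that] gp[OF that] Xp(3)[of "g x"] by blast
    qed
  qed
  have ginj: "inj_on g X"
  proof (rule inj_onI)
    fix x z assume a: "x \<in> X" "z \<in> X" "g x = g z"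
    have "u = g x \<or> x = z" using no4[of u x "g x" z] a(3) Xp[OF a(1)] Xp[OF a(2)] gp[OF a(1)] gp[OF a(2)] by metis
    then show "x = z" using gp(4)[OF a(1)] by blast
  qed
  have x0X: "x0 \<in> X" using x0 unfolding X_def by blast
  have yX: "y \<notin> X" using yu unfolding X_def by blast
  have vX: "v \<notin> X" unfolding X_def by blast
  have uX: "u \<notin> X" unfolding X_def using irr by blast
  define P where "P = {p \<in> D. (u, p) \<in> E \<and> p \<noteq> v \<and> p \<notin> X} \<union> {p \<in> D. (v, p) \<in> E \<and> p \<noteq> u \<and> p \<noteq> y}"
  have Nu: "z = v \<or> z \<in> X \<or> z \<in> P" if "z \<in> D" "(u, z) \<in> E" for z using that unfolding P_def by blast
  have Nv: "z = u \<or> z = y \<or> z \<in> P" if "z \<in> D" "(v, z) \<in> E" for z using that unfolding P_def by blast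
  have Ny: "z = v \<or> z = q" if "z \<in> D" "(y, z) \<in> E" for z
  proof (rule ccontr)
    assume n: "\<not> (z = v \<or> z = q)"
    have "(g x0, z) \<in> E"
      using XY[of x0 "g x0" y z] Xp[OF x0X] gp[OF x0X] that y0 n by blast
    then have "y = g x0 \<or> z = q" using no4[of y z "g x0" q] that vu gp[OF x0X] sym by blast
    then show False using n gne[OF x0X] by blast
  qed
  have Nx: "z = u \<or> z = g x" if x: "x \<in> X" and z: "z \<in> D" "(x, z) \<in> E" for x z
  proof (rule ccontr)
    assume n: "\<not> (z = u \<or> z = g x)"
    have "(z, q) \<in> E" using gq[OF x z] n by blast
    then have "x = q \<or> z = g x" using no4[of x z q "g x"] z gp[OF x] by blast
    then show False using n q_ne x by blast
  qed
  have Npu: "z = u" if p: "p \<in> D" "(u, p) \<in> E" "p \<noteq> v" "p \<notin> X" and z: "z \<in> D" "(p, z) \<in> E" for p z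
    using that unfolding X_def by blast
  have Npv: "z = v" if p: "p \<in> D" "(v, p) \<in> E" "p \<noteq> u" "p \<noteq> y" and z: "z \<in> D" "(p, z) \<in> E" for p z
    using uni[of p z] that by blast
  have hx: "hex u x (g x) q (g z) z" if "x \<in> X" "z \<in> X" "x \<noteq> z" for x z
  proof (rule hexI)
    show "g x \<noteq> g z" using ginj that by (auto dest: inj_onD)
    show "x \<noteq> q" "q \<noteq> z" using q_ne that by blast+
    show "u \<noteq> g x" "g z \<noteq> u" "z \<noteq> x" using gp[OF that(1)] gp[OF that(2)] that by blast+
    show "(u, x) \<in> E" "(x, g x) \<in> E" "(g x, q) \<in> E" "(q, g z) \<in> E" "(g z, z) \<in> E" "(z, u) \<in> E"
      using Xp[OF that(1)] Xp[OF that(2)] gp[OF that(1)] gp[OF that(2)] by blast+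
  qed
  define J where "J = {x \<in> X. \<exists>w\<in>D. (g x, w) \<in> E \<and> w \<noteq> x \<and> w \<noteq> q}"
  have J1: "x = z" if xz: "x \<in> J" "z \<in> J" for x z
  proof (rule ccontr)
    assume ne: "x \<noteq> z"
    obtain w where w: "x \<in> X" "w \<in> D" "(g x, w) \<in> E" "w \<noteq> x" "w \<noteq> q" using xz unfolding J_def by blast
    obtain w2 where w2: "z \<in> X" "w2 \<in> D" "(g z, w2) \<in> E" "w2 \<noteq> z" "w2 \<noteq> q" using xz unfolding J_def by blast
    note H = hx[OF w(1) w2(1) ne] and h = hex_adj[OF hx[OF w(1) w2(1) ne]]
    have 1: "v \<notin> {u, x, g x, q, g z, z}"
      using uv irr Xp[OF w(1)] Xp[OF w2(1)] gne[OF w(1)] gne[OF w2(1)] q_ne by blast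
    have 2: "w \<notin> {u, x, g x, q, g z, z}" using w h irr by blast
    have 3: "w2 \<notin> {u, x, g x, q, g z, z}" using w2 h irr by blast
    show False using h3nc[OF H vu(1) 1 _ 2 _ 3] w(3) w2(3) sym by blast
  qed
  obtain l where l: "l \<in> X" "\<And>x. x \<in> X \<Longrightarrow> x \<noteq> l \<Longrightarrow> x \<notin> J"
  proof (cases "J = {}")
    case True
    then show ?thesis using x0X that[of x0] by blast
  next
    case False
    then obtain l where "l \<in> J" by blast
    then show ?thesis using J1 that[of l] unfolding J_def by blast
  qed
  have Ng: "z = x \<or> z = q" if "x \<in> X" "x \<noteq> l" "z \<in> D" "(g x, z) \<in> E" for x z
    using l(2)[of x] that unfolding J_def by blast
  define G where "G = g(v := y)"
  define M where "M = {u, q} \<union> insert v X \<union> G ` insert v X"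
  define C where "C = symcl (Pair u ` insert v X \<union> (\<lambda>x. (x, G x)) ` insert v X \<union> (\<lambda>x. (G x, q)) ` insert v X)"
  have Gv: "G v = y" and GX: "\<And>x. x \<in> X \<Longrightarrow> G x = g x" unfolding G_def using vX by auto
  have GI: "G ` insert v X = insert y (g ` X)" using Gv GX by auto
  have cell0: "cell {u, v} {q, g l} M C"
    unfolding cell_def
  proof (rule exI[of _ u], rule exI[of _ q], rule exI[of _ "insert v X"], rule exI[of _ G], rule exI[of _ v],
      rule exI[of _ l], intro conjI)
    show "M = {u, q} \<union> insert v X \<union> G ` insert v X" by (rule M_def)
    show "C = symcl (Pair u ` insert v X \<union> (\<lambda>x. (x, G x)) ` insert v X \<union> (\<lambda>x. (G x, q)) ` insert v X)" by (rule C_def)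
    show "{q, g l} = {q, G l}" using GX l by simp
    show "{u, v} = {u, v}" ..
    show "finite (insert v X)" using D(1) unfolding X_def by simp
    show "v \<in> insert v X" "l \<in> insert v X" "v \<noteq> l" using l vX by blast+
    have "y \<notin> g ` X" using gne(2) by (metis imageE)
    then have "G v \<notin> G ` X" using Gv GX by (metis image_cong)
    moreover have "inj_on G X" using ginj GX by (metis inj_on_cong)
    ultimately show "inj_on G (insert v X)" using vX by simp
    show "u \<noteq> q" using q_ne by blast
    show "u \<notin> insert v X" using uX uv irr by blast
    show "q \<notin> insert v X" using q_ne by blast
    show "u \<notin> G ` insert v X" unfolding GI using y0(4) gp(4) by blast
    show "q \<notin> G ` insert v X" unfolding GI using q_ne gne(3) by blast
    show "insert v X \<inter> G ` insert v X = {}" unfolding GI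
      using yX gne(1,4) y0 irr by (auto simp: disjoint_iff)
  qed
  have cell1: "cell {q, g l} {u, v} M C" by (rule cell_sym[OF cell0])
  define Q where "Q = {(p, u') | p u'. p \<in> P \<and> u' \<in> {u, v} \<and> (p, u') \<in> E}"
  define W where "W = C \<union> symcl Q"
  have Mdef: "M = {u, q, v, y} \<union> X \<union> g ` X" unfolding M_def GI by blast
  define C0 where "C0 = {(u, v), (v, y), (y, q)} \<union> Pair u ` X \<union> (\<lambda>x. (x, g x)) ` X \<union> (\<lambda>x. (g x, q)) ` X"
  have "(\<lambda>x. (x, G x)) ` X = (\<lambda>x. (x, g x)) ` X" "(\<lambda>x. (G x, q)) ` X = (\<lambda>x. (g x, q)) ` X"
    using GX by (auto intro!: image_cong)
  then have C0: "C = symcl C0" unfolding C_def C0_def image_insert Gv by (simp add: insert_commute Un_insert_left Un_insert_right Un_assoc)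
  have Cin: "(u, v) \<in> C" "(v, y) \<in> C" "(y, q) \<in> C"
    unfolding C0 symcl_def C0_def by blast+
  have CinX: "(u, x) \<in> C" "(x, g x) \<in> C" "(g x, q) \<in> C" if "x \<in> X" for x
    unfolding C0 symcl_def C0_def using that by blast+
  have W2: "W = symcl (C0 \<union> Q)" unfolding W_def C0 symcl_Un ..
  have Wsym: "(a, b) \<in> W \<Longrightarrow> (b, a) \<in> W" for a b unfolding W2 by (rule symcl_sym)
  have CW: "C \<subseteq> W" unfolding W_def by blast
  have WW: "(u, v) \<in> W" "(v, u) \<in> W" "(v, y) \<in> W" "(y, v) \<in> W" "(y, q) \<in> W" "(q, y) \<in> W"
    using Cin CW Wsym[of u v] Wsym[of v y] Wsym[of y q] by blast+
  have WX: "(u, x) \<in> W" "(x, u) \<in> W" "(x, g x) \<in> W" "(g x, x) \<in> W" "(g x, q) \<in> W" "(q, g x) \<in> W"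
    if "x \<in> X" for x
    using CinX[OF that] CW Wsym[of u x] Wsym[of x "g x"] Wsym[of "g x" q] by blast+
  have CE: "C \<subseteq> E"
  proof
    have "C0 \<subseteq> E" unfolding C0_def using uv y0 vu Xp gp by blast
    fix e assume "e \<in> C"
    then show "e \<in> E" using \<open>C0 \<subseteq> E\<close> sym unfolding C0 symcl_def by blast
  qed
  have P0: "p \<in> D" "p \<notin> M" if "p \<in> P" for p
  proof -
    show "p \<in> D" using that unfolding P_def by blast
    have "p \<noteq> u" "p \<noteq> v" using that irr unfolding P_def by blast+
    moreover have "p \<noteq> q" using that qu qv unfolding P_def by blast
    moreover have "p \<noteq> y" using that yu unfolding P_def by blast
    moreover have "p \<notin> X" using that xv unfolding P_def by blast
    moreover have "p \<noteq> g x" if "x \<in> X" for x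
    proof
      assume "p = g x"
      then have "(u, g x) \<in> E \<or> (v, g x) \<in> E" using \<open>p \<in> P\<close> unfolding P_def by blast
      moreover have "(u, g x) \<notin> E" using n3[OF Xp(2)[OF that] gp(2)[OF that]] by blast
      moreover have "(v, g x) \<notin> E"
        using n4[of v u x "g x"] vu Xp[OF that] gp[OF that] gne[OF that] by blast
      ultimately show False by blast
    qed
    ultimately show "p \<notin> M" unfolding Mdef by blast
  qed
  have PW: "(p, z) \<in> W \<and> z \<in> M" if "p \<in> P" "z \<in> D" "(p, z) \<in> E" for p z
  proof -
    have "z = u \<or> z = v" using that Npu[of p z] Npv[of p z] unfolding P_def by blast
    then have "(p, z) \<in> Q" "z \<in> M" unfolding Q_def Mdef using that by blast+
    then show ?thesis unfolding W_def symcl_def by blast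
  qed
  define R where "R = {u, v, y} \<union> X \<union> (g ` X - {g l}) \<union> P"
  define D' where "D' = D - R"
  have MD: "M \<subseteq> D" unfolding Mdef using uv y0 Xp gp by blast
  have qR: "q \<notin> R"
    unfolding R_def using q_ne gne(3) P0(2)[of q] unfolding Mdef by blast
  have gR: "g l \<notin> R"
    unfolding R_def using gp[OF l(1)] gne[OF l(1)] P0(2)[of "g l"] l(1) unfolding Mdef by blast
  have RMP: "R = M \<union> P - {q, g l}"
    using qR gR unfolding R_def Mdef using l(1) by blast
  have key: "(s, t) \<in> W \<and> t \<in> M \<union> P" if s: "s \<in> R" and t: "t \<in> D" "(s, t) \<in> E" for s t
  proof -
    have pw: "(a, p) \<in> W \<and> p \<in> M \<union> P" if "p \<in> P" "a \<in> D" "(a, p) \<in> E" for a p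
      using PW[OF that(1,2) sym[OF that(3)]] Wsym[of p a] that(1) by blast
    consider "s = u" | "s = v" | "s = y" | "s \<in> X" | x where "x \<in> X" "x \<noteq> l" "s = g x" | "s \<in> P"
      using s unfolding R_def by blast
    then show ?thesis
    proof cases
      case 1
      then show ?thesis using Nu[of t] t pw[of t u] uv(1) WW WX unfolding Mdef by blast
    next
      case 2
      then show ?thesis using Nv[of t] t pw[of t v] uv(2) WW unfolding Mdef by blast
    next
      case 3
      then show ?thesis using Ny[of t] t WW unfolding Mdef by blast
    next
      case 4
      then show ?thesis using Nx[OF 4, of t] t WX[OF 4] 4 unfolding Mdef by blast
    next
      case (5 x)
      then show ?thesis using Ng[OF 5(1,2), of t] t WX[OF 5(1)] 5 unfolding Mdef by blast
    next
      case 6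
      then show ?thesis using PW[OF 6 t] by blast
    qed
  qed
  have qg: "(q, g l) \<in> E" "(q, g l) \<in> W" using gp[OF l(1)] WX[OF l(1)] by blast+
  have gq': "(g l, q) \<in> E" "(g l, q) \<in> W" using gp[OF l(1)] WX[OF l(1)] by blast+
  have RV: "Restr E (M \<union> P) = W"
  proof (intro equalityI subrelI)
    fix s t assume st: "(s, t) \<in> Restr E (M \<union> P)"
    then have stD: "s \<in> D" "t \<in> D" using MD P0 by blast+
    consider "s \<in> R" | "t \<in> R" | "s \<in> {q, g l}" "t \<in> {q, g l}" using st RMP by blast
    then show "(s, t) \<in> W"
    proof cases
      case 1
      then show ?thesis using key st stD by blast
    next
      case 2
      then show ?thesis using key[of t s] st stD sym[of s t] Wsym[of t s] by blast
    next
      case 3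
      then show ?thesis using st irr qg gq' by blast
    qed
  next
    fix s t assume "(s, t) \<in> W"
    moreover have "C \<subseteq> M \<times> M" using cell_sub[OF cell0] by blast
    moreover have "symcl Q \<subseteq> (M \<union> P) \<times> (M \<union> P)" unfolding symcl_def Q_def Mdef by blast
    moreover have "symcl Q \<subseteq> E" unfolding symcl_def Q_def using sym by blast
    ultimately show "(s, t) \<in> Restr E (M \<union> P)" using CE unfolding W_def by blast
  qed
  have dec: "deco M C {u, v} (M \<union> P) (Restr E (M \<union> P))"
    unfolding deco_def RV W_def
  proof (intro exI[of _ P] exI[of _ Q] conjI)
    show "P \<inter> M = {}" using P0 by blast
    show "Q \<subseteq> P \<times> {u, v}" unfolding Q_def by blast
    show "\<forall>p\<in>P. \<exists>!u. (p, u) \<in> Q"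
    proof
      fix p assume p: "p \<in> P"
      have "(p, u) \<in> E \<or> (p, v) \<in> E" using p sym unfolding P_def by blast
      moreover have "\<not> ((p, u) \<in> E \<and> (p, v) \<in> E)" using no3[of p u v] uv sym by blast
      ultimately show "\<exists>!u. (p, u) \<in> Q" unfolding Q_def using p by auto
    qed
  qed auto
  have PD: "P \<subseteq> D" using P0 by blast
  have D1: "D = D' \<union> (M \<union> P)" unfolding D'_def RMP using MD PD by blast
  have D2: "D' \<inter> (M \<union> P) = {q, g l}"
    unfolding D'_def RMP using MD PD unfolding Mdef using l(1) by blast
  have qD': "q \<in> D'" "g l \<in> D'" using D2 by blast+
  have out: "x \<in> {q, g l}" if "x \<in> D'" "s \<in> R" "(x, s) \<in> E" for x s
    using key[of s x] that sym RMP unfolding D'_def by blast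
  have an: "anti (D' - {q, g l}) (M \<union> P - {q, g l})"
    unfolding anti_def using out RMP by blast
  have cn: "conn D'"
  proof (rule conn_gate[OF D(2) _ qD'(1), of "{q, g l}"])
    show "D' \<subseteq> D" unfolding D'_def by blast
    show "\<And>x y. x \<in> D' \<Longrightarrow> y \<in> D - D' \<Longrightarrow> (x, y) \<in> E \<Longrightarrow> x \<in> {q, g l}"
      using out unfolding D'_def by blast
    show "\<And>x. x \<in> {q, g l} \<Longrightarrow> (x, q) \<in> (Restr E D')\<^sup>*" using gq' qD' by auto
  qed
  have Dy: "x \<in> D' \<Longrightarrow> x \<in> D \<and> x \<notin> R" for x unfolding D'_def by blast
  have "ctxE D' q (g l)"
    unfolding ctxE_def
  proof (intro conjI exI)
    show "finite D'" using D unfolding D'_def by blast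
    show "hex q y v u l (g l)"
      by (rule hexI) (use vu y0 uv Xp[OF l(1)] gp[OF l(1)] gne[OF l(1)] q_ne l(1) in blast)+
    show "y \<notin> D'" "v \<notin> D'" "u \<notin> D'" "l \<notin> D'" unfolding D'_def R_def using l by blast+
    show "\<forall>x\<in>D'. ((x, y) \<in> E \<longrightarrow> x = q) \<and> (x, v) \<notin> E \<and> (x, u) \<notin> E \<and> ((x, l) \<in> E \<longrightarrow> x = g l)"
    proof (intro ballI conjI impI notI)
      fix x assume x: "x \<in> D'"
      note x' = Dy[OF x]
      show "x = q" if "(x, y) \<in> E" using Ny[of x] x' that sym unfolding R_def by blast
      show False if "(x, v) \<in> E" using Nv[of x] x' that sym unfolding R_def by blast
      show False if "(x, u) \<in> E" using Nu[of x] x' that sym unfolding R_def by blast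
      show "x = g l" if "(x, l) \<in> E" using Nx[OF l(1), of x] x' that sym unfolding R_def by blast
    qed
  qed (use cn qD' in blast)+
  then have "cellres D u v D' q (g l)"
    unfolding cellres_def using cell1 dec D1 D2 an by blast
  then show ?thesis by blast
qed

lemma cellres_swap: "cellres D u v D' q w \<Longrightarrow> cellres D v u D' q w"
  unfolding cellres_def by (simp add: insert_commute)

lemma cell_step:
  assumes D: "finite D" "conn D" and uv: "u \<in> D" "v \<in> D" "(u, v) \<in> E"
    and XY: "\<And>x x' y y'. x \<in> D \<Longrightarrow> x' \<in> D \<Longrightarrow> y \<in> D \<Longrightarrow> y' \<in> D \<Longrightarrow> (u, x) \<in> E \<Longrightarrow> x \<noteq> v \<Longrightarrow> (x, x') \<in> E \<Longrightarrow> x' \<noteq> u \<Longrightarrow>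
      (v, y) \<in> E \<Longrightarrow> y \<noteq> u \<Longrightarrow> (y, y') \<in> E \<Longrightarrow> y' \<noteq> v \<Longrightarrow> (x', y') \<in> E"
    and x0: "x \<in> D" "x' \<in> D" "(u, x) \<in> E" "x \<noteq> v" "(x, x') \<in> E" "x' \<noteq> u"
    and y0: "y \<in> D" "y' \<in> D" "(v, y) \<in> E" "y \<noteq> u" "(y, y') \<in> E" "y' \<noteq> v"
  shows "\<exists>D' q w. cellres D u v D' q w"
proof (cases "\<forall>z z'. z \<in> D \<longrightarrow> z' \<in> D \<longrightarrow> (v, z) \<in> E \<longrightarrow> z \<noteq> u \<longrightarrow> (z, z') \<in> E \<longrightarrow> z' \<noteq> v \<longrightarrow> z = y")
  case True
  show ?thesis
  proof (rule cell_core[OF D uv _ x0 y0])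
    fix a a' b b' assume "a \<in> D" "a' \<in> D" "b \<in> D" "b' \<in> D" "(u, a) \<in> E" "a \<noteq> v" "(a, a') \<in> E" "a' \<noteq> u"
      "(v, b) \<in> E" "b \<noteq> u" "(b, b') \<in> E" "b' \<noteq> v"
    then show "(a', b') \<in> E" by (rule XY)
  next
    fix z z' assume "z \<in> D" "z' \<in> D" "(v, z) \<in> E" "z \<noteq> u" "(z, z') \<in> E" "z' \<noteq> v"
    then show "z = y" using True by blast
  qed
next
  case False
  then obtain z z' where z: "z \<in> D" "z' \<in> D" "(v, z) \<in> E" "z \<noteq> u" "(z, z') \<in> E" "z' \<noteq> v" "z \<noteq> y" by blast
  have yz: "y' \<noteq> z'"
  proof
    assume "y' = z'"
    then have "v = y' \<or> y = z" using no4[of v y y' z] y0 z sym by blast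
    then show False using y0 z by blast
  qed
  have uni: "t = x" if t: "t \<in> D" "t' \<in> D" "(u, t) \<in> E" "t \<noteq> v" "(t, t') \<in> E" "t' \<noteq> u" for t t'
  proof (rule ccontr)
    assume ne: "t \<noteq> x"
    have "(t', y') \<in> E" "(t', z') \<in> E" "(x', y') \<in> E" "(x', z') \<in> E"
      using XY[of t t' y y'] XY[of t t' z z'] XY[of x x' y y'] XY[of x x' z z'] t x0 y0 z by blast+
    then have "t' = x'" using no4[of t' y' x' z'] yz sym by blast
    then have "u = t' \<or> t = x" using no4[of u t t' x] t x0 sym by blast
    then show False using t ne by blast
  qed
  have "\<exists>D' q w. cellres D v u D' q w"
  proof (rule cell_core[OF D uv(2,1) sym[OF uv(3)] _ y0 x0])
    fix a a' b b' assume "a \<in> D" "a' \<in> D" "b \<in> D" "b' \<in> D" "(v, a) \<in> E" "a \<noteq> u" "(a, a') \<in> E" "a' \<noteq> v"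
      "(u, b) \<in> E" "b \<noteq> v" "(b, b') \<in> E" "b' \<noteq> u"
    then have "(b', a') \<in> E" using XY[of b b' a a'] by blast
    then show "(a', b') \<in> E" by (rule sym)
  next
    fix z z' assume "z \<in> D" "z' \<in> D" "(u, z) \<in> E" "z \<noteq> v" "(z, z') \<in> E" "z' \<noteq> u"
    then show "z = x" by (rule uni)
  qed
  then show ?thesis using cellres_swap by blast
qed

end

section \<open>Rooted decompositions\<close>

context xfree
begin

lemma ctxE_swap: "ctxE D u v \<Longrightarrow> ctxE D v u"
proof -
  assume a: "ctxE D u v"
  then obtain h1 h2 h3 h4 where h: "hex u h1 h2 h3 h4 v" "h1 \<notin> D" "h2 \<notin> D" "h3 \<notin> D" "h4 \<notin> D"
     "\<forall>x\<in>D. ((x, h1) \<in> E \<longrightarrow> x = u) \<and> (x, h2) \<notin> E \<and> (x, h3) \<notin> E \<and> ((x, h4) \<in> E \<longrightarrow> x = v)"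
    unfolding ctxE_def by blast
  have "hex v h4 h3 h2 h1 u" by (rule hex_rot[OF hex_rev[OF h(1)]])
  with a h show ?thesis
    unfolding ctxE_def
    apply (elim conjE)
    apply (intro conjI)
        apply assumption+
    apply (rule exI[of _ h4], rule exI[of _ h3], rule exI[of _ h2], rule exI[of _ h1])
    apply blast
    done
qed

lemma resE_swap: "resE D u v n \<Longrightarrow> resE D v u n"
  unfolding resE_def by (simp add: insert_commute)

lemma resE_base:
  assumes c: "ctxE D u v"
    and n: "\<And>y y'. y \<in> D \<Longrightarrow> y' \<in> D \<Longrightarrow> (v, y) \<in> E \<Longrightarrow> y \<noteq> u \<Longrightarrow> (y, y') \<in> E \<Longrightarrow> y' = v"
    and IH: "\<And>D' r. card D' < card D \<Longrightarrow> ctxR D' r \<Longrightarrow> good D' r"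
  shows "resE D u v 0"
proof -
  obtain h1 h2 h3 h4 where h: "hex u h1 h2 h3 h4 v" "h1 \<notin> D" "h2 \<notin> D" "h3 \<notin> D" "h4 \<notin> D"
     "\<forall>x\<in>D. ((x, h1) \<in> E \<longrightarrow> x = u) \<and> (x, h2) \<notin> E \<and> (x, h3) \<notin> E \<and> ((x, h4) \<in> E \<longrightarrow> x = v)"
    and D: "finite D" "conn D" "u \<in> D" "v \<in> D"
    using c unfolding ctxE_def by blast
  note uv = hex_adj(12)[OF h(1)] and vu = hex_adj(6)[OF h(1)]
  have ne: "u \<noteq> v" using uv irr by blast
  define P where "P = {y \<in> D. (v, y) \<in> E \<and> y \<noteq> u}"
  define D1 where "D1 = D - {v} - P"
  have pv: "y' = v" if "y \<in> P" "y' \<in> D" "(y, y') \<in> E" for y y' using that n unfolding P_def by blast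
  have pu: "(p, u) \<notin> E" if "p \<in> P" for p using pv[OF that D(3)] ne by blast
  have uD1: "u \<in> D1" using D ne unfolding D1_def P_def by blast
  have out: "x = u" if "x \<in> D1" "y \<in> insert v P" "(x, y) \<in> E" for x y
  proof (cases "y = v")
    case True
    then have "(v, x) \<in> E" using that sym by blast
    then show ?thesis using that(1) unfolding D1_def P_def by blast
  next
    case False
    then have "y \<in> P" "x \<in> D" using that unfolding D1_def by auto
    then have "x = v" using pv[of y x] sym[OF that(3)] by blast
    then show ?thesis using that(1) unfolding D1_def by blast
  qed
  have "conn D1"
  proof (rule conn_gate[OF D(2) _ uD1, of "{u}"])
    show "D1 \<subseteq> D" unfolding D1_def by blast
    show "\<And>x y. x \<in> D1 \<Longrightarrow> y \<in> D - D1 \<Longrightarrow> (x, y) \<in> E \<Longrightarrow> x \<in> {u}"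
      using out unfolding D1_def by blast
  qed auto
  moreover have "(u, h1) \<in> E" "(h1, h2) \<in> E" "(h2, h3) \<in> E" using hex_adj[OF h(1)] by blast+
  moreover have "h3 \<noteq> h1" using h(1) unfolding hex_def by auto
  moreover have "h1 \<notin> D1" "h2 \<notin> D1" "h3 \<notin> D1" using h unfolding D1_def by blast+
  moreover have "\<forall>x\<in>D1. ((x, h1) \<in> E \<longrightarrow> x = u) \<and> (x, h2) \<notin> E \<and> (x, h3) \<notin> E"
    using h(6) unfolding D1_def by blast
  moreover have "finite D1" using D unfolding D1_def by blast
  ultimately have "ctxR D1 u" unfolding ctxR_def using uD1 by blast
  moreover have "card D1 < card D"
    by (rule psubset_card_mono[OF D(1)]) (use D(4) in \<open>unfold D1_def, blast\<close>)
  ultimately have g: "good D1 u" using IH by blast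
  let ?V = "{u, v} \<union> P"
  have dec: "deco {u, v} {(u, v), (v, u)} {u, v} ?V (Restr E ?V)"
    unfolding deco_def
  proof (rule exI[of _ P], rule exI[of _ "P \<times> {v}"], intro conjI)
    show "P \<inter> {u, v} = {}" unfolding P_def using irr by blast
    show "Restr E ?V = {(u, v), (v, u)} \<union> symcl (P \<times> {v})"
    proof (intro equalityI subrelI)
      fix x y assume xy: "(x, y) \<in> Restr E ?V"
      have PD: "P \<subseteq> D" unfolding P_def by blast
      consider "x \<in> P" | "y \<in> P" | "x \<in> {u, v}" "y \<in> {u, v}" using xy by blast
      then show "(x, y) \<in> {(u, v), (v, u)} \<union> symcl (P \<times> {v})"
      proof cases
        case 1
        then have "y = v" using pv[of x y] xy D PD by blast
        then show ?thesis using 1 unfolding symcl_def by blast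
      next
        case 2
        then have "x = v" using pv[of y x] sym[of x y] xy D PD by blast
        then show ?thesis using 2 unfolding symcl_def by blast
      next
        case 3
        then show ?thesis using xy irr by blast
      qed
    next
      fix x y assume "(x, y) \<in> {(u, v), (v, u)} \<union> symcl (P \<times> {v})"
      moreover have "(p, v) \<in> E" "(v, p) \<in> E" if "p \<in> P" for p using that sym unfolding P_def by blast+
      ultimately show "(x, y) \<in> Restr E ?V" using uv vu unfolding symcl_def by blast
    qed
  qed auto
  have "strip 0 {u, v} {u, v} {u, v} {(u, v), (v, u)} {u, v}" by (rule strip.base[OF ne])
  moreover have "D = D1 \<union> ?V" unfolding D1_def P_def using D by blast
  moreover have "D1 \<inter> ?V = {u}" using uD1 unfolding D1_def by blast
  moreover have "anti (D1 - {u}) (?V - {u})" unfolding anti_def using out by blast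
  ultimately show ?thesis unfolding resE_def using dec g by blast
qed

lemma cellres_facts:
  assumes "cellres D u v D' q w" "finite D"
  shows "ctxE D' q w" "card D' < card D"
proof -
  show "ctxE D' q w" using assms unfolding cellres_def by blast
  obtain M C V where m: "cell {q, w} {u, v} M C" "deco M C {u, v} V (Restr E V)" "D = D' \<union> V" "D' \<inter> V = {q, w}"
    using assms(1) unfolding cellres_def by blast
  have "u \<in> M" "u \<notin> {q, w}" using cell_sub[OF m(1)] by blast+
  moreover have "M \<subseteq> V" using deco_sub[OF m(2)] by blast
  ultimately have "D' \<subset> D" using m(3,4) by blast
  then show "card D' < card D" using assms(2) by (rule psubset_card_mono[rotated])
qed

lemma claimE_step:
  assumes c: "ctxE D u v"
    and IHR: "\<And>D' r. card D' < card D \<Longrightarrow> ctxR D' r \<Longrightarrow> good D' r"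
    and IHE: "\<And>D' u v. card D' < card D \<Longrightarrow> ctxE D' u v \<Longrightarrow> \<exists>n. resE D' u v n"
  shows "\<exists>n. resE D u v n"
proof -
  obtain h1 h2 h3 h4 where h: "hex u h1 h2 h3 h4 v" "h1 \<notin> D" "h2 \<notin> D" "h3 \<notin> D" "h4 \<notin> D"
     "\<forall>x\<in>D. ((x, h1) \<in> E \<longrightarrow> x = u) \<and> (x, h2) \<notin> E \<and> (x, h3) \<notin> E \<and> ((x, h4) \<in> E \<longrightarrow> x = v)"
    and D: "finite D" "conn D" "u \<in> D" "v \<in> D"
    using c unfolding ctxE_def by blast
  note uv = hex_adj(12)[OF h(1)] and vu = hex_adj(6)[OF h(1)]
  show ?thesis
  proof (cases "\<exists>y y'. y \<in> D \<and> y' \<in> D \<and> (v, y) \<in> E \<and> y \<noteq> u \<and> (y, y') \<in> E \<and> y' \<noteq> v")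
    case False
    have "resE D u v 0"
      by (rule resE_base[OF c]) (use False IHR in blast)+
    then show ?thesis ..
  next
    case True
    then obtain y0 y0' where y: "y0 \<in> D" "y0' \<in> D" "(v, y0) \<in> E" "y0 \<noteq> u" "(y0, y0') \<in> E" "y0' \<noteq> v" by blast
    show ?thesis
    proof (cases "\<exists>y y'. y \<in> D \<and> y' \<in> D \<and> (u, y) \<in> E \<and> y \<noteq> v \<and> (y, y') \<in> E \<and> y' \<noteq> u")
      case False
      have "resE D v u 0"
        by (rule resE_base[OF ctxE_swap[OF c]]) (use False IHR in blast)+
      then show ?thesis using resE_swap by blast
    next
      case True
      then obtain x0 x0' where x: "x0 \<in> D" "x0' \<in> D" "(u, x0) \<in> E" "x0 \<noteq> v" "(x0, x0') \<in> E" "x0' \<noteq> u" by blast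
      have "\<exists>D' q w. cellres D u v D' q w"
      proof (rule cell_step[OF D uv _ x y])
        fix a a' b b' assume a: "a \<in> D" "a' \<in> D" "b \<in> D" "b' \<in> D" "(u, a) \<in> E" "a \<noteq> v" "(a, a') \<in> E" "a' \<noteq> u"
          "(v, b) \<in> E" "b \<noteq> u" "(b, b') \<in> E" "b' \<noteq> v"
        have H: "hex u v h4 h3 h2 h1" by (rule hex_rev[OF h(1)])
        have 1: "a \<notin> {u, v, h4, h3, h2, h1}" "b \<notin> {u, v, h4, h3, h2, h1}" using a h irr by blast+
        have "a' \<noteq> v" using no3[of u a v] a vu by blast
        moreover have "b' \<noteq> u" using no3[of v b u] a uv by blast
        ultimately have 2: "a' \<notin> {u, v, h4, h3, h2, h1}" "b' \<notin> {u, v, h4, h3, h2, h1}" using a h by blast+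
        have "(a', h3) \<in> E \<or> (b', h2) \<in> E \<or> (a', b') \<in> E"
          by (rule h2l2[OF H _ 1(1) _ 2(1) _ 1(2) _ 2(2)]) (use a sym in blast)+
        then show "(a', b') \<in> E" using h(6) a by blast
      qed
      then obtain D' q w where c': "cellres D u v D' q w" by blast
      obtain n where "resE D' q w n" using IHE cellres_facts[OF c' D(1)] by blast
      then have "resE D u v (Suc n)" by (rule resE_step[OF c'])
      then show ?thesis ..
    qed
  qed
qed

definition leg :: "'v set \<Rightarrow> 'v \<Rightarrow> 'v \<Rightarrow> 'v \<Rightarrow> 'v \<Rightarrow> bool" where
  "leg D r y y2 y3 \<longleftrightarrow> y \<in> D \<and> y2 \<in> D \<and> y3 \<in> D \<and> (r, y) \<in> E \<and> (y, y2) \<in> E \<and> (y2, y3) \<in> E \<and>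
     y2 \<noteq> r \<and> y3 \<noteq> r \<and> y3 \<noteq> y"

lemma comp_cl:
  assumes "y \<in> D" "y \<noteq> r" "a \<in> comp (D - {r}) y" "b \<in> D" "b \<noteq> r" "(a, b) \<in> E \<or> (b, a) \<in> E"
  shows "b \<in> comp (D - {r}) y"
  using comp_closed[of a "D - {r}" y b] assms sym[of b a] by blast

lemma comp_not:
  assumes "y \<in> D" "y \<noteq> r"
  shows "comp (D - {r}) y \<subseteq> D" "r \<notin> comp (D - {r}) y"
  using comp_sub[of y "D - {r}"] assms by blast+

lemma nbr_unique:
  assumes nh: "\<And>x a b c y. x \<in> D \<Longrightarrow> a \<in> D \<Longrightarrow> b \<in> D \<Longrightarrow> c \<in> D \<Longrightarrow> y \<in> D \<Longrightarrow> \<not> hex r x a b c y"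
    and y: "y \<in> D" "(r, y) \<in> E" and z: "z \<in> comp (D - {r}) y" "(r, z) \<in> E"
  shows "z = y"
proof (rule ccontr)
  assume ne: "z \<noteq> y"
  have yr: "y \<noteq> r" using y irr by blast
  let ?K = "comp (D - {r}) y"
  note K = comp_not[OF y(1) yr]
  have yz: "(y, z) \<in> (Restr E ?K)\<^sup>*"
    using comp_conn[of y "D - {r}"] y yr z comp_self unfolding conn_def by blast
  have "\<exists>a\<in>{y}. \<exists>b\<in>{x\<in>?K. (r, x) \<in> E \<and> x \<noteq> y}. \<exists>d1\<in>?K. \<exists>d2\<in>?K. \<exists>d3\<in>?K. hex r a d1 d2 d3 b"
  proof (rule ear[OF K(2)])
    show "((r, x) \<in> E) = (x \<in> {y} \<or> x \<in> {x \<in> ?K. (r, x) \<in> E \<and> x \<noteq> y})" if "x \<in> ?K" for x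
      using that y by auto
    show "{y} \<subseteq> ?K" using comp_self by simp
    show "z \<in> {x \<in> ?K. (r, x) \<in> E \<and> x \<noteq> y}" using z ne by simp
  qed (use yz in auto)
  then obtain b d1 d2 d3 where "hex r y d1 d2 d3 b" "b \<in> ?K" "d1 \<in> ?K" "d2 \<in> ?K" "d3 \<in> ?K" by auto
  then show False using nh[of y d1 d2 d3 b] K y by blast
qed

lemma legs_conflict:
  assumes c: "ctxR D r" and l: "leg D r y a b" and m: "leg D r z d e"
    and z: "z \<notin> comp (D - {r}) y"
  shows False
proof -
  obtain p1 p2 p3 where p: "p1 \<notin> D" "p2 \<notin> D" "p3 \<notin> D" "(r, p1) \<in> E" "(p1, p2) \<in> E" "(p2, p3) \<in> E" "p3 \<noteq> p1"
    "\<And>x. x \<in> D \<Longrightarrow> (x, p2) \<notin> E" "\<And>x. x \<in> D \<Longrightarrow> (x, p3) \<notin> E" and rD: "r \<in> D"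
    using c unfolding ctxR_def by blast
  note L = l[unfolded leg_def] and M = m[unfolded leg_def]
  have yr: "y \<in> D" "y \<noteq> r" and zr: "z \<noteq> r" using L M irr by blast+
  note cl = comp_cl[OF yr]
  have yC: "y \<in> comp (D - {r}) y" by (rule comp_self)
  have aC: "a \<in> comp (D - {r}) y" using cl[OF yC, of a] L by blast
  have bC: "b \<in> comp (D - {r}) y" using cl[OF aC, of b] L by blast
  have dC: "d \<notin> comp (D - {r}) y" using cl[of d z] M zr z by blast
  have eC: "e \<notin> comp (D - {r}) y" using cl[of e d] M dC by blast
  have nadj: "(s, t) \<notin> E" if "s \<in> comp (D - {r}) y" "t \<notin> comp (D - {r}) y" "t \<in> D" "t \<noteq> r" for s t
    using cl[of s t] that by blast
  have pp: "(p2, x) \<notin> E" "(p3, x) \<notin> E" if "x \<in> D" for x using p(8,9)[OF that] sym by blast+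
  show False
  proof (rule s333[of r y a b z d e p1 p2 p3])
    show "(a, e) \<notin> E" using nadj aC eC M by blast
    show "(b, d) \<notin> E" using nadj bC dC M by blast
    show "(b, e) \<notin> E" using nadj bC eC M by blast
    show "b \<noteq> e" using bC eC by blast
    show "y \<noteq> z" using yC z by blast
  qed (use L M p rD in blast)+
qed

lemma star_glue:
  assumes D: "finite D" "conn D" "r \<in> D" and y: "y \<in> D" "(r, y) \<in> E"
    and g: "good (insert r (comp (D - {r}) y)) r"
    and nl: "\<And>z d e. leg D r z d e \<Longrightarrow> z \<in> comp (D - {r}) y"
  shows "good D r"
proof -
  let ?C = "comp (D - {r}) y"
  have yr: "y \<noteq> r" using y irr by blast
  note K = comp_not[OF y(1) yr]
  have "star_graph (D - ?C) (Restr E (D - ?C)) r"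
  proof (rule star_rest[OF D(2,3) K])
    show "\<And>a b. a \<in> ?C \<Longrightarrow> b \<in> D \<Longrightarrow> (a, b) \<in> E \<Longrightarrow> b \<noteq> r \<Longrightarrow> b \<in> ?C"
      using comp_cl[OF y(1) yr] by blast
    show "\<And>z d e. z \<in> D - ?C \<Longrightarrow> (r, z) \<in> E \<Longrightarrow> d \<in> D \<Longrightarrow> d \<noteq> r \<Longrightarrow> (z, d) \<in> E \<Longrightarrow> e \<in> D \<Longrightarrow> e \<noteq> r \<Longrightarrow> e \<noteq> z \<Longrightarrow> (d, e) \<notin> E"
      using nl unfolding leg_def by blast
  qed
  then have "good (insert r ?C \<union> (D - ?C)) r"
  proof (rule good.glue_star[OF g])
    show "insert r ?C \<inter> (D - ?C) = {r}" using D K by blast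
    show "anti (insert r ?C - {r}) (D - ?C - {r})"
      unfolding anti_def using comp_cl[OF y(1) yr] by blast
  qed
  moreover have "insert r ?C \<union> (D - ?C) = D" using D K by blast
  ultimately show ?thesis by simp
qed

lemma good_shallow:
  assumes D: "conn D" "r \<in> D" and nl: "\<And>z d e. \<not> leg D r z d e"
  shows "good D r"
proof -
  have "star_graph (D - {}) (Restr E (D - {})) r"
    by (rule star_rest[OF D]) (use nl in \<open>unfold leg_def, blast\<close>)+
  then show ?thesis by (simp add: good.star)
qed

lemma claimR_nohex:
  assumes c: "ctxR D r"
    and nh: "\<And>x a b c y. x \<in> D \<Longrightarrow> a \<in> D \<Longrightarrow> b \<in> D \<Longrightarrow> c \<in> D \<Longrightarrow> y \<in> D \<Longrightarrow> \<not> hex r x a b c y"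
    and IHR: "\<And>D' r. card D' < card D \<Longrightarrow> ctxR D' r \<Longrightarrow> good D' r"
  shows "good D r"
proof -
  obtain p1 p2 p3 where p: "p1 \<notin> D" "p2 \<notin> D" "p3 \<notin> D" "(r, p1) \<in> E" "(p1, p2) \<in> E" "(p2, p3) \<in> E" "p3 \<noteq> p1"
    "\<And>x. x \<in> D \<Longrightarrow> (x, p1) \<in> E \<Longrightarrow> x = r" "\<And>x. x \<in> D \<Longrightarrow> (x, p2) \<notin> E"
    and D: "finite D" "conn D" "r \<in> D"
    using c unfolding ctxR_def by blast
  show ?thesis
  proof (cases "\<exists>y a b. leg D r y a b")
    case False
    then show ?thesis using good_shallow[OF D(2,3)] by blast
  next
    case True
    then obtain y a b where l: "leg D r y a b" by blast
    then have y: "y \<in> D" "(r, y) \<in> E" unfolding leg_def by blast+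
    have yr: "y \<noteq> r" using y irr by blast
    let ?C = "comp (D - {r}) y"
    note K = comp_not[OF y(1) yr]
    have uni: "z = y" if "z \<in> ?C" "(z, r) \<in> E" for z
      using nbr_unique[OF nh y that(1)] sym[OF that(2)] by blast
    have "ctxR ?C y"
      unfolding ctxR_def
    proof (intro conjI exI)
      show "finite ?C" by (rule finite_subset[OF K(1) D(1)])
      show "conn ?C" using comp_conn[of y "D - {r}"] y yr by blast
      show "y \<in> ?C" by (rule comp_self)
      show "r \<notin> ?C" by (rule K(2))
      show "p1 \<notin> ?C" "p2 \<notin> ?C" using K p by blast+
      show "(y, r) \<in> E" by (rule sym[OF y(2)])
      show "(r, p1) \<in> E" "(p1, p2) \<in> E" by (rule p)+
      show "p2 \<noteq> r" using p D by blast
      show "\<forall>x\<in>?C. ((x, r) \<in> E \<longrightarrow> x = y) \<and> (x, p1) \<notin> E \<and> (x, p2) \<notin> E"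
        using uni K p(8,9) by blast
    qed
    moreover have "card ?C < card D"
      by (rule psubset_card_mono[OF D(1)]) (use K D in blast)
    ultimately have "good ?C y" using IHR by blast
    then have "good (insert r ?C) r"
    proof (rule good.edge)
      show "y \<in> ?C" by (rule comp_self)
      show "(y, r) \<in> E" by (rule sym[OF y(2)])
      show "r \<notin> ?C" by (rule K(2))
      show "anti {r} (?C - {y})" unfolding anti_def using uni sym by blast
    qed
    then show ?thesis
      by (rule star_glue[OF D y]) (use legs_conflict[OF c l] in blast)
  qed
qed

end

context xfree
begin

text \<open>A hexagon at a vertex with an outside path of length 3 determines the vertex opposite to it:
  all neighbours of \<open>r\<close> in the same component lie on paths of length 3 to \<open>q\<close>.\<close>

lemma theta_at_root:
  assumes c: "ctxR D r" and H: "hex r c1 c2 q c4 c5" and cD: "c1 \<in> D" "c2 \<in> D" "q \<in> D" "c4 \<in> D" "c5 \<in> D"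
    and y: "y \<in> comp (D - {r}) c1" "(r, y) \<in> E"
  shows "\<exists>y'\<in>D. (y, y') \<in> E \<and> (y', q) \<in> E"
proof (rule ccontr)
  assume neg: "\<not> (\<exists>y'\<in>D. (y, y') \<in> E \<and> (y', q) \<in> E)"
  obtain p1 p2 p3 where p: "p1 \<notin> D" "p2 \<notin> D" "p3 \<notin> D" "(r, p1) \<in> E" "(p1, p2) \<in> E" "(p2, p3) \<in> E" "p3 \<noteq> p1"
    "\<And>x. x \<in> D \<Longrightarrow> (x, p1) \<in> E \<Longrightarrow> x = r" "\<And>x. x \<in> D \<Longrightarrow> (x, p2) \<notin> E" "\<And>x. x \<in> D \<Longrightarrow> (x, p3) \<notin> E"
    and D: "finite D" "conn D" "r \<in> D"
    using c unfolding ctxR_def by blast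
  have pp: "(p2, x) \<notin> E" "(p3, x) \<notin> E" if "x \<in> D" for x using p(9,10)[OF that] sym by blast+
  note h = hex_adj[OF H]
  have c1r: "c1 \<noteq> r" using h irr by blast
  let ?C = "comp (D - {r}) c1"
  note K = comp_not[OF cD(1) c1r]
  define B where "B = {x \<in> ?C. (r, x) \<in> E \<and> (\<exists>x'\<in>D. (x, x') \<in> E \<and> (x', q) \<in> E)}"
  define A where "A = {x \<in> ?C. (r, x) \<in> E \<and> \<not> (\<exists>x'\<in>D. (x, x') \<in> E \<and> (x', q) \<in> E)}"
  have dist: "distinct [r, c1, c2, q, c4, c5]" using H unfolding hex_def by blast
  have c1C: "c1 \<in> ?C" by (rule comp_self)
  note cl = comp_cl[OF cD(1) c1r]
  have c2C: "c2 \<in> ?C" using cl[OF c1C, of c2] h cD dist by auto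
  have qC: "q \<in> ?C" using cl[OF c2C, of q] h cD dist by auto
  have c4C: "c4 \<in> ?C" using cl[OF qC, of c4] h cD dist by auto
  have c5C: "c5 \<in> ?C" using cl[OF c4C, of c5] h cD dist by auto
  have c1B: "c1 \<in> B" unfolding B_def using c1C h cD by blast
  have c5B: "c5 \<in> B" unfolding B_def using c5C h cD by blast
  have yA: "y \<in> A" using y neg unfolding A_def by blast
  have path: "(y, c1) \<in> (Restr E ?C)\<^sup>*"
    using comp_conn[of c1 "D - {r}"] cD(1) c1r y c1C unfolding conn_def by blast
  have "\<exists>a\<in>A. \<exists>b\<in>B. \<exists>d1\<in>?C. \<exists>d2\<in>?C. \<exists>d3\<in>?C. hex r a d1 d2 d3 b"
  proof (rule ear[OF K(2)])
    show "((r, x) \<in> E) = (x \<in> A \<or> x \<in> B)" if "x \<in> ?C" for x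
      using that unfolding A_def B_def by blast
    show "A \<subseteq> ?C" "B \<subseteq> ?C" "A \<inter> B = {}" unfolding A_def B_def by blast+
  qed (use yA c1B path in auto)
  then obtain z x d1 d2 d3 where z: "z \<in> A" "x \<in> B" "d1 \<in> ?C" "d2 \<in> ?C" "d3 \<in> ?C" "hex r z d1 d2 d3 x" by blast
  have dD: "d1 \<in> D" "d2 \<in> D" "d3 \<in> D" "d1 \<noteq> r" "d2 \<noteq> r" "d3 \<noteq> r" using z(3-5) K by blast+
  have zD: "z \<in> D" "x \<in> D" using z(1,2) K unfolding A_def B_def by blast+
  obtain x' where x': "x' \<in> D" "(x, x') \<in> E" "(x', q) \<in> E" using z(2) unfolding B_def by blast
  have "c1 \<noteq> c5" using dist by auto
  then have "\<exists>x2\<in>B. x2 \<noteq> x" using c1B c5B by metis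
  then obtain x2 x2' where x2: "x2 \<in> B" "x2 \<noteq> x" "x2' \<in> D" "(x2, x2') \<in> E" "(x2', q) \<in> E"
    unfolding B_def by blast
  have x2D: "x2 \<in> D" "(r, x2) \<in> E" "(r, x) \<in> E" using x2(1) z(2) K unfolding B_def by blast+
  have zB: "t = t" "(z, t) \<notin> E \<or> (t, q) \<notin> E" if "t \<in> D" for t using z(1) that unfolding A_def by blast+
  have rq: "(r, q) \<notin> E" "(q, r) \<notin> E" using h by blast+
  have x'r: "x' \<noteq> r" "x2' \<noteq> r" using rq x'(3) x2(5) by blast+
  have xx2: "x' \<noteq> x2'"
  proof
    assume "x' = x2'"
    then have "r = x' \<or> x = x2" using no4[of r x x' x2] x2D x' x2 sym by blast
    then show False using x'r x2 by blast
  qed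
  have HH: "hex r x x' q x2' x2"
    by (rule hexI) (use x2D x' x2 sym rq x'r xx2 in blast)+
  note hh = hex_adj[OF HH]
  note h' = hex_adj[OF z(6)]
  have dist': "distinct [r, z, d1, d2, d3, x]" using z(6) unfolding hex_def by blast
  have dist2: "distinct [r, x, x', q, x2', x2]" using HH unfolding hex_def by blast
  have zx2: "z \<noteq> x2" using z(1) x2(1) unfolding A_def B_def by blast
  have qD: "q \<in> D" by (rule cD)
  show False
  proof (cases "d3 = x'")
    case False
    have 1: "p1 \<notin> {r, x, x', q, x2', x2}" "p2 \<notin> {r, x, x', q, x2', x2}"
      using p D zD x' qD x2 x2D by blast+
    have d3x: "(d3, x) \<in> E" "(d2, d3) \<in> E" "(d2, d1) \<in> E" "(d1, z) \<in> E" using h' by blast+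
    have 2: "d3 \<notin> {r, x, x', q, x2', x2}" using False d3x dD hh irr by blast
    have "d3 \<notin> {x, x', q, x2', x2, r}" using 2 by blast
    note at = attach_once[OF hex_rot[OF HH] d3x(1) this]
    have 3: "d2 \<notin> {r, x, x', q, x2', x2}" using at d3x dD dist' by auto
    have "(p2, q) \<in> E \<or> (d2, x2') \<in> E \<or> (p2, d2) \<in> E"
      by (rule h2l2[OF HH sym[OF p(4)] 1(1) sym[OF p(5)] 1(2) d3x(1) 2 d3x(2) 3])
    have H3: "hex r x d3 d2 d1 z" by (rule hex_rev[OF z(6)])
    have 4: "p1 \<notin> {r, x, d3, d2, d1, z}" "p2 \<notin> {r, x, d3, d2, d1, z}"
      using p D zD dD by blast+
    have x'x: "(x', x) \<in> E" "(q, x') \<in> E" using hh by blast+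
    have "x' \<noteq> z" using hh h' by blast
    moreover have "x' \<noteq> d2" "x' \<noteq> d1" using x' h' by blast+
    ultimately have 5: "x' \<notin> {r, x, d3, d2, d1, z}" using x'r x' irr False by blast
    have "x' \<notin> {x, d3, d2, d1, z, r}" using 5 by blast
    note at' = attach_once[OF hex_rot[OF H3] x'x(1) this]
    have 6: "q \<notin> {r, x, d3, d2, d1, z}" using at' x'x dist2 by auto
    have "(p2, d2) \<in> E \<or> (q, d1) \<in> E \<or> (p2, q) \<in> E"
      by (rule h2l2[OF H3 sym[OF p(4)] 4(1) sym[OF p(5)] 4(2) x'x(1) 5 x'x(2) 6])
    then have "(d1, q) \<in> E" using pp[OF dD(2)] pp[OF qD] sym by blast
    then show False using zB(2)[OF dD(1)] h' by blast
  next
    case True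
    have d1q: "(d1, q) \<notin> E" using zB(2)[OF dD(1)] h' by blast
    have d2q: "d2 \<noteq> q" using d1q h' by blast
    have d2x': "(d2, x') \<in> E" using h' True by blast
    have a: "(d2, x2') \<notin> E" using n4[OF d2x' x'(3), of x2'] x2(5) sym d2q xx2 by blast
    have b: "(d2, q) \<notin> E" using n3[OF d2x' x'(3)] by blast
    show False
    proof (rule s333[of r p1 p2 p3 z d1 d2 x2 x2' q])
      show "(d1, q) \<notin> E" "(d2, x2') \<notin> E" "(d2, q) \<notin> E" "d2 \<noteq> q" by (rule d1q a b d2q)+
      show "z \<noteq> x2" by (rule zx2)
      show "(r, z) \<in> E" "(z, d1) \<in> E" "(d1, d2) \<in> E" "d1 \<noteq> r" "d2 \<noteq> z" using h' dD dist' by auto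
      show "(r, x2) \<in> E" "(x2, x2') \<in> E" "(x2', q) \<in> E" "x2' \<noteq> r" "q \<noteq> x2" using x2 x2D x'r dist2 by auto
      show "p2 \<noteq> r" "p1 \<noteq> z" "p1 \<noteq> x2" "p3 \<noteq> d2" "p3 \<noteq> q" using p D zD x2D dD qD by blast+
    qed (use p pp[OF dD(1)] pp[OF dD(2)] pp[OF x2(3)] pp[OF qD] in blast)+
  qed
qed

lemma claimR_hex:
  assumes c: "ctxR D r" and H: "hex r c1 c2 q c4 c5" and cD: "c1 \<in> D" "c2 \<in> D" "q \<in> D" "c4 \<in> D" "c5 \<in> D"
    and IHE: "\<And>D' u v. card D' < card D \<Longrightarrow> ctxE D' u v \<Longrightarrow> \<exists>n. resE D' u v n"
  shows "good D r"
proof -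
  obtain p1 p2 p3 where p: "p1 \<notin> D" "p2 \<notin> D" "p3 \<notin> D" "(r, p1) \<in> E" "(p1, p2) \<in> E" "(p2, p3) \<in> E" "p3 \<noteq> p1"
    "\<And>x. x \<in> D \<Longrightarrow> (x, p1) \<in> E \<Longrightarrow> x = r" "\<And>x. x \<in> D \<Longrightarrow> (x, p2) \<notin> E" "\<And>x. x \<in> D \<Longrightarrow> (x, p3) \<notin> E"
    and D: "finite D" "conn D" "r \<in> D"
    using c unfolding ctxR_def by blast
  have pp: "(p2, x) \<notin> E" "(p3, x) \<notin> E" if "x \<in> D" for x using p(9,10)[OF that] sym by blast+
  note h = hex_adj[OF H]
  have c1r: "c1 \<noteq> r" using h irr by blast
  let ?C = "comp (D - {r}) c1"
  note K = comp_not[OF cD(1) c1r]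
  have dist: "distinct [r, c1, c2, q, c4, c5]" using H unfolding hex_def by blast
  have c1C: "c1 \<in> ?C" by (rule comp_self)
  note cl = comp_cl[OF cD(1) c1r]
  have c2C: "c2 \<in> ?C" using cl[OF c1C, of c2] h cD dist by auto
  have qC: "q \<in> ?C" using cl[OF c2C, of q] h cD dist by auto
  have c4C: "c4 \<in> ?C" using cl[OF qC, of c4] h cD dist by auto
  have c5C: "c5 \<in> ?C" using cl[OF c4C, of c5] h cD dist by auto
  have rq: "(r, q) \<notin> E" "(q, r) \<notin> E" "r \<noteq> q" using h dist by auto
  define D0 where "D0 = insert r ?C"
  have D0D: "D0 \<subseteq> D" "finite D0" using K D unfolding D0_def by (auto intro: finite_subset)
  define N where "N = {x \<in> ?C. (r, x) \<in> E}"
  define st where "st = (\<lambda>x. SOME x'. x' \<in> D \<and> (x, x') \<in> E \<and> (x', q) \<in> E)"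
  have st0: "st x \<in> D \<and> (x, st x) \<in> E \<and> (st x, q) \<in> E" if "x \<in> N" for x
    unfolding st_def
    by (rule someI_ex) (use theta_at_root[OF c H cD, of x] that in \<open>unfold N_def, blast\<close>)
  have Np: "x \<in> D" "(r, x) \<in> E" "(x, r) \<in> E" "x \<noteq> q" "x \<in> ?C" "x \<noteq> r" if "x \<in> N" for x
    using that K sym rq unfolding N_def by blast+
  have stp: "st x \<in> D" "(x, st x) \<in> E" "(st x, x) \<in> E" "(st x, q) \<in> E" "(q, st x) \<in> E" "st x \<noteq> r" "st x \<in> ?C"
    if "x \<in> N" for x
  proof -
    show a: "st x \<in> D" "(x, st x) \<in> E" "(st x, x) \<in> E" "(st x, q) \<in> E" "(q, st x) \<in> E"
      using st0[OF that] sym by blast+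
    show b: "st x \<noteq> r" using a(4) rq by blast
    show "st x \<in> ?C" using cl[of x "st x"] Np[OF that] a b by blast
  qed
  have stu: "t = st x" if "x \<in> N" "(x, t) \<in> E" "(t, q) \<in> E" for x t
    using no4[of x t q "st x"] that stp[OF that(1)] Np[OF that(1)] by blast
  have Hx: "hex r x (st x) q (st z) z" if "x \<in> N" "z \<in> N" "x \<noteq> z" for x z
  proof (rule hexI)
    show "st x \<noteq> st z"
    proof
      assume "st x = st z"
      then have "r = st x \<or> x = z" using no4[of r x "st x" z] Np[OF that(1)] Np[OF that(2)] stp[OF that(1)] stp[OF that(2)] by metis
      then show False using stp(6)[OF that(1)] that(3) by blast
    qed
  qed (use that Np[OF that(1)] Np[OF that(2)] stp[OF that(1)] stp[OF that(2)] in blast)+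
  have p1out: "p1 \<notin> {r, x, st x, q, st z, z}" "p2 \<notin> {r, x, st x, q, st z, z}" if "x \<in> N" "z \<in> N" for x z
    using p D cD Np[OF that(1)] Np[OF that(2)] stp[OF that(1)] stp[OF that(2)] by blast+
  define J1 where "J1 = {x \<in> N. \<exists>w\<in>D0. (x, w) \<in> E \<and> w \<noteq> r \<and> w \<noteq> st x}"
  define J2 where "J2 = {x \<in> N. \<exists>w\<in>D0. (st x, w) \<in> E \<and> w \<noteq> x \<and> w \<noteq> q}"
  have J1N: "J1 \<subseteq> N" "J2 \<subseteq> N" unfolding J1_def J2_def by blast+
  have w1: "\<exists>w. (w, x) \<in> E \<and> w \<notin> {r, x, st x, q, st z, z}" if t: "x \<in> J1" "z \<in> N" "x \<noteq> z" for x z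
  proof -
    obtain w where w: "x \<in> N" "(x, w) \<in> E" "w \<noteq> r" "w \<noteq> st x" using t unfolding J1_def by blast
    have "w \<notin> {r, x, st x, q, st z, z}" using w hex_adj[OF Hx[OF w(1) t(2,3)]] irr by blast
    then show ?thesis using w sym by blast
  qed
  have w2: "\<exists>w. (w, st x) \<in> E \<and> w \<notin> {r, x, st x, q, st z, z}" if t: "x \<in> J2" "z \<in> N" "x \<noteq> z" for x z
  proof -
    obtain w where w: "x \<in> N" "(st x, w) \<in> E" "w \<noteq> x" "w \<noteq> q" using t unfolding J2_def by blast
    have "w \<notin> {r, x, st x, q, st z, z}" using w hex_adj[OF Hx[OF w(1) t(2,3)]] irr by blast
    then show ?thesis using w sym by blast
  qed
  have J11: "x = z" if t: "x \<in> J1" "z \<in> J1" for x z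
  proof (rule ccontr)
    assume ne: "x \<noteq> z"
    have N: "x \<in> N" "z \<in> N" using t J1N by blast+
    obtain w where w: "(w, x) \<in> E" "w \<notin> {r, x, st x, q, st z, z}" using w1[OF t(1) N(2) ne] by blast
    obtain w' where w': "(w', z) \<in> E" "w' \<notin> {r, z, st z, q, st x, x}" using w1[OF t(2) N(1) ne[symmetric]] by blast
    have H': "hex z r x (st x) q (st z)" using hex_rot[OF hex_rot[OF hex_rot[OF hex_rot[OF hex_rot[OF Hx[OF N ne]]]]]] .
    show False
      by (rule h3c[OF H' w'(1) _ sym[OF p(4)] _ w(1)]) (use w w' p1out[OF N] in blast)+
  qed
  have J22: "x = z" if t: "x \<in> J2" "z \<in> J2" for x z
  proof (rule ccontr)
    assume ne: "x \<noteq> z"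
    have N: "x \<in> N" "z \<in> N" using t J1N by blast+
    obtain w where w: "(w, st x) \<in> E" "w \<notin> {r, x, st x, q, st z, z}" using w2[OF t(1) N(2) ne] by blast
    obtain w' where w': "(w', st z) \<in> E" "w' \<notin> {r, z, st z, q, st x, x}" using w2[OF t(2) N(1) ne[symmetric]] by blast
    show False
      by (rule h3nc[OF Hx[OF N ne] sym[OF p(4)] _ w(1) _ w'(1)]) (use w w' p1out[OF N] in blast)+
  qed
  have c1N: "c1 \<in> N" and c5N: "c5 \<in> N" using c1C c5C h unfolding N_def by blast+
  have c15: "c1 \<noteq> c5" using dist by auto
  have other: "\<exists>z\<in>N. z \<noteq> x" for x using c1N c5N c15 by metis
  have J12: "x \<notin> J2" if t: "x \<in> J1" for x
  proof
    assume "x \<in> J2"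
    obtain z where z: "z \<in> N" "z \<noteq> x" using other by blast
    have N: "x \<in> N" using t J1N by blast
    obtain w where w: "(w, x) \<in> E" "w \<notin> {r, x, st x, q, st z, z}" using w1[OF t z(1)] z(2) by blast
    obtain w' where w': "(w', st x) \<in> E" "w' \<notin> {r, x, st x, q, st z, z}" using w2[OF \<open>x \<in> J2\<close> z(1)] z(2) by blast
    show False
      by (rule h3c[OF Hx[OF N z(1) z(2)[symmetric]] sym[OF p(4)] p1out(1)[OF N z(1)] w w'])
  qed
  obtain v where v: "v \<in> N" "v \<notin> J2" "\<And>x. x \<in> N \<Longrightarrow> x \<noteq> v \<Longrightarrow> x \<notin> J1"
  proof (cases "J1 = {}")
    case True
    have "c1 \<notin> J2 \<or> c5 \<notin> J2" using J22 c15 by blast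
    then show ?thesis using that c1N c5N True by blast
  next
    case False
    then obtain v where "v \<in> J1" by blast
    then show ?thesis using that[of v] J11 J12 J1N by blast
  qed
  have rv: "(r, v) \<in> E" "v \<in> D0" "r \<in> D0" using Np[OF v(1)] unfolding D0_def by blast+
  have conn0: "conn D0"
  proof (rule connI[of r])
    show "r \<in> D0" by (rule rv)
    fix z assume z: "z \<in> D0"
    show "(z, r) \<in> (Restr E D0)\<^sup>*"
    proof (cases "z = r")
      case False
      then have "z \<in> ?C" using z unfolding D0_def by blast
      then have "(z, c1) \<in> (Restr E ?C)\<^sup>*"
        using comp_conn[of c1 "D - {r}"] cD(1) c1r c1C unfolding conn_def by blast
      moreover have "Restr E ?C \<subseteq> Restr E D0" unfolding D0_def by blast
      ultimately have "(z, c1) \<in> (Restr E D0)\<^sup>*" using rtrancl_mono by blast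
      moreover have "(c1, r) \<in> Restr E D0" using c1C h unfolding D0_def by blast
      ultimately show ?thesis by (rule rtrancl.rtrancl_into_rtrancl)
    qed simp
  qed
  have stD0: "st x \<in> D0" if "x \<in> N" for x using stp(7)[OF that] unfolding D0_def by blast
  have qD0: "q \<in> D0" using qC unfolding D0_def by blast
  obtain z where z: "z \<in> N" "z \<noteq> v" using other by blast
  have "\<exists>D' q' w. cellres D0 r v D' q' w"
  proof (rule cell_step[OF D0D(2) conn0 rv(3,2,1)])
    show "z \<in> D0" using Np[OF z(1)] unfolding D0_def by blast
    show "st z \<in> D0" "st v \<in> D0" using stD0 z v by blast+
    show "(r, z) \<in> E" "z \<noteq> v" "(z, st z) \<in> E" "st z \<noteq> r" using Np[OF z(1)] stp[OF z(1)] z by blast+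
    show "q \<in> D0" by (rule qD0)
    show "(v, st v) \<in> E" "st v \<noteq> r" "(st v, q) \<in> E" "q \<noteq> v" using stp[OF v(1)] Np[OF v(1)] by blast+
    fix x x' y y' assume a: "x \<in> D0" "x' \<in> D0" "y \<in> D0" "y' \<in> D0" "(r, x) \<in> E" "x \<noteq> v" "(x, x') \<in> E" "x' \<noteq> r"
      "(v, y) \<in> E" "y \<noteq> r" "(y, y') \<in> E" "y' \<noteq> v"
    have xN: "x \<in> N" using a irr unfolding N_def D0_def by blast
    have x': "x' = st x" using v(3)[OF xN a(6)] a xN unfolding J1_def by blast
    note HH = Hx[OF v(1) xN a(6)[symmetric]]
    note hh = hex_adj[OF HH]
    show "(x', y') \<in> E"
    proof (cases "y = st v")
      case True
      then have "y' = q" using v(1,2) a unfolding J2_def by blast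
      then show ?thesis using x' stp[OF xN] by blast
    next
      case False
      have yo: "y \<notin> {r, v, st v, q, st x, x}" using a False hh irr by blast
      have "y \<notin> {v, st v, q, st x, x, r}" using yo by blast
      note at = attach_once[OF hex_rot[OF HH] sym[OF a(9)] this]
      have yo': "y' \<notin> {r, v, st v, q, st x, x}" using at a by blast
      have "(p2, q) \<in> E \<or> (y', st x) \<in> E \<or> (p2, y') \<in> E"
        by (rule h2l2[OF HH sym[OF p(4)] p1out(1)[OF v(1) xN] sym[OF p(5)] p1out(2)[OF v(1) xN]
          sym[OF a(9)] yo sym[OF a(11)] yo'])
      then show ?thesis using pp[OF cD(3)] pp[of y'] a(4) D0D x' sym by blast
    qed
  qed
  then obtain D' q' w where cr: "cellres D0 r v D' q' w" by blast
  have "card D' < card D" using cellres_facts[OF cr D0D(2)] card_mono[OF D(1) D0D(1)] by linarith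
  then obtain n where "resE D' q' w n" using IHE cellres_facts[OF cr D0D(2)] by blast
  then have "resE D0 r v (Suc n)" by (rule resE_step[OF cr])
  then have "good D0 r" by (rule resE_good) auto
  moreover have "leg D r c1 c2 q" unfolding leg_def using h cD dist by auto
  ultimately show ?thesis
    unfolding D0_def using star_glue[OF D cD(1)] legs_conflict[OF c] h by blast
qed

theorem claims: "(ctxR D r \<longrightarrow> good D r) \<and> (ctxE D u v \<longrightarrow> (\<exists>n. resE D u v n))"
proof (induction "card D" arbitrary: D r u v rule: less_induct)
  case less
  have IHR: "\<And>D' r. card D' < card D \<Longrightarrow> ctxR D' r \<Longrightarrow> good D' r"
    and IHE: "\<And>D' u v. card D' < card D \<Longrightarrow> ctxE D' u v \<Longrightarrow> \<exists>n. resE D' u v n"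
    using less by blast+
  have "good D r" if c: "ctxR D r"
  proof (cases "\<exists>x a b c y. x \<in> D \<and> a \<in> D \<and> b \<in> D \<and> c \<in> D \<and> y \<in> D \<and> hex r x a b c y")
    case True
    then obtain x a b d y where "x \<in> D" "a \<in> D" "b \<in> D" "d \<in> D" "y \<in> D" "hex r x a b d y" by blast
    then show ?thesis using claimR_hex[OF c _ _ _ _ _ _ IHE] by blast
  next
    case False
    show ?thesis by (rule claimR_nohex[OF c]) (use False IHR in blast)+
  qed
  moreover have "\<exists>n. resE D u v n" if "ctxE D u v"
    by (rule claimE_step[OF that]) (use IHR IHE in blast)+
  ultimately show ?case by blast
qed

lemmas claimR = claims[THEN conjunct1, rule_format]
lemmas claimE = claims[THEN conjunct2, rule_format]

end

section \<open>Connected graphs\<close>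

context xfree
begin

definition twosided :: "'v set \<Rightarrow> bool" where
  "twosided D \<longleftrightarrow> (\<exists>D1 D2 r. good D1 r \<and> good D2 r \<and> D = D1 \<union> D2 \<and> D1 \<inter> D2 = {r} \<and> anti (D1 - {r}) (D2 - {r}))"

lemma good_singleton: "good {r} r"
proof (rule good.star)
  have "Restr E {r} = symcl (Pair r ` {} \<union> (\<lambda>z. (z, id z)) ` {})" using irr by (auto simp: symcl_def)
  then show "star_graph {r} (Restr E {r}) r"
    unfolding star_graph_def by - (rule exI[of _ "{}"], rule exI[of _ "{}"], rule exI[of _ id], simp)
qed

lemma good_mem: "good D r \<Longrightarrow> r \<in> D"
proof (induction rule: good.induct)
  case (glue_strip D w n L R S C U V w')
  then show ?case using strip_sub[OF glue_strip(2)] deco_sub[OF glue_strip(4)] by blast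
qed (auto simp: star_graph_def)

lemma twosided_good: "good D r \<Longrightarrow> twosided D"
  unfolding twosided_def
  by (rule exI[of _ D], rule exI[of _ "{r}"], rule exI[of _ r])
    (use good_singleton good_mem in \<open>auto simp: anti_def\<close>)

lemma twosided_nohex:
  assumes D: "finite D" "conn D" "D \<noteq> {}"
    and nh: "\<And>r x a b c y. r \<in> D \<Longrightarrow> x \<in> D \<Longrightarrow> a \<in> D \<Longrightarrow> b \<in> D \<Longrightarrow> c \<in> D \<Longrightarrow> y \<in> D \<Longrightarrow> \<not> hex r x a b c y"
  shows "twosided D"
proof (cases "\<exists>r x. r \<in> D \<and> (\<exists>a b. leg D r x a b)")
  case False
  obtain r where r: "r \<in> D" using D by blast
  have "good D r" by (rule good_shallow[OF D(2) r]) (use False r in blast)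
  then show ?thesis by (rule twosided_good)
next
  case True
  let ?P = "\<lambda>s. fst s \<in> D \<and> (\<exists>a b. leg D (fst s) (snd s) a b)"
  let ?f = "\<lambda>s. card (comp (D - {fst s}) (snd s))"
  obtain s0 where "?P s0" using True by force
  then obtain s where s: "?P s" "\<And>t. ?P t \<Longrightarrow> ?f s \<le> ?f t"
    using ex_has_least_nat[of ?P s0 ?f] by blast
  obtain r x where rx: "s = (r, x)" by (cases s)
  obtain y z where l: "leg D r x y z" using s(1) rx by auto
  have r: "r \<in> D" using s(1) rx by simp
  have xD: "x \<in> D" "(r, x) \<in> E" "(x, r) \<in> E" using l sym unfolding leg_def by blast+
  have xr: "x \<noteq> r" using xD irr by blast
  let ?C = "comp (D - {r}) x"
  note K = comp_not[OF xD(1) xr] and cl = comp_cl[OF xD(1) xr]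
  have xC: "x \<in> ?C" by (rule comp_self)
  have yC: "y \<in> ?C" using cl[OF xC, of y] l unfolding leg_def by blast
  have zC: "z \<in> ?C" using cl[OF yC, of z] l unfolding leg_def by blast
  have uni: "t = x" if "t \<in> ?C" "(r, t) \<in> E" for t
    by (rule nbr_unique[OF nh xD(1,2) that]) (use r in blast)+
  have out: "s = r \<and> t = x" if "s \<in> D - ?C" "t \<in> ?C" "(s, t) \<in> E" for s t
    using cl[OF that(2), of s] that uni by blast
  define D' where "D' = D - ?C"
  have rD': "r \<in> D'" unfolding D'_def using r K by blast
  have "ctxR D' r"
    unfolding ctxR_def
  proof (intro conjI exI)
    show "finite D'" unfolding D'_def using D by blast
    show "conn D'"
    proof (rule conn_gate[OF D(2) _ rD', of "{r}"])
      show "D' \<subseteq> D" unfolding D'_def by blast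
      show "\<And>a b. a \<in> D' \<Longrightarrow> b \<in> D - D' \<Longrightarrow> (a, b) \<in> E \<Longrightarrow> a \<in> {r}"
        using out unfolding D'_def by blast
    qed auto
    show "r \<in> D'" by (rule rD')
    show "x \<notin> D'" "y \<notin> D'" "z \<notin> D'" unfolding D'_def using xC yC zC by blast+
    show "(r, x) \<in> E" "(x, y) \<in> E" "(y, z) \<in> E" "z \<noteq> x" using l unfolding leg_def by blast+
    have "y \<noteq> x" using l irr unfolding leg_def by blast
    then show "\<forall>s\<in>D'. ((s, x) \<in> E \<longrightarrow> s = r) \<and> (s, y) \<notin> E \<and> (s, z) \<notin> E"
      using out xC yC zC \<open>z \<noteq> x\<close> unfolding D'_def by blast
  qed
  then have g: "good D' r" by (rule claimR)
  have xD': "x \<notin> D'" unfolding D'_def using xC by blast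
  have "anti {x} (D' - {r})" unfolding anti_def D'_def using out xC sym by blast
  from good.edge[OF g rD' xD(2) xD' this] have g2: "good (insert x D') x" .
  have nl: "\<not> leg ?C x a b c" for a b c
  proof
    assume l': "leg ?C x a b c"
    then have ld: "leg D x a b c" using K unfolding leg_def by blast
    have ax: "a \<in> ?C - {x}" using l' irr unfolding leg_def by blast
    have "comp (D - {x}) a \<subseteq> ?C - {x}"
      by (rule comp_least[OF ax]) (use cl uni sym in blast)
    then have "comp (D - {x}) a \<subset> ?C" using xC by blast
    moreover have "finite ?C" by (rule finite_subset[OF K(1) D(1)])
    ultimately have "?f (x, a) < ?f s" unfolding rx by (simp add: psubset_card_mono)
    moreover have "?f s \<le> ?f (x, a)" by (rule s(2)) (use ld xD in auto)
    ultimately show False by simp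
  qed
  have "conn ?C" using comp_conn[of x "D - {r}"] xD xr by blast
  then have "star_graph (?C - {}) (Restr E (?C - {})) x"
    by (rule star_rest[OF _ xC]) (use nl in \<open>unfold leg_def, blast\<close>)+
  then have st: "star_graph ?C (Restr E ?C) x" by simp
  have "good (insert x D' \<union> ?C) x"
  proof (rule good.glue_star[OF g2 st])
    show "insert x D' \<inter> ?C = {x}" unfolding D'_def using xC by blast
    show "anti (insert x D' - {x}) (?C - {x})" unfolding anti_def D'_def using out by blast
  qed
  moreover have "insert x D' \<union> ?C = D" unfolding D'_def using K xC by blast
  ultimately show ?thesis using twosided_good by simp
qed

text \<open>\<open>central D M h0 \<dots> h5\<close>: the cell \<open>M\<close> of \<open>D\<close> contains the hexagon \<open>h0 \<dots> h5\<close>, and the rest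
  of \<open>D\<close> is attached to it only at the left edge \<open>h0h1\<close> and the right edge \<open>h3h4\<close>.\<close>

definition central :: "'v set \<Rightarrow> 'v set \<Rightarrow> 'v \<Rightarrow> 'v \<Rightarrow> 'v \<Rightarrow> 'v \<Rightarrow> 'v \<Rightarrow> 'v \<Rightarrow> bool" where
  "central D M h0 h1 h2 h3 h4 h5 \<longleftrightarrow> M \<subseteq> D \<and> hex h0 h1 h2 h3 h4 h5 \<and> {h0, h1, h2, h3, h4, h5} \<subseteq> M \<and>
     cell {h0, h1} {h3, h4} M (Restr E M) \<and>
     (\<forall>x\<in>M - {h0, h1, h3, h4}. \<forall>w\<in>D. (x, w) \<in> E \<longrightarrow> w \<in> M) \<and>
     (\<forall>d1\<in>D - M. \<forall>d2\<in>D - M. (h0, d1) \<in> E \<longrightarrow> (d1, d2) \<in> E \<longrightarrow> (d2, h3) \<notin> E) \<and>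
     (\<forall>d1\<in>D - M. \<forall>d2\<in>D - M. (h1, d1) \<in> E \<longrightarrow> (d1, d2) \<in> E \<longrightarrow> (d2, h4) \<notin> E)"

lemma no8:
  assumes e: "(a, b) \<in> E" "(b, c) \<in> E" "(c, d) \<in> E" "(d, e) \<in> E" "(e, f) \<in> E" "(f, g) \<in> E" "(g, h) \<in> E" "(h, a) \<in> E"
    and dist: "distinct [a, b, c, d, e, f, g, h]"
    and n: "(a, d) \<notin> E" "(a, f) \<notin> E" "(b, e) \<notin> E" "(b, g) \<notin> E" "(c, f) \<notin> E" "(c, h) \<notin> E" "(d, g) \<notin> E" "(e, h) \<notin> E"
      "(a, e) \<notin> E" "(b, f) \<notin> E" "(c, g) \<notin> E" "(d, h) \<notin> E"
  shows False
proof -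
  have s: "(b, a) \<in> E" "(c, b) \<in> E" "(d, c) \<in> E" "(e, d) \<in> E" "(f, e) \<in> E" "(g, f) \<in> E" "(h, g) \<in> E" "(a, h) \<in> E"
    using e sym by blast+
  have n': "(d, a) \<notin> E" "(f, a) \<notin> E" "(e, b) \<notin> E" "(g, b) \<notin> E" "(f, c) \<notin> E" "(h, c) \<notin> E" "(g, d) \<notin> E" "(h, e) \<notin> E"
      "(e, a) \<notin> E" "(f, b) \<notin> E" "(g, c) \<notin> E" "(h, d) \<notin> E"
    using n sym by blast+
  have m: "(a, c) \<notin> E" "(c, a) \<notin> E" "(b, d) \<notin> E" "(d, b) \<notin> E" "(c, e) \<notin> E" "(e, c) \<notin> E" "(d, f) \<notin> E" "(f, d) \<notin> E"
    "(e, g) \<notin> E" "(g, e) \<notin> E" "(f, h) \<notin> E" "(h, f) \<notin> E" "(g, a) \<notin> E" "(a, g) \<notin> E" "(h, b) \<notin> E" "(b, h) \<notin> E"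
    using n3[OF e(1,2)] n3[OF e(2,3)] n3[OF e(3,4)] n3[OF e(4,5)] n3[OF e(5,6)] n3[OF e(6,7)] n3[OF e(7,8)] n3[OF e(8,1)]
    by blast+
  let ?xs = "[a, b, c, d, e, f, g, h]"
  have "\<forall>i<8. \<forall>j<8. (?xs ! i, ?xs ! j) \<in> E \<longleftrightarrow>
      j = Suc i \<or> i = Suc j \<or> (i = 0 \<and> j = 8 - 1) \<or> (j = 0 \<and> i = 8 - 1)"
    unfolding all_less_numerals
    using e s n n' m irr by (simp add: nth_Cons')
  moreover have "(i, j) \<in> cycle_edges 8 \<union> (cycle_edges 8)\<inverse> \<longleftrightarrow>
      j = Suc i \<or> i = Suc j \<or> (i = 0 \<and> j = 8 - 1) \<or> (j = 0 \<and> i = 8 - 1)" if "i < 8" "j < 8" for i j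
    by (rule cycle_edges_iff[OF _ that]) simp
  ultimately have "\<forall>i<8. \<forall>j<8. (?xs ! i, ?xs ! j) \<in> E \<longleftrightarrow> (i, j) \<in> cycle_edges 8 \<union> (cycle_edges 8)\<inverse>"
    by presburger
  from emb_list'[OF dist this] have "emb 8 (cycle_edges 8) E" by simp
  then show False using no_cyc[of 8] by simp
qed

lemma central_k2:
  assumes H: "hex h0 h1 h2 h3 h4 h5" and D: "{h0, h1, h2, h3, h4, h5} \<subseteq> D"
    and att: "\<And>w. w \<in> D \<Longrightarrow> (h2, w) \<in> E \<Longrightarrow> w \<in> {h0, h1, h2, h3, h4, h5}"
      "\<And>w. w \<in> D \<Longrightarrow> (h5, w) \<in> E \<Longrightarrow> w \<in> {h0, h1, h2, h3, h4, h5}"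
    and n1: "\<And>d1 d2. d1 \<in> D - {h0, h1, h2, h3, h4, h5} \<Longrightarrow> d2 \<in> D - {h0, h1, h2, h3, h4, h5} \<Longrightarrow>
      (h0, d1) \<in> E \<Longrightarrow> (d1, d2) \<in> E \<Longrightarrow> (d2, h3) \<notin> E"
    and n2: "\<And>d1 d2. d1 \<in> D - {h0, h1, h2, h3, h4, h5} \<Longrightarrow> d2 \<in> D - {h0, h1, h2, h3, h4, h5} \<Longrightarrow>
      (h1, d1) \<in> E \<Longrightarrow> (d1, d2) \<in> E \<Longrightarrow> (d2, h4) \<notin> E"
  shows "central D {h0, h1, h2, h3, h4, h5} h0 h1 h2 h3 h4 h5"
proof -
  let ?M = "{h0, h1, h2, h3, h4, h5}"
  note h = hex_adj[OF H]
  have dist: "distinct [h0, h1, h2, h3, h4, h5]" using H unfolding hex_def by blast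
  let ?g = "(\<lambda>_. h4)(h1 := h2)"
  have h51: "h5 \<noteq> h1" using dist by auto
  have "Restr E ?M = symcl {(h0, h1), (h0, h5), (h1, h2), (h5, h4), (h2, h3), (h4, h3)}"
    using h irr by (auto simp: symcl_def)
  also have "\<dots> = symcl (Pair h0 ` {h1, h5} \<union> (\<lambda>x. (x, ?g x)) ` {h1, h5} \<union> (\<lambda>x. (?g x, h3)) ` {h1, h5})"
    using dist h51 by (simp add: insert_commute)
  finally have R: "Restr E ?M = \<dots>" .
  have c: "cell {h0, h1} {h3, h4} ?M (Restr E ?M)"
    unfolding cell_def
  proof (rule exI[of _ h0], rule exI[of _ h3], rule exI[of _ "{h1, h5}"], rule exI[of _ ?g], rule exI[of _ h1],
      rule exI[of _ h5], intro conjI)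
    show "Restr E ?M = symcl (Pair h0 ` {h1, h5} \<union> (\<lambda>x. (x, ?g x)) ` {h1, h5} \<union> (\<lambda>x. (?g x, h3)) ` {h1, h5})"
      by (rule R)
  qed (use dist in auto)
  show ?thesis
    unfolding central_def
  proof (intro conjI ballI impI)
    show "?M \<subseteq> D" by (rule D)
    show "hex h0 h1 h2 h3 h4 h5" by (rule H)
    show "cell {h0, h1} {h3, h4} ?M (Restr E ?M)" by (rule c)
    fix x w assume x: "x \<in> ?M - {h0, h1, h3, h4}" and w: "w \<in> D" "(x, w) \<in> E"
    then have "x = h2 \<or> x = h5" by blast
    then show "w \<in> ?M" using att w by metis
  next
    show "(d2, h3) \<notin> E" if "d1 \<in> D - ?M" "d2 \<in> D - ?M" "(h0, d1) \<in> E" "(d1, d2) \<in> E" for d1 d2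
      by (rule n1[OF that])
    show "(d2, h4) \<notin> E" if "d1 \<in> D - ?M" "d2 \<in> D - ?M" "(h1, d1) \<in> E" "(d1, d2) \<in> E" for d1 d2
      by (rule n2[OF that])
  qed simp
qed

lemma central_k3:
  assumes D: "finite D" and H: "hex h0 h1 h2 h3 h4 h5" and hD: "{h0, h1, h2, h3, h4, h5} \<subseteq> D"
    and d: "d1 \<in> D - {h0, h1, h2, h3, h4, h5}" "d2 \<in> D - {h0, h1, h2, h3, h4, h5}"
      "(h0, d1) \<in> E" "(d1, d2) \<in> E" "(d2, h3) \<in> E"
  shows "\<exists>M h1 h2 h4 h5. central D M h0 h1 h2 h3 h4 h5"
proof -
  let ?a = h0 and ?b = h3
  note h = hex_adj[OF H]
  have dist: "distinct [h0, h1, h2, h3, h4, h5]" using H unfolding hex_def by blast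
  have ab: "(h0, h3) \<notin> E" "(h3, h0) \<notin> E" "h0 \<noteq> h3" "h0 \<in> D" "h3 \<in> D" using h dist hD by auto
  define X where "X = {x \<in> D. (h0, x) \<in> E \<and> (\<exists>x'\<in>D. (x, x') \<in> E \<and> (x', h3) \<in> E)}"
  define g where "g = (\<lambda>x. SOME x'. x' \<in> D \<and> (x, x') \<in> E \<and> (x', h3) \<in> E)"
  have g0: "g x \<in> D \<and> (x, g x) \<in> E \<and> (g x, h3) \<in> E" if "x \<in> X" for x
    unfolding g_def by (rule someI_ex) (use that X_def in blast)
  have Xp: "x \<in> D" "(h0, x) \<in> E" "(x, h0) \<in> E" "x \<noteq> h3" "x \<noteq> h0" if "x \<in> X" for x
    using that sym ab irr unfolding X_def by blast+
  have gp: "g x \<in> D" "(x, g x) \<in> E" "(g x, x) \<in> E" "(g x, h3) \<in> E" "(h3, g x) \<in> E" "g x \<noteq> h0" "g x \<noteq> h3" if "x \<in> X" for x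
    using g0[OF that] sym ab irr by blast+
  have gX: "g x \<notin> X" if "x \<in> X" for x
  proof
    assume "g x \<in> X"
    then have "(h0, g x) \<in> E" unfolding X_def by blast
    then show False using no3[of h0 x "g x"] Xp[OF that] gp[OF that] sym by blast
  qed
  have X3: "h1 \<in> X" "h5 \<in> X" "d1 \<in> X" using h hD d unfolding X_def by blast+
  have ne3: "h1 \<noteq> h5" "d1 \<noteq> h1" "d1 \<noteq> h5" using dist d by auto
  have third: "\<exists>y\<in>X. y \<noteq> x \<and> y \<noteq> z" for x z using X3 ne3 by metis
  have ginj: "x = z" if t: "x \<in> X" "z \<in> X" "g x = g z" for x z
  proof -
    have "h0 = g x \<or> x = z" using no4[of h0 x "g x" z] Xp[OF t(1)] Xp[OF t(2)] gp[OF t(1)] gp[OF t(2)] t(3) by metis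
    then show ?thesis using gp(6)[OF t(1)] by blast
  qed
  have Hx: "hex h0 x (g x) h3 (g z) z" if "x \<in> X" "z \<in> X" "x \<noteq> z" for x z
    by (rule hexI) (use that Xp[OF that(1)] Xp[OF that(2)] gp[OF that(1)] gp[OF that(2)] ginj[OF that(1,2)] in blast)+
  have yo: "y \<notin> {h0, x, g x, h3, g z, z}" "g y \<notin> {h0, x, g x, h3, g z, z}"
    if t: "x \<in> X" "z \<in> X" "y \<in> X" "y \<noteq> x" "y \<noteq> z" for x y z
  proof -
    have "y \<noteq> g x" "y \<noteq> g z" "g y \<noteq> x" "g y \<noteq> z" using gX t by metis+
    then show "y \<notin> {h0, x, g x, h3, g z, z}" "g y \<notin> {h0, x, g x, h3, g z, z}"
      using t Xp[OF t(3)] gp[OF t(3)] ginj[OF t(3,1)] ginj[OF t(3,2)] by auto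
  qed
  define J1 where "J1 = {x \<in> X. \<exists>w\<in>D. (x, w) \<in> E \<and> w \<noteq> h0 \<and> w \<noteq> g x}"
  define J2 where "J2 = {x \<in> X. \<exists>w\<in>D. (g x, w) \<in> E \<and> w \<noteq> x \<and> w \<noteq> h3}"
  have JX: "J1 \<subseteq> X" "J2 \<subseteq> X" unfolding J1_def J2_def by blast+
  have w1: "\<exists>w. (w, x) \<in> E \<and> w \<notin> {h0, x, g x, h3, g z, z}" if t: "x \<in> J1" "z \<in> X" "x \<noteq> z" for x z
  proof -
    obtain w where w: "x \<in> X" "(x, w) \<in> E" "w \<noteq> h0" "w \<noteq> g x" using t unfolding J1_def by blast
    have "w \<notin> {h0, x, g x, h3, g z, z}" using w hex_adj[OF Hx[OF w(1) t(2,3)]] irr by blast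
    then show ?thesis using w sym by blast
  qed
  have w2: "\<exists>w. (w, g x) \<in> E \<and> w \<notin> {h0, x, g x, h3, g z, z}" if t: "x \<in> J2" "z \<in> X" "x \<noteq> z" for x z
  proof -
    obtain w where w: "x \<in> X" "(g x, w) \<in> E" "w \<noteq> x" "w \<noteq> h3" using t unfolding J2_def by blast
    have "w \<notin> {h0, x, g x, h3, g z, z}" using w hex_adj[OF Hx[OF w(1) t(2,3)]] irr by blast
    then show ?thesis using w sym by blast
  qed
  have J11: "x = z" if t: "x \<in> J1" "z \<in> J1" for x z
  proof (rule ccontr)
    assume ne: "x \<noteq> z"
    have N: "x \<in> X" "z \<in> X" using t JX by blast+
    obtain y where y: "y \<in> X" "y \<noteq> x" "y \<noteq> z" using third by blast
    obtain w where w: "(w, x) \<in> E" "w \<notin> {h0, x, g x, h3, g z, z}" using w1[OF t(1) N(2) ne] by blast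
    obtain w' where w': "(w', z) \<in> E" "w' \<notin> {h0, z, g z, h3, g x, x}" using w1[OF t(2) N(1) ne[symmetric]] by blast
    have H': "hex z h0 x (g x) h3 (g z)" using hex_rot[OF hex_rot[OF hex_rot[OF hex_rot[OF hex_rot[OF Hx[OF N ne]]]]]] .
    show False
      by (rule h3c[OF H' w'(1) _ Xp(3)[OF y(1)] _ w(1)]) (use w w' yo[OF N y] in blast)+
  qed
  have J22: "x = z" if t: "x \<in> J2" "z \<in> J2" for x z
  proof (rule ccontr)
    assume ne: "x \<noteq> z"
    have N: "x \<in> X" "z \<in> X" using t JX by blast+
    obtain y where y: "y \<in> X" "y \<noteq> x" "y \<noteq> z" using third by blast
    obtain w where w: "(w, g x) \<in> E" "w \<notin> {h0, x, g x, h3, g z, z}" using w2[OF t(1) N(2) ne] by blast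
    obtain w' where w': "(w', g z) \<in> E" "w' \<notin> {h0, z, g z, h3, g x, x}" using w2[OF t(2) N(1) ne[symmetric]] by blast
    have H': "hex (g x) h3 (g z) z h0 x" using hex_rot[OF hex_rot[OF Hx[OF N ne]]] .
    show False
      by (rule h3c[OF H' w(1) _ gp(4)[OF y(1)] _ w'(1)]) (use w w' yo[OF N y] in blast)+
  qed
  have J12: "x \<notin> J2" if t: "x \<in> J1" for x
  proof
    assume x2: "x \<in> J2"
    have N: "x \<in> X" using t JX by blast
    obtain z where z: "z \<in> X" "z \<noteq> x" using third by blast
    obtain y where y: "y \<in> X" "y \<noteq> x" "y \<noteq> z" using third by blast
    obtain w where w: "(w, x) \<in> E" "w \<notin> {h0, x, g x, h3, g z, z}" using w1[OF t z(1)] z(2) by blast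
    obtain w' where w': "(w', g x) \<in> E" "w' \<notin> {h0, x, g x, h3, g z, z}" using w2[OF x2 z(1)] z(2) by blast
    show False
      by (rule h3c[OF Hx[OF N z(1) z(2)[symmetric]] Xp(3)[OF y(1)] yo(1)[OF N z(1) y] w w'])
  qed
  have "\<exists>a1\<in>X. \<exists>x2\<in>X. a1 \<noteq> x2 \<and> (\<forall>x\<in>X. x \<noteq> a1 \<longrightarrow> x \<notin> J1) \<and> (\<forall>x\<in>X. x \<noteq> x2 \<longrightarrow> x \<notin> J2)"
  proof -
    consider i j where "i \<in> J1" "j \<in> J2" | i where "i \<in> J1" "J2 = {}" | j where "J1 = {}" "j \<in> J2" | "J1 = {}" "J2 = {}"
      by blast
    then show ?thesis
    proof cases
      case (1 i j)
      then show ?thesis using J11 J22 J12 JX by (intro bexI[of _ i] bexI[of _ j]) auto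
    next
      case (2 i)
      obtain j where "j \<in> X" "j \<noteq> i" using third by blast
      with 2 show ?thesis using J11 JX by (intro bexI[of _ i] bexI[of _ j]) auto
    next
      case (3 j)
      obtain i where "i \<in> X" "i \<noteq> j" using third by blast
      with 3 show ?thesis using J22 JX by (intro bexI[of _ i] bexI[of _ j]) auto
    next
      case 4
      then show ?thesis using X3 ne3 by (intro bexI[of _ h1] bexI[of _ h5]) auto
    qed
  qed
  then obtain a1 x2 where a1: "a1 \<in> X" "x2 \<in> X" "a1 \<noteq> x2" "\<And>x. x \<in> X \<Longrightarrow> x \<noteq> a1 \<Longrightarrow> x \<notin> J1"
    "\<And>x. x \<in> X \<Longrightarrow> x \<noteq> x2 \<Longrightarrow> x \<notin> J2" by blast
  have Nx: "w = h0 \<or> w = g x" if "x \<in> X" "x \<noteq> a1" "w \<in> D" "(x, w) \<in> E" for x w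
    using a1(4)[of x] that unfolding J1_def by blast
  have Ng: "w = x \<or> w = h3" if "x \<in> X" "x \<noteq> x2" "w \<in> D" "(g x, w) \<in> E" for x w
    using a1(5)[of x] that unfolding J2_def by blast
  define M where "M = {h0, h3} \<union> X \<union> g ` X"
  define C0 where "C0 = Pair h0 ` X \<union> (\<lambda>x. (x, g x)) ` X \<union> (\<lambda>x. (g x, h3)) ` X"
  note HH = Hx[OF a1(1-3)]
  note hh = hex_adj[OF HH]
  have MD: "M \<subseteq> D" unfolding M_def using ab Xp gp by blast
  have CX: "(h0, x) \<in> symcl C0" "(x, h0) \<in> symcl C0" "(x, g x) \<in> symcl C0" "(g x, x) \<in> symcl C0"
    "(g x, h3) \<in> symcl C0" "(h3, g x) \<in> symcl C0" if "x \<in> X" for x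
    using that unfolding symcl_def C0_def by blast+
  have N: "(s, t) \<in> symcl C0" if s: "s \<in> M - {h0, a1, h3, g x2}" and t: "t \<in> D" "(s, t) \<in> E" for s t
  proof -
    consider "s \<in> X" "s \<noteq> a1" | x where "s = g x" "x \<in> X" "x \<noteq> x2" using s unfolding M_def by blast
    then show ?thesis
    proof cases
      case 1
      then show ?thesis using Nx[OF 1 t] CX[OF 1(1)] by blast
    next
      case (2 x)
      then show ?thesis using Ng[OF 2(2,3), of t] t CX[OF 2(2)] by blast
    qed
  qed
  have C0M: "symcl C0 \<subseteq> M \<times> M" unfolding symcl_def C0_def M_def by blast
  have C0E: "symcl C0 \<subseteq> E"
  proof -
    have "C0 \<subseteq> E" unfolding C0_def using Xp gp by blast
    then show ?thesis using sym unfolding symcl_def by blast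
  qed
  have R: "Restr E M = symcl C0"
  proof (intro equalityI subrelI)
    fix s t assume st: "(s, t) \<in> Restr E M"
    consider "s \<in> M - {h0, a1, h3, g x2}" | "t \<in> M - {h0, a1, h3, g x2}" | "s \<in> {h0, a1, h3, g x2}" "t \<in> {h0, a1, h3, g x2}"
      using st by blast
    then show "(s, t) \<in> symcl C0"
    proof cases
      case 1
      then show ?thesis using N st MD by blast
    next
      case 2
      then have "(t, s) \<in> symcl C0" using N[of t s] sym[of s t] st MD by blast
      then show ?thesis by (rule symcl_sym)
    next
      case 3
      then show ?thesis using st hh irr CX[OF a1(1)] CX[OF a1(2)] by blast
    qed
  next
    fix s t assume "(s, t) \<in> symcl C0"
    then show "(s, t) \<in> Restr E M" using C0M C0E by blast
  qed
  have gXX: "X \<inter> g ` X = {}" using gX by blast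
  have c: "cell {h0, a1} {h3, g x2} M (Restr E M)"
    unfolding cell_def
  proof (rule exI[of _ h0], rule exI[of _ h3], rule exI[of _ X], rule exI[of _ g], rule exI[of _ a1], rule exI[of _ x2], intro conjI)
    show "Restr E M = symcl (Pair h0 ` X \<union> (\<lambda>x. (x, g x)) ` X \<union> (\<lambda>x. (g x, h3)) ` X)"
      using R unfolding C0_def .
    show "finite X" using D unfolding X_def by simp
    show "inj_on g X" using ginj by (rule inj_onI)
    show "h0 \<notin> X" "h3 \<notin> X" using Xp by blast+
    show "h0 \<notin> g ` X" "h3 \<notin> g ` X" using gp by blast+
  qed (use a1 gXX ab M_def in auto)
  obtain y where y: "y \<in> X" "y \<noteq> a1" "y \<noteq> x2" using third by blast
  have np2: "False" if e: "e1 \<in> D - M" "e2 \<in> D - M" "(a1, e1) \<in> E" "(e1, e2) \<in> E" "(e2, g x2) \<in> E" for e1 e2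
  proof -
    have h0M: "{h0, a1, h3, g x2, y, g y} \<subseteq> M" unfolding M_def using a1 y by blast
    have eD: "e1 \<in> D" "e2 \<in> D" "e1 \<notin> {h0, a1, h3, g x2, y, g y}" "e2 \<notin> {h0, a1, h3, g x2, y, g y}"
      using e h0M by blast+
    have ye: "(y, w) \<notin> E" "(w, y) \<notin> E" if "w \<in> D" "w \<noteq> h0" "w \<noteq> g y" for w
      using Nx[OF y(1,2) that(1)] that sym by blast+
    have gye: "(g y, w) \<notin> E" "(w, g y) \<notin> E" if "w \<in> D" "w \<noteq> y" "w \<noteq> h3" for w
      using Ng[OF y(1,3) that(1)] that sym by blast+
    have s: "(e1, a1) \<in> E" "(e2, e1) \<in> E" "(g x2, e2) \<in> E" using e sym by blast+
    have "y \<noteq> g y" using gp(2)[OF y(1)] irr by metis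
    then have d8: "distinct [h0, y, g y, h3, g x2, e2, e1, a1]"
      using eD yo[OF a1(1,2) y] HH irr e \<open>y \<noteq> g y\<close> unfolding hex_def by auto
    have "(h0, e1) \<notin> E" using n3[OF hh(1) e(3)] by blast
    have f1: "(h0, e2) \<notin> E" using n4[OF hh(1) e(3,4)] eD by blast
    have f2: "(h3, e1) \<notin> E" using n4[OF _ s(3,2), of h3] hh eD by blast
    have D5: "h0 \<in> D" "a1 \<in> D" "h3 \<in> D" "g x2 \<in> D" using h0M MD by blast+
    show False
    proof (rule no8[of h0 y "g y" h3 "g x2" e2 e1 a1])
      show "distinct [h0, y, g y, h3, g x2, e2, e1, a1]" by (rule d8)
      have "g x2 \<noteq> h0" "g x2 \<noteq> g y" "e1 \<noteq> h0" "e2 \<noteq> h0" "e1 \<noteq> g y" "e2 \<noteq> g y" using d8 by auto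
      then show "(y, g x2) \<notin> E" "(y, e1) \<notin> E" "(y, e2) \<notin> E" using ye D5 eD by blast+
      have "e1 \<noteq> y" "e2 \<noteq> y" "e1 \<noteq> h3" "e2 \<noteq> h3" "a1 \<noteq> y" "a1 \<noteq> h3" using d8 by auto
      then show "(g y, e1) \<notin> E" "(g y, e2) \<notin> E" "(g y, a1) \<notin> E" using gye D5 eD by blast+
      show "(h0, h3) \<notin> E" "(g x2, a1) \<notin> E" "(h0, g x2) \<notin> E" "(h3, a1) \<notin> E" "(h3, g x2) \<in> E" "(a1, h0) \<in> E"
        using hh by blast+
      show "(h0, y) \<in> E" "(y, g y) \<in> E" "(g y, h3) \<in> E" using Xp[OF y(1)] gp[OF y(1)] by blast+
    qed (rule f1 f2 s)+
  qed
  have np1: "False" if e: "e1 \<in> D - M" "e2 \<in> D - M" "(h0, e1) \<in> E" "(e1, e2) \<in> E" "(e2, h3) \<in> E" for e1 e2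
  proof -
    have "e1 \<in> X" unfolding X_def using e by blast
    then show False using e unfolding M_def by blast
  qed
  have "central D M h0 a1 (g a1) h3 (g x2) x2"
    unfolding central_def
  proof (intro conjI ballI impI)
    show "M \<subseteq> D" by (rule MD)
    show "hex h0 a1 (g a1) h3 (g x2) x2" by (rule HH)
    show "{h0, a1, g a1, h3, g x2, x2} \<subseteq> M" unfolding M_def using a1 by blast
    show "cell {h0, a1} {h3, g x2} M (Restr E M)" by (rule c)
    show "w \<in> M" if "x \<in> M - {h0, a1, h3, g x2}" "w \<in> D" "(x, w) \<in> E" for x w
      using N[OF that] C0M by blast
    show "(e2, h3) \<notin> E" if "e1 \<in> D - M" "e2 \<in> D - M" "(h0, e1) \<in> E" "(e1, e2) \<in> E" for e1 e2
      using np1[OF that] by blast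
    show "(e2, g x2) \<notin> E" if "e1 \<in> D - M" "e2 \<in> D - M" "(a1, e1) \<in> E" "(e1, e2) \<in> E" for e1 e2
      using np2[OF that] by blast
  qed
  then show ?thesis by blast
qed

lemma central_exists:
  assumes D: "finite D" and H: "hex h0 h1 h2 h3 h4 h5" and hD: "{h0, h1, h2, h3, h4, h5} \<subseteq> D"
  shows "\<exists>M h0 h1 h2 h3 h4 h5. central D M h0 h1 h2 h3 h4 h5"
proof (rule ccontr)
  assume neg: "\<not> ?thesis"
  have n: "(d2, k3) \<notin> E" if K: "hex k0 k1 k2 k3 k4 k5" "{k0, k1, k2, k3, k4, k5} \<subseteq> D"
     "d1 \<in> D - {k0, k1, k2, k3, k4, k5}" "d2 \<in> D - {k0, k1, k2, k3, k4, k5}" "(k0, d1) \<in> E" "(d1, d2) \<in> E" for k0 k1 k2 k3 k4 k5 d1 d2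
  proof
    assume "(d2, k3) \<in> E"
    then have "\<exists>M k1 k2 k4 k5. central D M k0 k1 k2 k3 k4 k5" by (rule central_k3[OF D K])
    then show False using neg by metis
  qed
  have rot: "{b, c, d, e, f, a} = {a, b, c, d, e, f}" for a b c d e f :: 'v by auto
  have pair: "\<exists>w\<in>D. w \<notin> {k0, k1, k2, k3, k4, k5} \<and> ((k2, w) \<in> E \<or> (k5, w) \<in> E)"
    if K: "hex k0 k1 k2 k3 k4 k5" "{k0, k1, k2, k3, k4, k5} \<subseteq> D" for k0 k1 k2 k3 k4 k5
  proof (rule ccontr)
    assume c: "\<not> ?thesis"
    have "central D {k0, k1, k2, k3, k4, k5} k0 k1 k2 k3 k4 k5"
    proof (rule central_k2[OF K])
      show "\<And>w. w \<in> D \<Longrightarrow> (k2, w) \<in> E \<Longrightarrow> w \<in> {k0, k1, k2, k3, k4, k5}"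
        "\<And>w. w \<in> D \<Longrightarrow> (k5, w) \<in> E \<Longrightarrow> w \<in> {k0, k1, k2, k3, k4, k5}" using c by blast+
      show "\<And>d1 d2. d1 \<in> D - {k0, k1, k2, k3, k4, k5} \<Longrightarrow> d2 \<in> D - {k0, k1, k2, k3, k4, k5} \<Longrightarrow>
        (k0, d1) \<in> E \<Longrightarrow> (d1, d2) \<in> E \<Longrightarrow> (d2, k3) \<notin> E" by (rule n[OF K])
      show "\<And>d1 d2. d1 \<in> D - {k0, k1, k2, k3, k4, k5} \<Longrightarrow> d2 \<in> D - {k0, k1, k2, k3, k4, k5} \<Longrightarrow>
        (k1, d1) \<in> E \<Longrightarrow> (d1, d2) \<in> E \<Longrightarrow> (d2, k4) \<notin> E"
        using n[OF hex_rot[OF K(1)], unfolded rot] K(2) by blast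
    qed
    then show False using neg by blast
  qed
  define A where "A = (\<lambda>x. \<exists>w\<in>D. w \<notin> {h0, h1, h2, h3, h4, h5} \<and> (x, w) \<in> E)"
  note H1 = hex_rot[OF H] note H2 = hex_rot[OF H1] note H3 = hex_rot[OF H2] note H4 = hex_rot[OF H3] note H5 = hex_rot[OF H4]
  have s1: "{h1, h2, h3, h4, h5, h0} = {h0, h1, h2, h3, h4, h5}" "{h2, h3, h4, h5, h0, h1} = {h0, h1, h2, h3, h4, h5}"
    by auto
  have a1: "A h2 \<or> A h5" using pair[OF H hD] unfolding A_def by blast
  have a2: "A h3 \<or> A h0" using pair[OF H1] hD unfolding A_def s1 by blast
  have a3: "A h4 \<or> A h1" using pair[OF H2] hD unfolding A_def s1 by blast
  have c3: "\<not> (A k0 \<and> A k1 \<and> A k2)" and c3n: "\<not> (A k0 \<and> A k2 \<and> A k4)"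
    if K: "hex k0 k1 k2 k3 k4 k5" "{k0, k1, k2, k3, k4, k5} = {h0, h1, h2, h3, h4, h5}" for k0 k1 k2 k3 k4 k5
  proof -
    have A': "\<exists>w. (w, x) \<in> E \<and> w \<notin> {k0, k1, k2, k3, k4, k5}" if "A x" for x
      using that sym unfolding A_def K(2) by blast
    show "\<not> (A k0 \<and> A k1 \<and> A k2)" using A'[of k0] A'[of k1] A'[of k2] h3c[OF K(1)] by blast
    show "\<not> (A k0 \<and> A k2 \<and> A k4)" using A'[of k0] A'[of k2] A'[of k4] h3nc[OF K(1)] by blast
  qed
  have "\<not> (A h0 \<and> A h1 \<and> A h2)" "\<not> (A h1 \<and> A h2 \<and> A h3)" "\<not> (A h2 \<and> A h3 \<and> A h4)" "\<not> (A h3 \<and> A h4 \<and> A h5)"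
    "\<not> (A h4 \<and> A h5 \<and> A h0)" "\<not> (A h5 \<and> A h0 \<and> A h1)" "\<not> (A h0 \<and> A h2 \<and> A h4)" "\<not> (A h1 \<and> A h3 \<and> A h5)"
    by (rule c3[OF H] c3[OF H1] c3[OF H2] c3[OF H3] c3[OF H4] c3[OF H5] c3n[OF H] c3n[OF H1]; auto)+
  then show False using a1 a2 a3 by blast
qed

end

context xfree
begin

lemma close_path:
  assumes K: "\<And>i. i \<le> m \<Longrightarrow> g i \<in> K" and g: "\<And>i. i < m \<Longrightarrow> (g i, g (Suc i)) \<in> E" "inj_on g {..m}"
      "\<And>i j. i \<le> m \<Longrightarrow> j \<le> m \<Longrightarrow> (g i, g j) \<in> E \<Longrightarrow> j = Suc i \<or> i = Suc j"
    and y: "distinct ys" "length ys = k" "2 \<le> k" "set ys \<inter> K = {}"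
      "\<forall>i<k. \<forall>j<k. (ys ! i, ys ! j) \<in> E \<longleftrightarrow> j = Suc i \<or> i = Suc j"
    and att: "\<And>i x. i \<le> m \<Longrightarrow> x \<in> set ys \<Longrightarrow> (g i, x) \<in> E \<longleftrightarrow> i = m \<and> x = ys ! 0 \<or> i = 0 \<and> x = ys ! (k - 1)"
  shows "Suc m + k = 6"
proof (rule close_cycle[OF g y(1,2)])
  show "k \<noteq> 0" "3 \<le> Suc m + k" using y(3) by simp_all
  show "\<And>i j. i < k \<Longrightarrow> j < k \<Longrightarrow> (ys ! i, ys ! j) \<in> E \<longleftrightarrow> j = Suc i \<or> i = Suc j" using y(5) by blast
  show "g i \<noteq> ys ! l" if "i \<le> m" "l < k" for i l
  proof -
    have "ys ! l \<in> set ys" using that y(2) by simp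
    then show ?thesis using K[OF that(1)] y(4) by auto
  qed
  show "(g i, ys ! l) \<in> E \<longleftrightarrow> i = m \<and> l = 0 \<or> i = 0 \<and> l = k - 1" if "i \<le> m" "l < k" for i l
  proof -
    have "ys ! l \<in> set ys" using that y(2) by simp
    moreover have "ys ! l = ys ! 0 \<longleftrightarrow> l = 0" "ys ! l = ys ! (k - 1) \<longleftrightarrow> l = k - 1"
      using that y(1-3) by (auto simp: nth_eq_iff_index_eq)
    ultimately show ?thesis using att[OF that(1)] by simp
  qed
qed

lemma central_separates:
  assumes c: "central D M h0 h1 h2 h3 h4 h5"
    and x: "x \<in> D - M" "(l, x) \<in> E" "l \<in> {h0, h1}" and y: "y \<in> D - M" "(r, y) \<in> E" "r \<in> {h3, h4}"
  shows "y \<notin> comp (D - M) x"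
proof
  assume yx: "y \<in> comp (D - M) x"
  note cc = c[unfolded central_def]
  have H: "hex h0 h1 h2 h3 h4 h5" and hM: "{h0, h1, h2, h3, h4, h5} \<subseteq> M" and MD: "M \<subseteq> D"
    by (rule cc[THEN conjunct2, THEN conjunct1] cc[THEN conjunct2, THEN conjunct2, THEN conjunct1]
      cc[THEN conjunct1])+
  note h = hex_adj[OF H]
  have dist: "distinct [h0, h1, h2, h3, h4, h5]" using H unfolding hex_def by blast
  let ?K = "D - M"
  define A where "A = {x \<in> ?K. (h0, x) \<in> E \<or> (h1, x) \<in> E}"
  define B where "B = {x \<in> ?K. (h3, x) \<in> E \<or> (h4, x) \<in> E}"
  have once: "k' = k" if t: "w \<in> ?K" "k \<in> {h0, h1, h2, h3, h4, h5}" "k' \<in> {h0, h1, h2, h3, h4, h5}" "(w, k) \<in> E" "(w, k') \<in> E" for w k k'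
  proof -
    have w: "w \<notin> {h0, h1, h2, h3, h4, h5}" using t(1) hM by blast
    have nn: "(w, b) \<notin> E \<and> (w, c) \<notin> E \<and> (w, d) \<notin> E \<and> (w, e) \<notin> E \<and> (w, f) \<notin> E"
      if "hex a b c d e f" "(w, a) \<in> E" "w \<notin> {a, b, c, d, e, f}" for a b c d e f
      by (intro conjI attach_once[OF that])
    note H1 = hex_rot[OF H] note H2 = hex_rot[OF H1] note H3 = hex_rot[OF H2] note H4 = hex_rot[OF H3] note H5 = hex_rot[OF H4]
    consider "k = h0" | "k = h1" | "k = h2" | "k = h3" | "k = h4" | "k = h5" using t(2) by blast
    then show ?thesis
    proof cases
      case 1
      then have e: "(w, h0) \<in> E" using t(4) by simp
      have "w \<notin> {h0, h1, h2, h3, h4, h5}" using w by blast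
      from nn[OF H e this] show ?thesis using t(3,5) 1 by blast
    next
      case 2
      then have e: "(w, h1) \<in> E" using t(4) by simp
      have "w \<notin> {h1, h2, h3, h4, h5, h0}" using w by blast
      from nn[OF H1 e this] show ?thesis using t(3,5) 2 by blast
    next
      case 3
      then have e: "(w, h2) \<in> E" using t(4) by simp
      have "w \<notin> {h2, h3, h4, h5, h0, h1}" using w by blast
      from nn[OF H2 e this] show ?thesis using t(3,5) 3 by blast
    next
      case 4
      then have e: "(w, h3) \<in> E" using t(4) by simp
      have "w \<notin> {h3, h4, h5, h0, h1, h2}" using w by blast
      from nn[OF H3 e this] show ?thesis using t(3,5) 4 by blast
    next
      case 5
      then have e: "(w, h4) \<in> E" using t(4) by simp
      have "w \<notin> {h4, h5, h0, h1, h2, h3}" using w by blast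
      from nn[OF H4 e this] show ?thesis using t(3,5) 5 by blast
    next
      case 6
      then have e: "(w, h5) \<in> E" using t(4) by simp
      have "w \<notin> {h5, h0, h1, h2, h3, h4}" using w by blast
      from nn[OF H5 e this] show ?thesis using t(3,5) 6 by blast
    qed
  qed
  have AB: "A \<inter> B = {}"
  proof (rule ccontr)
    assume "A \<inter> B \<noteq> {}"
    then obtain w k k' where "w \<in> ?K" "k \<in> {h0, h1}" "k' \<in> {h3, h4}" "(k, w) \<in> E" "(k', w) \<in> E"
      unfolding A_def B_def by blast
    then have "k' = k" using once[of w k k'] sym by blast
    then show False using \<open>k \<in> _\<close> \<open>k' \<in> _\<close> dist by auto
  qed
  have ABx: "A \<subseteq> ?K" "B \<subseteq> ?K" "x \<in> A" "y \<in> B" "(x, y) \<in> (Restr E ?K)\<^sup>*"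
    using x y yx unfolding A_def B_def comp_def by auto
  obtain m g where m0: "1 \<le> m" "g 0 \<in> A" "g m \<in> B" "\<forall>i\<le>m. g i \<in> ?K"
    "\<forall>i<m. (g i, g (Suc i)) \<in> E" "\<forall>i\<le>m. 0 < i \<longrightarrow> g i \<notin> A"
    "\<forall>i<m. g i \<notin> B" "inj_on g {..m}"
    "\<forall>i\<le>m. \<forall>j\<le>m. (g i, g j) \<in> E \<longrightarrow> j = Suc i \<or> i = Suc j"
    using minpath[OF ABx(1,2) AB ABx(3-5)] by (elim exE conjE) (rule that)
  note m = m0(1-3) m0(4-7)[rule_format] m0(8) m0(9)[rule_format]
  obtain l where l: "l = h0 \<or> l = h1" "(g 0, l) \<in> E" using m(2) sym unfolding A_def by blast
  obtain r where r: "r = h3 \<or> r = h4" "(g m, r) \<in> E" using m(3) sym unfolding B_def by blast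
  have att: "(g i, k) \<in> E \<longleftrightarrow> i = m \<and> k = r \<or> i = 0 \<and> k = l"
    if i: "i \<le> m" and k: "k \<in> {h0, h1, h2, h3, h4, h5}" for i k
  proof
    assume e: "(g i, k) \<in> E"
    have "k \<noteq> h2" "k \<noteq> h5"
      using cc m(4)[OF i] e sym[OF e] hM dist by auto
    then consider "k = h0 \<or> k = h1" | "k = h3 \<or> k = h4" using k by blast
    then show "i = m \<and> k = r \<or> i = 0 \<and> k = l"
    proof cases
      case 1
      then have "g i \<in> A" unfolding A_def using m(4)[OF i] sym[OF e] by blast
      then have "i = 0" using m(6)[OF i] by blast
      then show ?thesis using once[of "g 0" l k] m(4)[of 0] l e k by auto
    next
      case 2
      then have "g i \<in> B" unfolding B_def using m(4)[OF i] sym[OF e] by blast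
      then have "i = m" using m(7)[of i] i by fastforce
      then show ?thesis using once[of "g m" r k] m(4)[of m] r e k by auto
    qed
  next
    assume "i = m \<and> k = r \<or> i = 0 \<and> k = l"
    then show "(g i, k) \<in> E" using l r by blast
  qed
  have hK: "set ys \<inter> ?K = {}" if "set ys \<subseteq> {h0, h1, h2, h3, h4, h5}" for ys using that hM by blast
  have len: "Suc m + length ys = 6"
    if "distinct ys" "2 \<le> length ys" "set ys \<subseteq> {h0, h1, h2, h3, h4, h5}" "ys ! 0 = r" "ys ! (length ys - 1) = l"
      "\<forall>i<length ys. \<forall>j<length ys. (ys ! i, ys ! j) \<in> E \<longleftrightarrow> j = Suc i \<or> i = Suc j" for ys
  proof (rule close_path[of m g ?K ys])
    show "\<And>i. i \<le> m \<Longrightarrow> g i \<in> ?K" by (rule m(4))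
    show "\<And>i. i < m \<Longrightarrow> (g i, g (Suc i)) \<in> E" by (rule m(5))
    show "inj_on g {..m}" by (rule m(8))
    show "\<And>i j. i \<le> m \<Longrightarrow> j \<le> m \<Longrightarrow> (g i, g j) \<in> E \<Longrightarrow> j = Suc i \<or> i = Suc j" by (rule m(9))
    show "distinct ys" "2 \<le> length ys" "set ys \<inter> ?K = {}" by (rule that hK[OF that(3)])+
    show "\<forall>i<length ys. \<forall>j<length ys. ((ys ! i, ys ! j) \<in> E) = (j = Suc i \<or> i = Suc j)" by (rule that)
    show "length ys = length ys" ..
    show "((g i, x) \<in> E) = (i = m \<and> x = ys ! 0 \<or> i = 0 \<and> x = ys ! (length ys - 1))" if "i \<le> m" "x \<in> set ys" for i x
      unfolding \<open>ys ! 0 = r\<close> \<open>ys ! (length ys - 1) = l\<close>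
      by (rule att) (use that \<open>set ys \<subseteq> _\<close> in auto)
  qed
  have five: "\<forall>i<length ys. \<forall>j<length ys. (ys ! i, ys ! j) \<in> E \<longleftrightarrow> j = Suc i \<or> i = Suc j"
    if "ys = [a, b, c, d, e]" "hex a b c d e f" for ys a b c d e f
    unfolding that(1) using hex_adj[OF that(2)] irr
    by (simp add: all_less_numerals nth_Cons')
  have four: "\<forall>i<length ys. \<forall>j<length ys. (ys ! i, ys ! j) \<in> E \<longleftrightarrow> j = Suc i \<or> i = Suc j"
    if "ys = [a, b, c, d]" "hex a b c d e f" for ys a b c d e f
    unfolding that(1) using hex_adj[OF that(2)] irr
    by (simp add: all_less_numerals nth_Cons')
  have three: "\<forall>i<length ys. \<forall>j<length ys. (ys ! i, ys ! j) \<in> E \<longleftrightarrow> j = Suc i \<or> i = Suc j"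
    if "ys = [a, b, c]" "hex a b c d e f" for ys a b c d e f
    unfolding that(1) using hex_adj[OF that(2)] irr
    by (simp add: all_less_numerals nth_Cons')
  note H1 = hex_rot[OF H] note H2 = hex_rot[OF H1] note H3 = hex_rot[OF H2] note H4 = hex_rot[OF H3] note H5 = hex_rot[OF H4]
  note R = hex_rev[OF H] hex_rev[OF H1] hex_rev[OF H2] hex_rev[OF H3] hex_rev[OF H4] hex_rev[OF H5]
  have np: "False" if "m = 1" "(l = h0 \<and> r = h3) \<or> (l = h1 \<and> r = h4)"
  proof -
    have "g 0 \<in> ?K" "g 1 \<in> ?K" "(g 0, g 1) \<in> E" "(l, g 0) \<in> E" "(g 1, r) \<in> E"
      using m(4)[of 0] m(4)[of 1] m(5)[of 0] that(1) l(2) r(2) sym by auto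
    then show False using cc that(2) by blast
  qed
  consider "l = h0" "r = h3" | "l = h1" "r = h4" | "l = h0" "r = h4" | "l = h1" "r = h3" using l r by blast
  then show False
  proof cases
    case 1
    have "Suc m + length [h3, h2, h1, h0] = 6"
      by (rule len[OF _ _ _ _ _ four[OF refl R(4)]]) (use 1 dist in auto)
    then show False using np 1 by simp
  next
    case 2
    have "Suc m + length [h4, h3, h2, h1] = 6"
      by (rule len[OF _ _ _ _ _ four[OF refl R(5)]]) (use 2 dist in auto)
    then show False using np 2 by simp
  next
    case 3
    have "Suc m + length [h4, h5, h0] = 6"
      by (rule len[OF _ _ _ _ _ three[OF refl H4]]) (use 3 dist in auto)
    moreover have "Suc m + length [h4, h3, h2, h1, h0] = 6"
      by (rule len[OF _ _ _ _ _ five[OF refl R(5)]]) (use 3 dist in auto)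
    ultimately show False by simp
  next
    case 4
    have "Suc m + length [h3, h2, h1] = 6"
      by (rule len[OF _ _ _ _ _ three[OF refl R(4)]]) (use 4 dist in auto)
    moreover have "Suc m + length [h3, h4, h5, h0, h1] = 6"
      by (rule len[OF _ _ _ _ _ five[OF refl H3]]) (use 4 dist in auto)
    ultimately show False by simp
  qed
qed

lemma combine_sides:
  assumes cM: "cell L0 R0 M (Restr E M)" and LM: "L0 \<subseteq> M" "R0 \<subseteq> M" and DLM: "DL \<inter> M = L0" "DR \<inter> M = R0"
    and disj: "DL \<inter> DR = {}" and tot: "D = DL \<union> M \<union> DR"
    and clL: "\<And>s t. s \<in> DL \<Longrightarrow> s \<notin> L0 \<Longrightarrow> t \<in> D \<Longrightarrow> (s, t) \<in> E \<Longrightarrow> t \<in> DL"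
    and clR: "\<And>s t. s \<in> DR \<Longrightarrow> s \<notin> R0 \<Longrightarrow> t \<in> D \<Longrightarrow> (s, t) \<in> E \<Longrightarrow> t \<in> DR"
    and s: "strip n L' L0 S C U" "deco S C U V (Restr E V)" "w \<in> L'"
     "good D1 w" "DL = D1 \<union> V" "D1 \<inter> V = {w}" "anti (D1 - {w}) (V - {w})"
    and t: "strip n' R' R0 S2 C2 U2" "deco S2 C2 U2 V2 (Restr E V2)" "w2 \<in> R'"
     "good D2 w2" "DR = D2 \<union> V2" "D2 \<inter> V2 = {w2}" "anti (D2 - {w2}) (V2 - {w2})"
  shows "twosided D"
proof -
  have MD: "M \<subseteq> D" and DLD: "DL \<subseteq> D" "DR \<subseteq> D" unfolding tot by blast+
  have sub: "L0 \<subseteq> S" "S \<subseteq> V" "R0 \<subseteq> S2" "S2 \<subseteq> V2" "V \<subseteq> DL" "V2 \<subseteq> DR"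
  proof -
    show "L0 \<subseteq> S" using strip_sub[OF s(1)] by blast
    show "S \<subseteq> V" using deco_sub[OF s(2)] by blast
    show "R0 \<subseteq> S2" using strip_sub[OF t(1)] by blast
    show "S2 \<subseteq> V2" using deco_sub[OF t(2)] by blast
    show "V \<subseteq> DL" unfolding s(5) by blast
    show "V2 \<subseteq> DR" unfolding t(5) by blast
  qed
  have i1: "S \<inter> M = L0"
  proof
    show "S \<inter> M \<subseteq> L0" using order.trans[OF sub(2,5)] unfolding DLM(1)[symmetric] by blast
  qed (rule Int_greatest[OF sub(1) LM(1)])
  have i2: "(S \<union> M) \<inter> S2 = R0"
  proof -
    have 1: "S \<inter> S2 = {}" using order.trans[OF sub(2,5)] order.trans[OF sub(4,6)] disj by (rule_tac equals0I) blast
    have 2: "M \<inter> S2 \<subseteq> R0" using order.trans[OF sub(4,6)] unfolding DLM(2)[symmetric] by blast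
    have 3: "R0 \<subseteq> M \<inter> S2" using sub(3) LM(2) by (rule_tac Int_greatest)
    show ?thesis unfolding Int_Un_distrib2 1 using 2 3 by (simp add: equalityI)
  qed
  have st: "strip (Suc n + n') L' R' (S \<union> M \<union> S2) (C \<union> Restr E M \<union> C2) (U \<union> R0 \<union> U2)"
    by (rule strip_concat[OF strip_rev[OF t(1)] strip.snoc[OF s(1) cM i1] i2])
  have d1: "deco (S \<union> M) (C \<union> Restr E M) (U \<union> R0) (V \<union> M) (Restr E V \<union> Restr E M)"
  proof (rule deco_union[OF s(2) deco_refl])
    have "V \<inter> M \<subseteq> L0" using sub(5) unfolding DLM(1)[symmetric] by blast
    then show "V \<inter> M \<subseteq> S \<inter> M" unfolding i1 .
  qed
  have d2: "deco (S \<union> M \<union> S2) (C \<union> Restr E M \<union> C2) (U \<union> R0 \<union> U2) (V \<union> M \<union> V2) (Restr E V \<union> Restr E M \<union> Restr E V2)"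
  proof (rule deco_union[OF d1 t(2)])
    have "V \<inter> V2 = {}" using sub(5,6) disj by blast
    moreover have "M \<inter> V2 \<subseteq> R0" using sub(6) unfolding DLM(2)[symmetric] by blast
    ultimately show "(V \<union> M) \<inter> V2 \<subseteq> (S \<union> M) \<inter> S2" unfolding i2 by blast
  qed
  have e1: "Restr E V \<union> Restr E M = Restr E (V \<union> M)"
  proof (rule Restr_Un[symmetric])
    show "anti (V - M) (M - V)"
      unfolding anti_def
    proof (intro ballI notI)
      fix a b assume "a \<in> V - M" "b \<in> M - V" "(a, b) \<in> E"
      then have "b \<in> DL" using clL[of a b] sub LM MD by blast
      then show False using \<open>b \<in> M - V\<close> DLM(1) sub by blast
    qed
  qed
  have e2: "Restr E (V \<union> M) \<union> Restr E V2 = Restr E (V \<union> M \<union> V2)"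
  proof (rule Restr_Un[symmetric])
    show "anti (V \<union> M - V2) (V2 - (V \<union> M))"
      unfolding anti_def
    proof (intro ballI notI)
      fix a b assume ab: "a \<in> V \<union> M - V2" "b \<in> V2 - (V \<union> M)" "(a, b) \<in> E"
      then have "a \<in> DR" using clR[of b a] sym[of a b] sub LM MD DLD by blast
      then show False using ab(1) DLM(2) sub disj by blast
    qed
  qed
  have dec: "deco (S \<union> M \<union> S2) (C \<union> Restr E M \<union> C2) (U \<union> R0 \<union> U2) (V \<union> M \<union> V2) (Restr E (V \<union> M \<union> V2))"
    using d2 unfolding e1 e2 .
  have D1V: "D1 \<inter> (V \<union> M \<union> V2) = {w}"
  proof -
    have LV: "L0 \<subseteq> V" using sub(1,2) by (rule order.trans)
    have D1: "D1 \<subseteq> DL" unfolding s(5) by blast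
    have "D1 \<inter> M \<subseteq> V" using D1 LV unfolding DLM(1)[symmetric] by blast
    then have "D1 \<inter> M \<subseteq> {w}" using s(6) by blast
    moreover have "D1 \<inter> V2 = {}" using D1 sub(6) disj by blast
    ultimately show ?thesis using s(6) by blast
  qed
  have an1: "anti (D1 - {w}) (V \<union> M \<union> V2 - {w})"
    unfolding anti_def
  proof (intro ballI notI)
    fix a b assume ab: "a \<in> D1 - {w}" "b \<in> V \<union> M \<union> V2 - {w}" "(a, b) \<in> E"
    have a: "a \<in> DL" "a \<notin> L0" using ab(1) s(5,6) sub by blast+
    have "b \<in> D" using ab(2) sub DLD MD by blast
    then have "b \<in> DL" by (rule clL[OF a _ ab(3)])
    then have "b \<in> V" using ab(2) DLM(1) disj sub by blast
    then show False using s(7) ab unfolding anti_def by blast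
  qed
  have g: "good (D1 \<union> (V \<union> M \<union> V2)) w2"
    by (rule good.glue_strip[OF s(4) st _ dec s(3) t(3) D1V an1]) simp
  have "D = (D1 \<union> (V \<union> M \<union> V2)) \<union> D2" unfolding tot s(5) t(5) by blast
  moreover have "(D1 \<union> (V \<union> M \<union> V2)) \<inter> D2 = {w2}"
  proof -
    have RV: "R0 \<subseteq> V2" using sub(3,4) by (rule order.trans)
    have D2: "D2 \<subseteq> DR" unfolding t(5) by blast
    have "M \<inter> D2 \<subseteq> V2" using D2 RV unfolding DLM(2)[symmetric] by blast
    then have "M \<inter> D2 \<subseteq> {w2}" using t(6) by blast
    moreover have "D1 \<union> V \<subseteq> DL" unfolding s(5) by blast
    then have "(D1 \<union> V) \<inter> D2 = {}" using D2 disj by blast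
    ultimately show ?thesis using t(6) by blast
  qed
  moreover have "anti (D1 \<union> (V \<union> M \<union> V2) - {w2}) (D2 - {w2})"
    unfolding anti_def
  proof (intro ballI notI)
    fix b a assume ab: "b \<in> D1 \<union> (V \<union> M \<union> V2) - {w2}" "a \<in> D2 - {w2}" "(b, a) \<in> E"
    have a: "a \<in> DR" "a \<notin> R0" using ab(2) t(5,6) sub by blast+
    have "b \<in> D" using ab(1) s(5) sub DLD MD by blast
    then have "b \<in> DR" by (rule clR[OF a _ sym[OF ab(3)]])
    then have "b \<in> V2" using ab(1) s(5) DLM(2) disj sub by blast
    then show False using t(7) ab sym unfolding anti_def by blast
  qed
  ultimately show ?thesis unfolding twosided_def using g t(4) by blast
qed

lemma twosided_hex:
  assumes D: "finite D" "conn D" and c: "central D M h0 h1 h2 h3 h4 h5"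
  shows "twosided D"
proof -
  note cc = c[unfolded central_def]
  have H: "hex h0 h1 h2 h3 h4 h5" and hM: "{h0, h1, h2, h3, h4, h5} \<subseteq> M" and MD: "M \<subseteq> D"
    and cM: "cell {h0, h1} {h3, h4} M (Restr E M)"
    by (rule cc[THEN conjunct2, THEN conjunct1] cc[THEN conjunct2, THEN conjunct2, THEN conjunct1]
      cc[THEN conjunct1] cc[THEN conjunct2, THEN conjunct2, THEN conjunct2, THEN conjunct1])+
  have attM: "w \<in> M" if "x \<in> M" "x \<notin> {h0, h1}" "x \<notin> {h3, h4}" "w \<in> D" "(x, w) \<in> E" for x w
    using cc[THEN conjunct2, THEN conjunct2, THEN conjunct2, THEN conjunct2, THEN conjunct1] that by blast
  note h = hex_adj[OF H]
  have dist: "distinct [h0, h1, h2, h3, h4, h5]" using H unfolding hex_def by blast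
  have dist': "distinct [h5, h4, h3, h2, h1, h0]" using dist by auto
  let ?L = "{h0, h1}" and ?R = "{h3, h4}" and ?K = "D - M"
  define DL where "DL = ?L \<union> {z \<in> ?K. \<exists>x\<in>?K. \<exists>l\<in>?L. (l, x) \<in> E \<and> z \<in> comp ?K x}"
  define DR where "DR = ?R \<union> (?K - DL)"
  have LR: "?L \<inter> ?R = {}" using dist by auto
  have DLD: "DL \<subseteq> D" "DR \<subseteq> D" unfolding DL_def DR_def using hM MD by blast+
  have LM: "?L \<subseteq> M" "?R \<subseteq> M" using hM by blast+
  have DLM: "DL \<inter> M = ?L" "DR \<inter> M = ?R" unfolding DL_def DR_def using LM by blast+
  have disj: "DL \<inter> DR = {}" using LR LM unfolding DR_def DL_def by blast
  have tot: "D = DL \<union> M \<union> DR" unfolding DR_def using MD DLD LM by blast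
  have clL: "t \<in> DL" if s: "s \<in> DL" "s \<notin> ?L" and t: "t \<in> D" "(s, t) \<in> E" for s t
  proof -
    obtain x l where x: "s \<in> ?K" "x \<in> ?K" "l \<in> ?L" "(l, x) \<in> E" "s \<in> comp ?K x" using s unfolding DL_def by blast
    show ?thesis
    proof (cases "t \<in> M")
      case False
      then have "t \<in> comp ?K x" using comp_closed[OF x(5) t(2) x(2)] t(1) by blast
      then show ?thesis unfolding DL_def using x False t by blast
    next
      case True
      have "t \<notin> ?R"
      proof
        assume "t \<in> ?R"
        then show False using central_separates[OF c x(2,4,3) x(1) sym[OF t(2)]] x(5) by blast
      qed
      then have "t \<in> ?L" using attM[OF True, of s] sym[OF t(2)] x(1) by blast
      then show ?thesis unfolding DL_def by blast
    qed
  qed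
  have clR: "t \<in> DR" if s: "s \<in> DR" "s \<notin> ?R" and t: "t \<in> D" "(s, t) \<in> E" for s t
  proof -
    have sK: "s \<in> ?K" "s \<notin> DL" using s unfolding DR_def by blast+
    show ?thesis
    proof (cases "t \<in> M")
      case False
      have "t \<notin> DL"
      proof
        assume "t \<in> DL"
        then show False using clL[of t s] sym[OF t(2)] False LM sK by blast
      qed
      then show ?thesis using False t unfolding DR_def by blast
    next
      case True
      have "t \<notin> ?L"
      proof
        assume "t \<in> ?L"
        then have "s \<in> DL" unfolding DL_def using sK sym[OF t(2)] comp_self by blast
        then show False using sK by blast
      qed
      then have "t \<in> ?R" using attM[OF True, of s] sym[OF t(2)] sK by blast
      then show ?thesis unfolding DR_def by blast
    qed
  qed
  have cL: "conn DL"
  proof (rule conn_gate[OF D(2) DLD(1), of h0 ?L])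
    show "h0 \<in> DL" unfolding DL_def by blast
    show "\<And>x. x \<in> ?L \<Longrightarrow> (x, h0) \<in> (Restr E DL)\<^sup>*" using h unfolding DL_def by auto
    show "\<And>x y. x \<in> DL \<Longrightarrow> y \<in> D - DL \<Longrightarrow> (x, y) \<in> E \<Longrightarrow> x \<in> ?L" using clL by blast
  qed
  have cR: "conn DR"
  proof (rule conn_gate[OF D(2) DLD(2), of h3 ?R])
    show "h3 \<in> DR" unfolding DR_def by blast
    show "\<And>x. x \<in> ?R \<Longrightarrow> (x, h3) \<in> (Restr E DR)\<^sup>*" using h unfolding DR_def by auto
    show "\<And>x y. x \<in> DR \<Longrightarrow> y \<in> D - DR \<Longrightarrow> (x, y) \<in> E \<Longrightarrow> x \<in> ?R" using clR by blast
  qed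
  have hD: "h0 \<in> D" "h1 \<in> D" "h2 \<in> D" "h3 \<in> D" "h4 \<in> D" "h5 \<in> D" using hM MD by blast+
  have nL: "h2 \<notin> DL" "h3 \<notin> DL" "h4 \<notin> DL" "h5 \<notin> DL" 
  proof -
    have "x \<notin> DL" if "x \<in> M" "x \<notin> ?L" for x using DLM(1) that by blast
    then show "h2 \<notin> DL" "h3 \<notin> DL" "h4 \<notin> DL" "h5 \<notin> DL" using hM dist dist' by simp_all
  qed
  have nR: "h0 \<notin> DR" "h1 \<notin> DR" "h2 \<notin> DR" "h5 \<notin> DR" 
  proof -
    have "x \<notin> DR" if "x \<in> M" "x \<notin> ?R" for x using DLM(2) that by blast
    then show "h0 \<notin> DR" "h1 \<notin> DR" "h2 \<notin> DR" "h5 \<notin> DR" using hM dist dist' by simp_all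
  qed
  have HL: "hex h0 h5 h4 h3 h2 h1" by (rule hex_rev[OF H])
  have HR: "hex h3 h2 h1 h0 h5 h4" by (rule hex_rev[OF hex_rot[OF hex_rot[OF hex_rot[OF H]]]])
  have "ctxE DL h0 h1"
    unfolding ctxE_def
  proof (intro conjI exI)
    show "finite DL" using D DLD by (rule_tac finite_subset)
    show "hex h0 h5 h4 h3 h2 h1" by (rule HL)
    show "\<forall>x\<in>DL. ((x, h5) \<in> E \<longrightarrow> x = h0) \<and> (x, h4) \<notin> E \<and> (x, h3) \<notin> E \<and> ((x, h2) \<in> E \<longrightarrow> x = h1)"
    proof
      fix x assume x: "x \<in> DL"
      show "((x, h5) \<in> E \<longrightarrow> x = h0) \<and> (x, h4) \<notin> E \<and> (x, h3) \<notin> E \<and> ((x, h2) \<in> E \<longrightarrow> x = h1)"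
      proof (cases "x \<in> ?L")
        case True
        then show ?thesis using h by blast
      next
        case False
        then show ?thesis using clL[OF x False] hD nL by blast
      qed
    qed
  qed (use cL nL in \<open>auto simp: DL_def\<close>)
  then obtain n where rL: "resE DL h0 h1 n" using claimE by blast
  have "ctxE DR h3 h4"
    unfolding ctxE_def
  proof (intro conjI exI)
    show "finite DR" using D DLD by (rule_tac finite_subset)
    show "hex h3 h2 h1 h0 h5 h4" by (rule HR)
    show "\<forall>x\<in>DR. ((x, h2) \<in> E \<longrightarrow> x = h3) \<and> (x, h1) \<notin> E \<and> (x, h0) \<notin> E \<and> ((x, h5) \<in> E \<longrightarrow> x = h4)"
    proof
      fix x assume x: "x \<in> DR"
      show "((x, h2) \<in> E \<longrightarrow> x = h3) \<and> (x, h1) \<notin> E \<and> (x, h0) \<notin> E \<and> ((x, h5) \<in> E \<longrightarrow> x = h4)"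
      proof (cases "x \<in> ?R")
        case True
        then show ?thesis using h by blast
      next
        case False
        then show ?thesis using clR[OF x False] hD nR by blast
      qed
    qed
  qed (use cR nR in \<open>auto simp: DR_def\<close>)
  then obtain n' where rR: "resE DR h3 h4 n'" using claimE by blast
  obtain L' S C U V D1 w where s: "strip n L' ?L S C U" "deco S C U V (Restr E V)" "w \<in> L'"
     "good D1 w" "DL = D1 \<union> V" "D1 \<inter> V = {w}" "anti (D1 - {w}) (V - {w})"
    using rL unfolding resE_def by blast
  obtain R' S2 C2 U2 V2 D2 w2 where t: "strip n' R' ?R S2 C2 U2" "deco S2 C2 U2 V2 (Restr E V2)" "w2 \<in> R'"
     "good D2 w2" "DR = D2 \<union> V2" "D2 \<inter> V2 = {w2}" "anti (D2 - {w2}) (V2 - {w2})"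
    using rR unfolding resE_def by blast
  show ?thesis
    by (rule combine_sides[OF cM LM DLM disj tot clL clR s t])
qed

theorem twosided:
  assumes "finite D" "conn D" "D \<noteq> {}"
  shows "twosided D"
proof (cases "\<exists>r x a b c y. hex r x a b c y \<and> {r, x, a, b, c, y} \<subseteq> D")
  case True
  then obtain r x a b c y where "hex r x a b c y" "{r, x, a, b, c, y} \<subseteq> D" by (elim exE conjE) (rule that)
  then obtain M h0 h1 h2 h3 h4 h5 where "central D M h0 h1 h2 h3 h4 h5"
    using central_exists[OF assms(1)] by metis
  then show ?thesis by (rule twosided_hex[OF assms(1,2)])
next
  case False
  show ?thesis by (rule twosided_nohex[OF assms]) (use False in blast)
qed

end

section \<open>Trees, distances and lobsters\<close>

abbreviation pgraph :: "'v set \<Rightarrow> 'v rel \<Rightarrow> 'v pair_pre_digraph" where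
  "pgraph V E \<equiv> \<lparr>pverts = V, parcs = E\<rparr>"

lemma pair_graphI:
  assumes "finite V" "E \<subseteq> V \<times> V" "\<And>x y. (x, y) \<in> E \<Longrightarrow> (y, x) \<in> E" "\<And>x. (x, x) \<notin> E"
  shows "pair_graph (pgraph V E)"
proof -
  have "finite E" using assms(1,2) by (auto intro: finite_subset)
  moreover have "symmetric (with_proj (pgraph V E))"
    unfolding symmetric_def using assms(3) by (auto intro: symI)
  ultimately show ?thesis
    using assms by unfold_locales auto
qed

lemma pair_graphD:
  assumes "pair_graph G"
  shows "finite (pverts G)" "parcs G \<subseteq> pverts G \<times> pverts G" "(x, y) \<in> parcs G \<Longrightarrow> (y, x) \<in> parcs G"
    "(x, x) \<notin> parcs G" "pair_wf_digraph G"
proof -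
  interpret pair_graph G by fact
  show "finite (pverts G)" by (rule pair_finite_verts)
  show "parcs G \<subseteq> pverts G \<times> pverts G" using in_arcsD1 in_arcsD2 by auto
  show "(x, y) \<in> parcs G \<Longrightarrow> (y, x) \<in> parcs G" by (rule arcs_symmetric)
  show "(x, x) \<notin> parcs G" using pair_no_loops by fastforce
  show "pair_wf_digraph G" by unfold_locales
qed

lemma connected_iff:
  assumes "pair_graph T"
  shows "connected (with_proj T) \<longleftrightarrow> pverts T \<noteq> {} \<and> (\<forall>u\<in>pverts T. \<forall>v\<in>pverts T. (u, v) \<in> (parcs T)\<^sup>*)"
proof -
  interpret pair_graph T by fact
  have "(\<Union>e\<in>parcs T. {(fst e, snd e), (snd e, fst e)}) = parcs T"
    using arcs_symmetric by auto
  then have "mk_symmetric (with_proj T) = T"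
    unfolding mk_symmetric_def by simp
  then show ?thesis
    unfolding connected_def strongly_connected_def using reachable_conv' by auto
qed

lemma graph_dist_le_2:
  assumes G: "pair_wf_digraph G" and u: "u \<in> pverts G"
  shows "graph_dist G u v \<le> 2 \<longleftrightarrow> u = v \<or> (u, v) \<in> parcs G \<or> (\<exists>z. (u, z) \<in> parcs G \<and> (z, v) \<in> parcs G)"
proof -
  interpret pair_wf_digraph G by fact
  have cost: "awalk_cost (\<lambda>_. 1) p = real (length p)" for p
    by (induction p) (auto simp: awalk_cost_def)
  have d: "graph_dist G u v = (INF p\<in>{p. awalk u p v}. ereal (real (length p)))"
    unfolding graph_dist_def \<mu>_def cost ..
  have le: "graph_dist G u v \<le> ereal (real (length p))" if "awalk u p v" for p
    unfolding d by (rule INF_lower) (use that in simp)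
  show ?thesis
  proof
    assume l: "graph_dist G u v \<le> 2"
    show "u = v \<or> (u, v) \<in> parcs G \<or> (\<exists>z. (u, z) \<in> parcs G \<and> (z, v) \<in> parcs G)"
    proof (rule ccontr)
      assume n: "\<not> ?thesis"
      have "3 \<le> length p" if "awalk u p v" for p
      proof (rule ccontr)
        assume "\<not> 3 \<le> length p"
        then consider "p = []" | e where "p = [e]" | e f where "p = [e, f]"
          by (cases p rule: remdups_adj.cases) (auto simp: Suc_le_eq numeral_3_eq_3)
        then show False
          using n that by cases (auto simp: awalk_def)
      qed
      then have "3 \<le> graph_dist G u v"
        unfolding d by (intro INF_greatest) (auto simp: numeral_eq_ereal)
      then have "(3::ereal) \<le> 2" using l by (rule order.trans)
      then show False by simp
    qed
  next
    assume "u = v \<or> (u, v) \<in> parcs G \<or> (\<exists>z. (u, z) \<in> parcs G \<and> (z, v) \<in> parcs G)"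
    then consider "u = v" | "(u, v) \<in> parcs G" | z where "(u, z) \<in> parcs G" "(z, v) \<in> parcs G" by blast
    then show "graph_dist G u v \<le> 2"
    proof cases
      case 1
      then have "awalk u [] v" using u by (simp add: awalk_def)
      from le[OF this] show ?thesis by (simp add: order.trans)
    next
      case 2
      then have "awalk u [(u, v)] v" using u by (simp add: awalk_def)
      from le[OF this] show ?thesis by (simp add: order.trans)
    next
      case (3 z)
      then have "awalk u [(u, z), (z, v)] v" using u by (simp add: awalk_def)
      from le[OF this] show ?thesis by simp
    qed
  qed
qed

lemma cycle_imp_fun:
  assumes "pre_digraph.cycle (with_proj T) c" "n = length c"
  shows "\<exists>f. inj_on f {..<n} \<and> (\<forall>i<n. (f i, f (Suc i mod n)) \<in> parcs T)"
proof -
  interpret pair_pre_digraph T .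
  obtain u where u: "awalk u c u" "distinct (tl (awalk_verts u c))" "c \<noteq> []"
    using assms(1) unfolding cycle_def by blast
  have cas: "pcas u c u" and sub: "set c \<subseteq> parcs T" using u(1) by (auto simp: awalk_def)
  have n0: "0 < n" using u(3) assms(2) by simp
  have tl: "pcas a es b \<Longrightarrow> pawalk_verts a es = a # map snd es" for a es b
    by (induction es arbitrary: a) auto
  have nxt: "pcas a es b \<Longrightarrow> Suc i < length es \<Longrightarrow> fst (es ! Suc i) = snd (es ! i)" for a es b i
  proof (induction es arbitrary: a i)
    case (Cons e es)
    then show ?case
      by (cases i; cases es) auto
  qed simp
  have fst0: "pcas a es b \<Longrightarrow> es \<noteq> [] \<Longrightarrow> fst (es ! 0) = a \<and> snd (last es) = b" for a es b
  proof (induction es arbitrary: a)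
    case (Cons e es)
    then show ?case by (cases es) auto
  qed simp
  have dist: "distinct (map snd c)" using u(2) tl[OF cas] by simp
  let ?f = "\<lambda>i. snd (c ! i)"
  have "inj_on ?f {..<n}"
    using dist assms(2) by (auto simp: inj_on_def distinct_conv_nth)
  moreover have "(?f i, ?f (Suc i mod n)) \<in> parcs T" if "i < n" for i
  proof -
    have *: "fst (c ! (Suc i mod n)) = snd (c ! i)"
    proof (cases "Suc i < n")
      case True
      then show ?thesis using nxt[OF cas, of i] assms(2) by simp
    next
      case False
      then have "Suc i = n" using that by simp
      then have "i = length c - 1" "Suc i mod n = 0" using assms(2) by auto
      then show ?thesis using fst0[OF cas u(3)] u(3) by (simp add: last_conv_nth)
    qed
    have "c ! (Suc i mod n) \<in> parcs T"
      using sub assms(2) n0 by (metis mod_less_divisor nth_mem subsetD)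
    then show ?thesis using * by (metis prod.collapse)
  qed
  ultimately show ?thesis by blast
qed

lemma cycle_max:
  fixes \<iota> :: "'v \<Rightarrow> nat"
  assumes inj: "inj_on f {..<n}" and n: "3 \<le> n" and e: "\<And>i. i < n \<Longrightarrow> (f i, f (Suc i mod n)) \<in> E"
    and sym: "\<And>x y. (x, y) \<in> E \<Longrightarrow> (y, x) \<in> E"
  shows "\<exists>v x y. v \<in> f ` {..<n} \<and> (v, x) \<in> E \<and> (v, y) \<in> E \<and> x \<noteq> y \<and> \<iota> x \<le> \<iota> v \<and> \<iota> y \<le> \<iota> v \<and>
    x \<in> f ` {..<n} \<and> y \<in> f ` {..<n} \<and> (\<forall>w\<in>f ` {..<n}. \<iota> w \<le> \<iota> v)"
proof -
  let ?A = "(\<lambda>i. \<iota> (f i)) ` {..<n}"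
  have A: "finite ?A" "?A \<noteq> {}" using n lessThan_empty_iff[of n] by auto
  obtain i where i0: "i < n" "\<iota> (f i) = Max ?A" using Max_in[OF A] by fastforce
  have i: "i < n" "\<And>j. j < n \<Longrightarrow> \<iota> (f j) \<le> \<iota> (f i)" unfolding i0(2) using i0(1) A(1) by auto
  define k where "k = (if i = 0 then n - 1 else i - 1)"
  define l where "l = Suc i mod n"
  have kl: "k < n" "l < n" "Suc k mod n = i" "k \<noteq> l"
    using i(1) n unfolding k_def l_def by (auto simp: mod_Suc)
  have "(f k, f i) \<in> E" "(f i, f l) \<in> E" using e[OF kl(1)] e[OF i(1)] kl(3) unfolding l_def by auto
  then have 1: "(f i, f k) \<in> E" "(f i, f l) \<in> E" using sym[of "f k" "f i"] by blast+
  have 2: "f k \<noteq> f l" using inj kl by (auto dest: inj_onD)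
  have 3: "f i \<in> f ` {..<n}" "f k \<in> f ` {..<n}" "f l \<in> f ` {..<n}" using i kl by auto
  have 4: "\<forall>w\<in>f ` {..<n}. \<iota> w \<le> \<iota> (f i)" using i(2) by auto
  show ?thesis
  proof (rule exI[of _ "f i"], rule exI[of _ "f k"], rule exI[of _ "f l"], intro conjI)
    show "(f i, f k) \<in> E" "(f i, f l) \<in> E" by (rule 1)+
    show "f k \<noteq> f l" by (rule 2)
    show "f i \<in> f ` {..<n}" "f k \<in> f ` {..<n}" "f l \<in> f ` {..<n}" by (rule 3)+
    show "\<iota> (f k) \<le> \<iota> (f i)" by (rule i(2)[OF kl(1)])
    show "\<iota> (f l) \<le> \<iota> (f i)" by (rule i(2)[OF kl(2)])
    show "\<forall>w\<in>f ` {..<n}. \<iota> w \<le> \<iota> (f i)" by (rule 4)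
  qed
qed

lemma graph_treeI:
  fixes \<iota> :: "'v \<Rightarrow> nat"
  assumes G: "pair_graph T" and r: "r \<in> pverts T" and c: "\<And>v. v \<in> pverts T \<Longrightarrow> (r, v) \<in> (parcs T)\<^sup>*"
    and \<iota>: "\<And>v x y. (v, x) \<in> parcs T \<Longrightarrow> (v, y) \<in> parcs T \<Longrightarrow> \<iota> x \<le> \<iota> v \<Longrightarrow> \<iota> y \<le> \<iota> v \<Longrightarrow> x = y"
  shows "graph_tree T"
proof -
  have s: "(x, y) \<in> (parcs T)\<^sup>* \<Longrightarrow> (y, x) \<in> (parcs T)\<^sup>*" for x y
    using pair_graphD(3)[OF G] by (metis sym_rtrancl symD symI)
  have "connected (with_proj T)"
    unfolding connected_iff[OF G]
  proof (intro conjI ballI)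
    show "pverts T \<noteq> {}" using r by blast
    show "(u, v) \<in> (parcs T)\<^sup>*" if "u \<in> pverts T" "v \<in> pverts T" for u v
      by (rule rtrancl_trans[OF s[OF c[OF that(1)]] c[OF that(2)]])
  qed
  moreover have "\<not> (\<exists>c. pre_digraph.cycle (with_proj T) c \<and> 3 \<le> length c)"
  proof
    assume "\<exists>c. pre_digraph.cycle (with_proj T) c \<and> 3 \<le> length c"
    then obtain c where c: "pre_digraph.cycle (with_proj T) c" "3 \<le> length c" by blast
    obtain f where f: "inj_on f {..<length c}" "\<And>i. i < length c \<Longrightarrow> (f i, f (Suc i mod length c)) \<in> parcs T"
      using cycle_imp_fun[OF c(1) refl] by blast
    show False using cycle_max[OF f(1) c(2) f(2) pair_graphD(3)[OF G], of \<iota>] \<iota> by blast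
  qed
  ultimately show ?thesis unfolding graph_tree_def using G by blast
qed

lemma star_graph_lobster:
  assumes s: "star_graph V E a" and fin: "finite V"
  shows "lobster (pgraph V E) a a"
proof -
  obtain Y Z par where d: "V = {a} \<union> Y \<union> Z" "a \<notin> Y" "a \<notin> Z" "Y \<inter> Z = {}" "par ` Z \<subseteq> Y"
    "E = symcl (Pair a ` Y \<union> (\<lambda>z. (z, par z)) ` Z)"
    using s unfolding star_graph_def by (elim exE conjE) (rule that)
  have aV: "a \<in> V" using d(1) by blast
  have sub: "E \<subseteq> V \<times> V" unfolding d(6) symcl_def using d(1,5) by blast
  have ir: "(x, x) \<notin> E" for x unfolding d(6) symcl_def using d(2-5) by blast
  have G: "pair_graph (pgraph V E)"
    by (rule pair_graphI[OF fin sub _ ir]) (unfold d(6), rule symcl_sym)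
  have ay: "(a, y) \<in> E" if "y \<in> Y" for y unfolding d(6) symcl_def using that by blast
  have zp: "(par z, z) \<in> E" "(a, par z) \<in> E" if "z \<in> Z" for z
    using ay[of "par z"] that d(5) unfolding d(6) symcl_def by blast+
  define \<iota> :: "'a \<Rightarrow> nat" where "\<iota> = (\<lambda>v. if v = a then 0 else if v \<in> Y then 1 else 2)"
  have up: "(v = a \<and> x \<in> Y) \<or> (v \<in> Y \<and> (x = a \<or> x \<in> Z)) \<or> (v \<in> Z \<and> x = par v)" if "(v, x) \<in> E" for v x
    using that d(5) unfolding d(6) symcl_def by blast
  have tree: "graph_tree (pgraph V E)"
  proof (rule graph_treeI[OF G, of a \<iota>])
    show "a \<in> pverts (pgraph V E)" using aV by simp
    fix v assume "v \<in> pverts (pgraph V E)"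
    then consider "v = a" | "v \<in> Y" | "v \<in> Z" using d(1) by auto
    then show "(a, v) \<in> (parcs (pgraph V E))\<^sup>*"
    proof cases
      case 2
      then show ?thesis using ay by auto
    next
      case 3
      then show ?thesis using zp by (auto intro: rtrancl_trans[OF r_into_rtrancl r_into_rtrancl])
    qed simp
  next
    fix v x y assume "(v, x) \<in> parcs (pgraph V E)" "(v, y) \<in> parcs (pgraph V E)" "\<iota> x \<le> \<iota> v" "\<iota> y \<le> \<iota> v"
    then show "x = y" using up[of v x] up[of v y] d(2-4) unfolding \<iota>_def by (auto split: if_splits)
  qed
  have "lobster_path (pgraph V E) [a]"
    unfolding lobster_path_def
  proof (intro conjI ballI bexI)
    show "vpath [a] (with_proj (pgraph V E))" using aV by (simp add: vpath_def vwalk_def)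
    fix v assume "v \<in> pverts (pgraph V E)"
    then have "v = a \<or> v \<in> Y \<or> v \<in> Z" using d(1) by auto
    then show "graph_dist (pgraph V E) a v \<le> 2"
      using graph_dist_le_2[OF pair_graphD(5)[OF G], of a v] aV ay zp by auto
  qed simp
  moreover have "length [a] \<le> length q" if "lobster_path (pgraph V E) q" for q
    using that by (cases q) (auto simp: lobster_path_def vpath_def vwalk_def)
  ultimately show ?thesis unfolding lobster_def using tree by (intro conjI exI[of _ "[a]"]) auto
qed

definition path6 :: "'v set \<Rightarrow> 'v rel \<Rightarrow> 'v \<Rightarrow> 'v \<Rightarrow> bool" where
  "path6 V E a b \<longleftrightarrow> (\<exists>x y z t. distinct [x, y, a, b, z, t] \<and> V = {x, y, a, b, z, t} \<and>
     E = symcl {(x, y), (y, a), (a, b), (b, z), (z, t)})"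

lemma path6_lobster:
  assumes "path6 V E a b"
  shows "lobster (pgraph V E) a b"
proof -
  obtain x y z t where d: "distinct [x, y, a, b, z, t]" "V = {x, y, a, b, z, t}"
     "E = symcl {(x, y), (y, a), (a, b), (b, z), (z, t)}"
    using assms unfolding path6_def by (elim exE conjE) (rule that)
  have E: "E = {(x, y), (y, x), (y, a), (a, y), (a, b), (b, a), (b, z), (z, b), (z, t), (t, z)}"
    unfolding d(3) symcl_def by auto
  have G: "pair_graph (pgraph V E)"
    by (rule pair_graphI) (use d(1) in \<open>auto simp: d(2) E\<close>)
  define \<iota> :: "'a \<Rightarrow> nat" where
    "\<iota> = (\<lambda>v. if v = x then 0 else if v = y then 1 else if v = a then 2 else if v = b then 3 else if v = z then 4 else 5)"
  have tree: "graph_tree (pgraph V E)"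
  proof (rule graph_treeI[OF G, of a \<iota>])
    have e: "(a, b) \<in> E" "(b, z) \<in> E" "(z, t) \<in> E" "(a, y) \<in> E" "(y, x) \<in> E" unfolding E by auto
    have "(a, z) \<in> E\<^sup>*" using e by (meson rtrancl.rtrancl_into_rtrancl r_into_rtrancl)
    moreover have "(a, t) \<in> E\<^sup>*" using \<open>(a, z) \<in> E\<^sup>*\<close> e by (meson rtrancl.rtrancl_into_rtrancl)
    moreover have "(a, x) \<in> E\<^sup>*" using e by (meson rtrancl.rtrancl_into_rtrancl r_into_rtrancl)
    ultimately show "(a, v) \<in> (parcs (pgraph V E))\<^sup>*" if "v \<in> pverts (pgraph V E)" for v
      using that e by (auto simp: d(2))
    have i: "\<iota> x = 0" "\<iota> y = 1" "\<iota> a = 2" "\<iota> b = 3" "\<iota> z = 4" "\<iota> t = 5"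
      unfolding \<iota>_def using d(1) by auto
    fix v p q assume pq: "(v, p) \<in> parcs (pgraph V E)" "(v, q) \<in> parcs (pgraph V E)" "\<iota> p \<le> \<iota> v" "\<iota> q \<le> \<iota> v"
    have "\<exists>w. \<forall>p. (v, p) \<in> E \<longrightarrow> \<iota> p \<le> \<iota> v \<longrightarrow> p = w"
    proof (cases "v \<in> V")
      case True
      then consider "v = x" | "v = y" | "v = a" | "v = b" | "v = z" | "v = t" unfolding d(2) by blast
      then show ?thesis
      proof cases
        case 1 then show ?thesis using d(1) i unfolding E by (intro exI[of _ x]) auto
      next
        case 2 then show ?thesis using d(1) i unfolding E by (intro exI[of _ x]) auto
      next
        case 3 then show ?thesis using d(1) i unfolding E by (intro exI[of _ y]) auto
      next
        case 4 then show ?thesis using d(1) i unfolding E by (intro exI[of _ a]) auto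
      next
        case 5 then show ?thesis using d(1) i unfolding E by (intro exI[of _ b]) auto
      next
        case 6 then show ?thesis using d(1) i unfolding E by (intro exI[of _ z]) auto
      qed
    next
      case False
      then show ?thesis unfolding E d(2) by auto
    qed
    then show "p = q" using pq by auto
  qed (simp add: d(2))
  note dist = graph_dist_le_2[OF pair_graphD(5)[OF G], unfolded pair_pre_digraph.simps]
  have dx: "w = x \<or> w = y \<or> w = a" if "w \<in> V" "graph_dist (pgraph V E) w x \<le> 2" for w
    using that(2)[unfolded dist[OF that(1)]] d(1) unfolding E by auto
  have dt: "w = t \<or> w = z \<or> w = b" if "w \<in> V" "graph_dist (pgraph V E) w t \<le> 2" for w
    using that(2)[unfolded dist[OF that(1)]] d(1) unfolding E by auto
  have "lobster_path (pgraph V E) [a, b]"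
    unfolding lobster_path_def
  proof (intro conjI ballI)
    show "vpath [a, b] (with_proj (pgraph V E))"
      using d(1) by (auto simp: vpath_def vwalk_def d(2) E)
    fix v assume "v \<in> pverts (pgraph V E)"
    then have "v = x \<or> v = y \<or> v = a \<or> v = b \<or> v = z \<or> v = t" by (auto simp: d(2))
    moreover have ab: "a \<in> V" "b \<in> V" by (auto simp: d(2))
    have e: "(a, y) \<in> E" "(y, x) \<in> E" "(b, z) \<in> E" "(z, t) \<in> E" by (auto simp: E)
    ultimately have "graph_dist (pgraph V E) a v \<le> 2 \<or> graph_dist (pgraph V E) b v \<le> 2"
      unfolding dist[OF ab(1)] dist[OF ab(2)] using e by metis
    then show "\<exists>w\<in>set [a, b]. graph_dist (pgraph V E) w v \<le> 2" by auto
  qed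
  moreover have "length [a, b] \<le> length q" if q: "lobster_path (pgraph V E) q" for q
  proof (rule ccontr)
    assume "\<not> length [a, b] \<le> length q"
    moreover have "q \<noteq> []" using q by (auto simp: lobster_path_def vpath_def vwalk_def)
    ultimately obtain w where w: "q = [w]" by (cases q; cases "tl q") auto
    have "w \<in> V" using q w by (auto simp: lobster_path_def vpath_def vwalk_def)
    moreover have "graph_dist (pgraph V E) w x \<le> 2" "graph_dist (pgraph V E) w t \<le> 2"
      using q w unfolding lobster_path_def by (auto simp: d(2))
    ultimately show False using dx[of w] dt[of w] d(1) by auto
  qed
  ultimately show ?thesis unfolding lobster_def using tree by (intro conjI exI[of _ "[a, b]"]) auto
qed

section \<open>Identification of vertices\<close>

lemma ident_class_self: "p \<in> ident_class R p"
  by (simp add: ident_class_def)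

lemma ident_class_eqI:
  assumes "(p, q) \<in> (R \<union> R\<inverse>)\<^sup>*"
  shows "ident_class R p = ident_class R q"
proof -
  have s: "(x, y) \<in> (R \<union> R\<inverse>)\<^sup>* \<Longrightarrow> (y, x) \<in> (R \<union> R\<inverse>)\<^sup>*" for x y
    by (metis converse_Un converse_converse rtrancl_converseD sup_commute)
  show ?thesis
    unfolding ident_class_def using assms s[OF assms] by (auto intro: rtrancl_trans)
qed

lemma identify_via_map:
  assumes R: "\<And>p q. (p, q) \<in> R \<Longrightarrow> h p = h q"
    and fib: "\<And>p q. p \<in> pverts G \<Longrightarrow> q \<in> pverts G \<Longrightarrow> h p = h q \<Longrightarrow> (p, q) \<in> (R \<union> R\<inverse>)\<^sup>*"
  shows "\<exists>f. inj_on f (pverts (identify G R)) \<and> (\<forall>p. f (ident_class R p) = h p) \<and>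
    map_graph f (identify G R) = map_graph h G"
proof -
  define f where "f = (\<lambda>c. h (SOME p. p \<in> c))"
  have f: "f (ident_class R p) = h p" for p
  proof -
    have "h q = h p" if "(p, q) \<in> (R \<union> R\<inverse>)\<^sup>*" for q
      using that by (induction rule: rtrancl_induct) (use R in auto)
    moreover have "(SOME q. q \<in> ident_class R p) \<in> ident_class R p"
      using ident_class_self by (rule someI)
    ultimately show ?thesis unfolding f_def ident_class_def by blast
  qed
  have "inj_on f (pverts (identify G R))"
  proof (rule inj_onI)
    fix c c' assume c: "c \<in> pverts (identify G R)" "c' \<in> pverts (identify G R)" "f c = f c'"
    then obtain p q where pq: "p \<in> pverts G" "q \<in> pverts G" "c = ident_class R p" "c' = ident_class R q"
      unfolding identify_def by auto
    then have "h p = h q" using c(3) f by simp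
    from ident_class_eqI[OF fib[OF pq(1,2) this]] show "c = c'" unfolding pq .
  qed
  moreover have "map_graph f (identify G R) = map_graph h G"
    unfolding identify_def map_graph_def using f by (simp add: image_image map_prod_def case_prod_unfold)
  ultimately show ?thesis using f by blast
qed

section \<open>Strips with pendant vertices are hexagonal caterpillars\<close>

lemma C6k_simps:
  "pverts (C6k k) = {PA, PB} \<union> QA ` {1..k} \<union> QB ` {1..k}"
  "parcs (C6k k) = symcl (\<Union>j\<in>{1..k}. {(PA, QA j), (QA j, QB j), (QB j, PB)})"
  by (simp_all add: C6k_def undirected_def symcl_def)

lemma map_prod_symcl: "map_prod c c ` symcl A = symcl (map_prod c c ` A)"
  by (auto simp: symcl_def image_iff)

lemma cell_rep:
  assumes "cell L R M C"
  shows "\<exists>k c. 2 \<le> k \<and> inj_on c (pverts (C6k k)) \<and> c ` pverts (C6k k) = M \<and> map_prod c c ` parcs (C6k k) = C \<and>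
    L = {c PA, c (QA 1)} \<and> R = {c PB, c (QB 2)}"
proof -
  obtain a b X g x1 x2 where m: "finite X" "x1 \<in> X" "x2 \<in> X" "x1 \<noteq> x2" "inj_on g X"
     "a \<noteq> b" "a \<notin> X" "b \<notin> X" "a \<notin> g ` X" "b \<notin> g ` X" "X \<inter> g ` X = {}"
     "L = {a, x1}" "R = {b, g x2}" "M = {a, b} \<union> X \<union> g ` X"
     "C = symcl (Pair a ` X \<union> (\<lambda>x. (x, g x)) ` X \<union> (\<lambda>x. (g x, b)) ` X)"
    using assms unfolding cell_def
    apply (elim exE conjE)
    subgoal for a b X g x1 x2 by (rule that[of X x1 x2 g a b])
    done
  define k where "k = card X"
  have "card {x1, x2} \<le> card X" by (rule card_mono) (use m in auto)
  then have k2: "2 \<le> k" unfolding k_def using m(4) by simp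
  have "card (X - {x1, x2}) = k - 2" unfolding k_def using m(1-4) by (simp add: card_Diff_subset)
  then have "card {3..k} = card (X - {x1, x2})" by simp
  then obtain e0 where e0: "bij_betw e0 {3..k} (X - {x1, x2})"
    using finite_same_card_bij[of "{3..k}" "X - {x1, x2}"] m(1) by auto
  define e where "e = (\<lambda>j. if j = 1 then x1 else if j = 2 then x2 else e0 j)"
  have s: "{1..k} = insert 1 (insert 2 {3..k})" using k2 by auto
  have e0e: "e j = e0 j" if "j \<in> {3..k}" for j using that unfolding e_def by auto
  have im: "e ` {1..k} = X"
  proof -
    have e3: "e ` {3..k} = X - {x1, x2}" using e0 e0e unfolding bij_betw_def by (metis image_cong)
    have "e 1 = x1" "e 2 = x2" unfolding e_def by simp_all
    then have "e ` {1..k} = insert x1 (insert x2 (X - {x1, x2}))" unfolding s image_insert e3 by simp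
    also have "\<dots> = X" using m(2,3) by auto
    finally show ?thesis .
  qed
  have ie: "inj_on e {1..k}"
    by (rule eq_card_imp_inj_on) (simp, simp only: im, simp add: k_def)
  define c where "c = (\<lambda>v. case v of PA \<Rightarrow> a | PB \<Rightarrow> b | QA j \<Rightarrow> e j | QB j \<Rightarrow> g (e j))"
  have cs: "c PA = a" "c PB = b" "c (QA j) = e j" "c (QB j) = g (e j)" for j unfolding c_def by simp_all
  have eX: "e j \<in> X" if "j \<in> {1..k}" for j using im that by blast
  have cM: "c ` pverts (C6k k) = M"
    unfolding C6k_simps m(14) image_Un image_image by (simp add: cs im[symmetric] image_image)
  have "map_prod c c ` (\<Union>j\<in>{1..k}. {(PA, QA j), (QA j, QB j), (QB j, PB)}) =
      Pair a ` e ` {1..k} \<union> (\<lambda>x. (x, g x)) ` e ` {1..k} \<union> (\<lambda>x. (g x, b)) ` e ` {1..k}"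
    by (auto simp: image_UN cs)
  then have cC: "map_prod c c ` parcs (C6k k) = C"
    unfolding C6k_simps m(15) map_prod_symcl im by simp
  have "inj_on c (pverts (C6k k))"
  proof (rule inj_on_inverseI)
    let ?r = "\<lambda>v. if v = a then PA else if v = b then PB else if v \<in> X then QA (inv_into {1..k} e v)
      else QB (inv_into {1..k} e (inv_into X g v))"
    fix p assume p: "p \<in> pverts (C6k k)"
    show "?r (c p) = p"
    proof (cases p)
      case PA
      then show ?thesis by (simp add: cs)
    next
      case PB
      then show ?thesis using m(6) by (simp add: cs)
    next
      case (QA j)
      then have j: "j \<in> {1..k}" using p by (auto simp: C6k_simps)
      have "e j \<noteq> a" "e j \<noteq> b" using eX[OF j] m(7,8) by auto
      then show ?thesis using eX[OF j] inv_into_f_f[OF ie j] by (simp add: cs QA)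
    next
      case (QB j)
      then have j: "j \<in> {1..k}" using p by (auto simp: C6k_simps)
      have "g (e j) \<noteq> a" "g (e j) \<noteq> b" "g (e j) \<notin> X" using eX[OF j] m(9-11) by blast+
      then show ?thesis using inv_into_f_f[OF m(5) eX[OF j]] inv_into_f_f[OF ie j] by (simp add: cs QB)
    qed
  qed
  then show ?thesis using k2 cM cC m(12,13) by (intro exI[of _ k] exI[of _ c]) (simp add: cs e_def)
qed

definition strip_rep :: "nat \<Rightarrow> (nat \<Rightarrow> nat) \<Rightarrow> (nat \<Rightarrow> int) \<Rightarrow> (nat \<times> hex_vertex \<Rightarrow> 'v) \<Rightarrow>
    'v set \<Rightarrow> 'v set \<Rightarrow> 'v set \<Rightarrow> 'v rel \<Rightarrow> 'v set \<Rightarrow> bool" where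
  "strip_rep n k d h L R S C U \<longleftrightarrow> strip_params n k d \<and>
     (\<Union>i\<in>{1..n}. (\<lambda>x. h (i, x)) ` pverts (C6k (k i))) = S \<and>
     (\<Union>i\<in>{1..n}. map_prod (\<lambda>x. h (i, x)) (\<lambda>x. h (i, x)) ` parcs (C6k (k i))) = C \<and>
     (\<forall>(p, q)\<in>strip_gluing n d. h p = h q) \<and>
     (\<forall>i\<in>{1..n}. \<forall>j\<in>{1..n}. \<forall>x\<in>pverts (C6k (k i)). \<forall>y\<in>pverts (C6k (k j)). h (i, x) = h (j, y) \<longrightarrow>
        (i, x) = (j, y) \<or> ((i, x), (j, y)) \<in> strip_gluing n d \<or> ((j, y), (i, x)) \<in> strip_gluing n d) \<and>
     L = {h (1, PA), h (1, QA 1)} \<and> R = {h (n, PB), h (n, QB 2)} \<and>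
     U = {h (i, x) | i x. i \<in> {1..n} \<and> x \<in> {PA, PB, QA 1, QB 2}}"

lemma strip_repD:
  assumes "strip_rep n k d h L R S C U"
  shows "strip_params n k d"
    "(\<Union>i\<in>{1..n}. (\<lambda>x. h (i, x)) ` pverts (C6k (k i))) = S"
    "(\<Union>i\<in>{1..n}. map_prod (\<lambda>x. h (i, x)) (\<lambda>x. h (i, x)) ` parcs (C6k (k i))) = C"
    "\<forall>(p, q)\<in>strip_gluing n d. h p = h q"
    "\<forall>i\<in>{1..n}. \<forall>j\<in>{1..n}. \<forall>x\<in>pverts (C6k (k i)). \<forall>y\<in>pverts (C6k (k j)). h (i, x) = h (j, y) \<longrightarrow>
        (i, x) = (j, y) \<or> ((i, x), (j, y)) \<in> strip_gluing n d \<or> ((j, y), (i, x)) \<in> strip_gluing n d"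
    "L = {h (1, PA), h (1, QA 1)}" "R = {h (n, PB), h (n, QB 2)}"
    "U = {h (i, x) | i x. i \<in> {1..n} \<and> x \<in> {PA, PB, QA 1, QB 2}}"
  using assms unfolding strip_rep_def by - (elim conjE, assumption)+

lemma strip_gluing_Suc:
  "1 \<le> n \<Longrightarrow> strip_gluing (Suc n) d = strip_gluing n d \<union>
    (if d n = 1 then {((n, QB 2), (Suc n, PA)), ((n, PB), (Suc n, QA 1))}
     else {((n, QB 2), (Suc n, QA 1)), ((n, PB), (Suc n, PA))})"
  unfolding strip_gluing_def atLeastLessThanSuc by auto

lemma strip_gluing_cong: "(\<And>i. i < n \<Longrightarrow> d i = d' i) \<Longrightarrow> strip_gluing n d = strip_gluing n d'"
  unfolding strip_gluing_def by auto

lemma strip_gluing_shape: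
  "((i, x), (j, y)) \<in> strip_gluing n d \<Longrightarrow> j = Suc i \<and> i < n \<and> x \<in> {PB, QB 2} \<and> y \<in> {PA, QA 1}"
  unfolding strip_gluing_def by (auto split: if_splits)

lemma strip_rep_exists:
  assumes "strip n L R S C U" "1 \<le> n"
  shows "\<exists>k d h. strip_rep n k d h L R S C U"
  using assms
proof (induction rule: strip.induct)
  case (base x y)
  then show ?case by simp
next
  case (snoc n L R S C U R' M C')
  obtain kk c where c: "2 \<le> kk" "inj_on c (pverts (C6k kk))" "c ` pverts (C6k kk) = M" "map_prod c c ` parcs (C6k kk) = C'"
    "R = {c PA, c (QA 1)}" "R' = {c PB, c (QB 2)}"
    using cell_rep[OF snoc(2)] by (elim exE conjE) (rule that)
  have mem: "PA \<in> pverts (C6k kk)" "PB \<in> pverts (C6k kk)" "QA 1 \<in> pverts (C6k kk)" "QB 2 \<in> pverts (C6k kk)"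
    using c(1) by (auto simp: C6k_simps)
  show ?case
  proof (cases "n = 0")
    case True
    obtain x y where e: "L = {x, y}" "R = {x, y}" "S = {x, y}" "C = {(x, y), (y, x)}" "U = {x, y}"
      using snoc(1) True by (cases rule: strip.cases) auto
    have xy: "(x, y) \<in> C'" "(y, x) \<in> C'" "{x, y} \<subseteq> M"
    proof -
      obtain u v where "R = {u, v}" "u \<noteq> v" "(u, v) \<in> C'" "(v, u) \<in> C'"
        by (rule strip_cell_edge[OF snoc(2)])
      then show "(x, y) \<in> C'" "(y, x) \<in> C'" using e(2) by (auto simp: doubleton_eq_iff)
      show "{x, y} \<subseteq> M" using cell_sub[OF snoc(2)] e(2) by blast
    qed
    have "strip_gluing 1 (\<lambda>_. 1) = {}" by (simp add: strip_gluing_def)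
    moreover have "U \<union> R' = {c x | x. x \<in> {PA, PB, QA 1, QB 2}}" using e c(5,6) by auto
    moreover have "S \<union> M = M" "C \<union> C' = C'" using e xy by auto
    moreover have "L = {c PA, c (QA 1)}" using e c(5) by simp
    ultimately have "strip_rep (Suc n) (\<lambda>_. kk) (\<lambda>_. 1) (\<lambda>p. c (snd p)) L R' (S \<union> M) (C \<union> C') (U \<union> R')"
      unfolding strip_rep_def True using c by (auto simp: strip_params_def inj_on_def)
    then show ?thesis by blast
  next
    case False
    then have n1: "1 \<le> n" by simp
    obtain k d h where "strip_rep n k d h L R S C U" using snoc(4)[OF n1] by blast
    note r = strip_repD[OF this]
    note p = r(1) and S = r(2) and C = r(3) and LRU = r(6-8)
    have gl: "h p = h q" if "(p, q) \<in> strip_gluing n d" for p q using bspec[OF r(4) that] by simp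
    have inj: "(i, x) = (j, y) \<or> ((i, x), (j, y)) \<in> strip_gluing n d \<or> ((j, y), (i, x)) \<in> strip_gluing n d"
      if "i \<in> {1..n}" "j \<in> {1..n}" "x \<in> pverts (C6k (k i))" "y \<in> pverts (C6k (k j))" "h (i, x) = h (j, y)" for i j x y
      by (rule r(5)[rule_format, OF that])
    have kn: "2 \<le> k n" using p n1 unfolding strip_params_def by auto
    have memn: "PB \<in> pverts (C6k (k n))" "QB 2 \<in> pverts (C6k (k n))" using kn by (auto simp: C6k_simps)
    have last: "p = n \<and> z = x" if "p \<in> {1..n}" "x \<in> pverts (C6k (k p))" "z \<in> {PB, QB 2}" "h (p, x) = h (n, z)" for p x z
      using inj[of p n x z] that n1 memn strip_gluing_shape[of p x n z n d] strip_gluing_shape[of n z p x n d] by auto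
    define d' where "d' = d(n := if c PA = h (n, QB 2) then 1 else - 1)"
    define k' where "k' = k(Suc n := kk)"
    define h' where "h' = (\<lambda>p. if fst p = Suc n then c (snd p) else h p)"
    have hh: "h' (Suc n, x) = c x" "i \<in> {1..n} \<Longrightarrow> h' (i, x) = h (i, x)" for i x unfolding h'_def by auto
    have kk': "k' (Suc n) = kk" "i \<in> {1..n} \<Longrightarrow> k' i = k i" for i unfolding k'_def by auto
    have ne: "h (n, PB) \<noteq> h (n, QB 2)" using last[of n PB "QB 2"] memn n1 by auto
    have cne: "c PA \<noteq> c (QA 1)" using inj_onD[OF c(2) _ mem(1,3)] by blast
    have eqR: "{c PA, c (QA 1)} = {h (n, PB), h (n, QB 2)}" using c(5) LRU(2) by simp
    have glue_eq: "(c PA = h (n, QB 2) \<and> c (QA 1) = h (n, PB) \<and> d' n = 1) \<or>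
        (c PA = h (n, PB) \<and> c (QA 1) = h (n, QB 2) \<and> d' n = - 1)"
      using eqR ne cne unfolding d'_def by (auto simp: doubleton_eq_iff)
    have "strip_gluing n d' = strip_gluing n d" by (rule strip_gluing_cong) (simp add: d'_def)
    then have G: "strip_gluing (Suc n) d' = strip_gluing n d \<union>
      (if d' n = 1 then {((n, QB 2), (Suc n, PA)), ((n, PB), (Suc n, QA 1))}
       else {((n, QB 2), (Suc n, QA 1)), ((n, PB), (Suc n, PA))})"
      using strip_gluing_Suc[OF n1] by simp
    have nin: "n \<in> {1..n}" using n1 by simp
    have ins: "{1..Suc n} = insert (Suc n) {1..n}" by auto
    have cross: "((i, x), (Suc n, y)) \<in> strip_gluing (Suc n) d'"
      if i: "i \<in> {1..n}" "x \<in> pverts (C6k (k i))" "y \<in> pverts (C6k kk)" "h (i, x) = c y" for i x y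
    proof -
      have "h (i, x) \<in> S" "c y \<in> M" using i S c(3) by blast+
      then have "c y \<in> R" using i(4) snoc(3) by auto
      then have yc: "c y = c PA \<or> c y = c (QA 1)" unfolding c(5) by blast
      have y: "y = PA \<or> y = QA 1" using yc inj_onD[OF c(2) _ i(3) mem(1)] inj_onD[OF c(2) _ i(3) mem(3)] by blast
      have "c y = h (n, PB) \<or> c y = h (n, QB 2)" using yc eqR by blast
      then have "i = n \<and> (x = PB \<or> x = QB 2)" using last[of i x PB] last[of i x "QB 2"] i by auto
      then show ?thesis unfolding G using glue_eq y i(4) ne cne by auto
    qed
    have "strip_rep (Suc n) k' d' h' L R' (S \<union> M) (C \<union> C') (U \<union> R')"
      unfolding strip_rep_def
    proof (intro conjI)
      show "strip_params (Suc n) k' d'"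
        using p c(1) unfolding strip_params_def k'_def d'_def by (auto simp: less_Suc_eq)
      show "(\<Union>i\<in>{1..Suc n}. (\<lambda>x. h' (i, x)) ` pverts (C6k (k' i))) = S \<union> M"
        unfolding ins S[symmetric] c(3)[symmetric] using hh kk' by (auto simp: image_iff)
      show "(\<Union>i\<in>{1..Suc n}. map_prod (\<lambda>x. h' (i, x)) (\<lambda>x. h' (i, x)) ` parcs (C6k (k' i))) = C \<union> C'"
      proof -
        have "(\<Union>i\<in>{1..n}. map_prod (\<lambda>x. h' (i, x)) (\<lambda>x. h' (i, x)) ` parcs (C6k (k' i))) = C"
          unfolding C[symmetric] using hh kk' by (intro SUP_cong) auto
        moreover have "map_prod (\<lambda>x. h' (Suc n, x)) (\<lambda>x. h' (Suc n, x)) ` parcs (C6k (k' (Suc n))) = C'"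
          using c(4) unfolding hh kk' .
        ultimately show ?thesis unfolding ins by auto
      qed
      show "\<forall>(p, q)\<in>strip_gluing (Suc n) d'. h' p = h' q"
      proof (intro ballI, clarify)
        fix i x j y assume e: "((i, x), (j, y)) \<in> strip_gluing (Suc n) d'"
        show "h' (i, x) = h' (j, y)"
        proof (cases "((i, x), (j, y)) \<in> strip_gluing n d")
          case True
          then show ?thesis using gl[OF True] strip_gluing_shape[OF True] unfolding h'_def by auto
        next
          case False
          then show ?thesis using e glue_eq unfolding G h'_def by (auto split: if_splits)
        qed
      qed
      show "\<forall>i\<in>{1..Suc n}. \<forall>j\<in>{1..Suc n}. \<forall>x\<in>pverts (C6k (k' i)). \<forall>y\<in>pverts (C6k (k' j)). h' (i, x) = h' (j, y) \<longrightarrow>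
        (i, x) = (j, y) \<or> ((i, x), (j, y)) \<in> strip_gluing (Suc n) d' \<or> ((j, y), (i, x)) \<in> strip_gluing (Suc n) d'"
      proof (intro ballI impI)
        fix i j x y assume a: "i \<in> {1..Suc n}" "j \<in> {1..Suc n}" "x \<in> pverts (C6k (k' i))" "y \<in> pverts (C6k (k' j))"
          "h' (i, x) = h' (j, y)"
        consider "i \<in> {1..n}" "j \<in> {1..n}" | "i \<in> {1..n}" "j = Suc n" | "i = Suc n" "j \<in> {1..n}" | "i = Suc n" "j = Suc n"
          using a(1,2) unfolding ins by blast
        then show "(i, x) = (j, y) \<or> ((i, x), (j, y)) \<in> strip_gluing (Suc n) d' \<or> ((j, y), (i, x)) \<in> strip_gluing (Suc n) d'"
        proof cases
          case 1
          then show ?thesis using inj[of i j x y] a(3-5) hh kk' unfolding G by auto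
        next
          case 2
          then show ?thesis using cross[of i x y] a(3-5) hh kk' by auto
        next
          case 3
          then show ?thesis using cross[of j y x] a(3-5) hh kk' by auto
        next
          case 4
          then show ?thesis using a(3-5) hh kk' inj_onD[OF c(2), of x y] by auto
        qed
      qed
      show "L = {h' (1, PA), h' (1, QA 1)}" using LRU(1) hh n1 by auto
      show "R' = {h' (Suc n, PB), h' (Suc n, QB 2)}" using c(6) hh by auto
      show "U \<union> R' = {h' (i, x) | i x. i \<in> {1..Suc n} \<and> x \<in> {PA, PB, QA 1, QB 2}}" (is "_ = ?W")
      proof
        show "U \<union> R' \<subseteq> ?W"
        proof
          fix v assume "v \<in> U \<union> R'"
          then consider i x where "v = h (i, x)" "i \<in> {1..n}" "x \<in> {PA, PB, QA 1, QB 2}" | "v = c PB" | "v = c (QB 2)"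
            unfolding LRU(3) c(6) by blast
          then show "v \<in> ?W"
          proof cases
            case (1 i x)
            then have "v = h' (i, x)" "i \<in> {1..Suc n}" using hh by auto
            then show ?thesis using 1(3) by (intro CollectI exI[of _ i] exI[of _ x]) simp
          next
            case 2
            then show ?thesis using hh(1)[of PB] by (intro CollectI exI[of _ "Suc n"] exI[of _ PB]) simp
          next
            case 3
            then show ?thesis using hh(1)[of "QB 2"] by (intro CollectI exI[of _ "Suc n"] exI[of _ "QB 2"]) simp
          qed
        qed
        show "?W \<subseteq> U \<union> R'"
        proof
          fix v assume "v \<in> ?W"
          then obtain i x where v: "v = h' (i, x)" "i \<in> {1..Suc n}" "x \<in> {PA, PB, QA 1, QB 2}" by blast
          show "v \<in> U \<union> R'"
          proof (cases "i = Suc n")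
            case False
            then have "v = h (i, x)" "i \<in> {1..n}" using v hh by auto
            then show ?thesis unfolding LRU(3) using v(3) by blast
          next
            case True
            have "R \<subseteq> U" unfolding LRU using nin by blast
            then have "c PA \<in> U" "c (QA 1) \<in> U" using c(5) by auto
            then show ?thesis using v True hh c(6) by auto
          qed
        qed
      qed
    qed
    then show ?thesis by blast
  qed
qed

lemma decorated_pendants:
  assumes "finite P" "P \<inter> S = {}" "par ` P \<subseteq> U"
  shows "decorated (pgraph S C) U a b (pgraph (S \<union> P) (C \<union> symcl ((\<lambda>p. (p, par p)) ` P)))"
  using assms
proof (induction P rule: finite_induct)
  case empty
  then show ?case using decorated.base by (simp add: symcl_def)
next
  case (insert p P)
  let ?G = "pgraph (S \<union> P) (C \<union> symcl ((\<lambda>p. (p, par p)) ` P))"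
  have "decorated (pgraph S C) U a b ?G" using insert by auto
  then have "decorated (pgraph S C) U a b \<lparr>pverts = insert p (pverts ?G), parcs = parcs ?G \<union> {(par p, p), (p, par p)}\<rparr>"
    by (rule decorated.pendant) (use insert in auto)
  moreover have "insert p (pverts ?G) = S \<union> insert p P" by simp
  moreover have "parcs ?G \<union> {(par p, p), (p, par p)} = C \<union> symcl ((\<lambda>p. (p, par p)) ` insert p P)"
    by (auto simp: symcl_def)
  ultimately show ?case by simp
qed

lemma strip_hexagonal_caterpillar:
  assumes st: "strip n L R S C U" "1 \<le> n" and dec: "deco S C U V W" and fin: "finite V" and ab: "a \<in> L" "b \<in> R"
  shows "hexagonal_caterpillar (pgraph V W) a b"
proof -
  obtain k d h where "strip_rep n k d h L R S C U" using strip_rep_exists[OF st] by blast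
  note r = strip_repD[OF this]
  let ?D = "disjoint_union {1..n} (\<lambda>i. C6k (k i))"
  note p = r(1) and S = r(2) and C = r(3) and LRU = r(6-8)
  have gl: "h p = h q" if "(p, q) \<in> strip_gluing n d" for p q using bspec[OF r(4) that] by simp
  have inj: "(i, x) = (j, y) \<or> ((i, x), (j, y)) \<in> strip_gluing n d \<or> ((j, y), (i, x)) \<in> strip_gluing n d"
    if "i \<in> {1..n}" "j \<in> {1..n}" "x \<in> pverts (C6k (k i))" "y \<in> pverts (C6k (k j))" "h (i, x) = h (j, y)" for i j x y
    by (rule r(5)[rule_format, OF that])
  have fib: "(p, q) \<in> (strip_gluing n d \<union> (strip_gluing n d)\<inverse>)\<^sup>*"
    if "p \<in> pverts ?D" "q \<in> pverts ?D" "h p = h q" for p q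
    using inj[of "fst p" "fst q" "snd p" "snd q"] that unfolding disjoint_union_def by auto
  obtain f where f: "inj_on f (pverts (hexagonal_strip n k d))" "\<And>p. f (ident_class (strip_gluing n d) p) = h p"
    "map_graph f (hexagonal_strip n k d) = map_graph h ?D"
    using identify_via_map[of "strip_gluing n d" h ?D, OF gl fib] unfolding hexagonal_strip_def by blast
  have fv: "f (strip_vertex n d i x) = h (i, x)" for i x unfolding strip_vertex_def by (rule f(2))
  have "h ` pverts ?D = S" unfolding S[symmetric] disjoint_union_def by (auto simp: image_iff)
  moreover have "map_prod h h ` parcs ?D = C"
    unfolding C[symmetric] disjoint_union_def by (auto simp: image_iff; force)
  ultimately have mg: "map_graph f (hexagonal_strip n k d) = pgraph S C" unfolding f(3) by (simp add: map_graph_def)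
  obtain P Q where pq: "V = S \<union> P" "P \<inter> S = {}" "Q \<subseteq> P \<times> U" "\<forall>p\<in>P. \<exists>!u. (p, u) \<in> Q" "W = C \<union> symcl Q"
    by (rule decoE[OF dec])
  define par where "par = (\<lambda>p. THE u. (p, u) \<in> Q)"
  have par: "(p, par p) \<in> Q" if "p \<in> P" for p
    unfolding par_def by (rule theI') (use pq(4) that in blast)
  have Q: "Q = (\<lambda>p. (p, par p)) ` P"
  proof
    show "Q \<subseteq> (\<lambda>p. (p, par p)) ` P"
    proof (rule subrelI)
      fix x u assume xu: "(x, u) \<in> Q"
      then have "x \<in> P" using pq(3) by blast
      then have "u = par x" using bspec[OF pq(4)] par xu by blast
      then show "(x, u) \<in> (\<lambda>p. (p, par p)) ` P" using \<open>x \<in> P\<close> by blast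
    qed
  qed (use par in blast)
  have "decorated (pgraph S C) U a b (pgraph V W)"
    unfolding pq(1,5) Q
    by (rule decorated_pendants) (use pq(1-3) fin par in \<open>auto\<close>)
  then show ?thesis
    unfolding hexagonal_caterpillar_def using p f(1) ab
    by (intro exI[of _ n] exI[of _ k] exI[of _ d] exI[of _ f]) (simp add: fv mg LRU)
qed

section \<open>Chains of blocks\<close>

definition piece :: "'v set \<Rightarrow> 'v rel \<Rightarrow> 'v \<Rightarrow> 'v \<Rightarrow> bool" where
  "piece V E a b \<longleftrightarrow> finite V \<and>
     ((\<exists>n L R S C U. strip n L R S C U \<and> 1 \<le> n \<and> deco S C U V E \<and> a \<in> L \<and> b \<in> R) \<or>
      (star_graph V E a \<and> a = b) \<or> path6 V E a b)"

lemma path6_rev: "path6 V E a b \<Longrightarrow> path6 V E b a"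
proof -
  assume "path6 V E a b"
  then obtain x y z t where d: "distinct [x, y, a, b, z, t]" "V = {x, y, a, b, z, t}"
     "E = symcl {(x, y), (y, a), (a, b), (b, z), (z, t)}"
    unfolding path6_def by (elim exE conjE) (rule that)
  show ?thesis
    unfolding path6_def
    by (rule exI[of _ t], rule exI[of _ z], rule exI[of _ y], rule exI[of _ x]) (use d in \<open>auto simp: symcl_def\<close>)
qed

lemma piece_rev: "piece V E a b \<Longrightarrow> piece V E b a"
  unfolding piece_def using strip_rev path6_rev by metis

lemma piece_sub:
  assumes "piece V E a b"
  shows "a \<in> V" "b \<in> V" "finite V" "E \<subseteq> V \<times> V"
proof -
  show "finite V" using assms unfolding piece_def by blast
  consider n L R S C U where "strip n L R S C U" "deco S C U V E" "a \<in> L" "b \<in> R"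
    | "star_graph V E a" "a = b" | "path6 V E a b"
    using assms unfolding piece_def by blast
  then have "a \<in> V \<and> b \<in> V \<and> E \<subseteq> V \<times> V"
  proof cases
    case (1 n L R S C U)
    obtain P Q where "V = S \<union> P" "P \<inter> S = {}" "Q \<subseteq> P \<times> U" "\<forall>p\<in>P. \<exists>!u. (p, u) \<in> Q" "E = C \<union> symcl Q"
      by (rule decoE[OF 1(2)])
    then show ?thesis using strip_sub[OF 1(1)] 1(3,4) by (auto simp: symcl_def)
  next
    case 2
    then show ?thesis unfolding star_graph_def by (auto simp: symcl_def)
  next
    case 3
    then show ?thesis unfolding path6_def by (auto simp: symcl_def)
  qed
  then show "a \<in> V" "b \<in> V" "E \<subseteq> V \<times> V" by blast+
qed

lemma piece_graph:
  assumes "piece V E a b"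
  shows "hexagonal_caterpillar (pgraph V E) a b \<or> lobster (pgraph V E) a b"
proof -
  have "finite V" by (rule piece_sub(3)[OF assms])
  then show ?thesis
    using assms strip_hexagonal_caterpillar star_graph_lobster path6_lobster unfolding piece_def by metis
qed

inductive chain :: "'v set \<Rightarrow> 'v rel \<Rightarrow> 'v \<Rightarrow> 'v \<Rightarrow> bool" where
  one: "piece V E a b \<Longrightarrow> chain V E a b"
| snoc: "chain V E a b \<Longrightarrow> piece V' E' b c \<Longrightarrow> V \<inter> V' = {b} \<Longrightarrow> chain (V \<union> V') (E \<union> E') a c"

lemma chain_sub:
  assumes "chain V E a b"
  shows "a \<in> V \<and> b \<in> V \<and> finite V \<and> E \<subseteq> V \<times> V"
  using assms
proof induction
  case (one V E a b)
  then show ?case using piece_sub[OF one] by blast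
next
  case (snoc V E a b V' E' c)
  then show ?case using piece_sub[OF snoc(2)] by blast
qed

lemma chain_concat:
  assumes "chain V' E' b c" "chain V E a b" "V \<inter> V' = {b}"
  shows "chain (V \<union> V') (E \<union> E') a c"
  using assms
proof induction
  case (one V' E' b c)
  show ?case by (rule chain.snoc[OF one(2,1,3)])
next
  case (snoc V1 E1 b c V2 E2 d)
  have b: "b \<in> V1" using chain_sub[OF snoc(1)] by blast
  have 1: "V \<inter> V1 = {b}" using snoc(6) b by blast
  have "(V \<union> V1) \<inter> V2 = {c}" using snoc(3,6) b by blast
  from chain.snoc[OF snoc(4)[OF snoc(5) 1] snoc(2) this] show ?case by (simp add: Un_assoc)
qed

lemma chain_rev: "chain V E a b \<Longrightarrow> chain V E b a"
proof (induction rule: chain.induct)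
  case (one V E a b)
  show ?case by (rule chain.one[OF piece_rev[OF one]])
next
  case (snoc V E a b V' E' c)
  have "V' \<inter> V = {b}" using snoc(3) by blast
  from chain_concat[OF snoc(4) chain.one[OF piece_rev[OF snoc(2)]] this] show ?case by (simp add: Un_commute)
qed

lemma chain_seq:
  assumes "chain V E a b"
  shows "\<exists>k Vs Es as bs. 1 \<le> (k::nat) \<and> (\<forall>i\<in>{1..k}. piece (Vs i) (Es i) (as i) (bs i)) \<and> V = (\<Union>i\<in>{1..k}. Vs i) \<and>
    E = (\<Union>i\<in>{1..k}. Es i) \<and> bs k = b \<and> (\<forall>i\<in>{1..<k}. bs i = as (Suc i)) \<and>
    (\<forall>i\<in>{1..<k}. (\<Union>j\<in>{1..i}. Vs j) \<inter> Vs (Suc i) = {bs i})"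
  using assms
proof induction
  case (one V E a b)
  then show ?case
    by (intro exI[of _ 1] exI[of _ "\<lambda>_. V"] exI[of _ "\<lambda>_. E"] exI[of _ "\<lambda>_. a"] exI[of _ "\<lambda>_. b"]) auto
next
  case (snoc V E a b V' E' c)
  obtain k Vs Es as bs where s: "1 \<le> (k::nat)" "\<forall>i\<in>{1..k}. piece (Vs i) (Es i) (as i) (bs i)" "V = (\<Union>i\<in>{1..k}. Vs i)"
    "E = (\<Union>i\<in>{1..k}. Es i)" "bs k = b" "\<forall>i\<in>{1..<k}. bs i = as (Suc i)"
    "\<forall>i\<in>{1..<k}. (\<Union>j\<in>{1..i}. Vs j) \<inter> Vs (Suc i) = {bs i}"
    using snoc(4) by (elim exE conjE) (rule that)
  define Vs' where "Vs' = Vs(Suc k := V')"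
  define Es' where "Es' = Es(Suc k := E')"
  define as' where "as' = as(Suc k := b)"
  define bs' where "bs' = bs(Suc k := c)"
  have old: "Vs' i = Vs i" "Es' i = Es i" "as' i = as i" "bs' i = bs i" if "i \<le> k" for i
    using that unfolding Vs'_def Es'_def as'_def bs'_def by auto
  have new: "Vs' (Suc k) = V'" "Es' (Suc k) = E'" "as' (Suc k) = b" "bs' (Suc k) = c"
    unfolding Vs'_def Es'_def as'_def bs'_def by auto
  have ins: "{1..Suc k} = insert (Suc k) {1..k}" "{1..<Suc k} = insert k {1..<k}" using s(1) by auto
  have U: "(\<Union>j\<in>{1..i}. Vs' j) = (\<Union>j\<in>{1..i}. Vs j)" "(\<Union>j\<in>{1..i}. Es' j) = (\<Union>j\<in>{1..i}. Es j)" if "i \<le> k" for i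
    using old that by auto
  show ?case
  proof (rule exI[of _ "Suc k"], rule exI[of _ Vs'], rule exI[of _ Es'], rule exI[of _ as'], rule exI[of _ bs'], intro conjI)
    show "\<forall>i\<in>{1..Suc k}. piece (Vs' i) (Es' i) (as' i) (bs' i)"
      unfolding ins using s(2) snoc(2) old new by auto
    show "V \<union> V' = (\<Union>i\<in>{1..Suc k}. Vs' i)" "E \<union> E' = (\<Union>i\<in>{1..Suc k}. Es' i)"
      unfolding ins UN_insert U[OF order.refl] new s(3,4) by blast+
    show "bs' (Suc k) = c" by (rule new)
    show "\<forall>i\<in>{1..<Suc k}. bs' i = as' (Suc i)"
    proof
      fix i assume "i \<in> {1..<Suc k}"
      then consider "i = k" | "i \<in> {1..<k}" unfolding ins by blast
      then show "bs' i = as' (Suc i)" using s(5,6) old new by cases auto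
    qed
    show "\<forall>i\<in>{1..<Suc k}. (\<Union>j\<in>{1..i}. Vs' j) \<inter> Vs' (Suc i) = {bs' i}"
    proof
      fix i assume "i \<in> {1..<Suc k}"
      then consider "i = k" | "i \<in> {1..<k}" unfolding ins by blast
      then show "(\<Union>j\<in>{1..i}. Vs' j) \<inter> Vs' (Suc i) = {bs' i}"
      proof cases
        case 1
        then show ?thesis using snoc(3) s(3,5) U[of k] new old[of k] by simp
      next
        case 2
        then have "i \<le> k" "Suc i \<le> k" by auto
        then show ?thesis using 2 s(7) U[of i] old by auto
      qed
    qed
  qed simp
qed

lemma pair_wf_map_graph:
  assumes "\<And>x y. (x, y) \<in> parcs G \<Longrightarrow> x \<in> pverts G \<and> y \<in> pverts G"
  shows "pair_wf_digraph (map_graph f G)"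
  using assms by unfold_locales auto

lemma chain_caterpillar:
  assumes "chain (V :: nat set) E a b"
  shows "generalized_hexagonal_caterpillar (pgraph V E)"
proof -
  obtain k Vs Es as bs where s: "1 \<le> (k::nat)" "\<forall>i\<in>{1..k}. piece (Vs i) (Es i) (as i) (bs i)" "V = (\<Union>i\<in>{1..k}. Vs i)"
    "E = (\<Union>i\<in>{1..k}. Es i)" "bs k = b" "\<forall>i\<in>{1..<k}. bs i = as (Suc i)"
    "\<forall>i\<in>{1..<k}. (\<Union>j\<in>{1..i}. Vs j) \<inter> Vs (Suc i) = {bs i}"
    using chain_seq[OF assms] by (elim exE conjE) (rule that)
  let ?H = "\<lambda>i. pgraph (Vs i) (Es i)"
  let ?D = "disjoint_union {1..k} ?H"
  define R where "R = {((i, bs i), (i + 1, as (i + 1))) | i. i \<in> {1..<k}}"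
  have step: "((i, x), (Suc i, x)) \<in> R" if "i \<in> {1..<k}" "x = bs i" for i x
    unfolding R_def using s(6) that by auto
  have up: "((i, x), (j, x)) \<in> (R \<union> R\<inverse>)\<^sup>*" if "1 \<le> i" "i \<le> j" "j \<le> k" "x \<in> Vs i" "x \<in> Vs j" for i j x
    using that(2,3,5)
  proof (induction j rule: dec_induct)
    case base
    then show ?case by simp
  next
    case (step j)
    have j: "j \<in> {1..<k}" using step that(1) by auto
    have "x \<in> (\<Union>j\<in>{1..j}. Vs j) \<inter> Vs (Suc j)" using step that(1,4) by auto
    then have x: "x = bs j" using s(7) j by blast
    have "piece (Vs j) (Es j) (as j) (bs j)" using s(2) j by auto
    from piece_sub(2)[OF this] have "x \<in> Vs j" unfolding x .
    then have "((i, x), (j, x)) \<in> (R \<union> R\<inverse>)\<^sup>*" using step by auto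
    moreover have "((j, x), (Suc j, x)) \<in> R \<union> R\<inverse>" using \<open>\<And>x i. \<lbrakk>i \<in> {1..<k}; x = bs i\<rbrakk> \<Longrightarrow> ((i, x), Suc i, x) \<in> R\<close> j x by blast
    ultimately show ?case by (rule rtrancl.rtrancl_into_rtrancl)
  qed
  have s': "(x, y) \<in> (R \<union> R\<inverse>)\<^sup>* \<Longrightarrow> (y, x) \<in> (R \<union> R\<inverse>)\<^sup>*" for x y
    by (metis converse_Un converse_converse rtrancl_converseD sup_commute)
  have fib: "(p, q) \<in> (R \<union> R\<inverse>)\<^sup>*" if pq: "p \<in> pverts ?D" "q \<in> pverts ?D" "snd p = snd q" for p q
  proof -
    obtain i x j where p: "p = (i, x)" "q = (j, x)" "i \<in> {1..k}" "j \<in> {1..k}" "x \<in> Vs i" "x \<in> Vs j"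
      using pq unfolding disjoint_union_def by (cases p; cases q) auto
    show ?thesis
    proof (cases "i \<le> j")
      case True
      then show ?thesis unfolding p using up[of i j x] p by auto
    next
      case False
      then show ?thesis unfolding p using s'[OF up[of j i x]] p by auto
    qed
  qed
  have Rs: "snd p = snd q" if "(p, q) \<in> R" for p q using that s(6) unfolding R_def by auto
  obtain f where f: "inj_on f (pverts (identify ?D R))" "map_graph f (identify ?D R) = map_graph snd ?D"
    using identify_via_map[of R snd ?D, OF Rs fib] by blast
  have Es: "Es i \<subseteq> Vs i \<times> Vs i" if "i \<in> {1..k}" for i
  proof -
    have "piece (Vs i) (Es i) (as i) (bs i)" using s(2) that by blast
    then show ?thesis by (rule piece_sub(4))
  qed
  have "snd ` pverts ?D = V" unfolding s(3) disjoint_union_def by force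
  moreover have "map_prod snd snd ` parcs ?D = E" unfolding s(4) disjoint_union_def by (auto simp: image_iff)
  ultimately have mg: "map_graph f (identify ?D R) = pgraph V E" unfolding f(2) by (simp add: map_graph_def)
  have "pair_wf_digraph (identify ?D R)"
    unfolding identify_def by (rule pair_wf_map_graph) (use Es in \<open>auto simp: disjoint_union_def\<close>)
  from digraph_iso_map_graph[OF this f(1)]
  have iso: "digraph_iso (with_proj (identify ?D R)) (with_proj (pgraph V E))" unfolding mg .
  have cat: "\<forall>i\<in>{1..k}. hexagonal_caterpillar (?H i) (as i) (bs i) \<or> lobster (?H i) (as i) (bs i)"
    by (intro ballI piece_graph) (rule bspec[OF s(2)])
  show ?thesis
    unfolding generalized_hexagonal_caterpillar_def
    by (rule exI[of _ k], rule exI[of _ ?H], rule exI[of _ as], rule exI[of _ bs], intro conjI)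
      (rule s(1) cat iso[unfolded R_def])+
qed

section \<open>Every graph in the class embeds\<close>

lemma fresh4:
  assumes "finite (A :: nat set)"
  shows "\<exists>x y z t. distinct [x, y, z, t] \<and> x \<notin> A \<and> y \<notin> A \<and> z \<notin> A \<and> t \<notin> A"
proof -
  obtain m where m: "\<forall>a\<in>A. a < m" using finite_nat_set_iff_bounded[THEN iffD1, OF assms] ..
  have "m \<notin> A" "Suc m \<notin> A" "Suc (Suc m) \<notin> A" "Suc (Suc (Suc m)) \<notin> A" using m by force+
  then show ?thesis
    by (intro exI[of _ m] exI[of _ "Suc m"] exI[of _ "Suc (Suc m)"] exI[of _ "Suc (Suc (Suc m))"]) simp
qed

lemma path6_fresh:
  assumes "finite (A :: nat set)" "a \<in> A" "b \<in> A" "a \<noteq> b"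
  shows "\<exists>V E. piece V E a b \<and> V \<inter> A = {a, b} \<and> Restr E A = {(a, b), (b, a)}"
proof -
  obtain x y z t where f: "distinct [x, y, z, t]" "x \<notin> A" "y \<notin> A" "z \<notin> A" "t \<notin> A"
    using fresh4[OF assms(1)] by blast
  let ?V = "{x, y, a, b, z, t}" and ?E = "symcl {(x, y), (y, a), (a, b), (b, z), (z, t)}"
  have "path6 ?V ?E a b"
    unfolding path6_def
    by (rule exI[of _ x], rule exI[of _ y], rule exI[of _ z], rule exI[of _ t]) (use f assms in auto)
  then have "piece ?V ?E a b" unfolding piece_def by simp
  moreover have "?V \<inter> A = {a, b}" using f assms by auto
  moreover have "Restr ?E A = {(a, b), (b, a)}" using f assms by (auto simp: symcl_def)
  ultimately show ?thesis by blast
qed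

locale xfree_nat = xfree E for E :: "nat rel"
begin

definition hosts :: "nat set \<Rightarrow> nat rel \<Rightarrow> nat set \<Rightarrow> nat set \<Rightarrow> bool" where
  "hosts V' E' D A \<longleftrightarrow> D \<subseteq> V' \<and> V' \<inter> A \<subseteq> D \<and> Restr E' D = Restr E D"

lemma hosts_Un:
  assumes h1: "hosts V1 E1 D1 (A \<union> D2)" "E1 \<subseteq> V1 \<times> V1" and h2: "hosts V2 E2 D2 (A \<union> V1)" "E2 \<subseteq> V2 \<times> V2"
    and w: "D1 \<inter> D2 = {w}" "anti (D1 - {w}) (D2 - {w})"
  shows "V1 \<inter> V2 = {w} \<and> hosts (V1 \<union> V2) (E1 \<union> E2) (D1 \<union> D2) A"
proof -
  have a: "D1 \<subseteq> V1" "V1 \<inter> (A \<union> D2) \<subseteq> D1" "Restr E1 D1 = Restr E D1"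
    and b: "D2 \<subseteq> V2" "V2 \<inter> (A \<union> V1) \<subseteq> D2" "Restr E2 D2 = Restr E D2"
    using h1(1) h2(1) unfolding hosts_def by blast+
  have V: "V1 \<inter> V2 = {w}" using a(1,2) b(1,2) w(1) by blast
  have c1: "Restr E1 (D1 \<union> D2) = Restr E1 D1" using h1(2) a(2) by blast
  have c2: "Restr E2 (D1 \<union> D2) = Restr E2 D2" using h2(2) b(1,2) a(1) by blast
  have "anti (D1 - D2) (D2 - D1)" using w unfolding anti_def by blast
  from Restr_Un[OF this] have "Restr E (D1 \<union> D2) = Restr E1 (D1 \<union> D2) \<union> Restr E2 (D1 \<union> D2)"
    unfolding c1 c2 a(3) b(3) .
  then have "Restr (E1 \<union> E2) (D1 \<union> D2) = Restr E (D1 \<union> D2)" by (simp add: Int_Un_distrib2)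
  then show ?thesis using V a b unfolding hosts_def by blast
qed

lemma hosts_exact: "hosts D (Restr E D) D A"
  unfolding hosts_def by blast

lemma good_chain:
  assumes "good D w" "finite D" "finite A"
  shows "\<exists>V' E' s. chain V' E' s w \<and> hosts V' E' D A"
  using assms
proof (induction arbitrary: A rule: good.induct)
  case (star D r)
  then have "piece D (Restr E D) r r" unfolding piece_def by blast
  from chain.one[OF this] hosts_exact[of D A] show ?case by blast
next
  case (edge D w w')
  obtain V E1 s where c: "chain V E1 s w" "hosts V E1 D (A \<union> {w, w'})"
    using edge(6)[of "A \<union> {w, w'}"] edge(7,8) by auto
  note cs = chain_sub[OF c(1)]
  have ne: "w \<noteq> w'" using edge(2,4) by blast
  obtain V2 E2 where p: "piece V2 E2 w w'" "V2 \<inter> (A \<union> V \<union> {w'}) = {w, w'}" "Restr E2 (A \<union> V \<union> {w'}) = {(w, w'), (w', w)}"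
    using path6_fresh[of "A \<union> V \<union> {w'}" w w'] cs ne edge(8) by auto
  have "(w', w) \<in> E" using edge(3) sym by blast
  then have R: "Restr E {w, w'} = {(w, w'), (w', w)}" using edge(3) irr by auto
  have h2: "hosts V2 E2 {w, w'} (A \<union> V)"
    unfolding hosts_def R
  proof (intro conjI)
    show "{w, w'} \<subseteq> V2" using p(2) by blast
    show "V2 \<inter> (A \<union> V) \<subseteq> {w, w'}" using p(2) by blast
    show "Restr E2 {w, w'} = {(w, w'), (w', w)}" using p(3) cs by blast
  qed
  have "V \<inter> V2 = {w} \<and> hosts (V \<union> V2) (E1 \<union> E2) (D \<union> {w, w'}) A"
  proof (rule hosts_Un[OF c(2) _ h2])
    show "E1 \<subseteq> V \<times> V" using cs by blast
    show "E2 \<subseteq> V2 \<times> V2" by (rule piece_sub(4)[OF p(1)])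
    show "D \<inter> {w, w'} = {w}" using edge(2,4) by blast
    show "anti (D - {w}) ({w, w'} - {w})" using edge(5) sym unfolding anti_def by blast
  qed
  moreover have "D \<union> {w, w'} = insert w' D" using edge(2) by blast
  ultimately show ?case using chain.snoc[OF c(1) p(1)] by auto
next
  case (glue_star D w S)
  have fin: "finite D" "finite S" using glue_star(6) by auto
  obtain V E1 s where c: "chain V E1 s w" "hosts V E1 D (A \<union> S)"
    using glue_star(5)[of "A \<union> S"] fin glue_star(7) by auto
  note cs = chain_sub[OF c(1)]
  have p: "piece S (Restr E S) w w" unfolding piece_def using fin glue_star(2) by blast
  have "V \<inter> S = {w} \<and> hosts (V \<union> S) (E1 \<union> Restr E S) (D \<union> S) A"
    by (rule hosts_Un[OF c(2) _ hosts_exact _ glue_star(3,4)]) (use cs in blast)+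
  then show ?case using chain.snoc[OF c(1) p] by blast
next
  case (glue_strip D w n L R S C U V0 w')
  have fin: "finite D" "finite V0" using glue_strip(10) by auto
  obtain V E1 s where c: "chain V E1 s w" "hosts V E1 D (A \<union> V0)"
    using glue_strip(9)[of "A \<union> V0"] fin glue_strip(11) by auto
  note cs = chain_sub[OF c(1)]
  have p: "piece V0 (Restr E V0) w w'" unfolding piece_def using fin glue_strip(2-6) by blast
  have "V \<inter> V0 = {w} \<and> hosts (V \<union> V0) (E1 \<union> Restr E V0) (D \<union> V0) A"
    by (rule hosts_Un[OF c(2) _ hosts_exact _ glue_strip(7,8)]) (use cs in blast)+
  then show ?case using chain.snoc[OF c(1) p] by blast
qed

lemma conn_chain:
  assumes "finite D" "conn D" "D \<noteq> {}" "finite A"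
  shows "\<exists>V' E' s t. chain V' E' s t \<and> hosts V' E' D A"
proof -
  obtain D1 D2 r where d: "good D1 r" "good D2 r" "D = D1 \<union> D2" "D1 \<inter> D2 = {r}" "anti (D1 - {r}) (D2 - {r})"
    using twosided[OF assms(1-3)] unfolding twosided_def by blast
  have fin: "finite D1" "finite D2" using d(3) assms(1) by auto
  obtain V1 E1 s where c: "chain V1 E1 s r" "hosts V1 E1 D1 (A \<union> D2)"
    using good_chain[OF d(1) fin(1), of "A \<union> D2"] fin assms(4) by auto
  obtain V2 E2 t where c2: "chain V2 E2 t r" "hosts V2 E2 D2 (A \<union> V1)"
    using good_chain[OF d(2) fin(2), of "A \<union> V1"] chain_sub[OF c(1)] assms(4) by auto
  have h: "V1 \<inter> V2 = {r} \<and> hosts (V1 \<union> V2) (E1 \<union> E2) (D1 \<union> D2) A"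
    by (rule hosts_Un[OF c(2) _ c2(2) _ d(4,5)]) (use chain_sub[OF c(1)] chain_sub[OF c2(1)] in blast)+
  then have "chain (V1 \<union> V2) (E1 \<union> E2) s t" using chain_concat[OF chain_rev[OF c2(1)] c(1)] by blast
  then show ?thesis using h d(3) by blast
qed

text \<open>Different components are hosted by chains that are joined by two paths through a fresh vertex.\<close>

lemma all_chain:
  assumes "finite D" "D \<noteq> {}" "finite A"
  shows "\<exists>V' E' s t. chain V' E' s t \<and> hosts V' E' D A"
  using assms
proof (induction "card D" arbitrary: D A rule: less_induct)
  case less
  show ?case
  proof (cases "conn D")
    case True
    then show ?thesis using conn_chain less(2-4) by blast
  next
    case False
    obtain x where x: "x \<in> D" using less(3) by blast
    define C where "C = comp D x"
    have CD: "C \<subseteq> D" unfolding C_def by (rule comp_sub[OF x])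
    have cc: "conn C" unfolding C_def by (rule comp_conn[OF x])
    have xC: "x \<in> C" unfolding C_def by (rule comp_self)
    have ne: "D - C \<noteq> {}" using cc False CD by auto
    have cl: "b \<in> C" if "a \<in> C" "b \<in> D" "(a, b) \<in> E" for a b
      unfolding C_def by (rule comp_closed[of a]) (use that x C_def in auto)
    have fin: "finite C" "finite (D - C)" using less(2) CD by (auto intro: finite_subset)
    have "C \<noteq> {}" using xC by blast
    obtain V1 E1 s1 t1 where c1: "chain V1 E1 s1 t1" "hosts V1 E1 C (A \<union> D)"
      using conn_chain[OF fin(1) cc \<open>C \<noteq> {}\<close>, of "A \<union> D"] less(2,4) by auto
    note cs1 = chain_sub[OF c1(1)]
    have "card (D - C) < card D" by (rule psubset_card_mono[OF less(2)]) (use x xC in blast)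
    moreover have "finite (A \<union> D \<union> V1)" using less(2,4) cs1 by blast
    ultimately obtain V2 E2 s2 t2 where c2: "chain V2 E2 s2 t2" "hosts V2 E2 (D - C) (A \<union> D \<union> V1)"
      using less(1)[of "D - C" "A \<union> D \<union> V1"] fin ne by blast
    note cs2 = chain_sub[OF c2(1)]
    have d12: "V1 \<inter> V2 = {}" using c1(2) c2(2) CD unfolding hosts_def by blast
    let ?B = "A \<union> D \<union> V1 \<union> V2"
    have finB: "finite ?B" using less(2,4) cs1 cs2 by blast
    obtain z where z: "z \<notin> ?B" using fresh4[OF finB] by blast
    have zne: "t1 \<noteq> z" "z \<noteq> s2" using z cs1 cs2 by blast+
    obtain V3 E3 where p3: "piece V3 E3 t1 z" "V3 \<inter> (insert z ?B) = {t1, z}" "Restr E3 (insert z ?B) = {(t1, z), (z, t1)}"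
      using path6_fresh[of "insert z ?B" t1 z] zne cs1 finB by auto
    note ps3 = piece_sub[OF p3(1)]
    let ?B2 = "insert z ?B \<union> V3"
    obtain V4 E4 where p4: "piece V4 E4 z s2" "V4 \<inter> ?B2 = {z, s2}" "Restr E4 ?B2 = {(z, s2), (s2, z)}"
      using path6_fresh[of ?B2 z s2] zne cs2 finB ps3(3) by auto
    note ps4 = piece_sub[OF p4(1)]
    have "V1 \<inter> V3 = {t1}" using p3(2) cs1 z by blast
    from chain.snoc[OF c1(1) p3(1) this] have k1: "chain (V1 \<union> V3) (E1 \<union> E3) s1 z" .
    have s2V: "s2 \<in> V2" "t1 \<in> V1" using cs2 cs1 by blast+
    then have s2: "s2 \<notin> V1" using d12 by blast
    have "s2 \<notin> V3"
    proof
      assume "s2 \<in> V3"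
      then have "s2 \<in> {t1, z}" unfolding p3(2)[symmetric] using s2V by blast
      then show False using s2 s2V zne by blast
    qed
    note s2 = s2 this
    have "(V1 \<union> V3) \<inter> V4 = {z}"
    proof
      have "(V1 \<union> V3) \<inter> V4 \<subseteq> {z, s2}" unfolding p4(2)[symmetric] by blast
      then show "(V1 \<union> V3) \<inter> V4 \<subseteq> {z}" using s2 by blast
    qed (use ps3(2) ps4(1) in blast)
    from chain.snoc[OF k1 p4(1) this] have k2: "chain (V1 \<union> V3 \<union> V4) (E1 \<union> E3 \<union> E4) s1 s2" .
    have zV: "z \<notin> V2" using z by blast
    have "V3 \<inter> V2 \<subseteq> {t1, z}" unfolding p3(2)[symmetric] by blast
    moreover have "t1 \<notin> V2" using d12 s2V by blast
    ultimately have "V3 \<inter> V2 = {}" using zV by blast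
    moreover have "V4 \<inter> V2 \<subseteq> {z, s2}" unfolding p4(2)[symmetric] by blast
    then have "V4 \<inter> V2 = {s2}" using zV ps4(2) s2V by blast
    ultimately have "(V1 \<union> V3 \<union> V4) \<inter> V2 = {s2}" using d12 by blast
    from chain_concat[OF c2(1) k2 this] have k3: "chain (V1 \<union> V3 \<union> V4 \<union> V2) (E1 \<union> E3 \<union> E4 \<union> E2) s1 t2" .
    have h1: "C \<subseteq> V1" "V1 \<inter> (A \<union> D) \<subseteq> C" "Restr E1 C = Restr E C" using c1(2) unfolding hosts_def by blast+
    have h2: "D - C \<subseteq> V2" "V2 \<inter> (A \<union> D \<union> V1) \<subseteq> D - C" "Restr E2 (D - C) = Restr E (D - C)" using c2(2) unfolding hosts_def by blast+
    have v1: "V1 \<inter> D \<subseteq> C" and v2: "V2 \<inter> D \<subseteq> D - C" using h1(2) h2(2) by blast+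
    have e1: "E1 \<subseteq> V1 \<times> V1" and e2: "E2 \<subseteq> V2 \<times> V2" using cs1 cs2 by blast+
    have "Restr E1 D = Restr E1 C" using e1 v1 CD by blast
    then have r1: "Restr E1 D = Restr E C" unfolding h1(3) .
    have "Restr E2 D = Restr E2 (D - C)" using e2 v2 by blast
    then have r2: "Restr E2 D = Restr E (D - C)" unfolding h2(3) .
    have zD: "z \<notin> D" using z by blast
    have "Restr E3 D \<subseteq> {(t1, z), (z, t1)}" unfolding p3(3)[symmetric] by blast
    then have r3: "Restr E3 D = {}" using zD by blast
    have "Restr E4 D \<subseteq> {(z, s2), (s2, z)}" unfolding p4(3)[symmetric] by blast
    then have r4: "Restr E4 D = {}" using zD by blast
    have r: "Restr E D = Restr E C \<union> Restr E (D - C)" using cl sym CD by blast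
    have "hosts (V1 \<union> V3 \<union> V4 \<union> V2) (E1 \<union> E3 \<union> E4 \<union> E2) D A"
      unfolding hosts_def
    proof (intro conjI)
      show "D \<subseteq> V1 \<union> V3 \<union> V4 \<union> V2" using h1(1) h2(1) by blast
      have "V3 \<inter> A \<subseteq> {t1, z}" unfolding p3(2)[symmetric] by blast
      then have "V3 \<inter> A \<subseteq> V1" using s2V z by blast
      have "V4 \<inter> A \<subseteq> {z, s2}" unfolding p4(2)[symmetric] by blast
      then have "V4 \<inter> A \<subseteq> V2" using s2V z by blast
      note \<open>V3 \<inter> A \<subseteq> V1\<close> this
      then show "(V1 \<union> V3 \<union> V4 \<union> V2) \<inter> A \<subseteq> D" using h1(2) h2(2) CD by blast
      show "Restr (E1 \<union> E3 \<union> E4 \<union> E2) D = Restr E D"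
        unfolding r Int_Un_distrib2 r1 r2 r3 r4 by simp
    qed
    then show ?thesis using k3 by blast
  qed
qed

end

lemma class_X_embeds:
  assumes "G \<in> class_X"
  shows "\<exists>H :: nat pair_pre_digraph. generalized_hexagonal_caterpillar H \<and> contains_induced H G"
proof -
  have G: "pair_graph G" and X: "Xfree (parcs G)" using assms unfolding class_X_iff by blast+
  note g = pair_graphD[OF G]
  obtain \<phi> :: "'a \<Rightarrow> nat" where \<phi>: "inj_on \<phi> (pverts G)" using finite_imp_inj_to_nat_seg[OF g(1)] by blast
  define E where "E = map_prod \<phi> \<phi> ` parcs G"
  define D where "D = insert 0 (\<phi> ` pverts G)"
  have E_iff: "(\<phi> x, \<phi> y) \<in> E \<longleftrightarrow> (x, y) \<in> parcs G" if "x \<in> pverts G" "y \<in> pverts G" for x y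
  proof
    assume "(\<phi> x, \<phi> y) \<in> E"
    then obtain x' y' where xy: "(x', y') \<in> parcs G" "\<phi> x = \<phi> x'" "\<phi> y = \<phi> y'" unfolding E_def by auto
    then have "x = x'" "y = y'" using inj_onD[OF \<phi>] g(2) that by blast+
    then show "(x, y) \<in> parcs G" using xy by simp
  qed (force simp: E_def)
  have ED: "E \<subseteq> \<phi> ` pverts G \<times> \<phi> ` pverts G" unfolding E_def using g(2) by auto
  let ?\<psi> = "the_inv_into (pverts G) \<phi>"
  have \<psi>: "?\<psi> (\<phi> x) = x" if "x \<in> pverts G" for x using the_inv_into_f_f[OF \<phi> that] .
  have fE: "Field E \<subseteq> \<phi> ` pverts G" using ED by (auto simp: Field_def)
  have "Xfree E"
  proof (rule Xfree_embed[OF X])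
    show "inj_on ?\<psi> (Field E)" by (rule inj_on_subset[OF inj_on_the_inv_into[OF \<phi>] fE])
    fix x y assume "x \<in> Field E" "y \<in> Field E"
    then obtain x' y' where "x' \<in> pverts G" "x = \<phi> x'" "y' \<in> pverts G" "y = \<phi> y'" using fE by blast
    then show "((?\<psi> x, ?\<psi> y) \<in> parcs G) = ((x, y) \<in> E)" using \<psi> E_iff by simp
  qed
  moreover have "(y, x) \<in> E" if "(x, y) \<in> E" for x y using that g(3) unfolding E_def by force
  moreover have "(x, x) \<notin> E" for x
  proof
    assume "(x, x) \<in> E"
    then obtain x' where "x' \<in> pverts G" "x = \<phi> x'" using ED by blast
    then show False using E_iff[of x' x'] \<open>(x, x) \<in> E\<close> g(4) by simp
  qed
  ultimately interpret xfree_nat E by unfold_locales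
  have "finite D" "D \<noteq> {}" unfolding D_def using g(1) by auto
  then obtain V' E' s t where c: "chain V' E' s t" "hosts V' E' D {}" using all_chain[of D "{}"] by blast
  have cat: "generalized_hexagonal_caterpillar (pgraph V' E')" by (rule chain_caterpillar[OF c(1)])
  have wf: "pair_wf_digraph (pgraph V' E')" using chain_sub[OF c(1)] by unfold_locales auto
  have "contains_induced (pgraph V' E') G"
    unfolding contains_induced_iff[OF wf g(5)]
  proof (intro exI[of _ \<phi>] conjI ballI)
    show "\<phi> ` pverts G \<subseteq> pverts (pgraph V' E')" using c(2) unfolding hosts_def D_def by auto
    fix x y assume xy: "x \<in> pverts G" "y \<in> pverts G"
    then have "(\<phi> x, \<phi> y) \<in> E' \<longleftrightarrow> (\<phi> x, \<phi> y) \<in> Restr E' D" unfolding D_def by blast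
    also have "\<dots> \<longleftrightarrow> (\<phi> x, \<phi> y) \<in> Restr E D" using c(2) unfolding hosts_def by simp
    also have "\<dots> \<longleftrightarrow> (x, y) \<in> parcs G" using E_iff[OF xy] xy unfolding D_def by blast
    finally show "((\<phi> x, \<phi> y) \<in> parcs (pgraph V' E')) = ((x, y) \<in> parcs G)" by simp
  qed (rule \<phi>)
  then show ?thesis using cat by blast
qed

section \<open>Gluing at a vertex\<close>

text \<open>\<open>thin n F c T\<close>: in the graph \<open>F\<close>, the vertices in \<open>T\<close> form a path hanging off \<open>c\<close>.\<close>

definition thin :: "nat \<Rightarrow> nat rel \<Rightarrow> nat \<Rightarrow> nat list \<Rightarrow> bool" where
  "thin n F c T \<longleftrightarrow> length T \<le> 3 \<and> distinct T \<and> c \<notin> set T \<and> set T \<subseteq> {..<n} \<and>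
     (\<forall>k<length T. \<forall>j<n. (T ! k, j) \<in> symcl F \<longleftrightarrow>
        j = (if k = 0 then c else T ! (k - 1)) \<or> (Suc k < length T \<and> j = T ! Suc k))"

text \<open>\<open>tame n F\<close>: \<open>F\<close> is connected, and whenever a cut vertex \<open>c\<close> separates it into two sides then one
  of the sides is a path with at most 3 vertices that hangs off \<open>c\<close>.\<close>

definition tame :: "nat \<Rightarrow> nat rel \<Rightarrow> bool" where
  "tame n F \<longleftrightarrow> F \<subseteq> {..<n} \<times> {..<n} \<and> {..<n} \<subseteq> Field F \<and>
     (\<forall>\<chi>. (\<forall>(i, j)\<in>F. \<chi> i = \<chi> j) \<longrightarrow> (\<forall>i<n. \<chi> i) \<or> (\<forall>i<n. \<not> \<chi> i)) \<and>
     (\<forall>c<n. \<forall>\<chi>. (\<forall>(i, j)\<in>F. i \<noteq> c \<longrightarrow> j \<noteq> c \<longrightarrow> \<chi> i = \<chi> j) \<longrightarrow>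
        (\<exists>T. thin n F c T \<and> ((\<forall>i<n. i \<noteq> c \<longrightarrow> (\<chi> i \<longleftrightarrow> i \<in> set T)) \<or> (\<forall>i<n. i \<noteq> c \<longrightarrow> (\<not> \<chi> i \<longleftrightarrow> i \<in> set T)))))"

lemma thin_Nil: "thin n F c []"
  by (simp add: thin_def)

definition path3 :: "'v \<Rightarrow> 'v \<Rightarrow> 'v \<Rightarrow> 'v \<Rightarrow> 'v rel" where
  "path3 r p q s = symcl {(r, p), (p, q), (q, s)}"

lemma emb_glue_aux:
  assumes f: "inj_on f {..<n}" "\<And>i j. i < n \<Longrightarrow> j < n \<Longrightarrow> (f i, f j) \<in> E \<longleftrightarrow> (i, j) \<in> symcl F"
    and T: "thin n F c T" and c: "c < n" "f c = r"
    and V: "\<And>i. i < n \<Longrightarrow> i \<notin> set T \<Longrightarrow> f i \<in> V" and E2: "\<And>x y. x \<in> V \<Longrightarrow> y \<in> V \<Longrightarrow> (x, y) \<in> E2 \<longleftrightarrow> (x, y) \<in> E"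
    and sub: "E2 \<subseteq> V \<times> V" and p: "distinct [p, q, s]" "p \<notin> V" "q \<notin> V" "s \<notin> V"
  shows "emb n F (E2 \<union> path3 r p q s)"
proof -
  define ps where "ps = [p, q, s]"
  have t: "length T \<le> 3" "distinct T" "c \<notin> set T" "set T \<subseteq> {..<n}"
    "\<And>k j. k < length T \<Longrightarrow> j < n \<Longrightarrow> (T ! k, j) \<in> symcl F \<longleftrightarrow>
        j = (if k = 0 then c else T ! (k - 1)) \<or> (Suc k < length T \<and> j = T ! Suc k)"
    using T unfolding thin_def by blast+
  have rV: "r \<in> V" using V[OF c(1)] c(2) t(3) by simp
  define ix where "ix = (\<lambda>i. THE k. k < length T \<and> T ! k = i)"
  have ix: "ix (T ! k) = k" if "k < length T" for k
    unfolding ix_def using that t(2) by (intro the_equality) (auto simp: nth_eq_iff_index_eq)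
  define g where "g = (\<lambda>i. if i \<in> set T then ps ! ix i else f i)"
  have gT: "g (T ! k) = ps ! k" if "k < length T" for k using ix[OF that] that unfolding g_def by simp
  have gf: "g i = f i" if "i \<notin> set T" for i using that unfolding g_def by simp
  have psV: "ps ! k \<notin> V" if "k < 3" for k
    using that p unfolding ps_def by (auto simp: less_Suc_eq numeral_3_eq_3)
  have psd: "ps ! k = ps ! l \<longleftrightarrow> k = l" if "k < 3" "l < 3" for k l
    using that p(1) nth_eq_iff_index_eq[of ps k l] unfolding ps_def by simp
  let ?P = "path3 r p q s"
  have rps: "r \<noteq> p" "r \<noteq> q" "r \<noteq> s" using rV p by blast+
  have PV: "(x, y) \<in> ?P \<Longrightarrow> x \<notin> V \<or> y \<notin> V" for x y
    using p unfolding path3_def symcl_def by auto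
  have Pps: "(ps ! k, y) \<in> ?P \<longleftrightarrow> y = (if k = 0 then r else ps ! (k - 1)) \<or> (Suc k < 3 \<and> y = ps ! Suc k)" if "k < 3" for k y
  proof -
    from that consider "k = 0" | "k = 1" | "k = 2" by linarith
    then show ?thesis using p(1) rps unfolding ps_def path3_def symcl_def by cases auto
  qed
  have Psym: "(x, y) \<in> ?P \<longleftrightarrow> (y, x) \<in> ?P" for x y unfolding path3_def symcl_iff by blast
  have "inj_on g {..<n}"
  proof (rule inj_onI)
    fix i j assume ij: "i \<in> {..<n}" "j \<in> {..<n}" "g i = g j"
    consider "i \<in> set T" "j \<in> set T" | "i \<in> set T" "j \<notin> set T" | "i \<notin> set T" "j \<in> set T" | "i \<notin> set T" "j \<notin> set T" by blast
    then show "i = j"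
    proof cases
      case 1
      then obtain k l where kl: "k < length T" "l < length T" "i = T ! k" "j = T ! l" by (metis in_set_conv_nth)
      then have "ps ! k = ps ! l" using ij(3) gT by simp
      then show ?thesis using psd[of k l] kl t(1) by simp
    next
      case 2
      then obtain k where k: "k < length T" "i = T ! k" by (metis in_set_conv_nth)
      then show ?thesis using ij gT[OF k(1)] gf[OF 2(2)] psV[of k] V[of j] 2 t(1) by auto
    next
      case 3
      then obtain k where k: "k < length T" "j = T ! k" by (metis in_set_conv_nth)
      then show ?thesis using ij gT[OF k(1)] gf[OF 3(1)] psV[of k] V[of i] 3 t(1) by auto
    next
      case 4
      then show ?thesis using ij gf f(1) by (auto dest: inj_onD)
    qed
  qed
  moreover have "(g i, g j) \<in> E2 \<union> ?P \<longleftrightarrow> (i, j) \<in> F \<union> F\<inverse>" if ij: "i < n" "j < n" for i j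
  proof -
    have tj: "(g (T ! k), g j) \<in> E2 \<union> ?P \<longleftrightarrow> (T ! k, j) \<in> symcl F" if k: "k < length T" and j: "j < n" for k j
    proof -
      have k3: "k < 3" using k t(1) by simp
      have "(g (T ! k), g j) \<in> E2 \<union> ?P \<longleftrightarrow> (ps ! k, g j) \<in> ?P"
        unfolding gT[OF k] using sub psV[OF k3] by blast
      also have "\<dots> \<longleftrightarrow> g j = (if k = 0 then r else ps ! (k - 1)) \<or> (Suc k < 3 \<and> g j = ps ! Suc k)"
        by (rule Pps[OF k3])
      also have "\<dots> \<longleftrightarrow> j = (if k = 0 then c else T ! (k - 1)) \<or> (Suc k < length T \<and> j = T ! Suc k)"
      proof (cases "j \<in> set T")
        case True
        then obtain l where l: "l < length T" "j = T ! l" by (metis in_set_conv_nth)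
        have l3: "l < 3" using l t(1) by simp
        have "ps ! l \<noteq> r" using psV[OF l3] rV by blast
        moreover have "j \<noteq> c" using True t(3) by blast
        moreover have "ps ! l = ps ! (k - 1) \<longleftrightarrow> l = k - 1" using psd[OF l3] k3 by simp
        moreover have "Suc k < 3 \<Longrightarrow> ps ! l = ps ! Suc k \<longleftrightarrow> l = Suc k" using psd[OF l3] by simp
        moreover have "T ! l = T ! (k - 1) \<longleftrightarrow> l = k - 1" using k l(1) t(2) by (simp add: nth_eq_iff_index_eq)
        moreover have "Suc k < length T \<Longrightarrow> T ! l = T ! Suc k \<longleftrightarrow> l = Suc k" using l(1) t(2) by (simp add: nth_eq_iff_index_eq)
        ultimately show ?thesis
          unfolding l(2) gT[OF l(1)] using k k3 l t(1) by auto
      next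
        case False
        have "g j \<in> V" using V[OF j False] gf[OF False] by simp
        then have gn: "g j \<noteq> ps ! l" if "l < 3" for l using psV[OF that] by metis
        have "g j \<noteq> ps ! (k - 1)" using gn[of "k - 1"] k3 by simp
        moreover have "Suc k < 3 \<Longrightarrow> g j \<noteq> ps ! Suc k" by (rule gn)
        moreover have "g j = r \<longleftrightarrow> j = c" using gf[OF False] c j f(1) by (auto dest: inj_onD)
        moreover have "j \<noteq> T ! (k - 1)" "Suc k < length T \<Longrightarrow> j \<noteq> T ! Suc k" using False k by auto
        ultimately show ?thesis using k k3 by auto
      qed
      also have "\<dots> \<longleftrightarrow> (T ! k, j) \<in> symcl F" using t(5)[OF k j] by simp
      finally show ?thesis .
    qed
    have F: "(i, j) \<in> symcl F \<longleftrightarrow> (i, j) \<in> F \<union> F\<inverse>" for i j unfolding symcl_def ..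
    consider k where "k < length T" "i = T ! k" | k where "k < length T" "j = T ! k" | "i \<notin> set T" "j \<notin> set T"
      by (metis in_set_conv_nth)
    then show ?thesis
    proof cases
      case (1 k)
      then show ?thesis using tj[OF 1(1) ij(2)] F by simp
    next
      case (2 k)
      have k3: "k < 3" using 2 t(1) by simp
      have "(g i, g j) \<in> E2 \<union> ?P \<longleftrightarrow> (g j, g i) \<in> E2 \<union> ?P"
        unfolding 2(2) gT[OF 2(1)] using sub psV[OF k3] Psym by blast
      also have "\<dots> \<longleftrightarrow> (j, i) \<in> symcl F" unfolding 2(2) by (rule tj[OF 2(1) ij(1)])
      finally show ?thesis unfolding symcl_def by blast
    next
      case 3
      have "f i \<in> V" "f j \<in> V" using V ij 3 by blast+
      moreover have "(f i, f j) \<notin> ?P" using PV calculation by blast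
      ultimately show ?thesis using gf[OF 3(1)] gf[OF 3(2)] E2[of "f i" "f j"] f(2)[OF ij] F[of i j] by simp
    qed
  qed
  ultimately show ?thesis unfolding emb_def by blast
qed

lemma emb_glue:
  assumes F: "tame n F" and e: "emb n F (E1 \<union> E2)"
    and V: "E1 \<subseteq> V1 \<times> V1" "E2 \<subseteq> V2 \<times> V2" "V1 \<inter> V2 = {r}" and ir: "(r, r) \<notin> E1 \<union> E2"
    and p: "distinct [p, q, s]" "p \<notin> V1" "q \<notin> V1" "s \<notin> V1"
    and p': "distinct [p', q', s']" "p' \<notin> V2" "q' \<notin> V2" "s' \<notin> V2"
  shows "emb n F (E1 \<union> path3 r p q s) \<or> emb n F (E2 \<union> path3 r p' q' s')"
proof -
  let ?E = "E1 \<union> E2"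
  obtain f where f: "inj_on f {..<n}" "\<And>i j. i < n \<Longrightarrow> j < n \<Longrightarrow> (f i, f j) \<in> ?E \<longleftrightarrow> (i, j) \<in> symcl F"
    using e unfolding emb_def symcl_def by blast
  have t: "F \<subseteq> {..<n} \<times> {..<n}" "{..<n} \<subseteq> Field F"
    "\<And>\<chi>. (\<forall>(i, j)\<in>F. \<chi> i = \<chi> j) \<Longrightarrow> (\<forall>i<n. \<chi> i) \<or> (\<forall>i<n. \<not> \<chi> i)"
    "\<And>c \<chi>. c < n \<Longrightarrow> (\<forall>(i, j)\<in>F. i \<noteq> c \<longrightarrow> j \<noteq> c \<longrightarrow> \<chi> i = \<chi> j) \<Longrightarrow>
        (\<exists>T. thin n F c T \<and> ((\<forall>i<n. i \<noteq> c \<longrightarrow> (\<chi> i \<longleftrightarrow> i \<in> set T)) \<or> (\<forall>i<n. i \<noteq> c \<longrightarrow> (\<not> \<chi> i \<longleftrightarrow> i \<in> set T))))"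
  proof -
    note F' = F[unfolded tame_def]
    show "F \<subseteq> {..<n} \<times> {..<n}" "{..<n} \<subseteq> Field F"
      by (rule F'[THEN conjunct1] F'[THEN conjunct2, THEN conjunct1])+
    show "\<And>\<chi>. (\<forall>(i, j)\<in>F. \<chi> i = \<chi> j) \<Longrightarrow> (\<forall>i<n. \<chi> i) \<or> (\<forall>i<n. \<not> \<chi> i)"
      using F'[THEN conjunct2, THEN conjunct2, THEN conjunct1] by simp
    show "\<And>c \<chi>. c < n \<Longrightarrow> (\<forall>(i, j)\<in>F. i \<noteq> c \<longrightarrow> j \<noteq> c \<longrightarrow> \<chi> i = \<chi> j) \<Longrightarrow>
        (\<exists>T. thin n F c T \<and> ((\<forall>i<n. i \<noteq> c \<longrightarrow> (\<chi> i \<longleftrightarrow> i \<in> set T)) \<or> (\<forall>i<n. i \<noteq> c \<longrightarrow> (\<not> \<chi> i \<longleftrightarrow> i \<in> set T))))"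
      using F'[THEN conjunct2, THEN conjunct2, THEN conjunct2] by simp
  qed
  have fV: "f i \<in> V1 \<or> f i \<in> V2" if "i < n" for i
  proof -
    have "i \<in> Field F" using t(2) that by blast
    then obtain j where "(i, j) \<in> symcl F" unfolding Field_def symcl_def by blast
    moreover have "j < n" using calculation t(1) unfolding symcl_def by blast
    ultimately have "(f i, f j) \<in> ?E" using f(2) that by blast
    then show ?thesis using V by blast
  qed
  define \<chi> where "\<chi> = (\<lambda>i. f i \<in> V1)"
  have e1: "(x, y) \<in> E1 \<longleftrightarrow> (x, y) \<in> ?E" if "x \<in> V1" "y \<in> V1" for x y
  proof -
    have "(x, y) \<notin> E2"
    proof
      assume xy: "(x, y) \<in> E2"
      then have "x \<in> {r}" "y \<in> {r}" unfolding V(3)[symmetric] using V(2) that by blast+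
      then show False using ir xy by simp
    qed
    then show ?thesis by blast
  qed
  have e2: "(x, y) \<in> E2 \<longleftrightarrow> (x, y) \<in> ?E" if "x \<in> V2" "y \<in> V2" for x y
  proof -
    have "(x, y) \<notin> E1"
    proof
      assume xy: "(x, y) \<in> E1"
      then have "x \<in> {r}" "y \<in> {r}" unfolding V(3)[symmetric] using V(1) that by blast+
      then show False using ir xy by simp
    qed
    then show ?thesis by blast
  qed
  have edge: "\<chi> i = \<chi> j" if "(i, j) \<in> F" "f i \<noteq> r" "f j \<noteq> r" for i j
  proof -
    have "i < n" "j < n" using t(1) that(1) by blast+
    then have "(f i, f j) \<in> ?E" using f(2) that(1) unfolding symcl_def by blast
    then show ?thesis unfolding \<chi>_def using V that(2,3) by blast
  qed
  have mono: "emb n F (E0 \<union> path3 r p q s)" if "\<And>i. i < n \<Longrightarrow> f i \<in> W"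
    "\<And>x y. x \<in> W \<Longrightarrow> y \<in> W \<Longrightarrow> (x, y) \<in> E0 \<longleftrightarrow> (x, y) \<in> ?E" "E0 \<subseteq> W \<times> W" "p \<notin> W" "q \<notin> W" "s \<notin> W" for E0 W p q s
  proof -
    have "(f i, f j) \<in> E0 \<union> path3 r p q s \<longleftrightarrow> (i, j) \<in> F \<union> F\<inverse>" if ij: "i < n" "j < n" for i j
    proof -
      have "f i \<in> W" "f j \<in> W" using \<open>\<And>i. i < n \<Longrightarrow> f i \<in> W\<close> ij by blast+
      moreover have "(f i, f j) \<notin> path3 r p q s"
        unfolding path3_def symcl_def using calculation \<open>p \<notin> W\<close> \<open>q \<notin> W\<close> \<open>s \<notin> W\<close> by auto
      ultimately show ?thesis
        using \<open>\<And>x y. x \<in> W \<Longrightarrow> y \<in> W \<Longrightarrow> (x, y) \<in> E0 \<longleftrightarrow> (x, y) \<in> ?E\<close>[of "f i" "f j"] f(2)[OF ij] unfolding symcl_def by blast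
    qed
    then show ?thesis unfolding emb_def using f(1) by blast
  qed
  show ?thesis
  proof (cases "\<exists>c<n. f c = r")
    case False
    then have "(\<forall>i<n. \<chi> i) \<or> (\<forall>i<n. \<not> \<chi> i)" using edge t(1) by (intro t(3)) blast
    then show ?thesis
    proof
      assume "\<forall>i<n. \<chi> i"
      then show ?thesis using mono[of V1 E1 p q s] e1 V(1) p unfolding \<chi>_def by blast
    next
      assume "\<forall>i<n. \<not> \<chi> i"
      then have "f i \<in> V2" if "i < n" for i using fV[OF that] that unfolding \<chi>_def by blast
      then show ?thesis using mono[of V2 E2 p' q' s'] e2 V(2) p' by blast
    qed
  next
    case True
    then obtain c where c: "c < n" "f c = r" by blast
    have nr: "f i \<noteq> r" if "i < n" "i \<noteq> c" for i using f(1) c that by (auto dest: inj_onD)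
    have "\<forall>(i, j)\<in>F. i \<noteq> c \<longrightarrow> j \<noteq> c \<longrightarrow> \<chi> i = \<chi> j" using edge nr t(1) by blast
    from t(4)[OF c(1) this] obtain T where T: "thin n F c T"
      "(\<forall>i<n. i \<noteq> c \<longrightarrow> (\<chi> i \<longleftrightarrow> i \<in> set T)) \<or> (\<forall>i<n. i \<noteq> c \<longrightarrow> (\<not> \<chi> i \<longleftrightarrow> i \<in> set T))" by blast
    have r12: "r \<in> V1" "r \<in> V2" using V by blast+
    from T(2) show ?thesis
    proof
      assume a: "\<forall>i<n. i \<noteq> c \<longrightarrow> (\<chi> i \<longleftrightarrow> i \<in> set T)"
      have "f i \<in> V2" if "i < n" "i \<notin> set T" for i
        using a that fV[OF that(1)] c r12 unfolding \<chi>_def by (cases "i = c") auto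
      then have "emb n F (E2 \<union> path3 r p' q' s')"
        using emb_glue_aux[OF f T(1) c, of V2 E2 p' q' s'] e2 V(2) p' by blast
      then show ?thesis ..
    next
      assume a: "\<forall>i<n. i \<noteq> c \<longrightarrow> (\<not> \<chi> i \<longleftrightarrow> i \<in> set T)"
      have "f i \<in> V1" if "i < n" "i \<notin> set T" for i
        using a that c r12 unfolding \<chi>_def by (cases "i = c") auto
      then have "emb n F (E1 \<union> path3 r p q s)"
        using emb_glue_aux[OF f T(1) c, of V1 E1 p q s] e1 V(1) p by blast
      then show ?thesis ..
    qed
  qed
qed

lemma tame_cycle:
  assumes n: "3 \<le> n"
  shows "tame n (cycle_edges n)"
proof -
  have rot: "\<chi> ((c + 1 + k) mod n) = \<chi> ((c + 1) mod n)"
    if e: "\<forall>(i, j)\<in>cycle_edges n. i \<noteq> c \<longrightarrow> j \<noteq> c \<longrightarrow> \<chi> i = \<chi> j" and c: "c < n" and k: "k < n - 1" for c \<chi> k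
    using k
  proof (induction k)
    case 0
    then show ?case by simp
  next
    case (Suc k)
    let ?i = "(c + 1 + k) mod n"
    have ne: "(c + 1 + l) mod n \<noteq> c" if "l < n - 1" for l
    proof (cases "c + 1 + l < n")
      case True
      then show ?thesis by simp
    next
      case False
      then have "(c + 1 + l) mod n = c + 1 + l - n" using c that by (simp add: le_mod_geq)
      then show ?thesis using that False by linarith
    qed
    have s: "(c + 1 + Suc k) mod n = (?i + 1) mod n" by (simp add: mod_Suc_eq)
    have "(?i, (?i + 1) mod n) \<in> cycle_edges n" using n unfolding cycle_edges_def by auto
    then have "\<chi> ?i = \<chi> ((?i + 1) mod n)" using e ne[of k] ne[of "Suc k"] Suc(2) unfolding s[symmetric] by fastforce
    then show ?case using Suc s by simp
  qed
  have rep: "\<exists>k<n - 1. i = (c + 1 + k) mod n" if "i < n" "c < n" "i \<noteq> c" for i c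
  proof (cases "i > c")
    case True
    then show ?thesis using that by (intro exI[of _ "i - c - 1"]) auto
  next
    case False
    have "c + 1 + (i + n - c - 1) = i + n" using that by simp
    then have "(c + 1 + (i + n - c - 1)) mod n = i" using that by simp
    then show ?thesis using that False by (intro exI[of _ "i + n - c - 1"]) auto
  qed
  have const: "\<chi> i = \<chi> ((c + 1) mod n)"
    if "\<forall>(i, j)\<in>cycle_edges n. i \<noteq> c \<longrightarrow> j \<noteq> c \<longrightarrow> \<chi> i = \<chi> j" "c < n" "i < n" "i \<noteq> c" for c \<chi> i
    using rep[OF that(3,2,4)] rot[OF that(1,2)] by blast
  show ?thesis
    unfolding tame_def
  proof (intro conjI allI impI)
    show "cycle_edges n \<subseteq> {..<n} \<times> {..<n}" using n unfolding cycle_edges_def by auto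
    show "{..<n} \<subseteq> Field (cycle_edges n)" unfolding cycle_edges_def Field_def by auto
  next
    fix \<chi> :: "nat \<Rightarrow> bool" assume a: "\<forall>(i, j)\<in>cycle_edges n. \<chi> i = \<chi> j"
    have "(0, 1 mod n) \<in> cycle_edges n" using n unfolding cycle_edges_def by force
    then have "\<chi> 0 = \<chi> (1 mod n)" using a by blast
    then have "\<chi> i = \<chi> (1 mod n)" if "i < n" for i
      using const[of 0 \<chi> i] a that n by (cases "i = 0") auto
    then show "(\<forall>i<n. \<chi> i) \<or> (\<forall>i<n. \<not> \<chi> i)" by blast
  next
    fix c and \<chi> :: "nat \<Rightarrow> bool" assume c: "c < n" and a: "\<forall>(i, j)\<in>cycle_edges n. i \<noteq> c \<longrightarrow> j \<noteq> c \<longrightarrow> \<chi> i = \<chi> j"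
    then have "(\<forall>i<n. i \<noteq> c \<longrightarrow> (\<chi> i \<longleftrightarrow> i \<in> set [])) \<or> (\<forall>i<n. i \<noteq> c \<longrightarrow> (\<not> \<chi> i \<longleftrightarrow> i \<in> set []))"
      using const[OF a c] by auto
    then show "\<exists>T. thin n (cycle_edges n) c T \<and> ((\<forall>i<n. i \<noteq> c \<longrightarrow> (\<chi> i \<longleftrightarrow> i \<in> set T)) \<or> (\<forall>i<n. i \<noteq> c \<longrightarrow> (\<not> \<chi> i \<longleftrightarrow> i \<in> set T)))"
      using thin_Nil by blast
  qed
qed

lemma tameI:
  assumes "F \<subseteq> {..<n} \<times> {..<n}" "{..<n} \<subseteq> Field F"
    "\<And>\<chi>. (\<forall>(i, j)\<in>F. \<chi> i = \<chi> j) \<Longrightarrow> (\<forall>i<n. \<chi> i) \<or> (\<forall>i<n. \<not> \<chi> i)"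
    "\<forall>c<n. \<forall>T\<in>set (cand c). thin n F c T"
    "\<And>\<chi>. \<forall>c<n. (\<forall>(i, j)\<in>F. i \<noteq> c \<longrightarrow> j \<noteq> c \<longrightarrow> \<chi> i = \<chi> j) \<longrightarrow>
       (\<exists>T\<in>set ([] # cand c). (\<forall>i<n. i \<noteq> c \<longrightarrow> (\<chi> i \<longleftrightarrow> i \<in> set T)) \<or> (\<forall>i<n. i \<noteq> c \<longrightarrow> (\<not> \<chi> i \<longleftrightarrow> i \<in> set T)))"
  shows "tame n F"
  unfolding tame_def
proof (intro conjI allI impI assms(1-3))
  fix c and \<chi> :: "nat \<Rightarrow> bool" assume c: "c < n" and "\<forall>(i, j)\<in>F. i \<noteq> c \<longrightarrow> j \<noteq> c \<longrightarrow> \<chi> i = \<chi> j"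
  with assms(5) obtain T where T: "T \<in> set ([] # cand c)"
    "(\<forall>i<n. i \<noteq> c \<longrightarrow> (\<chi> i \<longleftrightarrow> i \<in> set T)) \<or> (\<forall>i<n. i \<noteq> c \<longrightarrow> (\<not> \<chi> i \<longleftrightarrow> i \<in> set T))" by blast
  have "thin n F c T" using T(1) assms(4) c thin_Nil by auto
  then show "\<exists>T. thin n F c T \<and> ((\<forall>i<n. i \<noteq> c \<longrightarrow> (\<chi> i \<longleftrightarrow> i \<in> set T)) \<or> (\<forall>i<n. i \<noteq> c \<longrightarrow> (\<not> \<chi> i \<longleftrightarrow> i \<in> set T)))"
    using T(2) by blast
qed

lemma all_less_small: "(\<forall>i<Suc 0. P i) \<longleftrightarrow> P 0" "(\<forall>i<Suc (Suc 0). P i) \<longleftrightarrow> P 0 \<and> P 1"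
  "(\<forall>i<Suc (Suc (Suc 0)). P i) \<longleftrightarrow> P 0 \<and> P 1 \<and> P (2::nat)"
  by (auto simp: less_Suc_eq numeral_2_eq_2)

lemma tame_S333: "tame 10 S333_edges"
  apply (rule tameI[where cand = "\<lambda>c. if c = 0 then [[1, 2, 3], [4, 5, 6], [7, 8, 9]] else if c = 1 then [[2, 3]]
    else if c = 2 then [[3]] else if c = 4 then [[5, 6]] else if c = 5 then [[6]] else if c = 7 then [[8, 9]]
    else if c = 8 then [[9]] else []"])
  subgoal by (simp add: less_10)
  subgoal by (simp add: less_10 Field_def Domain.simps Range.simps)
  subgoal unfolding all_less_numerals by auto
  subgoal unfolding all_less_numerals thin_def symcl_iff by (simp add: all_less_small less_10)
  subgoal unfolding all_less_numerals by simp blast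
  done

lemma tame_C6_3c: "tame 9 C6_3c_edges"
  apply (rule tameI[where cand = "\<lambda>c. if c = 0 then [[6]] else if c = 1 then [[7]] else if c = 2 then [[8]] else []"])
  subgoal by (simp add: less_9 cycle_edges_6)
  subgoal by (simp add: less_9 cycle_edges_6 Field_def Domain.simps Range.simps)
  subgoal unfolding all_less_numerals cycle_edges_6 by auto
  subgoal unfolding all_less_numerals thin_def symcl_iff cycle_edges_6 by (simp add: all_less_small less_9)
  subgoal unfolding all_less_numerals cycle_edges_6 by simp blast
  done

lemma tame_C6_3nc: "tame 9 C6_3nc_edges"
  apply (rule tameI[where cand = "\<lambda>c. if c = 0 then [[6]] else if c = 2 then [[7]] else if c = 4 then [[8]] else []"])
  subgoal by (simp add: less_9 cycle_edges_6)
  subgoal by (simp add: less_9 cycle_edges_6 Field_def Domain.simps Range.simps)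
  subgoal unfolding all_less_numerals cycle_edges_6 by auto
  subgoal unfolding all_less_numerals thin_def symcl_iff cycle_edges_6 by (simp add: all_less_small less_9)
  subgoal unfolding all_less_numerals cycle_edges_6 by simp blast
  done

lemma tame_C6_2l2: "tame 10 C6_2l2_edges"
  apply (rule tameI[where cand = "\<lambda>c. if c = 0 then [[6, 7]] else if c = 1 then [[8, 9]] else if c = 6 then [[7]]
    else if c = 8 then [[9]] else []"])
  subgoal by (simp add: less_10 cycle_edges_6)
  subgoal by (simp add: less_10 cycle_edges_6 Field_def Domain.simps Range.simps)
  subgoal unfolding all_less_numerals cycle_edges_6 by auto
  subgoal unfolding all_less_numerals thin_def symcl_iff cycle_edges_6 by (simp add: all_less_small less_10)
  subgoal unfolding all_less_numerals cycle_edges_6 by simp blast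
  done

lemma Xfree_glue:
  assumes X: "Xfree (E1 \<union> path3 r p q s)" "Xfree (E2 \<union> path3 r p' q' s')"
    and V: "E1 \<subseteq> V1 \<times> V1" "E2 \<subseteq> V2 \<times> V2" "V1 \<inter> V2 = {r}" "(r, r) \<notin> E1 \<union> E2"
      "distinct [p, q, s]" "p \<notin> V1" "q \<notin> V1" "s \<notin> V1" "distinct [p', q', s']" "p' \<notin> V2" "q' \<notin> V2" "s' \<notin> V2"
  shows "Xfree (E1 \<union> E2)"
proof -
  have g: "\<not> emb n F (E1 \<union> E2)" if "tame n F" "\<not> emb n F (E1 \<union> path3 r p q s)" "\<not> emb n F (E2 \<union> path3 r p' q' s')" for n F
    using emb_glue[OF that(1) _ V] that(2,3) by blast
  show ?thesis
    using X unfolding Xfree_def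
    by (intro conjI allI impI g tame_cycle tame_S333 tame_C6_3c tame_C6_3nc tame_C6_2l2) blast+
qed

text \<open>\<open>aug\<close> adds paths of length 3 at the two gluing vertices. They stand in for the other blocks: a
  forbidden graph reaches across a gluing vertex only with such a path on one of the sides.\<close>

definition tail_path :: "'v \<Rightarrow> bool \<Rightarrow> ('v + bool \<times> nat) rel" where
  "tail_path a s = path3 (Inl a) (Inr (s, 1)) (Inr (s, 2)) (Inr (s, 3))"

definition aug :: "'v rel \<Rightarrow> 'v \<Rightarrow> 'v \<Rightarrow> ('v + bool \<times> nat) rel" where
  "aug E a b = map_prod Inl Inl ` E \<union> tail_path a False \<union> tail_path b True"

definition fit :: "'v set \<Rightarrow> 'v rel \<Rightarrow> 'v \<Rightarrow> 'v \<Rightarrow> bool" where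
  "fit V E a b \<longleftrightarrow> E \<subseteq> V \<times> V \<and> a \<in> V \<and> b \<in> V \<and> (\<forall>x. (x, x) \<notin> E) \<and>
     (\<forall>x y. (x, y) \<in> E \<longrightarrow> (y, x) \<in> E) \<and> Xfree (aug E a b)"

lemma fitD:
  assumes "fit V E a b"
  shows "E \<subseteq> V \<times> V" "a \<in> V" "b \<in> V" "(x, x) \<notin> E" "(x, y) \<in> E \<Longrightarrow> (y, x) \<in> E" "Xfree (aug E a b)"
  using assms unfolding fit_def by simp_all

lemma fitI:
  assumes "E \<subseteq> V \<times> V" "a \<in> V" "b \<in> V" "\<And>x. (x, x) \<notin> E" "\<And>x y. (x, y) \<in> E \<Longrightarrow> (y, x) \<in> E" "Xfree (aug E a b)"
  shows "fit V E a b"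
  using assms unfolding fit_def by simp

lemma fit_glue:
  assumes 1: "fit V1 E1 a b" and 2: "fit V2 E2 b c" and V: "V1 \<inter> V2 = {b}"
  shows "fit (V1 \<union> V2) (E1 \<union> E2) a c"
proof -
  let ?I = "\<lambda>E. map_prod Inl Inl ` E :: ('a + bool \<times> nat) rel"
  let ?E1 = "?I E1 \<union> tail_path a False" and ?E2 = "?I E2 \<union> tail_path c True"
  let ?V1 = "Inl ` V1 \<union> Inr ` ({False} \<times> {1, 2, 3})" and ?V2 = "Inl ` V2 \<union> Inr ` ({True} \<times> {1, 2, 3})"
  have e: "E1 \<subseteq> V1 \<times> V1" "E2 \<subseteq> V2 \<times> V2" "a \<in> V1" "c \<in> V2" "\<And>x. (x, x) \<notin> E1" "\<And>x. (x, x) \<notin> E2"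
    using fitD(1-4)[OF 1] fitD(1-4)[OF 2] by simp_all
  have x: "Xfree (?E1 \<union> tail_path b True)" "Xfree (?E2 \<union> tail_path b False)"
    using fitD(6)[OF 1] fitD(6)[OF 2] unfolding aug_def by (simp_all add: Un_ac)
  have "Xfree (?E1 \<union> ?E2)"
  proof (rule Xfree_glue[OF x[unfolded tail_path_def[of b]], of ?V1 ?V2])
    have I: "?I E \<subseteq> Inl ` V \<times> Inl ` V" if "E \<subseteq> V \<times> V" for E V using that by auto
    have t: "tail_path x s \<subseteq> insert (Inl x) (Inr ` ({s} \<times> {1, 2, 3})) \<times> insert (Inl x) (Inr ` ({s} \<times> {1, 2, 3}))"
      for x :: 'a and s unfolding tail_path_def path3_def by (rule subrelI) (auto simp: symcl_iff)
    show "?E1 \<subseteq> ?V1 \<times> ?V1" using I[OF e(1)] t[of a False] e(3) by blast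
    show "?E2 \<subseteq> ?V2 \<times> ?V2" using I[OF e(2)] t[of c True] e(4) by blast
    show "?V1 \<inter> ?V2 = {Inl b}" using V by auto
    have "(Inl b, Inl b) \<notin> ?I E1" "(Inl b, Inl b) \<notin> ?I E2" using e(5,6)[of b] by auto
    then show "(Inl b, Inl b) \<notin> ?E1 \<union> ?E2" unfolding tail_path_def path3_def symcl_def by simp
  qed (simp_all add: image_iff)
  then have "Xfree (aug (E1 \<union> E2) a c)" unfolding aug_def by (simp add: image_Un Un_ac)
  then show ?thesis
    by (intro fitI) (use e fitD(5)[OF 1] fitD(5)[OF 2] in auto)
qed

lemma Xfree_image:
  assumes X: "Xfree E" and i: "inj_on \<Phi> (Field E)"
  shows "Xfree (map_prod \<Phi> \<Phi> ` E)"
proof (rule Xfree_embed[OF X])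
  let ?g = "inv_into (Field E) \<Phi>"
  have F: "Field (map_prod \<Phi> \<Phi> ` E) \<subseteq> \<Phi> ` Field E" unfolding Field_def by force
  show "inj_on ?g (Field (map_prod \<Phi> \<Phi> ` E))" by (rule inj_on_inv_into[OF F])
  fix x y assume "x \<in> Field (map_prod \<Phi> \<Phi> ` E)" "y \<in> Field (map_prod \<Phi> \<Phi> ` E)"
  then obtain x' y' where xy: "x' \<in> Field E" "x = \<Phi> x'" "y' \<in> Field E" "y = \<Phi> y'" using F by blast
  have "(\<Phi> x', \<Phi> y') \<in> map_prod \<Phi> \<Phi> ` E \<longleftrightarrow> (x', y') \<in> E"
  proof
    assume "(\<Phi> x', \<Phi> y') \<in> map_prod \<Phi> \<Phi> ` E"
    then obtain u v where uv: "(u, v) \<in> E" "\<Phi> x' = \<Phi> u" "\<Phi> y' = \<Phi> v" by auto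
    then have "u \<in> Field E" "v \<in> Field E" by (auto simp: Field_def)
    then have "x' = u" "y' = v" using inj_onD[OF i uv(2)] inj_onD[OF i uv(3)] xy by blast+
    then show "(x', y') \<in> E" using uv by simp
  qed force
  then show "((?g x, ?g y) \<in> E) = ((x, y) \<in> map_prod \<Phi> \<Phi> ` E)"
    unfolding xy(2,4) inv_into_f_f[OF i xy(1)] inv_into_f_f[OF i xy(3)] by simp
qed

lemma Field_aug: "E \<subseteq> V \<times> V \<Longrightarrow> a \<in> V \<Longrightarrow> b \<in> V \<Longrightarrow>
    Field (aug E a b) \<subseteq> Inl ` V \<union> {Inr (s, k) | s k. k \<in> {1, 2, 3}}"
  unfolding aug_def tail_path_def path3_def symcl_def Field_def by auto

lemma fit_map:
  assumes 1: "fit V E a b" and i: "inj_on \<phi> V"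
  shows "fit (\<phi> ` V) (map_prod \<phi> \<phi> ` E) (\<phi> a) (\<phi> b)"
proof -
  have f: "E \<subseteq> V \<times> V" "a \<in> V" "b \<in> V" "\<And>x. (x, x) \<notin> E" "\<And>x y. (x, y) \<in> E \<Longrightarrow> (y, x) \<in> E" "Xfree (aug E a b)"
    using fitD(1-3,6)[OF 1] fitD(4,5)[OF 1] by blast+
  let ?\<Phi> = "map_sum \<phi> id :: 'a + bool \<times> nat \<Rightarrow> _"
  have inj: "inj_on ?\<Phi> (Field (aug E a b))"
  proof (rule inj_onI)
    fix x y assume xy: "x \<in> Field (aug E a b)" "y \<in> Field (aug E a b)" "?\<Phi> x = ?\<Phi> y"
    have V: "u \<in> V" if "Inl u \<in> Field (aug E a b)" for u using subsetD[OF Field_aug[OF f(1-3)] that] by auto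
    show "x = y"
    proof (cases x)
      case (Inl u)
      then obtain v where v: "y = Inl v" "\<phi> u = \<phi> v" using xy(3) by (cases y) simp_all
      have "u = v" by (rule inj_onD[OF i v(2)]) (use V xy Inl v in simp_all)
      then show ?thesis using Inl v by simp
    next
      case (Inr p)
      then show ?thesis using xy(3) by (cases y) simp_all
    qed
  qed
  have t: "map_prod ?\<Phi> ?\<Phi> ` tail_path x s = tail_path (\<phi> x) s" for x s
    unfolding tail_path_def path3_def map_prod_symcl by simp
  have "map_prod ?\<Phi> ?\<Phi> ` aug E a b = aug (map_prod \<phi> \<phi> ` E) (\<phi> a) (\<phi> b)"
    unfolding aug_def image_Un t by (simp add: image_image map_prod_def case_prod_unfold)
  with Xfree_image[OF f(6) inj] have "Xfree (aug (map_prod \<phi> \<phi> ` E) (\<phi> a) (\<phi> b))" by simp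
  moreover have "(x, x) \<notin> map_prod \<phi> \<phi> ` E" for x
  proof
    assume "(x, x) \<in> map_prod \<phi> \<phi> ` E"
    then obtain u v where "(u, v) \<in> E" "\<phi> u = \<phi> v" by auto
    then show False using inj_onD[OF i, of u v] subsetD[OF f(1), of "(u, v)"] f(4)[of u] by auto
  qed
  moreover have "(y, x) \<in> map_prod \<phi> \<phi> ` E" if xy: "(x, y) \<in> map_prod \<phi> \<phi> ` E" for x y
  proof -
    from xy obtain u v where "(u, v) \<in> E" "x = \<phi> u" "y = \<phi> v" by auto
    then show ?thesis using f(5)[of u v] by force
  qed
  moreover have "map_prod \<phi> \<phi> ` E \<subseteq> \<phi> ` V \<times> \<phi> ` V" using f(1) by auto
  ultimately show ?thesis by (intro fitI imageI f(2,3))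
qed

lemma fit_Xfree: "fit V E a b \<Longrightarrow> Xfree E"
proof -
  assume "fit V E a b"
  then have "Xfree (aug E a b)" unfolding fit_def by blast
  then show "Xfree E"
    by (rule Xfree_embed[where \<phi> = Inl])
      (auto simp: aug_def tail_path_def path3_def symcl_def inj_on_def)
qed

section \<open>Trees with a dominating path\<close>

text \<open>\<open>layered E h par \<iota>\<close>: the vertices with \<open>h = 0\<close> lie on a path, with positions \<open>\<iota>\<close>, and the others
  form trees of height at most 2 over it.\<close>

definition layered :: "'v rel \<Rightarrow> ('v \<Rightarrow> nat) \<Rightarrow> ('v \<Rightarrow> 'v) \<Rightarrow> ('v \<Rightarrow> nat) \<Rightarrow> bool" where
  "layered E h par \<iota> \<longleftrightarrow> (\<forall>x y. (x, y) \<in> E \<longrightarrow> (y, x) \<in> E) \<and>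
     (\<forall>x y. (x, y) \<in> E \<longrightarrow> (h x = 0 \<and> h y = 0 \<and> (\<iota> x = Suc (\<iota> y) \<or> \<iota> y = Suc (\<iota> x))) \<or>
        (h x = Suc (h y) \<and> y = par x) \<or> (h y = Suc (h x) \<and> x = par y)) \<and>
     (\<forall>x\<in>Field E. h x \<le> 2) \<and>
     (\<forall>x\<in>Field E. \<forall>y\<in>Field E. h x = 0 \<longrightarrow> h y = 0 \<longrightarrow> \<iota> x = \<iota> y \<longrightarrow> x = y)"

lemma embE:
  assumes "emb n F E"
  obtains f where "inj_on f {..<n}" "\<And>i j. i < n \<Longrightarrow> j < n \<Longrightarrow> (f i, f j) \<in> E \<longleftrightarrow> (i, j) \<in> F \<union> F\<inverse>"
  using assms unfolding emb_def by blast

lemma layered_Xfree: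
  assumes "layered E h par \<iota>"
  shows "Xfree E"
proof -
  note L = assms[unfolded layered_def]
  have sym: "(y, x) \<in> E" if "(x, y) \<in> E" for x y using L that by blast
  have ed: "(h x = 0 \<and> h y = 0 \<and> (\<iota> x = Suc (\<iota> y) \<or> \<iota> y = Suc (\<iota> x))) \<or>
        (h x = Suc (h y) \<and> y = par x) \<or> (h y = Suc (h x) \<and> x = par y)" if "(x, y) \<in> E" for x y
    using L that by blast
  have h2: "h y \<le> 2" if "(x, y) \<in> E" for x y
    using L[THEN conjunct2, THEN conjunct2, THEN conjunct1] FieldI2[OF that] by blast
  have \<iota>: "x = y" if "(x, u) \<in> E" "(y, v) \<in> E" "h x = 0" "h y = 0" "\<iota> x = \<iota> y" for x y u v
  proof -
    have "x \<in> Field E" "y \<in> Field E" using that(1,2) by (simp_all add: FieldI1)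
    then show ?thesis using L[THEN conjunct2, THEN conjunct2, THEN conjunct2] that(3-5) by blast
  qed
  have nocyc: False if f: "inj_on f {..<n}" "3 \<le> n" "\<And>i. i < n \<Longrightarrow> (f i, f (Suc i mod n)) \<in> E" for f and n :: nat
  proof -
    obtain v x y where v: "(v, x) \<in> E" "(v, y) \<in> E" "x \<noteq> y" "h x \<le> h v" "h y \<le> h v" "\<forall>w\<in>f ` {..<n}. h w \<le> h v"
      using cycle_max[OF f(1,2,3) sym, of h] by blast
    have "h v = 0"
    proof (rule ccontr)
      assume "h v \<noteq> 0"
      moreover have "h x \<noteq> Suc (h v)" "h y \<noteq> Suc (h v)" using v(4,5) by simp_all
      ultimately have "x = par v" "y = par v" using ed[OF v(1)] ed[OF v(2)] by metis+
      then show False using v(3) by simp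
    qed
    then have h0: "h w = 0" if "w \<in> f ` {..<n}" for w using v(6) that by auto
    obtain u x y where u: "u \<in> f ` {..<n}" "(u, x) \<in> E" "(u, y) \<in> E" "x \<noteq> y" "\<iota> x \<le> \<iota> u" "\<iota> y \<le> \<iota> u"
      "x \<in> f ` {..<n}" "y \<in> f ` {..<n}"
      using cycle_max[OF f(1,2,3) sym, of \<iota>] by blast
    have "\<iota> u = Suc (\<iota> x)" "\<iota> u = Suc (\<iota> y)" using ed[OF u(2)] ed[OF u(3)] h0 u by auto
    then show False using \<iota>[OF sym[OF u(2)] sym[OF u(3)]] h0 u(4,7,8) by simp
  qed
  have c6: False if t: "emb n F E" "cycle_edges 6 \<subseteq> F" "6 \<le> n" for n F
  proof -
    obtain f where f: "inj_on f {..<n}" "\<And>i j. i < n \<Longrightarrow> j < n \<Longrightarrow> (f i, f j) \<in> E \<longleftrightarrow> (i, j) \<in> F \<union> F\<inverse>"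
      using t(1) unfolding emb_def by blast
    show False
    proof (rule nocyc[of f 6])
      show "inj_on f {..<6}" using f(1) t(3) by (auto intro: inj_on_subset)
      fix i :: nat assume i: "i < 6"
      then have "(i, Suc i mod 6) \<in> F" using t(2) unfolding cycle_edges_def by auto
      then show "(f i, f (Suc i mod 6)) \<in> E" using f(2)[of i "Suc i mod 6"] i t(3) by auto
    qed simp
  qed
  have cyc: False if t: "emb n (cycle_edges n) E" "3 \<le> n" for n
  proof -
    obtain f where f: "inj_on f {..<n}" "\<And>i j. i < n \<Longrightarrow> j < n \<Longrightarrow> (f i, f j) \<in> E \<longleftrightarrow> (i, j) \<in> cycle_edges n \<union> (cycle_edges n)\<inverse>"
      using t(1) unfolding emb_def by blast
    show False
    proof (rule nocyc[OF f(1) t(2)])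
      fix i assume i: "i < n"
      then have "(i, Suc i mod n) \<in> cycle_edges n" unfolding cycle_edges_def by auto
      then show "(f i, f (Suc i mod n)) \<in> E" using f(2)[of i "Suc i mod n"] i t(2) by auto
    qed
  qed
  have "\<not> emb 10 S333_edges E"
  proof
    assume "emb 10 S333_edges E"
    then obtain f where f: "inj_on f {..<10}" "\<And>i j. i < 10 \<Longrightarrow> j < 10 \<Longrightarrow> (f i, f j) \<in> E \<longleftrightarrow> (i, j) \<in> S333_edges \<union> S333_edges\<inverse>"
      by (rule embE) (rule that)
    have leg: "h a = 0 \<and> h c = 0 \<and> (\<iota> a = Suc (\<iota> c) \<or> \<iota> c = Suc (\<iota> a)) \<or> h c \<noteq> 0 \<and> a = par c"
      if l: "(c, a) \<in> E" "(a, b) \<in> E" "(b, d) \<in> E" "b \<noteq> c" "d \<noteq> a" for c a b d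
    proof (rule ccontr)
      assume n: "\<not> ?thesis"
      have 1: "h a = Suc (h c)" "c = par a" using n ed[OF l(1)] by auto
      then have 2: "h b = Suc (h a)" "a = par b" using ed[OF l(2)] l(4) by auto
      then have "h d = Suc (h b)" using ed[OF l(3)] l(5) 1 by auto
      then show False using 1 2 h2[OF l(3)] by simp
    qed
    have ne: "f i \<noteq> f j" if "i < 10" "j < 10" "i \<noteq> j" for i j using f(1) that by (auto dest: inj_onD)
    have e: "(f 0, f 1) \<in> E" "(f 1, f 2) \<in> E" "(f 2, f 3) \<in> E" "(f 0, f 4) \<in> E" "(f 4, f 5) \<in> E" "(f 5, f 6) \<in> E"
       "(f 0, f 7) \<in> E" "(f 7, f 8) \<in> E" "(f 8, f 9) \<in> E" using f(2) by simp_all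
    have L: "h (f i) = 0 \<and> h (f 0) = 0 \<and> (\<iota> (f i) = Suc (\<iota> (f 0)) \<or> \<iota> (f 0) = Suc (\<iota> (f i))) \<or> h (f 0) \<noteq> 0 \<and> f i = par (f 0)"
      if "i = 1 \<or> i = 4 \<or> i = 7" for i
    proof -
      have "f 2 \<noteq> f 0" "f 3 \<noteq> f 1" "f 5 \<noteq> f 0" "f 6 \<noteq> f 4" "f 8 \<noteq> f 0" "f 9 \<noteq> f 7" using ne by simp_all
      then show ?thesis using that leg[OF e(1-3)] leg[OF e(4-6)] leg[OF e(7-9)] by (elim disjE) simp_all
    qed
    have i: "f i = f j" if "h (f i) = 0" "h (f j) = 0" "\<iota> (f i) = \<iota> (f j)" "i = 1 \<or> i = 4 \<or> i = 7" "j = 1 \<or> j = 4 \<or> j = 7" for i j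
    proof -
      have "(f i, f 0) \<in> E" "(f j, f 0) \<in> E" using that(4,5) sym[OF e(1)] sym[OF e(4)] sym[OF e(7)] by auto
      then show ?thesis using \<iota> that(1-3) by blast
    qed
    have n3: "f 1 \<noteq> f 4" "f 1 \<noteq> f 7" "f 4 \<noteq> f 7" using ne by simp_all
    show False
    proof (cases "h (f 0) = 0")
      case True
      then have "h (f i) = 0 \<and> (\<iota> (f i) = Suc (\<iota> (f 0)) \<or> \<iota> (f 0) = Suc (\<iota> (f i)))" if "i = 1 \<or> i = 4 \<or> i = 7" for i
        using L[OF that] by blast
      note z = this
      have h: "h (f 1) = 0" "h (f 4) = 0" "h (f 7) = 0" using z by simp_all
      have "\<iota> (f 1) \<noteq> \<iota> (f 4)" "\<iota> (f 1) \<noteq> \<iota> (f 7)" "\<iota> (f 4) \<noteq> \<iota> (f 7)"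
        using i[OF h(1,2)] i[OF h(1,3)] i[OF h(2,3)] n3 by blast+
      moreover have "\<iota> (f 1) = Suc (\<iota> (f 0)) \<or> \<iota> (f 0) = Suc (\<iota> (f 1))" "\<iota> (f 4) = Suc (\<iota> (f 0)) \<or> \<iota> (f 0) = Suc (\<iota> (f 4))"
        "\<iota> (f 7) = Suc (\<iota> (f 0)) \<or> \<iota> (f 0) = Suc (\<iota> (f 7))" using z by simp_all
      ultimately show False by linarith
    next
      case False
      then show False using L[of 1] L[of 4] n3(1) by simp
    qed
  qed
  then show ?thesis unfolding Xfree_def using cyc c6[of 9 C6_3c_edges] c6[of 9 C6_3nc_edges] c6[of 10 C6_2l2_edges] by auto
qed

lemma layered_fit:
  assumes L: "layered E h par \<iota>" and V: "E \<subseteq> V \<times> V" "a \<in> V" "b \<in> V"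
    and core: "\<And>x y. x \<in> V \<Longrightarrow> y \<in> V \<Longrightarrow> h x = 0 \<Longrightarrow> h y = 0 \<Longrightarrow> \<iota> x = \<iota> y \<Longrightarrow> x = y"
    and ab: "h a = 0" "h b = 0" "\<iota> a = 0" "\<And>x. x \<in> V \<Longrightarrow> h x = 0 \<Longrightarrow> \<iota> x \<le> \<iota> b"
  shows "fit V E a b"
proof -
  note LL = L[unfolded layered_def]
  have sym: "(y, x) \<in> E" if "(x, y) \<in> E" for x y using LL[THEN conjunct1] that by blast
  have ed: "(h x = 0 \<and> h y = 0 \<and> (\<iota> x = Suc (\<iota> y) \<or> \<iota> y = Suc (\<iota> x))) \<or>
        (h x = Suc (h y) \<and> y = par x) \<or> (h y = Suc (h x) \<and> x = par y)" if "(x, y) \<in> E" for x y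
    using LL[THEN conjunct2, THEN conjunct1] that by blast
  have h2: "h x \<le> 2" "h y \<le> 2" if "(x, y) \<in> E" for x y
    using L[unfolded layered_def, THEN conjunct2, THEN conjunct2, THEN conjunct1] FieldI1[OF that] FieldI2[OF that] by blast+
  define h' :: "'a + bool \<times> nat \<Rightarrow> nat" where "h' = case_sum h (\<lambda>_. 0)"
  define par' :: "'a + bool \<times> nat \<Rightarrow> 'a + bool \<times> nat" where "par' = case_sum (\<lambda>x. Inl (par x)) Inr"
  define \<iota>' :: "'a + bool \<times> nat \<Rightarrow> nat" where "\<iota>' = case_sum (\<lambda>x. \<iota> x + 3) (\<lambda>p. if fst p then \<iota> b + 3 + snd p else 3 - snd p)"
  have s: "h' (Inl x) = h x" "h' (Inr p) = 0" "par' (Inl x) = Inl (par x)" "\<iota>' (Inl x) = \<iota> x + 3"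
    "\<iota>' (Inr (True, k)) = \<iota> b + 3 + k" "\<iota>' (Inr (False, k)) = 3 - k" for x p k
    unfolding h'_def par'_def \<iota>'_def by simp_all
  have "layered (aug E a b) h' par' \<iota>'"
    unfolding layered_def
  proof (intro conjI allI impI ballI)
    fix x y assume xy: "(x, y) \<in> aug E a b"
    from xy consider u v where "x = Inl u" "y = Inl v" "(u, v) \<in> E" | "(x, y) \<in> tail_path a False" | "(x, y) \<in> tail_path b True"
      unfolding aug_def by auto
    note cases = this
    then show "(y, x) \<in> aug E a b"
    proof cases
      case (1 u v)
      then show ?thesis using sym[of u v] unfolding aug_def by force
    next
      case 2
      then have "(y, x) \<in> tail_path a False" unfolding tail_path_def path3_def by (rule symcl_sym)
      then show ?thesis unfolding aug_def by blast
    next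
      case 3
      then have "(y, x) \<in> tail_path b True" unfolding tail_path_def path3_def by (rule symcl_sym)
      then show ?thesis unfolding aug_def by blast
    qed
    from cases show "(h' x = 0 \<and> h' y = 0 \<and> (\<iota>' x = Suc (\<iota>' y) \<or> \<iota>' y = Suc (\<iota>' x))) \<or>
        (h' x = Suc (h' y) \<and> y = par' x) \<or> (h' y = Suc (h' x) \<and> x = par' y)"
    proof cases
      case (1 u v)
      then show ?thesis using ed[of u v] by (auto simp: s)
    next
      case 2
      then show ?thesis using ab unfolding tail_path_def path3_def symcl_def by (auto simp: s)
    next
      case 3
      then show ?thesis using ab unfolding tail_path_def path3_def symcl_def by (auto simp: s)
    qed
  next
    fix x assume "x \<in> Field (aug E a b)"
    then show "h' x \<le> 2"
      using h2 ab unfolding aug_def tail_path_def path3_def symcl_def Field_def by (auto simp: s)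
  next
    fix x y assume xy: "x \<in> Field (aug E a b)" "y \<in> Field (aug E a b)" "h' x = 0" "h' y = 0" "\<iota>' x = \<iota>' y"
    have shape: "(\<exists>u\<in>V. z = Inl u) \<or> (\<exists>k. z = Inr (True, k) \<and> 1 \<le> k) \<or> (\<exists>k. z = Inr (False, k) \<and> 1 \<le> k \<and> k \<le> 3)"
      if "z \<in> Field (aug E a b)" for z
      using subsetD[OF Field_aug[OF V] that] by auto
    have pos: "(\<exists>u\<in>V. z = Inl u \<and> h u = 0 \<and> \<iota>' z = \<iota> u + 3 \<and> \<iota> u \<le> \<iota> b) \<or>
        (z = Inr (True, \<iota>' z - \<iota> b - 3) \<and> \<iota> b + 3 < \<iota>' z) \<or> (z = Inr (False, 3 - \<iota>' z) \<and> \<iota>' z < 3)"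
      if z: "z \<in> Field (aug E a b)" "h' z = 0" for z
      using shape[OF z(1)]
    proof (elim disjE bexE exE conjE)
      fix u assume u: "u \<in> V" "z = Inl u"
      then have "h u = 0" using z(2) by (simp add: s)
      then show ?thesis using u ab(4)[OF u(1)] by (simp add: s)
    qed (simp_all add: s)
    from pos[OF xy(1,3)] pos[OF xy(2,4)] xy(5) show "x = y"
    proof (elim disjE bexE conjE)
      fix u v assume "u \<in> V" "v \<in> V" "h u = 0" "h v = 0" "\<iota>' x = \<iota> u + 3" "\<iota>' y = \<iota> v + 3" "x = Inl u" "y = Inl v"
      moreover have "\<iota> u = \<iota> v" using calculation xy(5) by simp
      ultimately show ?thesis using core by blast
    next
      assume "x = Inr (True, \<iota>' x - \<iota> b - 3)" "y = Inr (True, \<iota>' y - \<iota> b - 3)"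
      then show ?thesis using xy(5) by metis
    next
      assume "x = Inr (False, 3 - \<iota>' x)" "y = Inr (False, 3 - \<iota>' y)"
      then show ?thesis using xy(5) by metis
    qed linarith+
  qed
  from layered_Xfree[OF this] have X: "Xfree (aug E a b)" .
  have "(x, x) \<notin> E" for x using ed[of x x] by auto
  then show ?thesis using fitI[OF V _ sym X] by blast
qed

lemma simple_path:
  assumes "(x, y) \<in> R\<^sup>*"
  shows "\<exists>m g. g 0 = x \<and> g m = y \<and> (\<forall>i<m. (g i, g (Suc i)) \<in> R) \<and> inj_on g {..m::nat}"
proof -
  let ?P = "\<lambda>m. (x, y) \<in> R ^^ m"
  define m where "m = (LEAST m. ?P m)"
  obtain k where "?P k" using assms rtrancl_imp_relpow by blast
  then have Pm: "?P m" unfolding m_def by (rule LeastI)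
  have least: "m \<le> k" if "?P k" for k unfolding m_def using that by (rule Least_le)
  obtain g where g: "g 0 = x" "g m = y" "\<And>i. i < m \<Longrightarrow> (g i, g (Suc i)) \<in> R"
    using Pm unfolding relpow_fun_conv by blast
  have seg: "(g i, g j) \<in> R ^^ (j - i)" if "i \<le> j" "j \<le> m" for i j
    unfolding relpow_fun_conv
    by (rule exI[of _ "\<lambda>k. g (i + k)"]) (use that g(3) in auto)
  have ne: False if "i < j" "j \<le> m" "g i = g j" for i j
  proof -
    have "(g 0, g m) \<in> R ^^ (i + (m - j))"
      using seg[of 0 i] seg[of j m] that unfolding relpow_add by auto
    then have "m \<le> i + (m - j)" using least g by simp
    then show ?thesis using that by linarith
  qed
  have "inj_on g {..m}"
    unfolding inj_on_def using ne by (metis atMost_iff linorder_neqE_nat)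
  then show ?thesis using g by blast
qed

lemma cycle_exists:
  assumes G: "pair_wf_digraph T" and g: "inj_on g {..m}" "\<And>i. i < m \<Longrightarrow> (g i, g (Suc i)) \<in> parcs T" "(g m, g 0) \<in> parcs T"
  shows "\<exists>c. pre_digraph.cycle (with_proj T) c \<and> length c = Suc m"
proof -
  interpret pair_wf_digraph T by fact
  let ?a = "map (\<lambda>i. (g i, g (Suc i))) [0..<m]"
  let ?c = "?a @ [(g m, g 0)]"
  have cas: "pcas (g 0) (map (\<lambda>i. (g i, g (Suc i))) [0..<k] @ es) v \<longleftrightarrow> pcas (g k) es v" for k es v
    by (induction k arbitrary: es) (simp_all del: cas_append_iff)
  have verts: "pcas a es b \<Longrightarrow> pawalk_verts a es = a # map snd es" for a es b
    by (induction es arbitrary: a) auto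
  have c: "pcas (g 0) ?c (g 0)" unfolding cas by simp
  have aw: "awalk (g 0) ?c (g 0)"
    unfolding awalk_def using c g(2,3) in_arcsD2[OF g(3)] by auto
  have "map snd ?c = map g ([1..<Suc m] @ [0])"
    by (simp add: map_Suc_upt[symmetric] o_def del: upt_Suc)
  moreover have "distinct (map g ([1..<Suc m] @ [0]))"
    unfolding distinct_map
  proof
    have "set ([1..<Suc m] @ [0]) \<subseteq> {..m}" by auto
    then show "inj_on g (set ([1..<Suc m] @ [0]))" using g(1) by (rule inj_on_subset[rotated])
  qed (simp del: upt_Suc)
  ultimately have "distinct (tl (pawalk_verts (g 0) ?c))" unfolding verts[OF c] by simp
  then have "cycle ?c" unfolding cycle_def using aw by blast
  then show ?thesis by (intro exI[of _ ?c]) simp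
qed

lemma tree_bridge:
  assumes T: "graph_tree T" and e: "(x, y) \<in> parcs T"
  shows "(x, y) \<notin> (parcs T - {(x, y), (y, x)})\<^sup>*"
proof
  let ?R = "parcs T - {(x, y), (y, x)}"
  have G: "pair_graph T" and nc: "\<not> (\<exists>c. pre_digraph.cycle (with_proj T) c \<and> 3 \<le> length c)"
    using T unfolding graph_tree_def by blast+
  note g = pair_graphD[OF G]
  assume "(x, y) \<in> ?R\<^sup>*"
  from simple_path[OF this] obtain m f where f: "f 0 = x" "f m = y" "\<And>i. i < m \<Longrightarrow> (f i, f (Suc i)) \<in> ?R" "inj_on f {..m}"
    by blast
  have "m \<noteq> 0"
  proof
    assume "m = 0"
    then have "x = y" using f(1,2) by simp
    then show False using e g(4)[of x] by simp
  qed
  moreover have "m \<noteq> 1" using f(1,2) f(3)[of 0] by auto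
  moreover obtain c where "pre_digraph.cycle (with_proj T) c" "length c = Suc m"
    using cycle_exists[OF g(5) f(4)] f(1-3) g(3)[OF e] by auto
  ultimately show False using nc by auto
qed

text \<open>In a tree every edge lies on the dominating path or joins a vertex to its parent: the other edges
  could be removed without disconnecting the tree.\<close>

lemma tree_layered:
  assumes T: "graph_tree T" and p: "vpath p (with_proj T)" and dom: "\<forall>v\<in>pverts T. \<exists>w\<in>set p. graph_dist T w v \<le> 2"
  shows "fit (pverts T) (parcs T) (hd p) (last p)"
proof -
  have G: "pair_graph T" using T unfolding graph_tree_def by blast
  note g = pair_graphD[OF G]
  let ?E = "parcs T" and ?V = "pverts T"
  have pd: "distinct p" "p \<noteq> []" "set p \<subseteq> ?V" "set (vwalk_arcs p) \<subseteq> ?E"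
    using p unfolding vpath_def vwalk_def by auto
  have arcs: "set (vwalk_arcs xs) = {(xs ! i, xs ! Suc i) | i. Suc i < length xs}" for xs :: "'a list"
  proof (induction xs rule: vwalk_arcs.induct)
    case (3 x y xs)
    show ?case
    proof (intro equalityI subsetI)
      fix e assume "e \<in> set (vwalk_arcs (x # y # xs))"
      then consider "e = (x, y)" | i where "e = ((y # xs) ! i, (y # xs) ! Suc i)" "Suc i < length (y # xs)" using 3 by auto
      then show "e \<in> {((x # y # xs) ! i, (x # y # xs) ! Suc i) | i. Suc i < length (x # y # xs)}"
      proof cases
        case 1
        then show ?thesis by (intro CollectI exI[of _ 0]) simp
      next
        case (2 i)
        then show ?thesis by (intro CollectI exI[of _ "Suc i"]) simp
      qed
    next
      fix e assume "e \<in> {((x # y # xs) ! i, (x # y # xs) ! Suc i) | i. Suc i < length (x # y # xs)}"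
      then obtain i where i: "e = ((x # y # xs) ! i, (x # y # xs) ! Suc i)" "Suc i < length (x # y # xs)" by blast
      show "e \<in> set (vwalk_arcs (x # y # xs))"
      proof (cases i)
        case (Suc j)
        then have "e \<in> set (vwalk_arcs (y # xs))" unfolding 3 using i by auto
        then show ?thesis by simp
      qed (use i in simp)
    qed
  qed auto
  have pe: "(p ! i, p ! Suc i) \<in> ?E" if "Suc i < length p" for i using pd(4) that unfolding arcs by blast
  define h :: "'a \<Rightarrow> nat" where "h = (\<lambda>v. if v \<in> set p then 0 else if \<exists>w\<in>set p. (w, v) \<in> ?E then 1 else 2)"
  define par where "par = (\<lambda>v. SOME u. (v, u) \<in> ?E \<and> h v = Suc (h u))"
  define \<iota> where "\<iota> = (\<lambda>v. THE i. i < length p \<and> p ! i = v)"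
  have \<iota>p: "\<iota> (p ! i) = i" if "i < length p" for i
    unfolding \<iota>_def using that pd(1) by (intro the_equality) (auto simp: nth_eq_iff_index_eq)
  have h0: "h v = 0 \<longleftrightarrow> v \<in> set p" for v unfolding h_def by simp
  have ex: "\<exists>u. (v, u) \<in> ?E \<and> h v = Suc (h u)" if v: "v \<in> ?V" "v \<notin> set p" for v
  proof -
    obtain w where w: "w \<in> set p" "graph_dist T w v \<le> 2" using dom v by blast
    have "w \<in> ?V" using w pd(3) by blast
    then have "(w, v) \<in> ?E \<or> (\<exists>z. (w, z) \<in> ?E \<and> (z, v) \<in> ?E)"
      using w v(2) graph_dist_le_2[OF g(5), of w v] by blast
    then consider "\<exists>w\<in>set p. (w, v) \<in> ?E" | z where "\<not> (\<exists>w\<in>set p. (w, v) \<in> ?E)" "(w, z) \<in> ?E" "(z, v) \<in> ?E" using w by blast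
    then show ?thesis
    proof cases
      case 1
      then obtain u where "u \<in> set p" "(u, v) \<in> ?E" by blast
      then show ?thesis using 1 v(2) g(3) by (intro exI[of _ u]) (auto simp: h_def)
    next
      case (2 z)
      then have "z \<notin> set p" by blast
      then show ?thesis using 2 v(2) g(3) w(1) by (intro exI[of _ z]) (auto simp: h_def)
    qed
  qed
  have par: "(v, par v) \<in> ?E" "h v = Suc (h (par v))" if "v \<in> ?V" "v \<notin> set p" for v
    using someI_ex[OF ex[OF that]] unfolding par_def by blast+
  define TE where "TE = symcl ({(p ! i, p ! Suc i) | i. Suc i < length p} \<union> {(v, par v) | v. v \<in> ?V \<and> v \<notin> set p})"
  have TEE: "TE \<subseteq> ?E" unfolding TE_def symcl_def using pe par g(3) by blast
  have TEs: "(x, y) \<in> TE \<Longrightarrow> (y, x) \<in> TE" for x y unfolding TE_def by (rule symcl_sym)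
  have TEr: "(x, y) \<in> TE\<^sup>* \<Longrightarrow> (y, x) \<in> TE\<^sup>*" for x y using TEs by (metis sym_rtrancl symD symI)
  have path: "i < length p \<Longrightarrow> (p ! i, p ! 0) \<in> TE\<^sup>*" for i
  proof (induction i)
    case (Suc i)
    then have "(p ! i, p ! Suc i) \<in> TE" unfolding TE_def symcl_def by blast
    then show ?case using Suc TEs by (auto intro: converse_rtrancl_into_rtrancl)
  qed simp
  have conn: "(v, p ! 0) \<in> TE\<^sup>*" if "v \<in> ?V" for v
    using that
  proof (induction "h v" arbitrary: v rule: less_induct)
    case less
    show ?case
    proof (cases "v \<in> set p")
      case True
      then show ?thesis using path by (metis in_set_conv_nth)
    next
      case False
      have "(v, par v) \<in> TE" unfolding TE_def symcl_def using False less(2) by blast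
      moreover have "(par v, p ! 0) \<in> TE\<^sup>*"
        using less(1)[of "par v"] par[OF less(2) False] g(2) by auto
      ultimately show ?thesis by (rule converse_rtrancl_into_rtrancl)
    qed
  qed
  have E: "(x, y) \<in> TE" if e: "(x, y) \<in> ?E" for x y
  proof (rule ccontr)
    assume n: "(x, y) \<notin> TE"
    then have "TE \<subseteq> ?E - {(x, y), (y, x)}" using TEE TEs by blast
    moreover have "(x, y) \<in> TE\<^sup>*"
    proof -
      have "x \<in> ?V" "y \<in> ?V" using e g(2) by blast+
      from rtrancl_trans[OF conn[OF this(1)] TEr[OF conn[OF this(2)]]] show ?thesis .
    qed
    ultimately show False using tree_bridge[OF T e] rtrancl_mono by blast
  qed
  have core: "x = y" if "x \<in> set p" "y \<in> set p" "\<iota> x = \<iota> y" for x y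
    using that \<iota>p by (metis in_set_conv_nth)
  have "layered ?E h par \<iota>"
    unfolding layered_def
  proof (intro conjI allI impI ballI)
    fix x y assume e: "(x, y) \<in> ?E"
    show "(y, x) \<in> ?E" by (rule g(3)[OF e])
    have one: "(h x = 0 \<and> h y = 0 \<and> (\<iota> x = Suc (\<iota> y) \<or> \<iota> y = Suc (\<iota> x))) \<or> (h x = Suc (h y) \<and> y = par x)"
      if "(x, y) \<in> {(p ! i, p ! Suc i) | i. Suc i < length p} \<union> {(v, par v) | v. v \<in> ?V \<and> v \<notin> set p}" for x y
      using that
    proof
      assume "(x, y) \<in> {(p ! i, p ! Suc i) | i. Suc i < length p}"
      then obtain i where i: "x = p ! i" "y = p ! Suc i" "Suc i < length p" by blast
      then show ?thesis using \<iota>p[of i] \<iota>p[of "Suc i"] by (simp add: h0)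
    next
      assume "(x, y) \<in> {(v, par v) | v. v \<in> ?V \<and> v \<notin> set p}"
      then show ?thesis using par(2) by auto
    qed
    have "(x, y) \<in> TE" by (rule E[OF e])
    then show "(h x = 0 \<and> h y = 0 \<and> (\<iota> x = Suc (\<iota> y) \<or> \<iota> y = Suc (\<iota> x))) \<or>
        (h x = Suc (h y) \<and> y = par x) \<or> (h y = Suc (h x) \<and> x = par y)"
      unfolding TE_def symcl_iff
    proof
      assume "(x, y) \<in> {(p ! i, p ! Suc i) | i. Suc i < length p} \<union> {(v, par v) | v. v \<in> ?V \<and> v \<notin> set p}"
      from one[OF this] show ?thesis by (elim disjE) simp_all
    next
      assume "(y, x) \<in> {(p ! i, p ! Suc i) | i. Suc i < length p} \<union> {(v, par v) | v. v \<in> ?V \<and> v \<notin> set p}"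
      from one[OF this] show ?thesis by (elim disjE) (simp_all add: disj_commute)
    qed
  next
    show "h x \<le> 2" for x unfolding h_def by simp
    show "x = y" if "h x = 0" "h y = 0" "\<iota> x = \<iota> y" for x y using that core unfolding h0 by blast
  qed
  then show ?thesis
  proof (rule layered_fit)
    show "?E \<subseteq> ?V \<times> ?V" by (rule g(2))
    show "hd p \<in> ?V" "last p \<in> ?V" using pd(2,3) by auto
    show "h (hd p) = 0" "h (last p) = 0" unfolding h0 using pd(2) by auto
    show "\<iota> (hd p) = 0" using \<iota>p[of 0] pd(2) by (simp add: hd_conv_nth)
    have l: "\<iota> (last p) = length p - 1" using \<iota>p[of "length p - 1"] pd(2) by (simp add: last_conv_nth)
    show "\<iota> x \<le> \<iota> (last p)" if x: "x \<in> ?V" "h x = 0" for x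
    proof -
      obtain i where "i < length p" "x = p ! i" using x(2) unfolding h0 by (metis in_set_conv_nth)
      then show ?thesis unfolding l using \<iota>p by auto
    qed
    show "x = y" if "x \<in> ?V" "y \<in> ?V" "h x = 0" "h y = 0" "\<iota> x = \<iota> y" for x y
      using that core unfolding h0 by blast
  qed
qed

lemma lobster_fit:
  assumes "lobster L a b"
  shows "fit (pverts L) (parcs L) a b"
proof -
  obtain p where p: "graph_tree L" "lobster_path L p" "a = hd p" "b = last p" using assms unfolding lobster_def by blast
  show ?thesis unfolding p(3,4)
    by (rule tree_layered[OF p(1)]) (use p(2) in \<open>auto simp: lobster_path_def\<close>)
qed

lemma radius2_fit:
  assumes "radius2_tree T r"
  shows "fit (pverts T) (parcs T) r r"
  using tree_layered[of T "[r]"] assms unfolding radius2_tree_def by (auto simp: vpath_def vwalk_def)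

lemma fit_singleton: "fit {a} {} a a"
  by (rule layered_fit[of _ "\<lambda>_. 0" id "\<lambda>_. 0"]) (auto simp: layered_def)

section \<open>The two-way infinite strip\<close>

text \<open>All strips are parts of a two-way infinite strip whose \<open>i\<close>-th cell $a^i,b^i,a^i_j,b^i_j$ lies between the edges
  \<open>Bd (i - 1) _\<close> and \<open>Bd i _\<close>. Here \<open>Bd i True\<close> is $b^i$, \<open>Bd i False\<close> is $b^i_2$, and
  \<open>Bd (i - 1) (\<delta> i)\<close> is $a^i$; \<open>I1 i\<close> is $b^i_1$, \<open>I2 i\<close> is $a^i_2$, and \<open>FF i j\<close>, \<open>GG i j\<close> are the
  vertices $a^i_j$, $b^i_j$ with $j \ge 3$. The \<open>Pd i s m\<close> are pendant vertices.\<close>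

datatype uvert = Bd int bool | I1 int | I2 int | FF int nat | GG int nat | Pd int bool nat

inductive_set uarcs :: "(int \<Rightarrow> bool) \<Rightarrow> uvert rel" for \<delta> where
  "(Bd i True, Bd i False) \<in> uarcs \<delta>"
| "(Bd i s, Pd i s m) \<in> uarcs \<delta>"
| "(Bd (i - 1) (\<not> \<delta> i), I1 i) \<in> uarcs \<delta>"
| "(I1 i, Bd i True) \<in> uarcs \<delta>"
| "(Bd (i - 1) (\<delta> i), I2 i) \<in> uarcs \<delta>"
| "(I2 i, Bd i False) \<in> uarcs \<delta>"
| "(Bd (i - 1) (\<delta> i), FF i j) \<in> uarcs \<delta>"
| "(FF i j, GG i j) \<in> uarcs \<delta>"
| "(GG i j, Bd i True) \<in> uarcs \<delta>"

definition ustrip :: "(int \<Rightarrow> bool) \<Rightarrow> uvert rel" where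
  "ustrip \<delta> = symcl (uarcs \<delta>)"

lemma ustrip_nbrs:
  "(Bd i s, y) \<in> ustrip \<delta> \<longleftrightarrow> y = Bd i (\<not> s) \<or> (\<exists>m. y = Pd i s m) \<or>
     (if s = \<delta> (i + 1) then y = I2 (i + 1) \<or> (\<exists>j. y = FF (i + 1) j) else y = I1 (i + 1)) \<or>
     (if s then y = I1 i \<or> (\<exists>j. y = GG i j) else y = I2 i)"
  "(I1 i, y) \<in> ustrip \<delta> \<longleftrightarrow> y = Bd (i - 1) (\<not> \<delta> i) \<or> y = Bd i True"
  "(I2 i, y) \<in> ustrip \<delta> \<longleftrightarrow> y = Bd (i - 1) (\<delta> i) \<or> y = Bd i False"
  "(FF i j, y) \<in> ustrip \<delta> \<longleftrightarrow> y = Bd (i - 1) (\<delta> i) \<or> y = GG i j"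
  "(GG i j, y) \<in> ustrip \<delta> \<longleftrightarrow> y = FF i j \<or> y = Bd i True"
  "(Pd i s m, y) \<in> ustrip \<delta> \<longleftrightarrow> y = Bd i s"
  unfolding ustrip_def symcl_iff uarcs.simps by (cases y; (simp; fail | auto))+

lemma ustrip_sym: "(x, y) \<in> ustrip \<delta> \<Longrightarrow> (y, x) \<in> ustrip \<delta>"
  unfolding ustrip_def by (rule symcl_sym)

subsection \<open>Induced cycles\<close>

lemma induced_cycle:
  fixes n :: nat
  assumes n: "3 \<le> n" and f: "inj_on f {..<n}" "\<And>i j. i < n \<Longrightarrow> j < n \<Longrightarrow> (f i, f j) \<in> E \<longleftrightarrow> (i, j) \<in> cycle_edges n \<union> (cycle_edges n)\<inverse>"
  shows "v \<in> f ` {..<n} \<Longrightarrow> \<exists>x\<in>f ` {..<n}. \<exists>y\<in>f ` {..<n}. x \<noteq> y \<and> (\<forall>z\<in>f ` {..<n}. (v, z) \<in> E \<longleftrightarrow> z = x \<or> z = y)"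
    and "x \<in> K \<Longrightarrow> K \<subseteq> f ` {..<n} \<Longrightarrow> (\<And>x y. x \<in> K \<Longrightarrow> y \<in> f ` {..<n} \<Longrightarrow> (x, y) \<in> E \<Longrightarrow> y \<in> K) \<Longrightarrow> K = f ` {..<n}"
proof -
  let ?s = "\<lambda>i. Suc i mod n" and ?p = "\<lambda>i. (i + (n - 1)) mod n"
  have ce: "(i, j) \<in> cycle_edges n \<longleftrightarrow> i < n \<and> j = ?s i" for i j unfolding cycle_edges_def by auto
  have sp: "j = ?p i \<longleftrightarrow> i = ?s j" if "i < n" "j < n" for i j
    using n that by (auto simp: mod_if)
  have ne: "?s i \<noteq> ?p i" if "i < n" for i using n that by (auto simp: mod_if)
  have lt: "?s i < n" "?p i < n" for i using n by simp_all
  have nb: "(f i, f j) \<in> E \<longleftrightarrow> j = ?s i \<or> j = ?p i" if "i < n" "j < n" for i j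
    using f(2)[OF that] sp[OF that] that by (simp add: ce)
  show "\<exists>x\<in>f ` {..<n}. \<exists>y\<in>f ` {..<n}. x \<noteq> y \<and> (\<forall>z\<in>f ` {..<n}. (v, z) \<in> E \<longleftrightarrow> z = x \<or> z = y)" if v: "v \<in> f ` {..<n}"
  proof -
    obtain i where i: "i < n" "v = f i" using v by blast
    show ?thesis
    proof (rule bexI[of _ "f (?s i)"], rule bexI[of _ "f (?p i)"], intro conjI ballI)
      show "f (?s i) \<noteq> f (?p i)"
      proof
        assume "f (?s i) = f (?p i)"
        from inj_onD[OF f(1) this] lt ne[OF i(1)] show False by blast
      qed
      fix z assume "z \<in> f ` {..<n}"
      then obtain j where j: "j < n" "z = f j" by blast
      show "(v, z) \<in> E \<longleftrightarrow> z = f (?s i) \<or> z = f (?p i)"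
        unfolding i j nb[OF i(1) j(1)] using inj_onD[OF f(1), of j "?s i"] inj_onD[OF f(1), of j "?p i"] lt j by auto
    qed (use lt in auto)
  qed
  show "K = f ` {..<n}" if K: "x \<in> K" "K \<subseteq> f ` {..<n}" "\<And>x y. x \<in> K \<Longrightarrow> y \<in> f ` {..<n} \<Longrightarrow> (x, y) \<in> E \<Longrightarrow> y \<in> K"
  proof (rule equalityI[OF K(2)], rule subsetI)
    fix z assume "z \<in> f ` {..<n}"
    then obtain j where j: "j < n" "z = f j" by blast
    obtain i where i: "i < n" "x = f i" using K(1,2) by blast
    have step: "f ((i + k) mod n) \<in> K" for k
    proof (induction k)
      case 0
      then show ?case using K(1) i by simp
    next
      case (Suc k)
      have l: "(i + k) mod n < n" using n by simp
      have "(f ((i + k) mod n), f (?s ((i + k) mod n))) \<in> E" using nb[OF l lt(1)] by simp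
      then have "f (?s ((i + k) mod n)) \<in> K" using K(3)[OF Suc] lt(1) by blast
      then show ?case by (simp add: mod_Suc_eq)
    qed
    have "(i + (j + n - i)) mod n = j" using i(1) j(1) by simp
    then show "z \<in> K" using step[of "j + n - i"] j(2) by simp
  qed
qed

lemma ustrip_no_cycle:
  assumes n: "3 \<le> n" "n \<noteq> 6"
  shows "\<not> emb n (cycle_edges n) (ustrip \<delta>)"
proof
  let ?U = "ustrip \<delta>"
  assume "emb n (cycle_edges n) ?U"
  then obtain f where f: "inj_on f {..<n}" "\<And>i j. i < n \<Longrightarrow> j < n \<Longrightarrow> (f i, f j) \<in> ?U \<longleftrightarrow> (i, j) \<in> cycle_edges n \<union> (cycle_edges n)\<inverse>"
    by (rule embE) (rule that)
  define C where "C = f ` {..<n}"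
  have reg: "\<exists>x\<in>C. \<exists>y\<in>C. x \<noteq> y \<and> (\<forall>z\<in>C. (v, z) \<in> ?U \<longleftrightarrow> z = x \<or> z = y)" if "v \<in> C" for v
    using induced_cycle(1)[OF n(1) f] that unfolding C_def by blast
  have conn: "K = C" if "x \<in> K" "K \<subseteq> C" "\<And>x y. x \<in> K \<Longrightarrow> y \<in> C \<Longrightarrow> (x, y) \<in> ?U \<Longrightarrow> y \<in> K" for x K
    using induced_cycle(2)[OF n(1) f, of x K] that unfolding C_def by blast
  have card: "card C = n" unfolding C_def using f(1) by (simp add: card_image)
  have two: "z = x \<or> z = y" if t: "v \<in> C" "x \<in> C" "y \<in> C" "z \<in> C" "x \<noteq> y" "(v, x) \<in> ?U" "(v, y) \<in> ?U" "(v, z) \<in> ?U" for v x y z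
  proof -
    obtain p q where "\<forall>z\<in>C. (v, z) \<in> ?U \<longleftrightarrow> z = p \<or> z = q" using reg[OF t(1)] by blast
    then have "x = p \<or> x = q" "y = p \<or> y = q" "z = p \<or> z = q" using t by blast+
    then show ?thesis using t(5) by metis
  qed
  have hex: False if h: "h0 \<in> C" "h1 \<in> C" "h2 \<in> C" "h3 \<in> C" "h4 \<in> C" "h5 \<in> C" "distinct [h0, h1, h2, h3, h4, h5]"
    "(h0, h1) \<in> ?U" "(h1, h2) \<in> ?U" "(h2, h3) \<in> ?U" "(h3, h4) \<in> ?U" "(h4, h5) \<in> ?U" "(h5, h0) \<in> ?U" for h0 h1 h2 h3 h4 h5
  proof -
    have s: "(h1, h0) \<in> ?U" "(h2, h1) \<in> ?U" "(h3, h2) \<in> ?U" "(h4, h3) \<in> ?U" "(h5, h4) \<in> ?U" "(h0, h5) \<in> ?U"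
      by (rule ustrip_sym, rule h)+
    have d: "h1 \<noteq> h5" "h0 \<noteq> h2" "h1 \<noteq> h3" "h2 \<noteq> h4" "h3 \<noteq> h5" "h4 \<noteq> h0" using h(7) by auto
    define K where "K = {h0, h1, h2, h3, h4, h5}"
    have "K = C"
    proof (rule conn[of h0])
      show "h0 \<in> K" "K \<subseteq> C" unfolding K_def using h(1-6) by simp_all
      fix x y assume x: "x \<in> K" and y: "y \<in> C" "(x, y) \<in> ?U"
      have "y = h1 \<or> y = h5" if "x = h0" using two[OF h(1,2,6) y(1) d(1) h(8) s(6)] y(2) that by simp
      moreover have "y = h0 \<or> y = h2" if "x = h1" using two[OF h(2,1,3) y(1) d(2) s(1) h(9)] y(2) that by simp
      moreover have "y = h1 \<or> y = h3" if "x = h2" using two[OF h(3,2,4) y(1) d(3) s(2) h(10)] y(2) that by simp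
      moreover have "y = h2 \<or> y = h4" if "x = h3" using two[OF h(4,3,5) y(1) d(4) s(3) h(11)] y(2) that by simp
      moreover have "y = h3 \<or> y = h5" if "x = h4" using two[OF h(5,4,6) y(1) d(5) s(4) h(12)] y(2) that by simp
      moreover have "y = h4 \<or> y = h0" if "x = h5" using two[OF h(6,5,1) y(1) d(6) s(5) h(13)] y(2) that by simp
      ultimately show "y \<in> K" using x unfolding K_def by (elim insertE emptyE) blast+
    qed
    moreover have "card K = 6" using distinct_card[OF h(7)] unfolding K_def by simp
    ultimately show False using card n(2) by simp
  qed
  have nbs: "\<exists>x\<in>C. \<exists>y\<in>C. x \<noteq> y \<and> (v, x) \<in> ?U \<and> (v, y) \<in> ?U" if "v \<in> C" for v using reg[OF that] by blast
  have both: "x \<in> C" "y \<in> C" if v: "v \<in> C" "\<And>z. (v, z) \<in> ?U \<longleftrightarrow> z = x \<or> z = y" for v x y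
  proof -
    obtain p q where "p \<in> C" "q \<in> C" "p \<noteq> q" "(v, p) \<in> ?U" "(v, q) \<in> ?U" using nbs[OF v(1)] by blast
    then have "p = x \<and> q = y \<or> p = y \<and> q = x" unfolding v(2) by blast
    then show "x \<in> C" "y \<in> C" using \<open>p \<in> C\<close> \<open>q \<in> C\<close> by blast+
  qed
  have I1C: "Bd (i - 1) (\<not> \<delta> i) \<in> C" "Bd i True \<in> C" if "I1 i \<in> C" for i
    using both[OF that ustrip_nbrs(2)] by blast+
  have I2C: "Bd (i - 1) (\<delta> i) \<in> C" "Bd i False \<in> C" if "I2 i \<in> C" for i
    using both[OF that ustrip_nbrs(3)] by blast+
  have FC: "Bd (i - 1) (\<delta> i) \<in> C" "GG i j \<in> C" if "FF i j \<in> C" for i j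
    using both[OF that ustrip_nbrs(4)] by blast+
  have GC: "FF i j \<in> C" "Bd i True \<in> C" if "GG i j \<in> C" for i j
    using both[OF that ustrip_nbrs(5)] by blast+
  have PC: "Pd i s m \<notin> C" for i s m
  proof
    assume "Pd i s m \<in> C"
    from nbs[OF this] show False unfolding ustrip_nbrs(6) by metis
  qed
  define pos where "pos = (\<lambda>v. case v of Bd i s \<Rightarrow> 3 * i | I1 i \<Rightarrow> 3 * i - 1 | I2 i \<Rightarrow> 3 * i - 1 | FF i j \<Rightarrow> 3 * i - 2
      | GG i j \<Rightarrow> 3 * i - 1 | Pd i s m \<Rightarrow> 3 * i)"
  have C: "finite C" "C \<noteq> {}" using card n by (auto intro: card_ge_0_finite)
  obtain v where v: "v \<in> C" "\<And>w. w \<in> C \<Longrightarrow> pos v \<le> pos w"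
    using ex_min_if_finite[of "pos ` C"] C by (metis (no_types, lifting) arg_min_if_finite(1) arg_min_least)
  have "\<exists>l s. v = Bd l s"
  proof (cases v)
    case (I1 i)
    then show ?thesis using I1C(1)[of i] v(1) v(2)[of "Bd (i - 1) (\<not> \<delta> i)"] by (simp add: pos_def)
  next
    case (I2 i)
    then show ?thesis using I2C(1)[of i] v(1) v(2)[of "Bd (i - 1) (\<delta> i)"] by (simp add: pos_def)
  next
    case (FF i j)
    then show ?thesis using FC(1)[of i j] v(1) v(2)[of "Bd (i - 1) (\<delta> i)"] by (simp add: pos_def)
  next
    case (GG i j)
    then show ?thesis using GC(1)[of i j] v(1) v(2)[of "FF i j"] by (simp add: pos_def)
  qed (use PC v(1) in auto)
  then obtain l s where ls: "v = Bd l s" by blast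
  have ge: "3 * l \<le> pos w" if "w \<in> C" for w using v(2)[OF that] by (simp add: ls pos_def)
  have left: "I1 l \<notin> C" "I2 l \<notin> C" "GG l j \<notin> C" for j
    using ge[of "I1 l"] ge[of "I2 l"] ge[of "GG l j"] by (auto simp: pos_def)
  define a b where "a = Bd l (\<delta> (l + 1))" and "b = Bd l (\<not> \<delta> (l + 1))"
  have an: "x = b \<or> x = I2 (l + 1) \<or> (\<exists>j. x = FF (l + 1) j)" if "(a, x) \<in> ?U" "x \<in> C" for x
    using that left PC unfolding a_def b_def ustrip_nbrs(1) by (auto split: if_splits)
  have bn: "x = a \<or> x = I1 (l + 1)" if "(b, x) \<in> ?U" "x \<in> C" for x
    using that left PC unfolding a_def b_def ustrip_nbrs(1) by (auto split: if_splits)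
  have bC: "a \<in> C" "I1 (l + 1) \<in> C" if b: "b \<in> C"
  proof -
    obtain p q where p: "p \<in> C" "q \<in> C" "p \<noteq> q" "(b, p) \<in> ?U" "(b, q) \<in> ?U" using nbs[OF b] by blast
    then have "p = a \<and> q = I1 (l + 1) \<or> p = I1 (l + 1) \<and> q = a" using bn[OF p(4,1)] bn[OF p(5,2)] by blast
    then show "a \<in> C" "I1 (l + 1) \<in> C" using p(1,2) by blast+
  qed
  have aC: "a \<in> C"
  proof (cases "s = \<delta> (l + 1)")
    case True
    then show ?thesis using v(1) unfolding a_def ls by simp
  next
    case False
    then have "v = b" unfolding b_def ls by simp
    then show ?thesis using bC(1) v(1) by simp
  qed
  obtain p q where p: "p \<in> C" "q \<in> C" "p \<noteq> q" "(a, p) \<in> ?U" "(a, q) \<in> ?U" using nbs[OF aC] by blast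
  note sm = ustrip_nbrs a_def b_def
  let ?l = "l + 1"
  have F: "GG ?l j \<in> C" "Bd ?l True \<in> C" if "FF ?l j \<in> C" for j using FC(2)[OF that] GC(2)[OF FC(2)[OF that]] by blast+
  have c1: False if "b \<in> C" "I2 ?l \<in> C"
    by (rule hex[of a b "I1 ?l" "Bd ?l True" "Bd ?l False" "I2 ?l"])
      (use that aC bC(2)[OF that(1)] I1C(2)[OF bC(2)[OF that(1)]] I2C(2)[OF that(2)] in \<open>simp_all add: sm\<close>)
  have c2: False if "b \<in> C" "FF ?l j \<in> C" for j
    by (rule hex[of a b "I1 ?l" "Bd ?l True" "GG ?l j" "FF ?l j"])
      (use that aC bC(2)[OF that(1)] F[OF that(2)] in \<open>simp_all add: sm\<close>)
  have c3: False if "I2 ?l \<in> C" "FF ?l j \<in> C" for j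
    by (rule hex[of a "I2 ?l" "Bd ?l False" "Bd ?l True" "GG ?l j" "FF ?l j"])
      (use that aC I2C(2)[OF that(1)] F[OF that(2)] in \<open>simp_all add: sm\<close>)
  have c4: False if "FF ?l i \<in> C" "FF ?l j \<in> C" "i \<noteq> j" for i j
    by (rule hex[of a "FF ?l i" "GG ?l i" "Bd ?l True" "GG ?l j" "FF ?l j"])
      (use that aC F[OF that(1)] F[OF that(2)] in \<open>simp_all add: sm\<close>)
  show False using an[OF p(4,1)] an[OF p(5,2)] p(1-3) c1 c2 c3 c4 by metis
qed

subsection \<open>The other obstructions\<close>

lemma ustrip_Bd:
  assumes "(v, x) \<in> ustrip \<delta>" "(v, y) \<in> ustrip \<delta>" "(v, z) \<in> ustrip \<delta>" "x \<noteq> y" "x \<noteq> z" "y \<noteq> z"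
  obtains m s where "v = Bd m s"
  using assms by (cases v) (auto simp: ustrip_nbrs)

lemma ustrip_Bd_Bd: "(Bd m s, Bd l t) \<in> ustrip \<delta> \<longleftrightarrow> l = m \<and> t = (\<not> s)"
  by (auto simp: ustrip_nbrs split: if_splits)

lemma ustrip_levels:
  assumes "(Bd m s, x) \<in> ustrip \<delta>" "(x, Bd l t) \<in> ustrip \<delta>" "Bd m s \<noteq> Bd l t"
  shows "l = m + 1 \<or> l = m - 1"
proof (cases x)
  case (Bd i u)
  then show ?thesis using assms by (auto simp: ustrip_Bd_Bd)
qed (use ustrip_sym[OF assms(1)] assms(2,3) in \<open>auto simp: ustrip_nbrs\<close>)

definition rleg :: "(int \<Rightarrow> bool) \<Rightarrow> int \<Rightarrow> bool \<Rightarrow> uvert \<Rightarrow> uvert \<Rightarrow> bool" where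
  "rleg \<delta> m s p q \<longleftrightarrow> (if s = \<delta> (m + 1) then p = I2 (m + 1) \<and> q = Bd (m + 1) False \<or> (\<exists>j. p = FF (m + 1) j \<and> q = GG (m + 1) j)
     else p = I1 (m + 1) \<and> q = Bd (m + 1) True)"

definition lleg :: "(int \<Rightarrow> bool) \<Rightarrow> int \<Rightarrow> bool \<Rightarrow> uvert \<Rightarrow> uvert \<Rightarrow> bool" where
  "lleg \<delta> m s p q \<longleftrightarrow> (if s then p = I1 m \<and> q = Bd (m - 1) (\<not> \<delta> m) \<or> (\<exists>j. p = GG m j \<and> q = FF m j)
     else p = I2 m \<and> q = Bd (m - 1) (\<delta> m))"

lemma leg_side:
  assumes "(Bd m s, p) \<in> ustrip \<delta>" "(p, q) \<in> ustrip \<delta>" "q \<noteq> Bd m s" "p \<noteq> Bd m (\<not> s)"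
  shows "rleg \<delta> m s p q \<or> lleg \<delta> m s p q"
  using assms unfolding ustrip_nbrs(1) rleg_def lleg_def by (auto simp: ustrip_nbrs split: if_splits)

lemma rleg_opposite: "rleg \<delta> m s p q \<Longrightarrow> rleg \<delta> m (\<not> s) p' q' \<Longrightarrow> (q, q') \<in> ustrip \<delta>"
  unfolding rleg_def by (auto simp: ustrip_nbrs split: if_splits)

lemma lleg_opposite: "lleg \<delta> m s p q \<Longrightarrow> lleg \<delta> m (\<not> s) p' q' \<Longrightarrow> (q, q') \<in> ustrip \<delta>"
  unfolding lleg_def by (auto simp: ustrip_nbrs split: if_splits)

lemma rleg_lleg: "rleg \<delta> m s p q \<Longrightarrow> lleg \<delta> m t p' q' \<Longrightarrow> (q, q') \<notin> ustrip \<delta>"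
  unfolding rleg_def lleg_def by (auto simp: ustrip_nbrs split: if_splits)

lemma rleg_rleg:
  assumes "rleg \<delta> m s p q" "rleg \<delta> m s p' q'" "p \<noteq> p'" "(q, r) \<in> ustrip \<delta>" "(q', r') \<in> ustrip \<delta>" "r \<noteq> p" "r' \<noteq> p'"
  shows "r = r' \<or> (q, r') \<in> ustrip \<delta> \<or> (r, q') \<in> ustrip \<delta>"
  using assms unfolding rleg_def by (auto simp: ustrip_nbrs split: if_splits)

lemma lleg_lleg:
  assumes "lleg \<delta> m s p q" "lleg \<delta> m s p' q'" "p \<noteq> p'" "(q, r) \<in> ustrip \<delta>" "(q', r') \<in> ustrip \<delta>" "r \<noteq> p" "r' \<noteq> p'"
  shows "r = r' \<or> (q, r') \<in> ustrip \<delta> \<or> (r, q') \<in> ustrip \<delta>"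
  using assms unfolding lleg_def by (auto simp: ustrip_nbrs split: if_splits)

lemma ustrip_3c: "\<not> emb 9 C6_3c_edges (ustrip \<delta>)"
proof
  let ?U = "ustrip \<delta>"
  assume "emb 9 C6_3c_edges ?U"
  then obtain f where f: "inj_on f {..<9}" "\<And>i j. i < 9 \<Longrightarrow> j < 9 \<Longrightarrow> (f i, f j) \<in> ?U \<longleftrightarrow> (i, j) \<in> C6_3c_edges \<union> C6_3c_edges\<inverse>"
    by (rule embE) (rule that)
  have ne: "f i \<noteq> f j" if "i < 9" "j < 9" "i \<noteq> j" for i j using f(1) that by (auto dest: inj_onD)
  have e: "(f 0, f 1) \<in> ?U" "(f 0, f 5) \<in> ?U" "(f 0, f 6) \<in> ?U" "(f 1, f 0) \<in> ?U" "(f 1, f 2) \<in> ?U" "(f 1, f 7) \<in> ?U"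
    "(f 2, f 1) \<in> ?U" "(f 2, f 3) \<in> ?U" "(f 2, f 8) \<in> ?U"
    using f(2) by (simp_all add: cycle_edges_6)
  obtain m s where 0: "f 0 = Bd m s" by (rule ustrip_Bd[OF e(1-3)]) (use ne in simp_all)
  obtain l t where 1: "f 1 = Bd l t" by (rule ustrip_Bd[OF e(4-6)]) (use ne in simp_all)
  obtain k u where 2: "f 2 = Bd k u" by (rule ustrip_Bd[OF e(7-9)]) (use ne in simp_all)
  have "f 0 = f 2" using e(4,5) unfolding 0 1 2 ustrip_Bd_Bd by simp
  then show False using ne[of 0 2] by simp
qed

lemma ustrip_3nc: "\<not> emb 9 C6_3nc_edges (ustrip \<delta>)"
proof
  let ?U = "ustrip \<delta>"
  assume "emb 9 C6_3nc_edges ?U"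
  then obtain f where f: "inj_on f {..<9}" "\<And>i j. i < 9 \<Longrightarrow> j < 9 \<Longrightarrow> (f i, f j) \<in> ?U \<longleftrightarrow> (i, j) \<in> C6_3nc_edges \<union> C6_3nc_edges\<inverse>"
    by (rule embE) (rule that)
  have ne: "f i \<noteq> f j" if "i < 9" "j < 9" "i \<noteq> j" for i j using f(1) that by (auto dest: inj_onD)
  have e: "(f 0, f 1) \<in> ?U" "(f 0, f 5) \<in> ?U" "(f 0, f 6) \<in> ?U" "(f 2, f 1) \<in> ?U" "(f 2, f 3) \<in> ?U" "(f 2, f 7) \<in> ?U"
    "(f 4, f 3) \<in> ?U" "(f 4, f 5) \<in> ?U" "(f 4, f 8) \<in> ?U" "(f 1, f 2) \<in> ?U" "(f 3, f 4) \<in> ?U" "(f 5, f 4) \<in> ?U"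
    using f(2) by (simp_all add: cycle_edges_6)
  obtain m s where 0: "f 0 = Bd m s" by (rule ustrip_Bd[OF e(1-3)]) (use ne in simp_all)
  obtain l t where 2: "f 2 = Bd l t" by (rule ustrip_Bd[OF e(4-6)]) (use ne in simp_all)
  obtain k u where 4: "f 4 = Bd k u" by (rule ustrip_Bd[OF e(7-9)]) (use ne in simp_all)
  have "l = m + 1 \<or> l = m - 1" using e(1,10) ne[of 0 2] unfolding 0 2 by (intro ustrip_levels) simp_all
  moreover have "k = l + 1 \<or> k = l - 1" using e(5,11) ne[of 2 4] unfolding 2 4 by (intro ustrip_levels) simp_all
  moreover have "k = m + 1 \<or> k = m - 1" using e(2,12) ne[of 0 4] unfolding 0 4 by (intro ustrip_levels) simp_all
  ultimately show False by linarith
qed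

lemma ustrip_2l2: "\<not> emb 10 C6_2l2_edges (ustrip \<delta>)"
proof
  let ?U = "ustrip \<delta>"
  assume "emb 10 C6_2l2_edges ?U"
  then obtain f where f: "inj_on f {..<10}" "\<And>i j. i < 10 \<Longrightarrow> j < 10 \<Longrightarrow> (f i, f j) \<in> ?U \<longleftrightarrow> (i, j) \<in> C6_2l2_edges \<union> C6_2l2_edges\<inverse>"
    by (rule embE) (rule that)
  have ne: "f i \<noteq> f j" if "i < 10" "j < 10" "i \<noteq> j" for i j using f(1) that by (auto dest: inj_onD)
  have e: "(f 0, f 1) \<in> ?U" "(f 0, f 5) \<in> ?U" "(f 0, f 6) \<in> ?U" "(f 1, f 0) \<in> ?U" "(f 1, f 2) \<in> ?U" "(f 1, f 8) \<in> ?U"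
    "(f 5, f 4) \<in> ?U" "(f 6, f 7) \<in> ?U" "(f 2, f 3) \<in> ?U" "(f 8, f 9) \<in> ?U" "(f 4, f 3) \<in> ?U" "(f 3, f 4) \<in> ?U"
    using f(2) by (simp_all add: cycle_edges_6)
  have nn: "(f 7, f 9) \<notin> ?U" "(f 7, f 3) \<notin> ?U" "(f 4, f 9) \<notin> ?U"
    using f(2) by (simp_all add: cycle_edges_6)
  obtain m s where 0: "f 0 = Bd m s" by (rule ustrip_Bd[OF e(1-3)]) (use ne in simp_all)
  obtain l t where "f 1 = Bd l t" by (rule ustrip_Bd[OF e(4-6)]) (use ne in simp_all)
  then have 1: "f 1 = Bd m (\<not> s)" using e(1) unfolding 0 by (simp add: ustrip_Bd_Bd)
  have 5: "rleg \<delta> m s (f 5) (f 4) \<or> lleg \<delta> m s (f 5) (f 4)"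
    by (rule leg_side) (use e(2,7) ne[of 4 0] ne[of 5 1] 0 1 in simp_all)
  have 6: "rleg \<delta> m s (f 6) (f 7) \<or> lleg \<delta> m s (f 6) (f 7)"
    by (rule leg_side) (use e(3,8) ne[of 7 0] ne[of 6 1] 0 1 in simp_all)
  have 2: "rleg \<delta> m (\<not> s) (f 2) (f 3) \<or> lleg \<delta> m (\<not> s) (f 2) (f 3)"
    by (rule leg_side) (use e(5,9) ne[of 3 1] ne[of 2 0] 0 1 in simp_all)
  have 8: "rleg \<delta> m (\<not> s) (f 8) (f 9) \<or> lleg \<delta> m (\<not> s) (f 8) (f 9)"
    by (rule leg_side) (use e(6,10) ne[of 9 1] ne[of 8 0] 0 1 in simp_all)
  show False using 5 6 2 8 nn e(11,12) rleg_opposite lleg_opposite rleg_lleg by metis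
qed

lemma ustrip_S333: "\<not> emb 10 S333_edges (ustrip \<delta>)"
proof
  let ?U = "ustrip \<delta>"
  assume "emb 10 S333_edges ?U"
  then obtain f where f: "inj_on f {..<10}" "\<And>i j. i < 10 \<Longrightarrow> j < 10 \<Longrightarrow> (f i, f j) \<in> ?U \<longleftrightarrow> (i, j) \<in> S333_edges \<union> S333_edges\<inverse>"
    by (rule embE) (rule that)
  have ne: "f i \<noteq> f j" if "i < 10" "j < 10" "i \<noteq> j" for i j using f(1) that by (auto dest: inj_onD)
  have e: "(f 0, f 1) \<in> ?U" "(f 0, f 4) \<in> ?U" "(f 0, f 7) \<in> ?U" using f(2) by simp_all
  obtain m s where 0: "f 0 = Bd m s" by (rule ustrip_Bd[OF e]) (use ne in simp_all)
  define R where "R = (\<lambda>i. rleg \<delta> m s (f i) (f (i + 1)) \<or> f i = Bd m (\<not> s) \<and> rleg \<delta> m (\<not> s) (f (i + 1)) (f (i + 2)))"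
  define L where "L = (\<lambda>i. lleg \<delta> m s (f i) (f (i + 1)) \<or> f i = Bd m (\<not> s) \<and> lleg \<delta> m (\<not> s) (f (i + 1)) (f (i + 2)))"
  have I: "i = 1 \<or> i = 4 \<or> i = 7 \<Longrightarrow> (f 0, f i) \<in> ?U \<and> (f i, f (i + 1)) \<in> ?U \<and> (f (i + 1), f (i + 2)) \<in> ?U \<and>
      f (i + 1) \<noteq> f 0 \<and> f (i + 2) \<noteq> f i" for i
    by (elim disjE) (use f(2) ne in simp_all)
  have side: "R i \<or> L i" if i: "i = 1 \<or> i = 4 \<or> i = 7" for i
  proof (cases "f i = Bd m (\<not> s)")
    case False
    then have "rleg \<delta> m s (f i) (f (i + 1)) \<or> lleg \<delta> m s (f i) (f (i + 1))"
      by (intro leg_side) (use I[OF i] 0 in simp_all)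
    then show ?thesis unfolding R_def L_def by blast
  next
    case True
    have "rleg \<delta> m (\<not> s) (f (i + 1)) (f (i + 2)) \<or> lleg \<delta> m (\<not> s) (f (i + 1)) (f (i + 2))"
      by (rule leg_side) (use I[OF i] 0 True in simp_all)
    then show ?thesis using True unfolding R_def L_def by blast
  qed
  have J: "f i \<noteq> f j \<and> f (i + 2) \<noteq> f (j + 2) \<and> (f (i + 1), f (j + 2)) \<notin> ?U \<and> (f (i + 2), f (j + 1)) \<notin> ?U"
    if "i = 1 \<or> i = 4 \<or> i = 7" "j = 1 \<or> j = 4 \<or> j = 7" "i \<noteq> j" for i j
    using that by (elim disjE) (use f(2) ne in simp_all)
  have RR: False if "R i" "R j" and i: "i = 1 \<or> i = 4 \<or> i = 7" "j = 1 \<or> j = 4 \<or> j = 7" "i \<noteq> j" for i j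
    using that(1,2) I[OF i(1)] I[OF i(2)] J[OF i] rleg_rleg[of \<delta> m s "f i" "f (i + 1)" "f j" "f (j + 1)" "f (i + 2)" "f (j + 2)"]
      rleg_opposite[of \<delta> m s "f i" "f (i + 1)" "f (j + 1)" "f (j + 2)"]
      rleg_opposite[of \<delta> m s "f j" "f (j + 1)" "f (i + 1)" "f (i + 2)", THEN ustrip_sym]
    unfolding R_def by argo
  have LL: False if "L i" "L j" and i: "i = 1 \<or> i = 4 \<or> i = 7" "j = 1 \<or> j = 4 \<or> j = 7" "i \<noteq> j" for i j
    using that(1,2) I[OF i(1)] I[OF i(2)] J[OF i] lleg_lleg[of \<delta> m s "f i" "f (i + 1)" "f j" "f (j + 1)" "f (i + 2)" "f (j + 2)"]
      lleg_opposite[of \<delta> m s "f i" "f (i + 1)" "f (j + 1)" "f (j + 2)"]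
      lleg_opposite[of \<delta> m s "f j" "f (j + 1)" "f (i + 1)" "f (i + 2)", THEN ustrip_sym]
    unfolding L_def by argo
  have "R 1 \<or> L 1" "R 4 \<or> L 4" "R 7 \<or> L 7" using side by simp_all
  then show False using RR[of 1 4] RR[of 1 7] RR[of 4 7] LL[of 1 4] LL[of 1 7] LL[of 4 7] by (elim disjE) simp_all
qed

lemma ustrip_Xfree: "Xfree (ustrip \<delta>)"
  unfolding Xfree_def using ustrip_no_cycle ustrip_S333 ustrip_3c ustrip_3nc ustrip_2l2 by auto

section \<open>Coordinates of a strip in the infinite strip\<close>

fun ucoord :: "(int \<Rightarrow> bool) \<Rightarrow> nat \<times> hex_vertex \<Rightarrow> uvert" where
  "ucoord \<delta> (i, PA) = Bd (int i - 1) (\<delta> (int i))"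
| "ucoord \<delta> (i, PB) = Bd (int i) True"
| "ucoord \<delta> (i, QA j) = (if j = 1 then Bd (int i - 1) (\<not> \<delta> (int i)) else if j = 2 then I2 (int i) else FF (int i) j)"
| "ucoord \<delta> (i, QB j) = (if j = 1 then I1 (int i) else if j = 2 then Bd (int i) False else GG (int i) j)"

fun ucore :: "nat \<Rightarrow> uvert \<Rightarrow> bool" where
  "ucore n (Bd i s) = (0 \<le> i \<and> i \<le> int n)"
| "ucore n (I1 i) = (1 \<le> i \<and> i \<le> int n)"
| "ucore n (I2 i) = (1 \<le> i \<and> i \<le> int n)"
| "ucore n (FF i j) = (1 \<le> i \<and> i \<le> int n)"
| "ucore n (GG i j) = (1 \<le> i \<and> i \<le> int n)"
| "ucore n (Pd i s m) = (0 \<le> i \<and> i \<le> int n)"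

lemma ucoord_arcs:
  assumes k: "\<forall>i\<in>{1..n}. 2 \<le> k i"
  shows "map_prod (ucoord \<delta>) (ucoord \<delta>) ` parcs (disjoint_union {1..n} (\<lambda>i. C6k (k i))) =
    {(x, y) \<in> ustrip \<delta>. x \<in> ucoord \<delta> ` pverts (disjoint_union {1..n} (\<lambda>i. C6k (k i))) \<and>
       y \<in> ucoord \<delta> ` pverts (disjoint_union {1..n} (\<lambda>i. C6k (k i)))}" (is "?PD = {(x, y) \<in> _. x \<in> ?S \<and> y \<in> ?S}")
proof -
  let ?D = "disjoint_union {1..n} (\<lambda>i. C6k (k i))" and ?\<psi> = "ucoord \<delta>"
  have vD: "(i, x) \<in> pverts ?D \<longleftrightarrow> i \<in> {1..n} \<and> x \<in> {PA, PB} \<union> QA ` {1..k i} \<union> QB ` {1..k i}" for i x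
    unfolding disjoint_union_def by (simp add: C6k_simps)
  have aD: "(p, q) \<in> parcs ?D \<longleftrightarrow> (\<exists>i x y. p = (i, x) \<and> q = (i, y) \<and> i \<in> {1..n} \<and>
      (x, y) \<in> symcl (\<Union>j\<in>{1..k i}. {(PA, QA j), (QA j, QB j), (QB j, PB)}))" for p q
    unfolding disjoint_union_def by (auto simp: C6k_simps(2))
  have PDI: "(?\<psi> (i, x), ?\<psi> (i, y)) \<in> ?PD"
    if "i \<in> {1..n}" "(x, y) \<in> symcl (\<Union>j\<in>{1..k i}. {(PA, QA j), (QA j, QB j), (QB j, PB)})" for i x y
  proof -
    have "((i, x), (i, y)) \<in> parcs ?D" unfolding aD using that by blast
    then show ?thesis by (rule rev_image_eqI) simp
  qed
  have PDs: "(y, x) \<in> ?PD" if xy: "(x, y) \<in> ?PD" for x y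
  proof -
    obtain p q where pq: "(p, q) \<in> parcs ?D" "x = ?\<psi> p" "y = ?\<psi> q" using xy by auto
    have "(q, p) \<in> parcs ?D" using pq(1) unfolding aD by (elim exE conjE) (intro exI conjI, assumption+, rule symcl_sym)
    then show ?thesis unfolding pq(2,3) by (rule rev_image_eqI) simp
  qed
  have base: "(?\<psi> (i, x), ?\<psi> (i, y)) \<in> ustrip \<delta>" if "(x, y) \<in> {(PA, QA j), (QA j, QB j), (QB j, PB)}" for i j x y
    using that by (elim insertE) (auto simp: ustrip_nbrs)
  have "?PD \<subseteq> {(x, y) \<in> ustrip \<delta>. x \<in> ?S \<and> y \<in> ?S}"
  proof (rule subrelI)
    fix u v assume "(u, v) \<in> ?PD"
    then obtain p q where pq: "(p, q) \<in> parcs ?D" "u = ?\<psi> p" "v = ?\<psi> q" by auto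
    then obtain i x y where i: "p = (i, x)" "q = (i, y)" "i \<in> {1..n}"
      "(x, y) \<in> symcl (\<Union>j\<in>{1..k i}. {(PA, QA j), (QA j, QB j), (QB j, PB)})" unfolding aD by blast
    have "p \<in> pverts ?D" "q \<in> pverts ?D" unfolding i(1,2) vD using i(3,4) by (auto simp: symcl_iff)
    moreover have "(u, v) \<in> ustrip \<delta>"
      using i(4) unfolding symcl_iff pq(2,3) i(1,2)
    proof
      assume "(x, y) \<in> (\<Union>j\<in>{1..k i}. {(PA, QA j), (QA j, QB j), (QB j, PB)})"
      then obtain j where "(x, y) \<in> {(PA, QA j), (QA j, QB j), (QB j, PB)}" by (rule UN_E)
      then show "(?\<psi> (i, x), ?\<psi> (i, y)) \<in> ustrip \<delta>" by (rule base)
    next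
      assume "(y, x) \<in> (\<Union>j\<in>{1..k i}. {(PA, QA j), (QA j, QB j), (QB j, PB)})"
      then obtain j where "(y, x) \<in> {(PA, QA j), (QA j, QB j), (QB j, PB)}" by (rule UN_E)
      then show "(?\<psi> (i, x), ?\<psi> (i, y)) \<in> ustrip \<delta>" by (rule base[THEN ustrip_sym])
    qed
    ultimately show "(u, v) \<in> {(x, y) \<in> ustrip \<delta>. x \<in> ?S \<and> y \<in> ?S}" using pq(2,3) by simp
  qed
  moreover have arc: "(u, v) \<in> ?PD" if uv: "(u, v) \<in> uarcs \<delta>" "u \<in> ?S" "v \<in> ?S" for u v
  proof -
    have SD: "\<exists>i x. w = ?\<psi> (i, x) \<and> i \<in> {1..n} \<and> x \<in> {PA, PB} \<union> QA ` {1..k i} \<union> QB ` {1..k i}" if w: "w \<in> ?S" for w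
    proof -
      obtain q where q: "q \<in> pverts ?D" "w = ?\<psi> q" using w by blast
      obtain i x where "q = (i, x)" by (cases q)
      then show ?thesis using q vD[of i x] by blast
    qed
    have I1S: "\<exists>i. l = int i \<and> i \<in> {1..n}" if "I1 l \<in> ?S" for l using SD[OF that] by (auto split: if_splits)
    have I2S: "\<exists>i. l = int i \<and> i \<in> {1..n}" if "I2 l \<in> ?S" for l using SD[OF that] by (auto split: if_splits)
    have FFS: "\<exists>i. l = int i \<and> i \<in> {1..n} \<and> 3 \<le> j \<and> j \<le> k i" if "FF l j \<in> ?S" for l j using SD[OF that] by (auto split: if_splits)
    have GGS: "\<exists>i. l = int i \<and> i \<in> {1..n} \<and> 3 \<le> j \<and> j \<le> k i" if "GG l j \<in> ?S" for l j using SD[OF that] by (auto split: if_splits)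
    have BdS: "0 \<le> l \<and> l \<le> int n \<and> 1 \<le> n" if "Bd l s \<in> ?S" for l s using SD[OF that] by (auto split: if_splits)
    have PdS: "Pd l s m \<notin> ?S" for l s m using SD[of "Pd l s m"] by (auto split: if_splits)
    have e: "(?\<psi> (i, PA), ?\<psi> (i, QA j)) \<in> ?PD" "(?\<psi> (i, QA j), ?\<psi> (i, QB j)) \<in> ?PD" "(?\<psi> (i, QB j), ?\<psi> (i, PB)) \<in> ?PD"
      if "i \<in> {1..n}" "1 \<le> j" "j \<le> k i" for i j
      by (rule PDI; use that in \<open>auto simp: symcl_iff\<close>)+
    have e1: "(?\<psi> (i, PA), ?\<psi> (i, QA 1)) \<in> ?PD" "(?\<psi> (i, QA 1), ?\<psi> (i, QB 1)) \<in> ?PD" "(?\<psi> (i, QB 1), ?\<psi> (i, PB)) \<in> ?PD"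
      if i: "i \<in> {1..n}" for i
    proof -
      have "1 \<le> k i" using bspec[OF k i] by simp
      note j = e[OF i le_refl this]
      show "(?\<psi> (i, PA), ?\<psi> (i, QA 1)) \<in> ?PD" "(?\<psi> (i, QA 1), ?\<psi> (i, QB 1)) \<in> ?PD" "(?\<psi> (i, QB 1), ?\<psi> (i, PB)) \<in> ?PD" by (rule j)+
    qed
    have e2: "(?\<psi> (i, PA), ?\<psi> (i, QA 2)) \<in> ?PD" "(?\<psi> (i, QA 2), ?\<psi> (i, QB 2)) \<in> ?PD" "(?\<psi> (i, QB 2), ?\<psi> (i, PB)) \<in> ?PD"
      if i: "i \<in> {1..n}" for i
    proof -
      have "2 \<le> k i" using bspec[OF k i] by simp
      note j = e[OF i one_le_numeral this]
      show "(?\<psi> (i, PA), ?\<psi> (i, QA 2)) \<in> ?PD" "(?\<psi> (i, QA 2), ?\<psi> (i, QB 2)) \<in> ?PD" "(?\<psi> (i, QB 2), ?\<psi> (i, PB)) \<in> ?PD" by (rule j)+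
    qed
    from uv show ?thesis
    proof (cases rule: uarcs.cases)
      case (1 l)
      then have l: "0 \<le> l" "l \<le> int n" "1 \<le> n" using BdS uv(2) by blast+
      show ?thesis
      proof (cases "l = 0")
        case True
        then show ?thesis using PDs[OF e1(1)[of 1]] e1(1)[of 1] l(3) 1 by (cases "\<delta> 1") simp_all
      next
        case False
        then have "nat l \<in> {1..n}" using l by auto
        from PDs[OF e2(3)[OF this]] show ?thesis using l 1 by simp
      qed
    next
      case (2 i s m)
      then show ?thesis using PdS uv(3) by blast
    next
      case (3 l)
      then obtain i where "l = int i" "i \<in> {1..n}" using I1S uv(3) by blast
      then show ?thesis using e1(2)[of i] 3 by simp
    next
      case (4 l)
      then obtain i where "l = int i" "i \<in> {1..n}" using I1S uv(2) by blast
      then show ?thesis using e1(3)[of i] 4 by simp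
    next
      case (5 l)
      then obtain i where "l = int i" "i \<in> {1..n}" using I2S uv(3) by blast
      then show ?thesis using e2(1)[of i] 5 by simp
    next
      case (6 l)
      then obtain i where "l = int i" "i \<in> {1..n}" using I2S uv(2) by blast
      then show ?thesis using e2(2)[of i] 6 by simp
    next
      case (7 l j)
      then obtain i where "l = int i" "i \<in> {1..n}" "3 \<le> j" "j \<le> k i" using FFS uv(3) by blast
      then show ?thesis using e(1)[of i j] 7 by simp
    next
      case (8 l j)
      then obtain i where "l = int i" "i \<in> {1..n}" "3 \<le> j" "j \<le> k i" using FFS uv(2) by blast
      then show ?thesis using e(2)[of i j] 8 by simp
    next
      case (9 l j)
      then obtain i where "l = int i" "i \<in> {1..n}" "3 \<le> j" "j \<le> k i" using GGS uv(2) by blast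
      then show ?thesis using e(3)[of i j] 9 by simp
    qed
  qed
  have "{(x, y) \<in> ustrip \<delta>. x \<in> ?S \<and> y \<in> ?S} \<subseteq> ?PD"
  proof (rule subrelI)
    fix x y assume "(x, y) \<in> {(x, y) \<in> ustrip \<delta>. x \<in> ?S \<and> y \<in> ?S}"
    then have "(x, y) \<in> ustrip \<delta>" "x \<in> ?S" "y \<in> ?S" by simp_all
    then show "(x, y) \<in> ?PD" unfolding ustrip_def symcl_iff using arc[of x y] arc[of y x, THEN PDs] by blast
  qed
  with calculation(1) show ?thesis by (rule equalityI)
qed

lemma strip_coords:
  fixes f :: "(nat \<times> hex_vertex) set \<Rightarrow> 'a"
  assumes p: "strip_params n k d" and inj: "inj_on f (pverts (hexagonal_strip n k d))"
    and a: "a \<in> {f (strip_vertex n d 1 PA), f (strip_vertex n d 1 (QA 1))}"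
    and b: "b \<in> {f (strip_vertex n d n PB), f (strip_vertex n d n (QB 2))}"
  shows "\<exists>\<delta> e. inj_on e (f ` pverts (hexagonal_strip n k d)) \<and>
    (\<forall>x\<in>f ` pverts (hexagonal_strip n k d). ucore n (e x)) \<and>
    (\<forall>x\<in>f ` pverts (hexagonal_strip n k d). \<forall>y\<in>f ` pverts (hexagonal_strip n k d).
       (x, y) \<in> map_prod f f ` parcs (hexagonal_strip n k d) \<longleftrightarrow> (e x, e y) \<in> ustrip \<delta>) \<and>
    (\<forall>i\<in>{1..n}. \<forall>x\<in>{PA, PB, QA 1, QB 2}. f (strip_vertex n d i x) \<in> f ` pverts (hexagonal_strip n k d) \<and>
       (\<exists>l s. e (f (strip_vertex n d i x)) = Bd l s)) \<and>
    e a = Bd 0 True \<and> e b = Bd (int n) (\<delta> (int n + 1)) \<and> finite (pverts (hexagonal_strip n k d)) \<and>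
    parcs (hexagonal_strip n k d) \<subseteq> pverts (hexagonal_strip n k d) \<times> pverts (hexagonal_strip n k d)"
proof -
  let ?H = "hexagonal_strip n k d" and ?D = "disjoint_union {1..n} (\<lambda>i. C6k (k i))" and ?R = "strip_gluing n d"
  have n: "1 \<le> n" and k: "\<forall>i\<in>{1..n}. 2 \<le> k i" using p unfolding strip_params_def by auto
  define \<delta> where "\<delta> = (\<lambda>l::int. if l = 1 then a = f (strip_vertex n d 1 PA)
    else if l = int n + 1 then b = f (strip_vertex n d n PB) else d (nat (l - 1)) \<noteq> 1)"
  let ?\<psi> = "ucoord \<delta>"
  have \<delta>: "\<delta> (1 + int i) \<longleftrightarrow> d i \<noteq> 1" if "1 \<le> i" "i < n" for i using that unfolding \<delta>_def by simp
  have gl: "((i, x), (Suc i, y)) \<in> ?R \<longleftrightarrow> (if d i = 1 then x = QB 2 \<and> y = PA \<or> x = PB \<and> y = QA 1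
      else x = QB 2 \<and> y = QA 1 \<or> x = PB \<and> y = PA)" if "1 \<le> i" "i < n" for i x y
    using that unfolding strip_gluing_def by (auto split: if_splits)
  have R\<psi>: "?\<psi> p = ?\<psi> q" if pq: "(p, q) \<in> ?R" for p q
  proof -
    obtain i x j y where ij: "p = (i, x)" "q = (j, y)" by (cases p; cases q)
    have s: "j = Suc i" "i < n" "1 \<le> i" using strip_gluing_shape[OF pq[unfolded ij]] pq unfolding ij strip_gluing_def
      by (auto split: if_splits)
    show ?thesis using pq unfolding ij s(1) gl[OF s(3,2)] by (auto simp: \<delta>[OF s(3,2)] split: if_splits)
  qed
  have vD: "(i, x) \<in> pverts ?D \<longleftrightarrow> i \<in> {1..n} \<and> x \<in> {PA, PB} \<union> QA ` {1..k i} \<union> QB ` {1..k i}" for i x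
    unfolding disjoint_union_def by (simp add: C6k_simps)
  have bd: "x = PA \<and> l = int i - 1 \<and> s = \<delta> (int i) \<or> x = QA 1 \<and> l = int i - 1 \<and> s = (\<not> \<delta> (int i)) \<or>
      x = PB \<and> l = int i \<and> s \<or> x = QB 2 \<and> l = int i \<and> \<not> s" if "?\<psi> (i, x) = Bd l s" for i x l s
    using that by (cases x) (auto split: if_splits)
  have fib: "(p, q) \<in> (?R \<union> ?R\<inverse>)\<^sup>*" if pq: "p \<in> pverts ?D" "q \<in> pverts ?D" "?\<psi> p = ?\<psi> q" for p q
  proof -
    obtain i x j y where ij: "p = (i, x)" "q = (j, y)" by (cases p; cases q)
    have l: "1 \<le> i" "i \<le> n" "1 \<le> j" "j \<le> n" using pq(1,2) unfolding ij vD by auto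
    have "p = q \<or> (p, q) \<in> ?R \<or> (q, p) \<in> ?R"
    proof (cases "\<exists>l s. ?\<psi> p = Bd l s")
      case True
      then obtain l' s where ls: "?\<psi> (i, x) = Bd l' s" "?\<psi> (j, y) = Bd l' s" using pq(3) unfolding ij by metis
      consider "i = j" | "j = Suc i" | "i = Suc j" using bd[OF ls(1)] bd[OF ls(2)] by linarith
      then show ?thesis
      proof cases
        case 1
        then show ?thesis using bd[OF ls(1)] bd[OF ls(2)] unfolding ij by auto
      next
        case 2
        have i: "1 \<le> i" "i < n" using l 2 by simp_all
        show ?thesis using bd[OF ls(1)] bd[OF ls(2)] unfolding ij 2 gl[OF i] by (auto simp: \<delta>[OF i])
      next
        case 3
        have i: "1 \<le> j" "j < n" using l 3 by simp_all
        show ?thesis using bd[OF ls(1)] bd[OF ls(2)] unfolding ij 3 gl[OF i] by (auto simp: \<delta>[OF i])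
      qed
    next
      case False
      then show ?thesis using pq(3) unfolding ij by (cases x; cases y) (auto split: if_splits)
    qed
    then show ?thesis by blast
  qed
  obtain g where g: "inj_on g (pverts ?H)" "\<And>p. g (ident_class ?R p) = ?\<psi> p" "map_graph g ?H = map_graph ?\<psi> ?D"
    using identify_via_map[of ?R ?\<psi> ?D, OF R\<psi> fib] unfolding hexagonal_strip_def by blast
  have gv: "g (strip_vertex n d i x) = ?\<psi> (i, x)" for i x unfolding strip_vertex_def by (rule g(2))
  have gV: "g ` pverts ?H = ?\<psi> ` pverts ?D" using g(3) by (simp add: map_graph_def)
  have gE: "map_prod g g ` parcs ?H = map_prod ?\<psi> ?\<psi> ` parcs ?D" using g(3) by (simp add: map_graph_def)
  have HV: "pverts ?H = ident_class ?R ` pverts ?D" and HE: "parcs ?H = map_prod (ident_class ?R) (ident_class ?R) ` parcs ?D"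
    unfolding hexagonal_strip_def identify_def map_graph_def by simp_all
  have "parcs ?D \<subseteq> pverts ?D \<times> pverts ?D" unfolding disjoint_union_def by (auto simp: C6k_simps symcl_iff)
  then have sub: "parcs ?H \<subseteq> pverts ?H \<times> pverts ?H" unfolding HV HE by auto
  have "finite (pverts ?D)" unfolding disjoint_union_def by (auto simp: C6k_simps)
  then have fin: "finite (pverts ?H)" unfolding HV by simp
  define e where "e = (\<lambda>x. g (inv_into (pverts ?H) f x))"
  have ef: "e (f x) = g x" if "x \<in> pverts ?H" for x unfolding e_def by (simp add: inv_into_f_f[OF inj that])
  have ei: "inj_on e (f ` pverts ?H)" using g(1) ef by (auto simp: inj_on_def)
  have core: "ucore n (?\<psi> p)" if p: "p \<in> pverts ?D" for p
  proof -
    obtain i x where ix: "p = (i, x)" by (cases p)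
    then have "1 \<le> i" "i \<le> n" using p vD[of i x] by simp_all
    then show ?thesis unfolding ix by (cases x) auto
  qed
  have adj: "(f u, f v) \<in> map_prod f f ` parcs ?H \<longleftrightarrow> (e (f u), e (f v)) \<in> ustrip \<delta>" if uv: "u \<in> pverts ?H" "v \<in> pverts ?H" for u v
  proof -
    have "(f u, f v) \<in> map_prod f f ` parcs ?H \<longleftrightarrow> (u, v) \<in> parcs ?H"
    proof
      assume "(f u, f v) \<in> map_prod f f ` parcs ?H"
      then obtain u' v' where u': "(u', v') \<in> parcs ?H" "f u = f u'" "f v = f v'" by auto
      then have "u' \<in> pverts ?H" "v' \<in> pverts ?H" using sub by auto
      then show "(u, v) \<in> parcs ?H" using inj_onD[OF inj u'(2)] inj_onD[OF inj u'(3)] uv u'(1) by simp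
    qed force
    also have "\<dots> \<longleftrightarrow> (g u, g v) \<in> map_prod g g ` parcs ?H"
    proof
      assume "(g u, g v) \<in> map_prod g g ` parcs ?H"
      then obtain u' v' where u': "(u', v') \<in> parcs ?H" "g u = g u'" "g v = g v'" by auto
      then have "u' \<in> pverts ?H" "v' \<in> pverts ?H" using sub by auto
      then show "(u, v) \<in> parcs ?H" using inj_onD[OF g(1) u'(2)] inj_onD[OF g(1) u'(3)] uv u'(1) by simp
    qed force
    also have "\<dots> \<longleftrightarrow> (g u, g v) \<in> ustrip \<delta>"
      unfolding gE ucoord_arcs[OF k] using uv gV by auto
    finally show ?thesis unfolding ef[OF uv(1)] ef[OF uv(2)] .
  qed
  have sv: "strip_vertex n d i x \<in> pverts ?H" if "i \<in> {1..n}" "x \<in> {PA, PB, QA 1, QB 2}" for i x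
  proof -
    have "2 \<le> k i" using k that(1) by blast
    then have "(i, x) \<in> pverts ?D" unfolding vD using that by auto
    then show ?thesis unfolding HV strip_vertex_def by blast
  qed
  have ev: "e (f (strip_vertex n d i x)) = ?\<psi> (i, x)" if "i \<in> {1..n}" "x \<in> {PA, PB, QA 1, QB 2}" for i x
    using ef[OF sv[OF that]] gv by simp
  have n1: "1 \<in> {1..n}" "n \<in> {1..n}" using n by simp_all
  have ea: "e a = Bd 0 True"
  proof (cases "a = f (strip_vertex n d 1 PA)")
    case True
    then show ?thesis using ev[OF n1(1), of PA] by (simp add: \<delta>_def)
  next
    case False
    then show ?thesis using a ev[OF n1(1), of "QA 1"] by (simp add: \<delta>_def)
  qed
  have eb: "e b = Bd (int n) (\<delta> (int n + 1))"
  proof (cases "b = f (strip_vertex n d n PB)")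
    case True
    then show ?thesis using ev[OF n1(2), of PB] n by (simp add: \<delta>_def)
  next
    case False
    then show ?thesis using b ev[OF n1(2), of "QB 2"] n by (simp add: \<delta>_def)
  qed
  have ec: "ucore n (e x)" if x: "x \<in> f ` pverts ?H" for x
  proof -
    obtain u where u: "u \<in> pverts ?H" "x = f u" using x by blast
    then have "e x \<in> ?\<psi> ` pverts ?D" using ef[OF u(1)] gV by auto
    then show ?thesis using core by auto
  qed
  have eU: "\<forall>i\<in>{1..n}. \<forall>x\<in>{PA, PB, QA 1, QB 2}. f (strip_vertex n d i x) \<in> f ` pverts ?H \<and>
       (\<exists>l s. e (f (strip_vertex n d i x)) = Bd l s)"
    using sv ev by auto
  have ead: "\<forall>x\<in>f ` pverts ?H. \<forall>y\<in>f ` pverts ?H. (x, y) \<in> map_prod f f ` parcs ?H \<longleftrightarrow> (e x, e y) \<in> ustrip \<delta>"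
  proof (intro ballI)
    fix x y assume "x \<in> f ` pverts ?H" "y \<in> f ` pverts ?H"
    then obtain u v where u: "u \<in> pverts ?H" "v \<in> pverts ?H" "x = f u" "y = f v" by blast
    show "(x, y) \<in> map_prod f f ` parcs ?H \<longleftrightarrow> (e x, e y) \<in> ustrip \<delta>" unfolding u(3,4) by (rule adj[OF u(1,2)])
  qed
  have ec': "\<forall>x\<in>f ` pverts ?H. ucore n (e x)" by (intro ballI ec)
  show ?thesis
    by (rule exI[of _ \<delta>], rule exI[of _ e], intro conjI) (rule ei ec' ead eU ea eb fin sub)+
qed

section \<open>Hexagonal caterpillars\<close>

text \<open>The paths that prolong the first \<open>n\<close> cells of the infinite strip beyond its two gluing vertices.\<close>

definition utail :: "(int \<Rightarrow> bool) \<Rightarrow> nat \<Rightarrow> bool \<Rightarrow> nat \<Rightarrow> uvert" where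
  "utail \<delta> n s k = (if s then (if k = 1 then I2 (int n + 1) else Bd (int n + 1) (k = 3))
     else (if k = 1 then I1 0 else Bd (- 1) (if k = 2 then \<not> \<delta> 0 else \<delta> 0)))"

lemma utail_core: "ucore n w \<Longrightarrow> w \<noteq> utail \<delta> n s k"
  by (cases w) (auto simp: utail_def)

lemma utail_nbr:
  assumes "ucore n w" "k \<in> {1, 2, 3}"
  shows "(w, utail \<delta> n s k) \<in> ustrip \<delta> \<longleftrightarrow> k = 1 \<and> w = (if s then Bd (int n) (\<delta> (int n + 1)) else Bd 0 True)"
  using assms by (cases w; cases s) (auto simp: utail_def ustrip_nbrs)

lemma utail_utail:
  assumes "k \<in> {1, 2, 3}" "l \<in> {1, 2, 3}"
  shows "(utail \<delta> n s k, utail \<delta> n t l) \<in> ustrip \<delta> \<longleftrightarrow> s = t \<and> (k = Suc l \<or> l = Suc k)"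
proof -
  have "k = 1 \<or> k = 2 \<or> k = 3" "l = 1 \<or> l = 2 \<or> l = 3" using assms by simp_all
  then show ?thesis by (elim disjE; cases s; cases t; cases "\<delta> 0"; simp add: utail_def ustrip_nbrs)
qed

lemma utail_inj:
  assumes "k \<in> {1, 2, 3}" "l \<in> {1, 2, 3}" "utail \<delta> n s k = utail \<delta> n t l"
  shows "s = t \<and> k = l"
proof -
  have "k = 1 \<or> k = 2 \<or> k = 3" "l = 1 \<or> l = 2 \<or> l = 3" using assms by simp_all
  then show ?thesis using assms(3) by (elim disjE; cases s; cases t; cases "\<delta> 0"; simp add: utail_def)
qed

lemma aug_iff:
  "(Inl x, Inl y) \<in> aug E a b \<longleftrightarrow> (x, y) \<in> E"
  "(Inl x, Inr (s, k)) \<in> aug E a b \<longleftrightarrow> k = 1 \<and> x = (if s then b else a)"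
  "(Inr (s, k), Inl x) \<in> aug E a b \<longleftrightarrow> k = 1 \<and> x = (if s then b else a)"
proof -
  have I: "(Inl x, Inl y) \<in> map_prod Inl Inl ` E \<longleftrightarrow> (x, y) \<in> E" "(Inl x, Inr q) \<notin> map_prod Inl Inl ` E"
    "(Inr q, Inl x) \<notin> map_prod Inl Inl ` E" for q :: "bool \<times> nat" by force+
  show "(Inl x, Inl y) \<in> aug E a b \<longleftrightarrow> (x, y) \<in> E"
    unfolding aug_def tail_path_def path3_def Un_iff symcl_iff I by simp
  show "(Inl x, Inr (s, k)) \<in> aug E a b \<longleftrightarrow> k = 1 \<and> x = (if s then b else a)"
    "(Inr (s, k), Inl x) \<in> aug E a b \<longleftrightarrow> k = 1 \<and> x = (if s then b else a)"
    unfolding aug_def tail_path_def path3_def Un_iff symcl_iff using I(2,3) by (cases s; simp; blast)+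
qed

lemma aug_tails:
  assumes "k \<in> {1, 2, 3}" "l \<in> {1, 2, 3}"
  shows "(Inr (s, k), Inr (t, l)) \<in> aug E a b \<longleftrightarrow> s = t \<and> (k = Suc l \<or> l = Suc k)"
proof -
  have I: "(Inr p, Inr q) \<notin> map_prod Inl Inl ` E" for p q :: "bool \<times> nat" by force
  have "k = 1 \<or> k = 2 \<or> k = 3" "l = 1 \<or> l = 2 \<or> l = 3" using assms by simp_all
  then show ?thesis
    unfolding aug_def tail_path_def path3_def Un_iff symcl_iff by (elim disjE; cases s; cases t; simp add: I)
qed

lemma ustrip_irrefl: "(x, x) \<notin> ustrip \<delta>"
  by (cases x) (auto simp: ustrip_nbrs)

lemma fit_coords:
  assumes e: "inj_on e V" "\<And>x. x \<in> V \<Longrightarrow> ucore n (e x)" "\<And>x y. x \<in> V \<Longrightarrow> y \<in> V \<Longrightarrow> (x, y) \<in> E \<longleftrightarrow> (e x, e y) \<in> ustrip \<delta>"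
    and E: "E \<subseteq> V \<times> V" and ab: "a \<in> V" "b \<in> V" "e a = Bd 0 True" "e b = Bd (int n) (\<delta> (int n + 1))"
  shows "fit V E a b"
proof (rule fitI[OF E ab(1,2)])
  show "(x, x) \<notin> E" for x using E e(3)[of x x] ustrip_irrefl by blast
  show "(y, x) \<in> E" if "(x, y) \<in> E" for x y
  proof -
    have "x \<in> V" "y \<in> V" using E that by blast+
    then show ?thesis using e(3)[of x y] e(3)[of y x] that ustrip_sym by blast
  qed
  define \<phi> where "\<phi> = (\<lambda>v. case v of Inl x \<Rightarrow> e x | Inr (s, k) \<Rightarrow> utail \<delta> n s k)"
  have \<phi>: "\<phi> (Inl x) = e x" "\<phi> (Inr (s, k)) = utail \<delta> n s k" for x s k unfolding \<phi>_def by simp_all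
  have shape: "(\<exists>x\<in>V. v = Inl x) \<or> (\<exists>s k. k \<in> {1, 2, 3} \<and> v = Inr (s, k))" if "v \<in> Field (aug E a b)" for v
    using subsetD[OF Field_aug[OF E ab(1,2)] that] by blast
  show "Xfree (aug E a b)"
  proof (rule Xfree_embed[OF ustrip_Xfree[of \<delta>], where \<phi> = \<phi>])
    show "inj_on \<phi> (Field (aug E a b))"
    proof (rule inj_onI)
      fix u v assume uv: "u \<in> Field (aug E a b)" "v \<in> Field (aug E a b)" "\<phi> u = \<phi> v"
      from shape[OF uv(1)] shape[OF uv(2)] show "u = v"
      proof (elim disjE bexE exE conjE)
        fix x y assume "x \<in> V" "y \<in> V" "u = Inl x" "v = Inl y"
        then show ?thesis using uv(3) inj_onD[OF e(1), of x y] by (simp add: \<phi>)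
      next
        fix x s k assume "x \<in> V" "u = Inl x" "v = Inr (s, k)"
        then show ?thesis using uv(3) utail_core[OF e(2)[of x]] by (simp add: \<phi>)
      next
        fix x s k assume "x \<in> V" "v = Inl x" "u = Inr (s, k)"
        then show ?thesis using uv(3) utail_core[OF e(2)[of x], of \<delta> s k] by (simp add: \<phi>)
      next
        fix s k t l assume kl: "k \<in> {1, 2, 3::nat}" "l \<in> {1, 2, 3::nat}" and "u = Inr (s, k)" "v = Inr (t, l)"
        then show ?thesis using uv(3) utail_inj[OF kl, of \<delta> n s t] by (simp add: \<phi>)
      qed
    qed
    have bd: "x = (if s then b else a) \<longleftrightarrow> e x = (if s then Bd (int n) (\<delta> (int n + 1)) else Bd 0 True)" if "x \<in> V" for x s
      using inj_onD[OF e(1), of x a] inj_onD[OF e(1), of x b] that ab by auto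
    have tl: "(e x, utail \<delta> n s k) \<in> ustrip \<delta> \<longleftrightarrow> k = 1 \<and> x = (if s then b else a)" if "x \<in> V" "k \<in> {1, 2, 3}" for x s k
      unfolding utail_nbr[OF e(2)[OF that(1)] that(2)] bd[OF that(1)] ..
    fix u v assume uv: "u \<in> Field (aug E a b)" "v \<in> Field (aug E a b)"
    from shape[OF uv(1)] shape[OF uv(2)] show "((\<phi> u, \<phi> v) \<in> ustrip \<delta>) = ((u, v) \<in> aug E a b)"
    proof (elim disjE bexE exE conjE)
      fix x y assume "x \<in> V" "y \<in> V" "u = Inl x" "v = Inl y"
      then show ?thesis using e(3)[of x y] by (simp add: \<phi> aug_iff)
    next
      fix x s k assume "x \<in> V" "k \<in> {1, 2, 3::nat}" and uv': "u = Inl x" "v = Inr (s, k)"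
      from tl[OF this(1,2), of s] show ?thesis unfolding uv' \<phi> aug_iff .
    next
      fix x s k assume "x \<in> V" "k \<in> {1, 2, 3::nat}" and uv': "v = Inl x" "u = Inr (s, k)"
      from tl[OF this(1,2), of s] show ?thesis unfolding uv' \<phi> aug_iff using ustrip_sym by blast
    next
      fix s k t l assume kl: "k \<in> {1, 2, 3::nat}" "l \<in> {1, 2, 3::nat}" and uv': "u = Inr (s, k)" "v = Inr (t, l)"
      show ?thesis unfolding uv' \<phi> utail_utail[OF kl] aug_tails[OF kl] ..
    qed
  qed
qed

text \<open>The part \<open>(V, E)\<close> of a hexagonal caterpillar without the trees at its gluing vertices embeds into the infinite strip.\<close>

definition hexdec :: "nat \<Rightarrow> (int \<Rightarrow> bool) \<Rightarrow> 'v set \<Rightarrow> 'v \<Rightarrow> 'v \<Rightarrow> 'v set \<Rightarrow> 'v rel \<Rightarrow>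
    'v set \<Rightarrow> 'v rel \<Rightarrow> ('v \<Rightarrow> uvert) \<Rightarrow> 'v set \<Rightarrow> 'v rel \<Rightarrow> 'v set \<Rightarrow> 'v rel \<Rightarrow> bool" where
  "hexdec n \<delta> U a b W F V E e Va Ea Vb Eb \<longleftrightarrow> W = V \<union> Va \<union> Vb \<and> F = E \<union> Ea \<union> Eb \<and> inj_on e V \<and>
     (\<forall>x\<in>V. ucore n (e x)) \<and> (\<forall>x\<in>V. \<forall>y\<in>V. (x, y) \<in> E \<longleftrightarrow> (e x, e y) \<in> ustrip \<delta>) \<and> E \<subseteq> V \<times> V \<and>
     (\<forall>u\<in>U. u \<in> V \<and> (\<exists>l s. e u = Bd l s)) \<and> a \<in> V \<and> b \<in> V \<and>
     e a = Bd 0 True \<and> e b = Bd (int n) (\<delta> (int n + 1)) \<and> fit Va Ea a a \<and> fit Vb Eb b b \<and>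
     V \<inter> Va = {a} \<and> V \<inter> Vb = {b} \<and> Va \<inter> Vb = {} \<and> finite W"

lemma hexdecD:
  assumes "hexdec n \<delta> U a b W F V E e Va Ea Vb Eb"
  shows "W = V \<union> Va \<union> Vb" "F = E \<union> Ea \<union> Eb" "inj_on e V" "\<forall>x\<in>V. ucore n (e x)"
    "\<forall>x\<in>V. \<forall>y\<in>V. (x, y) \<in> E \<longleftrightarrow> (e x, e y) \<in> ustrip \<delta>" "E \<subseteq> V \<times> V"
    "\<forall>u\<in>U. u \<in> V \<and> (\<exists>l s. e u = Bd l s)" "a \<in> V" "b \<in> V" "e a = Bd 0 True" "e b = Bd (int n) (\<delta> (int n + 1))"
    "fit Va Ea a a" "fit Vb Eb b b" "V \<inter> Va = {a}" "V \<inter> Vb = {b}" "Va \<inter> Vb = {}" "finite W"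
  using assms unfolding hexdec_def by - (elim conjE, assumption)+

lemma hexdec_pendant:
  assumes "hexdec n \<delta> U a b W F V E e Va Ea Vb Eb" and u: "u \<in> U" and v: "v \<notin> W"
  shows "\<exists>e'. hexdec n \<delta> U a b (insert v W) (F \<union> {(u, v), (v, u)}) (insert v V) (E \<union> {(u, v), (v, u)}) e' Va Ea Vb Eb"
proof -
  note h = hexdecD[OF assms(1)]
  obtain l s where ls: "e u = Bd l s" and uV: "u \<in> V" using bspec[OF h(7) u] by blast
  have lr: "0 \<le> l" "l \<le> int n" using bspec[OF h(4) uV] ls by simp_all
  have vn: "v \<notin> V" "v \<notin> Va" "v \<notin> Vb" using v h(1) by blast+
  have "finite V" using h(1,17) by simp
  then have "finite ((\<lambda>x. case e x of Pd _ _ m \<Rightarrow> m | _ \<Rightarrow> 0) ` V)" by simp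
  then obtain m where "m \<notin> (\<lambda>x. case e x of Pd _ _ m \<Rightarrow> m | _ \<Rightarrow> 0) ` V" using ex_new_if_finite[OF infinite_UNIV_nat] by blast
  then have m: "e x \<noteq> Pd l s m" if "x \<in> V" for x using that by force
  define e' where "e' = e(v := Pd l s m)"
  have e': "e' v = Pd l s m" "x \<in> V \<Longrightarrow> e' x = e x" for x unfolding e'_def using vn(1) by auto
  have nb: "(e x, Pd l s m) \<in> ustrip \<delta> \<longleftrightarrow> x = u" "(Pd l s m, e x) \<in> ustrip \<delta> \<longleftrightarrow> x = u" if x: "x \<in> V" for x
  proof -
    have "e x = Bd l s \<longleftrightarrow> x = u" using inj_onD[OF h(3) _ x uV] ls by auto
    then show "(Pd l s m, e x) \<in> ustrip \<delta> \<longleftrightarrow> x = u" by (simp add: ustrip_nbrs(6))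
    then show "(e x, Pd l s m) \<in> ustrip \<delta> \<longleftrightarrow> x = u" using ustrip_sym by blast
  qed
  have U': "w \<in> insert v V \<and> (\<exists>l s. e' w = Bd l s)" if "w \<in> U" for w
    using bspec[OF h(7) that] e'(2)[of w] by simp
  have adj: "(x, y) \<in> E \<union> {(u, v), (v, u)} \<longleftrightarrow> (e' x, e' y) \<in> ustrip \<delta>" if xy: "x \<in> insert v V" "y \<in> insert v V" for x y
  proof -
    have nE: "(v, z) \<notin> E" "(z, v) \<notin> E" for z using h(6) vn(1) by blast+
    have uv: "u \<noteq> v" using uV vn(1) by blast
    consider "x = v" "y = v" | "x = v" "y \<in> V" "y \<noteq> v" | "x \<in> V" "y = v" "x \<noteq> v" | "x \<in> V" "y \<in> V" "x \<noteq> v" "y \<noteq> v"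
      using xy vn(1) by blast
    then show ?thesis
    proof cases
      case 1
      then show ?thesis using nE uv by (simp add: ustrip_irrefl)
    next
      case 2
      then show ?thesis using nE uv nb(2)[OF 2(2)] e' by auto
    next
      case 3
      then show ?thesis using nE uv nb(1)[OF 3(1)] e' by auto
    next
      case 4
      then show ?thesis using h(5) e' by auto
    qed
  qed
  have i: "inj_on e' (insert v V)"
    unfolding inj_on_insert
  proof
    show "inj_on e' V" using h(3) e'(2) by (simp add: inj_on_def)
    show "e' v \<notin> e' ` (V - {v})" using e' m by fastforce
  qed
  have "hexdec n \<delta> U a b (insert v W) (F \<union> {(u, v), (v, u)}) (insert v V) (E \<union> {(u, v), (v, u)}) e' Va Ea Vb Eb"
    unfolding hexdec_def
  proof (intro conjI)
    show "\<forall>x\<in>insert v V. ucore n (e' x)" using h(4) e' lr by simp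
    show "\<forall>x\<in>insert v V. \<forall>y\<in>insert v V. ((x, y) \<in> E \<union> {(u, v), (v, u)}) = ((e' x, e' y) \<in> ustrip \<delta>)" using adj by blast
    show "\<forall>u\<in>U. u \<in> insert v V \<and> (\<exists>l s. e' u = Bd l s)" using U' by blast
    show "e' a = Bd 0 True" "e' b = Bd (int n) (\<delta> (int n + 1))" using h(8-11) e' by simp_all
    show "insert v V \<inter> Va = {a}" "insert v V \<inter> Vb = {b}" using h(14,15) vn by simp_all
    show "insert v W = insert v V \<union> Va \<union> Vb" using h(1) by simp
    show "F \<union> {(u, v), (v, u)} = E \<union> {(u, v), (v, u)} \<union> Ea \<union> Eb" using h(2) by blast
    show "E \<union> {(u, v), (v, u)} \<subseteq> insert v V \<times> insert v V" using h(6) uV by blast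
    show "inj_on e' (insert v V)" by (rule i)
    show "a \<in> insert v V" "b \<in> insert v V" using h(8,9) by simp_all
    show "fit Va Ea a a" "fit Vb Eb b b" "Va \<inter> Vb = {}" by (rule h)+
    show "finite (insert v W)" using h(17) by simp
  qed
  then show ?thesis by (intro exI)
qed

lemma hexdec_tree:
  assumes "hexdec n \<delta> U a b W F V E e Va Ea Vb Eb" and r: "r \<in> {a, b}" and T: "radius2_tree T r" "W \<inter> pverts T = {r}"
  shows "\<exists>Va' Ea' Vb' Eb'. hexdec n \<delta> U a b (W \<union> pverts T) (F \<union> parcs T) V E e Va' Ea' Vb' Eb'"
proof -
  note h = hexdecD[OF assms(1)]
  have fT: "finite (pverts T)" using T(1) pair_graphD(1) unfolding radius2_tree_def graph_tree_def by blast
  have mem: "a \<in> Va" "b \<in> Vb" using h(14,15) by blast+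
  show ?thesis
  proof (cases "r = a")
    case True
    have "Va \<inter> pverts T = {a}" using T(2) mem(1) h(1) True by blast
    from fit_glue[OF h(12) radius2_fit[OF T(1)[unfolded True]] this]
    have f: "fit (Va \<union> pverts T) (Ea \<union> parcs T) a a" .
    have "hexdec n \<delta> U a b (W \<union> pverts T) (F \<union> parcs T) V E e (Va \<union> pverts T) (Ea \<union> parcs T) Vb Eb"
      unfolding hexdec_def
    proof (intro conjI)
      show "W \<union> pverts T = V \<union> (Va \<union> pverts T) \<union> Vb" using h(1) by blast
      show "F \<union> parcs T = E \<union> (Ea \<union> parcs T) \<union> Eb" using h(2) by blast
      show "V \<inter> (Va \<union> pverts T) = {a}" using h(1,14) T(2) mem unfolding True by blast
      have "Vb \<subseteq> W" "a \<notin> Vb" using h(1,16) mem(1) by blast+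
      have "pverts T \<inter> Vb = {}"
      proof (intro equals0I)
        fix x assume x: "x \<in> pverts T \<inter> Vb"
        then have "x \<in> W \<inter> pverts T" using \<open>Vb \<subseteq> W\<close> by blast
        then have "x = a" using T(2) True by simp
        then show False using x \<open>a \<notin> Vb\<close> by simp
      qed
      then show "(Va \<union> pverts T) \<inter> Vb = {}" using h(16) by blast
      show "finite (W \<union> pverts T)" using h(17) fT by simp
    qed (rule h f)+
    then show ?thesis by (intro exI)
  next
    case False
    then have rb: "r = b" using r by simp
    have "Vb \<inter> pverts T = {b}" using T(2) mem(2) h(1) rb by blast
    from fit_glue[OF h(13) radius2_fit[OF T(1)[unfolded rb]] this]
    have f: "fit (Vb \<union> pverts T) (Eb \<union> parcs T) b b" .
    have "hexdec n \<delta> U a b (W \<union> pverts T) (F \<union> parcs T) V E e Va Ea (Vb \<union> pverts T) (Eb \<union> parcs T)"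
      unfolding hexdec_def
    proof (intro conjI)
      show "W \<union> pverts T = V \<union> Va \<union> (Vb \<union> pverts T)" using h(1) by blast
      show "F \<union> parcs T = E \<union> Ea \<union> (Eb \<union> parcs T)" using h(2) by blast
      show "V \<inter> (Vb \<union> pverts T) = {b}" using h(1,15) T(2) rb by blast
      have "Va \<subseteq> W" "b \<notin> Va" using h(1,16) mem(2) by blast+
      have "Va \<inter> pverts T = {}"
      proof (intro equals0I)
        fix x assume x: "x \<in> Va \<inter> pverts T"
        then have "x \<in> W \<inter> pverts T" using \<open>Va \<subseteq> W\<close> by blast
        then have "x = b" using T(2) rb by simp
        then show False using x \<open>b \<notin> Va\<close> by simp
      qed
      then show "Va \<inter> (Vb \<union> pverts T) = {}" using h(16) by blast
      show "finite (W \<union> pverts T)" using h(17) fT by simp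
    qed (rule h f)+
    then show ?thesis by (intro exI)
  qed
qed

lemma hexagonal_caterpillar_fit:
  assumes "hexagonal_caterpillar G a b"
  shows "fit (pverts G) (parcs G) a b" "finite (pverts G)"
proof -
  obtain n k d f where p: "strip_params n k d" and inj: "inj_on f (pverts (hexagonal_strip n k d))"
    and a: "a \<in> {f (strip_vertex n d 1 PA), f (strip_vertex n d 1 (QA 1))}"
    and b: "b \<in> {f (strip_vertex n d n PB), f (strip_vertex n d n (QB 2))}"
    and dec: "decorated (map_graph f (hexagonal_strip n k d))
          {f (strip_vertex n d i x) | i x. i \<in> {1..n} \<and> x \<in> {PA, PB, QA 1, QB 2}} a b G"
    using assms unfolding hexagonal_caterpillar_def by (elim exE conjE) (rule that)
  let ?H = "hexagonal_strip n k d" and ?U = "{f (strip_vertex n d i x) | i x. i \<in> {1..n} \<and> x \<in> {PA, PB, QA 1, QB 2}}"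
  let ?V = "f ` pverts ?H" and ?E = "map_prod f f ` parcs ?H"
  obtain \<delta> e where c: "inj_on e ?V" "\<forall>x\<in>?V. ucore n (e x)" "\<forall>x\<in>?V. \<forall>y\<in>?V. (x, y) \<in> ?E \<longleftrightarrow> (e x, e y) \<in> ustrip \<delta>"
    "\<forall>i\<in>{1..n}. \<forall>x\<in>{PA, PB, QA 1, QB 2}. f (strip_vertex n d i x) \<in> ?V \<and> (\<exists>l s. e (f (strip_vertex n d i x)) = Bd l s)"
    "e a = Bd 0 True" "e b = Bd (int n) (\<delta> (int n + 1))" "finite (pverts ?H)" "parcs ?H \<subseteq> pverts ?H \<times> pverts ?H"
    using strip_coords[OF p inj a b] by (elim exE conjE) (rule that)
  have n: "1 \<le> n" using p unfolding strip_params_def by blast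
  have ab: "a \<in> ?V" "b \<in> ?V" "a \<noteq> b"
  proof -
    have 1: "1 \<in> {1..n}" "n \<in> {1..n}" using n by simp_all
    show "a \<in> ?V" using a bspec[OF bspec[OF c(4) 1(1)], of PA] bspec[OF bspec[OF c(4) 1(1)], of "QA 1"] by auto
    show "b \<in> ?V" using b bspec[OF bspec[OF c(4) 1(2)], of PB] bspec[OF bspec[OF c(4) 1(2)], of "QB 2"] by auto
    show "a \<noteq> b" using c(5,6) n by auto
  qed
  have U: "\<forall>u\<in>?U. u \<in> ?V \<and> (\<exists>l s. e u = Bd l s)"
  proof
    fix u assume "u \<in> ?U"
    then obtain i x where "u = f (strip_vertex n d i x)" "i \<in> {1..n}" "x \<in> {PA, PB, QA 1, QB 2}" by blast
    then show "u \<in> ?V \<and> (\<exists>l s. e u = Bd l s)" using bspec[OF bspec[OF c(4)]] by simp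
  qed
  define U where "U = ?U"
  note dec' = dec[folded U_def] and U' = U[folded U_def]
  have "\<exists>V E e Va Ea Vb Eb. hexdec n \<delta> U a b (pverts G) (parcs G) V E e Va Ea Vb Eb"
    using dec'
  proof (induction rule: decorated.induct)
    case base
    have "hexdec n \<delta> U a b ?V ?E ?V ?E e {a} {} {b} {}"
      unfolding hexdec_def
    proof (intro conjI)
      show "?E \<subseteq> ?V \<times> ?V" using c(8) by auto
      show "?V = ?V \<union> {a} \<union> {b}" "?V \<inter> {a} = {a}" "?V \<inter> {b} = {b}" "{a} \<inter> {b} = {}" using ab by auto
      show "fit {a} {} a a" "fit {b} {} b b" by (rule fit_singleton)+
      show "finite ?V" using c(7) by simp
    qed (use c U' ab in simp_all)
    then show ?case unfolding map_graph_simps by (intro exI)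
  next
    case (pendant G u v)
    then obtain V E e Va Ea Vb Eb where "hexdec n \<delta> U a b (pverts G) (parcs G) V E e Va Ea Vb Eb" by blast
    from hexdec_pendant[OF this pendant(2,3)] show ?case by (elim exE) (simp, intro exI)
  next
    case (tree G r T)
    then obtain V E e Va Ea Vb Eb where "hexdec n \<delta> U a b (pverts G) (parcs G) V E e Va Ea Vb Eb" by blast
    from hexdec_tree[OF this tree(2-4)] show ?case by (elim exE) (simp, intro exI)
  qed
  then obtain V E e Va Ea Vb Eb where "hexdec n \<delta> U a b (pverts G) (parcs G) V E e Va Ea Vb Eb" by blast
  note h = hexdecD[OF this]
  have "fit V E a b"
    by (rule fit_coords[where e = e and n = n and \<delta> = \<delta>]) (use h in simp_all)
  from fit_glue[OF h(12) this] have "fit (Va \<union> V) (Ea \<union> E) a b" using h(14) by blast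
  from fit_glue[OF this h(13)] have "fit (Va \<union> V \<union> Vb) (Ea \<union> E \<union> Eb) a b" using h(15,16) by blast
  then show "fit (pverts G) (parcs G) a b" unfolding h(1,2) by (simp add: Un_ac)
  show "finite (pverts G)" by (rule h(17))
qed

section \<open>Generalized hexagonal caterpillars\<close>

lemma piece_fit:
  assumes "hexagonal_caterpillar H a b \<or> lobster H a b"
  shows "fit (pverts H) (parcs H) a b" "finite (pverts H)"
proof -
  show "fit (pverts H) (parcs H) a b"
    using assms by (elim disjE) (rule hexagonal_caterpillar_fit(1) lobster_fit, assumption)+
  show "finite (pverts H)"
    using assms
  proof
    assume "lobster H a b"
    then have "pair_graph H" unfolding lobster_def graph_tree_def by blast
    then show ?thesis by (rule pair_graphD(1))
  qed (rule hexagonal_caterpillar_fit(2))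
qed

text \<open>\<open>glued_from a b i x\<close> represents the class of \<open>(i, x)\<close>: a gluing vertex \<open>a i\<close> is replaced by \<open>b (i - 1)\<close>,
  repeatedly if that is \<open>a (i - 1)\<close> again.\<close>

fun glued_from :: "(nat \<Rightarrow> 'v) \<Rightarrow> (nat \<Rightarrow> 'v) \<Rightarrow> nat \<Rightarrow> 'v \<Rightarrow> nat \<times> 'v" where
  "glued_from a b 0 x = (0, x)"
| "glued_from a b (Suc i) x = (if x = a (Suc i) \<and> 1 \<le> i then glued_from a b i (b i) else (Suc i, x))"

lemma glued_from_le: "fst (glued_from a b i x) \<le> i"
  by (induction i arbitrary: x) (auto intro: le_SucI)

lemma glued_from_inj: "glued_from a b i x = glued_from a b i y \<Longrightarrow> x = y"
proof (cases i)
  case (Suc j)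
  assume "glued_from a b i x = glued_from a b i y"
  moreover have "(Suc j, z) \<noteq> glued_from a b j (b j)" for z using glued_from_le[of a b j "b j"] by (metis Suc_n_not_le_n fst_conv)
  then have "(Suc j, z) \<noteq> glued_from a b j (b j)" "glued_from a b j (b j) \<noteq> (Suc j, z)" for z by metis+
  ultimately show ?thesis unfolding Suc by (auto split: if_splits)
qed simp

lemma glued_from_class:
  assumes "1 \<le> i" "i \<le> k" "R = {((i, b i), (i + 1, a (i + 1))) | i. i \<in> {1..<k}}"
  shows "((i, x), glued_from a b i x) \<in> (R \<union> R\<inverse>)\<^sup>*"
  using assms(1,2)
proof (induction i arbitrary: x)
  case (Suc i)
  show ?case
  proof (cases "x = a (Suc i) \<and> 1 \<le> i")
    case True
    then have "((i, b i), (Suc i, x)) \<in> R" unfolding assms(3) using Suc(3) by auto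
    then have "((Suc i, x), (i, b i)) \<in> R \<union> R\<inverse>" by simp
    moreover have "((i, b i), glued_from a b i (b i)) \<in> (R \<union> R\<inverse>)\<^sup>*" using Suc True by simp
    ultimately show ?thesis using True by (simp add: converse_rtrancl_into_rtrancl)
  qed auto
qed simp

lemma generalized_hexagonal_caterpillar_class_X:
  assumes "generalized_hexagonal_caterpillar G"
  shows "G \<in> class_X"
proof -
  obtain k and H :: "nat \<Rightarrow> nat pair_pre_digraph" and a b where k: "1 \<le> k"
    and H: "\<forall>i\<in>{1..k}. hexagonal_caterpillar (H i) (a i) (b i) \<or> lobster (H i) (a i) (b i)"
    and iso: "digraph_iso (with_proj (identify (disjoint_union {1..k} H) {((i, b i), (i + 1, a (i + 1))) | i. i \<in> {1..<k}}))
          (with_proj G)"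
    using assms unfolding generalized_hexagonal_caterpillar_def by (elim exE conjE) (rule that)
  define R where "R = {((i, b i), (i + 1, a (i + 1))) | i. i \<in> {1..<k}}"
  let ?D = "disjoint_union {1..k} H" and ?\<psi> = "\<lambda>p. glued_from a b (fst p) (snd p)"
  have F: "fit (pverts (H i)) (parcs (H i)) (a i) (b i)" "finite (pverts (H i))" if "i \<in> {1..k}" for i
    using piece_fit[OF bspec[OF H that]] by blast+
  have R\<psi>: "?\<psi> p = ?\<psi> q" if "(p, q) \<in> R" for p q using that unfolding R_def by auto
  have fib: "(p, q) \<in> (R \<union> R\<inverse>)\<^sup>*" if pq: "p \<in> pverts ?D" "q \<in> pverts ?D" "?\<psi> p = ?\<psi> q" for p q
  proof -
    have "(p, ?\<psi> p) \<in> (R \<union> R\<inverse>)\<^sup>*" "(q, ?\<psi> q) \<in> (R \<union> R\<inverse>)\<^sup>*"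
      using glued_from_class[of "fst p" k R b a "snd p"] glued_from_class[of "fst q" k R b a "snd q"] pq(1,2) R_def
      unfolding disjoint_union_def by auto
    moreover have "sym ((R \<union> R\<inverse>)\<^sup>*)" by (intro sym_rtrancl) (auto simp: sym_def)
    ultimately have "(p, ?\<psi> p) \<in> (R \<union> R\<inverse>)\<^sup>*" "(?\<psi> p, q) \<in> (R \<union> R\<inverse>)\<^sup>*" unfolding pq(3) by (blast dest: symD)+
    then show ?thesis by (rule rtrancl_trans)
  qed
  obtain g where g: "inj_on g (pverts (identify ?D R))" "map_graph g (identify ?D R) = map_graph ?\<psi> ?D"
    using identify_via_map[of R ?\<psi> ?D, OF R\<psi> fib] by blast
  define V where "V = (\<lambda>i. glued_from a b i ` pverts (H i))"
  define E where "E = (\<lambda>i. map_prod (glued_from a b i) (glued_from a b i) ` parcs (H i))"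
  have pf: "fit (V i) (E i) (glued_from a b i (a i)) (glued_from a b i (b i))" if "i \<in> {1..k}" for i
    unfolding V_def E_def by (rule fit_map[OF F(1)[OF that]]) (rule inj_onI, rule glued_from_inj)
  have step: "glued_from a b (Suc i) (a (Suc i)) = glued_from a b i (b i)" if "1 \<le> i" for i using that by simp
  have meet: "(\<Union>j\<in>{1..i}. V j) \<inter> V (Suc i) = {glued_from a b i (b i)}" if i: "1 \<le> i" "Suc i \<le> k" for i
  proof
    have m: "b i \<in> pverts (H i)" "a (Suc i) \<in> pverts (H (Suc i))"
      using fitD(3)[OF F(1)[of i]] fitD(2)[OF F(1)[of "Suc i"]] i by simp_all
    have "glued_from a b i (b i) \<in> V i" "glued_from a b (Suc i) (a (Suc i)) \<in> V (Suc i)"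
      unfolding V_def by (rule imageI, rule m)+
    then have "glued_from a b i (b i) \<in> V i" "glued_from a b i (b i) \<in> V (Suc i)" unfolding step[OF i(1)] by simp_all
    then show "{glued_from a b i (b i)} \<subseteq> (\<Union>j\<in>{1..i}. V j) \<inter> V (Suc i)" using i(1) by auto
    show "(\<Union>j\<in>{1..i}. V j) \<inter> V (Suc i) \<subseteq> {glued_from a b i (b i)}"
    proof
      fix z assume zz: "z \<in> (\<Union>j\<in>{1..i}. V j) \<inter> V (Suc i)"
      then obtain j where j: "j \<in> {1..i}" "z \<in> V j" by blast
      obtain x where z: "j \<le> i" "z = glued_from a b j x" using j unfolding V_def by auto
      have "z \<in> V (Suc i)" using zz by blast
      then obtain y where y: "z = glued_from a b (Suc i) y" unfolding V_def by blast
      have "fst z \<le> i" using glued_from_le[of a b j x] z by simp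
      then show "z \<in> {glued_from a b i (b i)}" using y by (auto split: if_splits)
    qed
  qed
  have all: "fit (\<Union>j\<in>{1..i}. V j) (\<Union>j\<in>{1..i}. E j) (glued_from a b 1 (a 1)) (glued_from a b i (b i))" if "1 \<le> i" "i \<le> k" for i
    using that
  proof (induction i rule: dec_induct)
    case base
    then show ?case using pf[of 1] k by simp
  next
    case (step i)
    have "fit (V (Suc i)) (E (Suc i)) (glued_from a b i (b i)) (glued_from a b (Suc i) (b (Suc i)))"
      using pf[of "Suc i"] step(1,4) by simp
    from fit_glue[OF step(3) this meet] step(1,4)
    have "fit ((\<Union>j\<in>{1..i}. V j) \<union> V (Suc i)) ((\<Union>j\<in>{1..i}. E j) \<union> E (Suc i)) (glued_from a b 1 (a 1)) (glued_from a b (Suc i) (b (Suc i)))"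
      by simp
    moreover have "{1..Suc i} = insert (Suc i) {1..i}" by auto
    ultimately show ?case by (simp add: Un_commute)
  qed
  have gV: "g ` pverts (identify ?D R) = (\<Union>j\<in>{1..k}. V j)"
  proof -
    have "g ` pverts (identify ?D R) = ?\<psi> ` pverts ?D" using g(2) by (simp add: map_graph_def)
    also have "\<dots> = (\<Union>j\<in>{1..k}. V j)" unfolding V_def disjoint_union_def by force
    finally show ?thesis .
  qed
  have gE: "map_prod g g ` parcs (identify ?D R) = (\<Union>j\<in>{1..k}. E j)"
  proof -
    have "map_prod g g ` parcs (identify ?D R) = map_prod ?\<psi> ?\<psi> ` parcs ?D" using g(2) by (simp add: map_graph_def)
    also have "\<dots> = (\<Union>j\<in>{1..k}. E j)" unfolding E_def disjoint_union_def by force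
    finally show ?thesis .
  qed
  let ?I = "identify ?D R"
  note f = fitD[OF all[OF k order_refl]]
  obtain h where h: "inj_on h (pverts ?I)" "G = map_graph h ?I"
    using digraph_iso_imp_map_graph[OF iso[folded R_def]] by blast
  have DV: "parcs ?D \<subseteq> pverts ?D \<times> pverts ?D"
    using fitD(1)[OF F(1)] unfolding disjoint_union_def by fastforce
  have IV: "parcs ?I \<subseteq> pverts ?I \<times> pverts ?I"
    using DV unfolding identify_def map_graph_def by auto
  define w where "w = (\<lambda>x. h (inv_into (pverts ?I) g x))"
  have wg: "w (g x) = h x" if "x \<in> pverts ?I" for x unfolding w_def inv_into_f_f[OF g(1) that] ..
  have wi: "inj_on w (\<Union>j\<in>{1..k}. V j)"
    unfolding gV[symmetric] using h(1) wg by (auto simp: inj_on_def)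
  have GE: "parcs G = map_prod w w ` (\<Union>j\<in>{1..k}. E j)"
  proof -
    have "map_prod w w ` map_prod g g ` parcs ?I = map_prod h h ` parcs ?I"
      unfolding image_image using IV wg by (intro image_cong refl) auto
    then show ?thesis unfolding gE h(2) by (simp add: map_graph_def)
  qed
  have GV: "pverts G = w ` (\<Union>j\<in>{1..k}. V j)"
  proof -
    have "w ` g ` pverts ?I = h ` pverts ?I" unfolding image_image using wg by (intro image_cong refl) simp
    then show ?thesis unfolding gV h(2) by (simp add: map_graph_def)
  qed
  have G: "fit (pverts G) (parcs G) (w (glued_from a b 1 (a 1))) (w (glued_from a b k (b k)))"
    unfolding GV GE by (rule fit_map[OF all[OF k order_refl] wi])
  have "finite (pverts G)" unfolding GV V_def using F(2) by simp
  then have "pair_graph (pgraph (pverts G) (parcs G))" by (rule pair_graphI) (use fitD[OF G] in blast)+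
  moreover have "pgraph (pverts G) (parcs G) = G" by (cases G) simp
  ultimately have "pair_graph G" by (rule back_subst[where P = pair_graph])
  then show ?thesis using class_X_iff fit_Xfree[OF G] by blast
qed

theorem theorem14:
  shows "(\<forall>G :: 'a pair_pre_digraph. generalized_hexagonal_caterpillar G \<longrightarrow> G \<in> class_X) \<and>
    (\<forall>G :: 'a pair_pre_digraph. G \<in> class_X \<longrightarrow>
      (\<exists>H :: nat pair_pre_digraph. generalized_hexagonal_caterpillar H \<and> contains_induced H G))"
proof (intro conjI allI impI)
  show "G \<in> class_X" if "generalized_hexagonal_caterpillar G" for G :: "'a pair_pre_digraph"
    by (rule generalized_hexagonal_caterpillar_class_X[OF that])
  show "\<exists>H :: nat pair_pre_digraph. generalized_hexagonal_caterpillar H \<and> contains_induced H G"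
    if "G \<in> class_X" for G :: "'a pair_pre_digraph"
    by (rule class_X_embeds[OF that])
qed

end
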